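(* Let $q_0\in Q$, $p_0\in T^*_{q_0}Q$, and let $P$ be a real-valued penalization functional on $T^*Q$ which is continuous with respect to the weak topology of $L^2([0,1])\times L^2([0,1])$. Let $\mathcal{J}(p,q)=\mathcal{J}_0(p,q)+P(p(1),q(1))$ be the acceleration functional on $\mathcal{C}^0$ and let $\mathcal{J}_R^0$ be the functional on $\mathcal{C}^0_R$ defined by $$\mathcal{J}_R^0(p,q,\mu,\nu)=\int_D\eta\,d\nu+\int_D\eta\Big(\big[\dot p+\mathcal{U}(\mu,q)-\pi_1(p,q)-\pi_2(\mu,q)\big]^2-\dot p^2\Big)dx\,dt+P(p(1),q(1)),$$ where $\eta=\eta(q)$. Then $\mathcal{J}_R^0$ is the relaxation of the acceleration functional $\mathcal{J}$; namely, for every $(p,q,\mu,\nu)\in\mathcal{C}^0_R$ there exists a sequence $(p_n,q_n)\in\mathcal{C}^0$ such that $$\limsup_{n\to\infty}\mathcal{J}(p_n,q_n)\le\mathcal{J}_R^0(p,q,\mu,\nu).$$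
   Context: $D=[0,1]^2$ with points $(t,x)$ (time, space); dots are time derivatives. For $q\in L^2([0,1])$ put $\eta(q)(x)=\exp(\int_0^xq(u)\,du)$ and $\varphi(q)(x)=\int_0^x\eta(q)(y)\,dy$ (argument $q$ often omitted). Let $Q=\{q\in L^2([0,1]):\int_0^1q\,dx=0,\ \int_0^1\eta(q)\,dx=1\}$. Write $\langle f,g\rangle_\eta=\int_0^1fg\,\eta\,dx$, $H_2=\begin{bmatrix}1&1/2\\1/2&1/3\end{bmatrix}$, and $$\pi_q^*(p)=p-\begin{bmatrix}1&\varphi\end{bmatrix}H_2^{-1}\begin{bmatrix}\langle p,1\rangle_\eta\\ \langle p,\varphi\rangle_\eta\end{bmatrix}.$$ $T_q^*Q$ is identified with $\{p\in L^2([0,1]):\langle p,1\rangle_\eta=\langle p,\varphi\rangle_\eta=0\}$, the range of $\pi_q^*$. For time-dependent $p,q$ all these maps are applied at each time. Define $\mathcal{U}(f,q)(x)=\frac12\int_x^1\eta(q)f\,dy$; for a measure $\mu=\mu_t\,dt$ on $D$, $\mathcal{U}(\mu,q)(t,x)=\frac12\int_x^1\eta(q(t))\,d\mu_t$. Define $\pi_1(p,q)=\begin{bmatrix}1&\varphi\end{bmatrix}H_2^{-1}\begin{bmatrix}0\\ b\end{bmatrix}$ with $b=\frac32\int_0^1\big(\int_0^xp\circ\varphi^{-1}dy\big)^2dx$, and $\pi_2(f,q)=(\mathrm{id}-\pi_q^* )(\mathcal{U}(f,q))$. $\mathcal{C}^0$ is the set of curves $(p(t),q(t))\in T^*Q$,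 $t\in[0,1]$, with $q\in H^2([0,1],L^2([0,1]))$, $\dot q=\eta(q)p$, $q(0)=q_0$, $p(0)=p_0$ (so $p\in H^1([0,1],L^2([0,1]))$). On $\mathcal{C}^0$, $$\mathcal{J}_0(p,q)=\int_D\eta(q)\big(\dot p+\mathcal{U}(p^2,q)-\pi_1(p,q)-\pi_2(p^2,q)\big)^2dx\,dt.$$ Fisher-Rao functional: let $r(x,y)=\frac14\frac{y^2}{x}$ if $x>0$, $r(0,0)=0$, $r=+\infty$ otherwise. For finite signed Radon measures $\mu,\nu$ on $D$ and $f\in C^0(D,(0,\infty))$, $\mathrm{FR}_f(\mu,\nu)=\int_Dr\big(\frac{d\mu}{d\lambda},\frac{d\nu}{d\lambda}\big)f\,d\lambda$ for any positive measure $\lambda$ dominating $\mu,\nu$ (independent of $\lambda$). For a measure $\sigma$ on $D$, $\mathrm{FR}(\mu,\partial_t\mu)\preccurlyeq\sigma$ means that $\partial_t\mu$ is a finite Radon measure on $D$ and $\mathrm{FR}_f(\mu,\partial_t\mu)\le\int_Df\,d\sigma$ for all $f\in C^0(D,(0,\infty))$. $\mathcal{C}_R^0$ is the set of $(p,q,\mu,\nu)$ with $(p,q)\in\mathcal{C}^0$ and $\mu,\nu$ positive finite Radon measures on $D$ such that $\mu\ge p^2$, $\nu\ge\dot p^2$, $\mathrm{FR}(\mu-p^2,\partial_t(\mu-p^2))\preccurlyeq\nu-\dot p^2$ and $\mu(0)=p(0)^2$. Here $p^2,\dot p^2$ are identified with the measures $p^2dx\,dt$, $\dot p^2dx\,dt$.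 The conditions that $\Delta=\mu-p^2$ satisfies $\Delta(0)=0$ and $\partial_t\Delta=\delta$ are understood weakly: $\int_D\partial_tf\,d\Delta+\int_Df\,d\delta=0$ for every continuous $f$ on $D$ that is $C^1$ in $t$ and satisfies $f(1,x)=0$ for all $x\in[0,1]$. *)

theory Defs
  imports "HOL-Analysis.Analysis"
begin

text \<open>
  Elements of \<open>L\<^sup>2([0,1])\<close> are represented by Borel functions \<open>real \<Rightarrow> real\<close>, of which only the
  values on \<open>[0,1]\<close> matter, and time-dependent ones by \<open>u :: real \<Rightarrow> real \<Rightarrow> real\<close> with
  \<open>u t x\<close> the value at time \<open>t\<close> and position \<open>x\<close>. Equality in \<open>L\<^sup>2\<close> is equality
  almost everywhere and is always written out.
\<close>

definition L2 :: "(real \<Rightarrow> real) set" where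
  "L2 = {f. set_borel_measurable lborel {0..1} f \<and> set_integrable lborel {0..1} (\<lambda>x. (f x)\<^sup>2)}"

text \<open>
  The coarsest topology making all pairings with elements of \<open>L\<^sup>2\<close> continuous. Functions that agree
  almost everywhere are topologically indistinguishable, so a real function that is continuous
  for it descends to classes.
\<close>

definition weak_L2 :: "(real \<Rightarrow> real) topology" where
  "weak_L2 = topology_generated_by
     {{f \<in> L2. (LINT x:{0..1}|lborel. f x * g x) \<in> V} | g V. g \<in> L2 \<and> open (V :: real set)}"

definition eta :: "(real \<Rightarrow> real) \<Rightarrow> real \<Rightarrow> real" where
  "eta q x = exp (LINT u:{0..x}|lborel. q u)"

definition phi :: "(real \<Rightarrow> real) \<Rightarrow> real \<Rightarrow> real" where
  "phi q x = (LINT y:{0..x}|lborel. eta q y)"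

definition Q_space :: "(real \<Rightarrow> real) set" where
  "Q_space = {q \<in> L2. (LINT x:{0..1}|lborel. q x) = 0 \<and> (LINT x:{0..1}|lborel. eta q x) = 1}"

definition eta_inner :: "(real \<Rightarrow> real) \<Rightarrow> (real \<Rightarrow> real) \<Rightarrow> (real \<Rightarrow> real) \<Rightarrow> real" where
  "eta_inner q f g = (LINT x:{0..1}|lborel. f x * g x * eta q x)"

definition H2_mat :: "real^2^2" where
  "H2_mat = vector [vector [1, 1/2], vector [1/2, 1/3]]"

definition proj_star :: "(real \<Rightarrow> real) \<Rightarrow> (real \<Rightarrow> real) \<Rightarrow> real \<Rightarrow> real" where
  "proj_star q p x = p x - (vector [1, phi q x] :: real^2) \<bullet>
     (matrix_inv H2_mat *v vector [eta_inner q p (\<lambda>_. 1), eta_inner q p (phi q)])"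

definition cotangent :: "(real \<Rightarrow> real) \<Rightarrow> (real \<Rightarrow> real) set" where
  "cotangent q = {p \<in> L2. eta_inner q p (\<lambda>_. 1) = 0 \<and> eta_inner q p (phi q) = 0}"

definition cotangent_bundle :: "((real \<Rightarrow> real) \<times> (real \<Rightarrow> real)) set" where
  "cotangent_bundle = {(p, q). q \<in> Q_space \<and> p \<in> cotangent q}"

definition U_fun :: "(real \<Rightarrow> real) \<Rightarrow> (real \<Rightarrow> real) \<Rightarrow> real \<Rightarrow> real" where
  "U_fun f q x = 1/2 * (LINT y:{x..1}|lborel. eta q y * f y)"

text \<open>
  The same with a measure on \<open>[0,1]\<close> (the slice \<open>\<mu>\<^sub>t\<close>) in place of \<open>f\<close>. An atom at
  \<open>x\<close> is included; this affects only countably many \<open>x\<close>.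
\<close>

definition U_meas :: "real measure \<Rightarrow> (real \<Rightarrow> real) \<Rightarrow> real \<Rightarrow> real" where
  "U_meas m q x = 1/2 * (LINT y:{x..1}|m. eta q y)"

definition pi1 :: "(real \<Rightarrow> real) \<Rightarrow> (real \<Rightarrow> real) \<Rightarrow> real \<Rightarrow> real" where
  "pi1 p q x =
     (let b = 3/2 * (LINT z:{0..1}|lborel.
                (LINT y:{0..z}|lborel. p (the_inv_into {0..1} (phi q) y))\<^sup>2)
      in (vector [1, phi q x] :: real^2) \<bullet> (matrix_inv H2_mat *v vector [0, b]))"

definition pi2_fun :: "(real \<Rightarrow> real) \<Rightarrow> (real \<Rightarrow> real) \<Rightarrow> real \<Rightarrow> real" where
  "pi2_fun f q x = U_fun f q x - proj_star q (U_fun f q) x"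

definition pi2_meas :: "real measure \<Rightarrow> (real \<Rightarrow> real) \<Rightarrow> real \<Rightarrow> real" where
  "pi2_meas m q x = U_meas m q x - proj_star q (U_meas m q) x"

definition unit_square :: "(real \<times> real) set" where
  "unit_square = {0..1} \<times> {0..1}"

text \<open>\<open>L\<^sup>2([0,1], L\<^sup>2([0,1]))\<close>, identified with \<open>L\<^sup>2\<close> of the unit square.\<close>

definition L2_curve :: "(real \<Rightarrow> real \<Rightarrow> real) \<Rightarrow> bool" where
  "L2_curve u \<longleftrightarrow> set_borel_measurable lborel unit_square (\<lambda>(t, x). u t x)
     \<and> set_integrable lborel unit_square (\<lambda>(t, x). (u t x)\<^sup>2)"

text \<open>
  \<open>u\<close> is the continuous representative of an element of \<open>H\<^sup>1([0,1], L\<^sup>2([0,1]))\<close> and \<open>v\<close> is its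
  derivative: \<open>u(t) = u(0) + \<integral>\<^sub>0\<^sup>t v(s) ds\<close> in \<open>L\<^sup>2([0,1])\<close> for every \<open>t\<close>. The null set of
  exceptional \<open>x\<close> may depend on \<open>t\<close>.
\<close>

definition has_tderiv :: "(real \<Rightarrow> real \<Rightarrow> real) \<Rightarrow> (real \<Rightarrow> real \<Rightarrow> real) \<Rightarrow> bool" where
  "has_tderiv u v \<longleftrightarrow> L2_curve u \<and> L2_curve v \<and>
     (\<forall>t\<in>{0..1}. u t \<in> L2 \<and>
        (AE x\<in>{0..1} in lborel. u t x = u 0 x + (LINT s:{0..t}|lborel. v s x)))"

text \<open>Determined up to a null set of the unit square.\<close>

definition tderiv :: "(real \<Rightarrow> real \<Rightarrow> real) \<Rightarrow> real \<Rightarrow> real \<Rightarrow> real" where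
  "tderiv u = (SOME v. has_tderiv u v)"

text \<open>
  The curve \<open>w\<close> is the derivative of \<open>q\<close>. Being itself of class \<open>H\<^sup>1\<close>, it has a
  value in \<open>L\<^sup>2([0,1])\<close> at every time, and the evolution equation is imposed at every time.
\<close>

definition C0_curves ::
  "(real \<Rightarrow> real) \<Rightarrow> (real \<Rightarrow> real) \<Rightarrow> ((real \<Rightarrow> real \<Rightarrow> real) \<times> (real \<Rightarrow> real \<Rightarrow> real)) set" where
  "C0_curves p0 q0 = {(p, q).
     L2_curve p \<and> L2_curve q \<and>
     (\<forall>t\<in>{0..1}. (p t, q t) \<in> cotangent_bundle) \<and>
     (\<exists>w. has_tderiv q w \<and> (\<exists>z. has_tderiv w z) \<and>
        (\<forall>t\<in>{0..1}. AE x\<in>{0..1} in lborel. w t x = eta (q t) x * p t x)) \<and>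
     (AE x\<in>{0..1} in lborel. q 0 x = q0 x) \<and>
     (AE x\<in>{0..1} in lborel. p 0 x = p0 x)}"

definition J0 :: "(real \<Rightarrow> real \<Rightarrow> real) \<Rightarrow> (real \<Rightarrow> real \<Rightarrow> real) \<Rightarrow> real" where
  "J0 p q = (LINT (t, x):unit_square|lborel. eta (q t) x *
     (tderiv p t x + U_fun (\<lambda>y. (p t y)\<^sup>2) (q t) x - pi1 (p t) (q t) x
        - pi2_fun (\<lambda>y. (p t y)\<^sup>2) (q t) x)\<^sup>2)"

definition J_acc ::
  "((real \<Rightarrow> real) \<times> (real \<Rightarrow> real) \<Rightarrow> real) \<Rightarrow>
   (real \<Rightarrow> real \<Rightarrow> real) \<Rightarrow> (real \<Rightarrow> real \<Rightarrow> real) \<Rightarrow> real" where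
  "J_acc P p q = J0 p q + P (p 1, q 1)"

definition finite_radon :: "(real \<times> real) measure \<Rightarrow> bool" where
  "finite_radon \<mu> \<longleftrightarrow> sets \<mu> = sets (restrict_space borel unit_square) \<and> finite_measure \<mu>"

text \<open>
  A finite signed Radon measure on the unit square is given by a pair of positive finite ones,
  standing for their difference. The pair is not unique, but every notion below depends only on
  the difference.
\<close>

type_synonym signed_measure = "(real \<times> real) measure \<times> (real \<times> real) measure"

definition signed_radon :: "signed_measure \<Rightarrow> bool" where
  "signed_radon m \<longleftrightarrow> finite_radon (fst m) \<and> finite_radon (snd m)"

definition signed_integral :: "signed_measure \<Rightarrow> (real \<times> real \<Rightarrow> real) \<Rightarrow> real" where
  "signed_integral m f = (LINT z|fst m. f z) - (LINT z|snd m. f z)"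

definition has_signed_density ::
  "signed_measure \<Rightarrow> (real \<times> real) measure \<Rightarrow> (real \<times> real \<Rightarrow> real) \<Rightarrow> bool" where
  "has_signed_density m l g \<longleftrightarrow> integrable l g \<and>
     (\<forall>A\<in>sets l. measure (fst m) A - measure (snd m) A = (LINT z:A|l. g z))"

definition fr_r :: "real \<Rightarrow> real \<Rightarrow> ennreal" where
  "fr_r x y = (if x > 0 then ennreal (1/4 * (y\<^sup>2 / x)) else if x = 0 \<and> y = 0 then 0 else \<infinity>)"

text \<open>
  The value does not depend on the dominating measure \<open>l\<close> nor on the densities, so the choice
  is between copies of one number.
\<close>

definition FR :: "(real \<times> real \<Rightarrow> real) \<Rightarrow> signed_measure \<Rightarrow> signed_measure \<Rightarrow> ennreal" where
  "FR f m n = (SOME v. \<exists>l g h. finite_radon l \<and> has_signed_density m l g \<and> has_signed_density n l h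
     \<and> v = (\<integral>\<^sup>+ z. fr_r (g z) (h z) * ennreal (f z) \<partial>l))"

text \<open>
  \<open>\<partial>\<^sub>t m = d\<close> together with \<open>m(0) = 0\<close>, in weak form: the test functions vanish
  at the final time only.
\<close>

definition weak_tderiv_zero_init :: "signed_measure \<Rightarrow> signed_measure \<Rightarrow> bool" where
  "weak_tderiv_zero_init m d \<longleftrightarrow>
     (\<forall>f f'. continuous_on unit_square f \<and> continuous_on unit_square f' \<and>
        (\<forall>t\<in>{0..1}. \<forall>x\<in>{0..1}.
           ((\<lambda>s. f (s, x)) has_real_derivative f' (t, x)) (at t within {0..1})) \<and>
        (\<forall>x\<in>{0..1}. f (1, x) = 0)
      \<longrightarrow> signed_integral m f' + signed_integral d f = 0)"

definition FR_dominated :: "signed_measure \<Rightarrow> signed_measure \<Rightarrow> signed_measure \<Rightarrow> bool" where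
  "FR_dominated m d s \<longleftrightarrow>
     (\<forall>f. continuous_on unit_square f \<and> (\<forall>z\<in>unit_square. f z > 0)
        \<longrightarrow> enn2ereal (FR f m d) \<le> ereal (signed_integral s f))"

text \<open>The measure \<open>u\<^sup>2 dx dt\<close> on the unit square.\<close>

definition sq_measure :: "(real \<Rightarrow> real \<Rightarrow> real) \<Rightarrow> (real \<times> real) measure" where
  "sq_measure u = density (restrict_space lborel unit_square) (\<lambda>(t, x). ennreal ((u t x)\<^sup>2))"

text \<open>
  The inequalities between measures are setwise, since the measures involved have the same
  sets. The pair \<open>(\<mu>, sq_measure p)\<close> is the signed measure \<open>\<mu> - p\<^sup>2\<close>, and \<open>d\<close>
  is its time derivative. The condition \<open>\<mu>(0) = p(0)\<^sup>2\<close> is part of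
  \<^const>\<open>weak_tderiv_zero_init\<close>.
\<close>

definition CR0 ::
  "(real \<Rightarrow> real) \<Rightarrow> (real \<Rightarrow> real) \<Rightarrow> ((real \<Rightarrow> real \<Rightarrow> real) \<times> (real \<Rightarrow> real \<Rightarrow> real) \<times>
     (real \<times> real) measure \<times> (real \<times> real) measure) set" where
  "CR0 p0 q0 = {(p, q, \<mu>, \<nu>).
     (p, q) \<in> C0_curves p0 q0 \<and> finite_radon \<mu> \<and> finite_radon \<nu> \<and>
     sq_measure p \<le> \<mu> \<and> sq_measure (tderiv p) \<le> \<nu> \<and>
     (\<exists>d. signed_radon d \<and> weak_tderiv_zero_init (\<mu>, sq_measure p) d \<and>
        FR_dominated (\<mu>, sq_measure p) d (\<nu>, sq_measure (tderiv p)))}"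

text \<open>\<open>\<mu> = \<mu>\<^sub>t dt\<close> with \<open>\<mu>\<^sub>t = \<kappa> t\<close>.\<close>

definition disintegrates :: "(real \<times> real) measure \<Rightarrow> (real \<Rightarrow> real measure) \<Rightarrow> bool" where
  "disintegrates \<mu> \<kappa> \<longleftrightarrow>
     (\<forall>t\<in>{0..1}. sets (\<kappa> t) = sets (restrict_space borel {0..1}) \<and> finite_measure (\<kappa> t)) \<and>
     (\<forall>B\<in>sets (restrict_space borel {0..1}).
        (\<lambda>t. emeasure (\<kappa> t) B) \<in> borel_measurable (restrict_space borel {0..1})) \<and>
     (\<forall>A\<in>sets \<mu>. emeasure \<mu> A = (\<integral>\<^sup>+ t\<in>{0..1}. emeasure (\<kappa> t) {x. (t, x) \<in> A} \<partial>lborel))"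

text \<open>
  Meaningful for \<open>\<mu>\<close> with absolutely continuous time marginal, which holds on
  \<^const>\<open>CR0\<close> by the weak form of the time derivative; the slices are then determined for
  almost every \<open>t\<close>.
\<close>

definition slices :: "(real \<times> real) measure \<Rightarrow> real \<Rightarrow> real measure" where
  "slices \<mu> = (SOME \<kappa>. disintegrates \<mu> \<kappa>)"

definition JR0 ::
  "((real \<Rightarrow> real) \<times> (real \<Rightarrow> real) \<Rightarrow> real) \<Rightarrow>
   (real \<Rightarrow> real \<Rightarrow> real) \<Rightarrow> (real \<Rightarrow> real \<Rightarrow> real) \<Rightarrow>
   (real \<times> real) measure \<Rightarrow> (real \<times> real) measure \<Rightarrow> real" where
  "JR0 P p q \<mu> \<nu> =
     (LINT (t, x)|\<nu>. eta (q t) x) +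
     (LINT (t, x):unit_square|lborel. eta (q t) x *
        ((tderiv p t x + U_meas (slices \<mu> t) (q t) x - pi1 (p t) (q t) x
            - pi2_meas (slices \<mu> t) (q t) x)\<^sup>2 - (tderiv p t x)\<^sup>2)) +
     P (p 1, q 1)"

end

theory Submission
  imports Defs
begin

text \<open>Write Delta = mu - p^2, sigma = nu - pdot^2, and let F be the force term in which mu
  replaces p^2. Since nu = sigma + pdot^2, the relaxed functional is the integral of eta (pdot +
  F)^2, plus the integral of eta against sigma, plus the penalization (\<open>JR0_eq\<close>). It is
  reached by adding to p a spatial oscillation at scale 1/N whose square converges weakly to Delta
  and whose time derivative carries asymptotically at most the energy sigma.

  The amplitudes. In Legendre dual form (\<open>FR_dual\<close>) the Fisher-Rao bound can be tested
  with weights b. It follows that Delta has time slices, of mass \<open>cum B t\<close> on B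
  (\<open>\<Delta>_density\<close>), which start from 0, and, with b solving b' = - b^2, that (sqrt
  (cum B t) - sqrt (cum B s))^2 is at most (t - s) sigma((s,t] x B)
  (\<open>hellinger_increment\<close>). On each of N cells the amplitude a is the piecewise affine
  interpolation, at the times j/N, of the square root of N times the slice mass of the cell. Then
  a^2 dx tends to the slices of Delta (\<open>coef_tail_limit\<close>), and the integral of eta
  adot^2 is at most that of eta against sigma up to o(1) (\<open>slope_energy\<close>).

  The oscillation. Adding a times a sign pattern to p alone would violate qdot = eta p and the
  constraints of the cotangent bundle. The construction therefore perturbs eta: theta is eta plus
  the primitive of an amplitude e times the pattern, and q_n = theta_x / theta, its time derivative
  w_n and p_n = w_n / theta are derived from theta, so that eta(q_n) = theta and the evolution
  equation hold exactly. The pattern +, -, -, + on the quarters of a cell has vanishing first and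
  second primitives at the ends of the cell (\<open>prim_osc_grid\<close>). Hence theta(1) = 1 and
  theta has mean 1, and the time derivatives of these two identities are the two cotangent
  conditions (\<open>in_cotangent_bundle\<close>). The amplitude e is such that p_n is close to p +
  a walsh, and its time derivative to v + adot walsh with v = pdot, with errors of order 1/sqrt N
  (\<open>ap_pn\<close>, \<open>ap_vn\<close>). This rate has two sources: an L2-bounded amplitude
  is at most of order sqrt N on a cell while its oscillating primitive gains 1/N, and freezing
  Hoelder-1/2 coefficients at the nodes costs 1/sqrt N.

  The limit. Oscillations with L2-bounded amplitude are weakly null (\<open>osc_weak_null\<close>),
  so p_n(1) and q_n(1) converge weakly and the penalization converges. The force contains p_n^2 only
  through integrals in x: the mixed term 2 p a walsh disappears, a^2 contributes Delta, and the
  force converges strongly in L2 (\<open>FN_nrm\<close>). Expanding the square of v + F + adot walsh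
  leaves the main term, the energy of adot and a mixed term. The last one is made nonpositive for
  each N by a global sign of a, which changes neither a^2 nor adot^2 (\<open>sgn'\<close>). This
  gives the upper bound (\<open>J0_limit\<close>, \<open>recovery_sequence\<close>).

  Curves are classes modulo null sets that may depend on t. The final proof first passes to
  representatives whose trajectories in t are absolutely continuous for almost every x.\<close>

lemmas LINT_cong = Bochner_Integration.integral_cong and LINT_add = Bochner_Integration.integral_add
 and LINT_diff = Bochner_Integration.integral_diff and LINT_sum = Bochner_Integration.integral_sum
 and intble_bound = Bochner_Integration.integrable_bound and intble_add = Bochner_Integration.integrable_add
 and intble_diff = Bochner_Integration.integrable_diff and intble_sum = Bochner_Integration.integrable_sum
 and intble_cong = Bochner_Integration.integrable_cong

abbreviation I :: "real set" where "I \<equiv> {0..1}"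
abbreviation (input) bm :: "'a measure \<Rightarrow> ('a \<Rightarrow> 'b::topological_space) set" where "bm M \<equiv> borel_measurable M"
abbreviation (input) seqlim :: "(nat \<Rightarrow> 'a::topological_space) \<Rightarrow> 'a \<Rightarrow> bool" (infix "---->" 60) where
 "X ----> L \<equiv> X \<longlonglongrightarrow> L"

section \<open>Calculus in L2 of an arbitrary measure: Cauchy-Schwarz, Minkowski, domination\<close>

subsection \<open>Square-integrable functions\<close>

definition l2 :: "'a measure => ('a => real) => bool" where
 "l2 M f \<longleftrightarrow> f \<in> bm M & integrable M (%x. (f x)^2)"

definition nrm :: "'a measure => ('a => real) => real" where
 "nrm M f = sqrt (LINT x|M. (f x)^2)"

lemma l2_measurable: "l2 M f ==> f \<in> bm M"
 and l2_square: "l2 M f ==> integrable M (%x. (f x)^2)"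
 by (auto simp: l2_def)

lemma nrm_nonneg [simp]: "nrm M f >= 0"
 by (simp add: nrm_def)

lemma nrm_square: "(nrm M f)^2 = (LINT x|M. (f x)^2)"
 by (simp add: nrm_def)

lemma l2_mult_integrable:
 assumes "l2 M f" "l2 M g" shows "integrable M (%x. f x * g x)"
proof (rule intble_bound[of M "%x. (f x)^2 + (g x)^2"])
 show "integrable M (%x. (f x)^2 + (g x)^2)" using assms by (auto simp: l2_def)
 show "(%x. f x * g x) \<in> bm M" using assms by (auto simp: l2_def)
 have "\<bar>a * b\<bar> <= a^2 + b^2" for a b :: real
 proof -
  have "0 <= \<bar>a\<bar> * \<bar>b\<bar>" by simp
  then show ?thesis using sum_squares_bound[of "\<bar>a\<bar>" "\<bar>b\<bar>"] unfolding abs_mult power2_abs by linarith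
 qed
 then show "AE x in M. norm (f x * g x) <= norm ((f x)^2 + (g x)^2)" by simp
qed

lemma l2_add: assumes "l2 M f" "l2 M g" shows "l2 M (%x. f x + g x)"
proof -
 have "integrable M (%x. (f x)^2 + 2 * (f x * g x) + (g x)^2)"
  using assms l2_mult_integrable[OF assms] by (auto simp: l2_def)
 then show ?thesis using assms by (auto simp: l2_def power2_sum algebra_simps)
qed

lemma l2_cmult: "l2 M f ==> l2 M (%x. c * f x)"
 by (auto simp: l2_def power_mult_distrib)

lemma l2_minus: "l2 M f ==> l2 M (%x. - f x)"
 using l2_cmult[of M f "-1"] by simp

lemma l2_diff: "l2 M f ==> l2 M g ==> l2 M (%x. f x - g x)"
 using l2_add[OF _ l2_minus, of M f g] by simp

lemma l2_bound:
 assumes "l2 M g" "f \<in> bm M" "AE x in M. \<bar>f x\<bar> <= \<bar>g x\<bar>"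
 shows "l2 M f"
 unfolding l2_def
proof
 show "integrable M (%x. (f x)^2)"
  by (rule intble_bound[of M "%x. (g x)^2"])
    (use assms in "auto simp: l2_def power2_le_iff_abs_le abs_le_square_iff")
qed fact

lemma l2_abs: "l2 M f ==> l2 M (%x. \<bar>f x\<bar>)"
 by (auto simp: l2_def)

lemma l2_mult_bounded:
 assumes "l2 M f" "g \<in> bm M" "AE x in M. \<bar>g x\<bar> <= c"
 shows "l2 M (%x. g x * f x)"
proof (rule l2_bound[OF l2_cmult[OF assms(1), of c]])
 show "(%x. g x * f x) \<in> bm M" using assms by (auto simp: l2_def)
 show "AE x in M. \<bar>g x * f x\<bar> <= \<bar>c * f x\<bar>"
  using assms(3) by eventually_elim (auto simp: abs_mult intro!: mult_right_mono)
qed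

lemma (in finite_measure) l2_const [simp]: "l2 M (%x. c)"
 by (auto simp: l2_def)

lemma (in finite_measure) l2_integrable: "l2 M f ==> integrable M f"
 using l2_mult_integrable[OF _ l2_const, of f 1] by simp

lemma l2_cong_AE:
 assumes "l2 M f" "g \<in> bm M" "AE x in M. f x = g x" shows "l2 M g"
 by (rule l2_bound[OF assms(1,2)]) (use assms in auto)

lemma nrm_mono:
 assumes "l2 M g" "f \<in> bm M" "AE x in M. \<bar>f x\<bar> <= \<bar>g x\<bar>"
 shows "nrm M f <= nrm M g"
 unfolding nrm_def
 using l2_bound[OF assms] assms
 by (auto simp: l2_def abs_le_square_iff intro!: integral_mono_AE)

lemma Cauchy_Schwarz_l2:
 assumes f: "l2 M f" and g: "l2 M g"
 shows "\<bar>LINT x|M. f x * g x\<bar> <= nrm M f * nrm M g"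
proof -
 define A B C where "A = (LINT x|M. (f x)^2)" "B = (LINT x|M. f x * g x)" "C = (LINT x|M. (g x)^2)"
 note i = l2_square[OF f] l2_square[OF g] l2_mult_integrable[OF f g]
 have AC: "A >= 0" "C >= 0" by (auto simp: A_B_C_def)
 \<comment> \<open>Cauchy-Schwarz is the nonnegativity of this quadratic polynomial in c.\<close>
 have q: "A + 2 * c * B + c^2 * C >= 0" for c
 proof -
  have "0 <= (LINT x|M. (f x + c * g x)^2)" by simp
  also have "... = (LINT x|M. (f x)^2 + 2 * c * (f x * g x) + c^2 * (g x)^2)"
   by (intro LINT_cong) (auto simp: power2_eq_square algebra_simps)
  also have "... = A + 2 * c * B + c^2 * C" using i by (simp add: A_B_C_def)
  finally show ?thesis .
 qed
 have "B^2 <= A * C"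
 proof (cases "C = 0")
  case True
  have "B = 0"
  proof (rule ccontr)
   assume "B ~= 0"
   \<comment> \<open>With C = 0 the polynomial is affine in c, and this c gives it the value
     -1.\<close>
   then show False using q[of "- (A + 1) / (2 * B)"] True AC by (simp add: field_simps)
  qed
  then show ?thesis using True by simp
 next
  case False
  with AC have "C > 0" by simp
  then show ?thesis using q[of "- B / C"]
   by (simp add: field_simps power2_eq_square)
 qed
 then have "\<bar>B\<bar> <= sqrt (A * C)" by (metis real_sqrt_abs real_sqrt_le_iff)
 then show ?thesis by (simp add: A_B_C_def nrm_def real_sqrt_mult)
qed

lemma nrm_triangle:
 assumes f: "l2 M f" and g: "l2 M g"
 shows "nrm M (%x. f x + g x) <= nrm M f + nrm M g"
proof (rule power2_le_imp_le)
 note i = l2_square[OF f] l2_square[OF g] l2_mult_integrable[OF f g]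
 have "(nrm M (%x. f x + g x))^2 = (LINT x|M. (f x)^2 + 2 * (f x * g x) + (g x)^2)"
  unfolding nrm_square
  by (intro LINT_cong) (auto simp: power2_eq_square algebra_simps)
 also have "... = (nrm M f)^2 + 2 * (LINT x|M. f x * g x) + (nrm M g)^2"
  using i by (simp add: nrm_square)
 also have "... <= (nrm M f + nrm M g)^2"
  using Cauchy_Schwarz_l2[OF f g] by (simp add: power2_sum)
 finally show "(nrm M (%x. f x + g x))^2 <= (nrm M f + nrm M g)^2" .
qed simp

lemma nrm_cmult: "nrm M (%x. c * f x) = \<bar>c\<bar> * nrm M f"
 by (simp add: nrm_def power_mult_distrib real_sqrt_mult)

lemma nrm_abs [simp]: "nrm M (%x. \<bar>f x\<bar>) = nrm M f"
 by (simp add: nrm_def)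

section \<open>The probability space \<open>UI\<close> and its square, with translations from set
  integrals\<close>

subsection \<open>Lebesgue measure on the unit interval\<close>

definition UI :: "real measure" where "UI = restrict_space lborel I"

lemma space_UI [simp]: "space UI = I"
 by (simp add: UI_def space_restrict_space)

lemma sets_UI: "sets UI = sets (restrict_space borel I)"
 unfolding UI_def by (rule sets_restrict_space_cong) simp

lemma measurable_UI: "f \<in> measurable borel M ==> f \<in> measurable UI M"
 by (simp add: UI_def measurable_restrict_space1)

lemma measurable_UI_ident [measurable]: "(%x. x) \<in> bm UI"
 by (simp add: measurable_UI)

lemma emeasure_UI: "A \<in> sets borel ==> A \<subseteq> I ==> emeasure UI A = emeasure lborel A"
 by (simp add: UI_def emeasure_restrict_space)

interpretation UI: finite_measure UI
 by (rule finite_measureI) (simp add: emeasure_UI)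

interpretation UU: pair_sigma_finite UI UI ..

interpretation UUf: finite_measure "UI \<Otimes>\<^sub>M UI"
 by (rule finite_measureI)
   (use UI.emeasure_pair_measure_Times[of "I" UI "I"] in
    \<open>simp add: space_pair_measure emeasure_UI sets_UI sets_restrict_space_iff\<close>)

lemma measure_UI [simp]: "measure UI I = 1"
 by (simp add: measure_def emeasure_UI)

lemma UI_integrable_iff: "integrable UI f \<longleftrightarrow> set_integrable lborel I f" for f :: "real => real"
 by (simp add: UI_def integrable_restrict_space set_integrable_def)

lemma UI_integral: "(LINT x|UI. f x) = (LINT x:I|lborel. f x)" for f :: "real => real"
 by (simp add: UI_def integral_restrict_space set_lebesgue_integral_def)

lemma UI_measurable_iff: "f \<in> bm UI \<longleftrightarrow> set_borel_measurable lborel I f" for f :: "real => real"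
 by (simp add: UI_def borel_measurable_restrict_space_iff set_borel_measurable_def)

lemma UI_AE: "(AE x in UI. P x) \<longleftrightarrow> (AE x\<in>I in lborel. P x)"
 unfolding UI_def by (subst AE_restrict_space_iff) simp_all

lemma L2_iff: "f \<in> L2 \<longleftrightarrow> l2 UI f"
 by (simp add: L2_def l2_def UI_integrable_iff UI_measurable_iff)

text \<open>The curves are square integrable for planar Lebesgue measure on the square; as a product
  measure it admits Fubini and almost-everywhere statements on sections.\<close>

lemma lborel_square: "restrict_space lborel unit_square = UI \<Otimes>\<^sub>M UI"
proof (rule pair_measure_eqI[symmetric])
 have s: "sets (UI \<Otimes>\<^sub>M UI) = sets (restrict_space (borel \<Otimes>\<^sub>M borel) (I \<times> I))"
 proof (intro equalityI subsetI)
  let ?R = "restrict_space (borel \<Otimes>\<^sub>M borel) (I \<times> I) :: (real \<times> real) measure"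
  fix X assume "X \<in> sets ?R"
  then obtain Y where Y: "Y \<in> sets (borel \<Otimes>\<^sub>M borel)" "X = (I \<times> I) Int Y"
   by (auto simp: sets_restrict_space)
  have "(%z. (fst z, snd z)) \<in> measurable (UI \<Otimes>\<^sub>M UI) (borel \<Otimes>\<^sub>M borel)"
   by (intro measurable_Pair measurable_compose[OF measurable_fst] measurable_compose[OF measurable_snd]) auto
  from measurable_sets[OF this Y(1)] show "X \<in> sets (UI \<Otimes>\<^sub>M UI)"
   by (simp add: Y(2) space_pair_measure vimage_def Int_def conj_commute)
 next
  let ?R = "restrict_space (borel \<Otimes>\<^sub>M borel) (I \<times> I) :: (real \<times> real) measure"
  fix X assume X: "X \<in> sets (UI \<Otimes>\<^sub>M UI)"
  have f: "fst \<in> measurable ?R UI" "snd \<in> measurable ?R UI"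
   unfolding measurable_cong_sets[OF refl sets_UI]
   by (intro measurable_restrict_space2 measurable_restrict_space1; force simp: space_restrict_space space_pair_measure)+
  have "(%z. (fst z, snd z)) \<in> measurable ?R (UI \<Otimes>\<^sub>M UI)"
   by (intro measurable_Pair f)
  from measurable_sets[OF this X] sets.sets_into_space[OF X] show "X \<in> sets ?R"
   by (simp add: space_restrict_space space_pair_measure vimage_def Int_absorb2 Int_def[symmetric])
 qed
 then show "sets (UI \<Otimes>\<^sub>M UI) = sets (restrict_space lborel unit_square)"
  unfolding unit_square_def borel_prod by (simp only: sets_restrict_space sets_lborel)
 fix A B assume "A \<in> sets UI" "B \<in> sets UI"
 then have AB: "A \<in> sets borel" "A \<subseteq> I" "B \<in> sets borel" "B \<subseteq> I"
  by (auto simp: sets_UI sets_restrict_space_iff)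
 then have "A \<times> B \<in> sets (borel :: (real \<times> real) measure)"
  unfolding borel_prod[symmetric] by auto
 moreover have "unit_square \<in> sets (borel :: (real \<times> real) measure)"
  unfolding borel_prod[symmetric] by (auto simp: unit_square_def)
 ultimately show "emeasure UI A * emeasure UI B = emeasure (restrict_space lborel unit_square) (A \<times> B)"
  using AB lborel.emeasure_pair_measure_Times[of A lborel B]
  by (subst emeasure_restrict_space) (auto simp: emeasure_UI unit_square_def lborel_prod)
qed (auto intro: UI.sigma_finite_measure_axioms)

lemma fixes f :: "real \<times> real => real"
 shows UU_integrable_iff: "integrable (UI \<Otimes>\<^sub>M UI) f \<longleftrightarrow> set_integrable lborel unit_square f"
  and UU_integral: "(LINT z|(UI \<Otimes>\<^sub>M UI). f z) = (LINT z:unit_square|lborel. f z)"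
  and UU_measurable_iff: "f \<in> borel_measurable (UI \<Otimes>\<^sub>M UI) \<longleftrightarrow> set_borel_measurable lborel unit_square f"
proof -
 have u: "unit_square \<in> sets (borel :: (real \<times> real) measure)"
  unfolding borel_prod[symmetric] by (auto simp: unit_square_def)
 show "integrable (UI \<Otimes>\<^sub>M UI) f \<longleftrightarrow> set_integrable lborel unit_square f"
  using u by (simp add: lborel_square[symmetric] integrable_restrict_space set_integrable_def)
 show "(LINT z|(UI \<Otimes>\<^sub>M UI). f z) = (LINT z:unit_square|lborel. f z)"
  using u by (simp add: lborel_square[symmetric] integral_restrict_space set_lebesgue_integral_def)
 show "f \<in> borel_measurable (UI \<Otimes>\<^sub>M UI) \<longleftrightarrow> set_borel_measurable lborel unit_square f"
  using u by (simp add: lborel_square[symmetric] borel_measurable_restrict_space_iff set_borel_measurable_def)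
qed

lemma L2_curve_iff: "L2_curve u \<longleftrightarrow> l2 (UI \<Otimes>\<^sub>M UI) (%(t, x). u t x)"
proof -
 have *: "(%z. (case z of (t, x) => u t x)^2) = (%(t, x). (u t x)^2)" by (auto simp: fun_eq_iff)
 show ?thesis unfolding L2_curve_def l2_def UU_measurable_iff UU_integrable_iff * ..
qed

section \<open>Primitives and the calculus of absolutely continuous functions\<close>

subsection \<open>Indefinite integrals and absolutely continuous functions\<close>

definition prim :: "(real => real) => real => real" where
 "prim v x = (LINT y:{0..x}|lborel. v y)"

text \<open>Moves the variable end point from the domain into the integrand, so that dominated
  convergence, Fubini and monotonicity apply on the fixed space \<open>UI\<close>.\<close>

lemma prim_eq: "x <= 1 ==> prim v x = (LINT y|UI. (if y <= x then v y else 0))"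
 unfolding prim_def UI_integral set_lebesgue_integral_def
 by (intro LINT_cong) (auto split: split_indicator)

lemma prim_1: "prim v 1 = (LINT y|UI. v y)"
 by (simp add: prim_def UI_integral)

lemma prim_0 [simp]: "prim v 0 = 0"
proof -
 have "(LINT y:{0..0}|lborel. v y) = (LINT y|lborel. 0)"
  unfolding set_lebesgue_integral_def
  by (subst integral_eq_zero_AE[OF eventually_mono[OF AE_lborel_singleton[of 0]]])
    (auto split: split_indicator)
 then show ?thesis by (simp add: prim_def)
qed

lemma integrable_prim_aux:
 fixes v :: "real => real"
 assumes "integrable UI v" shows "integrable UI (%y. if y <= x then v y else 0)"
  "integrable UI (%y. if x < y then v y else 0)"
 by (rule intble_bound[OF assms];
   use borel_measurable_integrable[OF assms] in auto)+

lemma prim_cong_AE: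
 assumes "x <= 1" "v \<in> bm UI" "u \<in> bm UI" "AE y in UI. u y = v y"
 shows "prim u x = prim v x"
 unfolding prim_eq[OF assms(1)]
 by (rule integral_cong_AE) (use assms in "auto elim!: AE_mp")

lemma prim_cong: "x <= 1 ==> (!!y. y \<in> I ==> y <= x ==> u y = v y) ==> prim u x = prim v x"
 unfolding prim_eq by (intro LINT_cong) auto

lemma prim_add:
 assumes "x <= 1" "integrable UI u" "integrable UI v"
 shows "prim (%y. u y + v y) x = prim u x + prim v x"
 unfolding prim_eq[OF assms(1)]
 by (subst LINT_add[symmetric])
   (use assms in "auto intro!: integrable_prim_aux LINT_cong")

lemma prim_cmult: "prim (%y. c * u y) x = c * prim u x"
 by (simp add: prim_def)

lemma prim_diff:
 assumes "x <= 1" "integrable UI u" "integrable UI v"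
 shows "prim (%y. u y - v y) x = prim u x - prim v x"
 using prim_add[OF assms(1,2), of "%y. - v y"] prim_cmult[of "-1" v x] assms by simp

lemma prim_abs_le:
 assumes "x <= 1" "integrable UI v"
 shows "\<bar>prim v x\<bar> <= prim (%y. \<bar>v y\<bar>) x"
proof -
 have "norm (LINT y|UI. (if y <= x then v y else 0)) <= (LINT y|UI. norm (if y <= x then v y else 0))"
  by (rule integral_norm_bound)
 also have "... = (LINT y|UI. (if y <= x then \<bar>v y\<bar> else 0))"
  by (intro LINT_cong) auto
 finally show ?thesis unfolding prim_eq[OF assms(1)] by simp
qed

lemma prim_mono:
 assumes "x <= 1" "integrable UI u" "integrable UI v" "AE y in UI. u y <= v y"
 shows "prim u x <= prim v x"
 unfolding prim_eq[OF assms(1)]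
 by (rule integral_mono_AE) (use assms in "auto intro!: integrable_prim_aux elim!: AE_mp")

lemma prim_le_integral:
 assumes "x <= 1" "integrable UI v" "AE y in UI. 0 <= v y"
 shows "prim v x <= (LINT y|UI. v y)"
 unfolding prim_eq[OF assms(1)]
 by (rule integral_mono_AE) (use assms in "auto intro!: integrable_prim_aux elim!: AE_mp")

lemma prim_increment:
 assumes "s <= t" "t <= 1" "integrable UI v"
 shows "prim v t - prim v s = (LINT y|UI. (if s < y & y <= t then v y else 0))"
proof -
 have "prim v t - prim v s = (LINT y|UI. (if y <= t then v y else 0) - (if y <= s then v y else 0))"
  using assms by (simp add: prim_eq integrable_prim_aux)
 also have "... = (LINT y|UI. (if s < y & y <= t then v y else 0))"
  using assms by (intro LINT_cong) auto
 finally show ?thesis .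
qed

lemma prim_const: "x \<in> I ==> prim (%_. c) x = c * x"
 by (simp add: prim_def set_lebesgue_integral_def)

lemma prim_measurable_in: "prim v \<in> bm UI" if "v \<in> bm UI"
proof -
 have [measurable]: "v \<in> bm UI" by fact
 have "(%x. LINT y|UI. (if y <= x then v y else 0)) \<in> bm UI" by measurable
 then show ?thesis by (rule measurable_cong[THEN iffD1, rotated]) (simp add: prim_eq)
qed

lemma AE_UI_neq: "AE y in UI. y ~= s"
 unfolding UI_AE using AE_lborel_singleton[of s] by auto

lemma prim_continuous:
 assumes v: "integrable UI v"
 shows "continuous_on I (prim v)"
proof (rule continuous_on_sequentiallyI)
 fix u x assume u: "\<forall>n. u n \<in> {0..1::real}" "x \<in> I" "u ----> x"
 have [measurable]: "v \<in> bm UI" using v by auto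
 have "(%n. LINT y|UI. (if y <= u n then v y else 0)) ----> (LINT y|UI. (if y <= x then v y else 0))"
 proof (rule integral_dominated_convergence[where w="%y. \<bar>v y\<bar>"])
  show "AE y in UI. (%n. if y <= u n then v y else 0) ----> (if y <= x then v y else 0)"
   using AE_UI_neq[of x]
  proof eventually_elim
   case (elim y)
   then consider "y < x" | "y > x" by fastforce
   then show ?case
   proof cases
    case 1
    then have "\<forall>\<^sub>F n in sequentially. y < u n" using u(3) by (auto simp: order_tendsto_iff)
    then have "\<forall>\<^sub>F n in sequentially. (if y <= u n then v y else 0) = v y" by eventually_elim auto
    with 1 show ?thesis by (auto intro: tendsto_eventually)
   next
    case 2
    then have "\<forall>\<^sub>F n in sequentially. u n < y" using u(3) by (auto simp: order_tendsto_iff)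
    then have "\<forall>\<^sub>F n in sequentially. (if y <= u n then v y else 0) = 0" by eventually_elim auto
    with 2 show ?thesis by (auto intro: tendsto_eventually)
   qed
  qed
 qed (use v in auto)
 then show "(%n. prim v (u n)) ----> prim v x" using u by (auto simp: prim_eq)
qed

lemma integrable_product:
 fixes a b :: "real => real"
 assumes a: "integrable UI a" and b: "integrable UI b"
 shows "integrable (UI \<Otimes>\<^sub>M UI) (%(s, y). a s * b y)"
proof (rule UU.Fubini_integrable)
 have [measurable]: "a \<in> bm UI" "b \<in> bm UI" using a b by auto
 show "(%(s, y). a s * b y) \<in> borel_measurable (UI \<Otimes>\<^sub>M UI)" by measurable
 show "integrable UI (%x. LINT y|UI. norm (case (x, y) of (s, y) => a s * b y))"
  using a by (simp add: abs_mult)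
 show "AE x in UI. integrable UI (%y. case (x, y) of (s, y) => a s * b y)" using b by simp
qed

text \<open>The square of pairs (s, y) with both entries at most t is cut along its diagonal, and
  each half is integrated first in the shorter variable. This is the product rule for two
  primitives.\<close>

lemma prim_mult_prim:
 assumes a: "integrable UI a" and b: "integrable UI b" and t: "t <= 1"
 shows "prim a t * prim b t = prim (%s. a s * prim b s) t + prim (%s. prim a s * b s) t"
proof -
 have [measurable]: "a \<in> bm UI" "b \<in> bm UI" using a b by auto
 let ?a = "%s. if s <= t then a s else 0" and ?b = "%s. if s <= t then b s else 0"
 have i: "integrable (UI \<Otimes>\<^sub>M UI) (%(s, y). ?a s * ?b y)"
  by (rule integrable_product) (use a b in "auto intro: integrable_prim_aux")
 have i1: "integrable (UI \<Otimes>\<^sub>M UI) (%(s, y). if y <= s then ?a s * ?b y else 0)"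
  by (rule intble_bound[OF i]) auto
 have i2: "integrable (UI \<Otimes>\<^sub>M UI) (%(s, y). if s < y then ?a s * ?b y else 0)"
  by (rule intble_bound[OF i]) auto
 have "prim a t * prim b t = (LINT s|UI. LINT y|UI. ?a s * ?b y)" using t by (simp add: prim_eq)
 also have "... = (LINT z|(UI \<Otimes>\<^sub>M UI). (%(s, y). ?a s * ?b y) z)"
  by (subst UU.integral_fst'[symmetric, OF i]) simp
 also have "... = (LINT z|(UI \<Otimes>\<^sub>M UI). (%(s, y). if y <= s then ?a s * ?b y else 0) z
   + (%(s, y). if s < y then ?a s * ?b y else 0) z)"
  by (intro LINT_cong) auto
 also have "... = (LINT z|(UI \<Otimes>\<^sub>M UI). (%(s, y). if y <= s then ?a s * ?b y else 0) z)
   + (LINT z|(UI \<Otimes>\<^sub>M UI). (%(s, y). if s < y then ?a s * ?b y else 0) z)"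
  by (rule LINT_add[OF i1 i2])
 also have "(LINT z|(UI \<Otimes>\<^sub>M UI). (%(s, y). if y <= s then ?a s * ?b y else 0) z)
  = (LINT s|UI. LINT y|UI. (if y <= s then ?a s * ?b y else 0))"
  by (subst UU.integral_fst'[symmetric, OF i1]) simp
 also have "(LINT s|UI. LINT y|UI. (if y <= s then ?a s * ?b y else 0)) = prim (%s. a s * prim b s) t"
  unfolding prim_eq[OF t]
 proof (intro LINT_cong refl)
  fix s assume s: "s \<in> space UI"
  have "(LINT y|UI. (if y <= s then ?a s * ?b y else 0)) = (LINT y|UI. ?a s * (if y <= s then b y else 0))"
   by (intro LINT_cong) auto
  then show "(LINT y|UI. (if y <= s then ?a s * ?b y else 0)) = (if s <= t then a s * prim b s else 0)"
   using s by (auto simp: prim_eq)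
 qed
 also have "(LINT z|(UI \<Otimes>\<^sub>M UI). (%(s, y). if s < y then ?a s * ?b y else 0) z)
  = (LINT y|UI. LINT s|UI. (if s < y then ?a s * ?b y else 0))"
  using UU.integral_snd[OF i2] by simp
 also have "(LINT y|UI. LINT s|UI. (if s < y then ?a s * ?b y else 0)) = prim (%s. prim a s * b s) t"
  unfolding prim_eq[OF t]
 proof (intro LINT_cong refl)
  fix y assume y: "y \<in> space UI"
  \<comment> \<open>The diagonal is null, so the strict inequality may be relaxed.\<close>
  have "(LINT s|UI. (if s < y then ?a s * ?b y else 0)) = (LINT s|UI. (if s <= y then a s else 0) * ?b y)"
   by (intro integral_cong_AE eventually_mono[OF AE_UI_neq[of y]]) auto
  then show "(LINT s|UI. (if s < y then ?a s * ?b y else 0)) = (if y <= t then prim a y * b y else 0)"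
   using y by (auto simp: prim_eq)
 qed
 finally show ?thesis .
qed

text \<open>Absolute continuity on the unit interval with the density given explicitly, so that the
  rules below compute with densities rather than with derivatives almost everywhere.\<close>

definition ac :: "(real => real) => (real => real) => bool" where
 "ac u u' \<longleftrightarrow> integrable UI u' & (\<forall>t\<in>I. u t = u 0 + prim u' t)"

lemma ac_integrable: "ac u u' ==> integrable UI u'"
 and ac_eq: "ac u u' ==> t \<in> I ==> u t = u 0 + prim u' t"
 unfolding ac_def by blast+

lemma acI: "integrable UI u' ==> (!!t. t \<in> I ==> u t = u 0 + prim u' t) ==> ac u u'"
 unfolding ac_def by blast

lemma ac_prim: "integrable UI v ==> ac (prim v) v"
 by (rule acI) simp_all

lemma ac_continuous: assumes "ac u u'" shows "continuous_on I u"
proof -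
 have "continuous_on I (%t. u 0 + prim u' t)"
  by (rule continuous_on_add[OF continuous_on_const prim_continuous[OF ac_integrable[OF assms]]])
 then show ?thesis by (rule continuous_on_eq) (rule ac_eq[OF assms, symmetric])
qed

lemma continuous_measurable_UI: "continuous_on I u ==> u \<in> bm UI" for u :: "real => real"
 using borel_measurable_continuous_on_restrict[of "I" u] measurable_cong_sets[OF sets_UI, of borel borel] by auto

lemma continuous_bounded_UI:
 assumes "continuous_on I (u :: real => real)" obtains K where "K >= 0" "!!t. t \<in> I ==> \<bar>u t\<bar> <= K"
proof -
 have "bounded (u ` I)" by (intro compact_imp_bounded compact_continuous_image assms) auto
 then obtain K where "\<forall>x\<in>u ` I. norm x <= K" by (auto simp: bounded_iff)
 then show ?thesis by (intro that[of "\<bar>K\<bar>"]) force+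
qed

lemma continuous_mult_integrable:
 fixes u v :: "real => real"
 assumes "continuous_on I u" "integrable UI v" shows "integrable UI (%t. u t * v t)"
proof -
 obtain K where K: "K >= 0" "!!t. t \<in> I ==> \<bar>u t\<bar> <= K" using continuous_bounded_UI[OF assms(1)] by blast
 show ?thesis
  by (rule intble_bound[of _ "%t. K * v t"])
    (use assms K continuous_measurable_UI[OF assms(1)] in "auto simp: abs_mult intro!: mult_right_mono")
qed

lemma ac_const: "ac (%_. c) (%_. 0)"
 by (simp add: ac_def prim_def set_lebesgue_integral_def)

lemma ac_cong:
 assumes "ac u u'" "!!t. t \<in> I ==> v t = u t" "!!t. t \<in> I ==> v' t = u' t"
 shows "ac v v'"
proof -
 have "integrable UI v'" using ac_integrable[OF assms(1)] by (rule intble_cong[THEN iffD1, rotated -1]) (use assms in auto)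
 moreover have p: "prim v' t = prim u' t" if "t \<in> I" for t
  by (rule prim_cong) (use that assms in auto)
 moreover have "v t = v 0 + prim v' t" if "t \<in> I" for t
  unfolding p[OF that] using ac_eq[OF assms(1) that] assms(2)[OF that] assms(2)[of 0] by simp
 ultimately show ?thesis by (intro acI)
qed

lemma ac_add: assumes "ac u u'" "ac v v'" shows "ac (%t. u t + v t) (%t. u' t + v' t)"
 unfolding ac_def
proof (intro conjI ballI)
 show "integrable UI (%t. u' t + v' t)" using assms[THEN ac_integrable] by auto
 fix t :: real assume t: "t \<in> I"
 show "u t + v t = u 0 + v 0 + prim (%t. u' t + v' t) t"
  using ac_eq[OF assms(1) t] ac_eq[OF assms(2) t] t
  by (subst prim_add) (use assms[THEN ac_integrable] in auto)
qed

lemma ac_cmult: assumes "ac u u'" shows "ac (%t. c * u t) (%t. c * u' t)"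
proof (rule acI)
 show "integrable UI (%t. c * u' t)" using ac_integrable[OF assms] by simp
 fix t :: real assume "t \<in> I"
 from ac_eq[OF assms this] show "c * u t = c * u 0 + prim (%t. c * u' t) t"
  by (simp only: prim_cmult distrib_left)
qed

lemma ac_mult: assumes u: "ac u u'" and v: "ac v v'"
 shows "ac (%t. u t * v t) (%t. u' t * v t + u t * v' t)"
 unfolding ac_def
proof (intro conjI ballI)
 note i = ac_integrable[OF u] ac_integrable[OF v]
 note c = prim_continuous[OF i(1)] prim_continuous[OF i(2)]
 show "integrable UI (%t. u' t * v t + u t * v' t)"
  using continuous_mult_integrable[OF ac_continuous[OF v] i(1)]
   continuous_mult_integrable[OF ac_continuous[OF u] i(2)] by (auto simp: mult.commute)
 fix t :: real assume t: "t \<in> I"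
 then have t1: "t <= 1" by simp
 have "prim (%t. u' t * v t + u t * v' t) t
  = prim (%t. (v 0 * u' t + u 0 * v' t) + (u' t * prim v' t + prim u' t * v' t)) t"
 proof (rule prim_cong)
  fix y :: real assume "y \<in> I"
  then show "u' y * v y + u y * v' y = (v 0 * u' y + u 0 * v' y) + (u' y * prim v' y + prim u' y * v' y)"
   by (subst ac_eq[OF u], simp, subst ac_eq[OF v]) (auto simp: algebra_simps)
 qed (use t in auto)
 also have "... = (v 0 * prim u' t + u 0 * prim v' t) + prim u' t * prim v' t"
  using t1 i continuous_mult_integrable[OF c(1) i(2)]
   continuous_mult_integrable[OF c(2) i(1), unfolded mult.commute[of "prim v' _"]]
  by (simp add: prim_add prim_cmult prim_mult_prim)
 finally show "u t * v t = u 0 * v 0 + prim (%t. u' t * v t + u t * v' t) t"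
  using ac_eq[OF u t] ac_eq[OF v t] by (simp add: algebra_simps)
qed

lemma ac_minus: "ac u u' ==> ac (%t. - u t) (%t. - u' t)"
 using ac_cmult[of u u' "-1"] by simp

lemma ac_diff: "ac u u' ==> ac v v' ==> ac (%t. u t - v t) (%t. u' t - v' t)"
 using ac_add[OF _ ac_minus, of u u' v v'] by simp

lemma ac_power:
 assumes u: "ac u u'" shows "ac (%t. u t ^ n) (%t. real n * u t ^ (n - 1) * u' t)"
proof (induction n)
 case 0 show ?case using ac_const[of 1] by simp
next
 case (Suc n)
 show ?case by (rule ac_cong[OF ac_mult[OF u Suc]]) (cases n; auto simp: algebra_simps)+
qed

lemma ac_sum: "(!!k. k < n ==> ac (f k) (f' k)) ==> ac (%t. \<Sum>k<n. f k t) (%t. \<Sum>k<n. f' k t)" for n :: nat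
proof (induction n)
 case 0 show ?case using ac_const[of 0] by simp
next
 case (Suc n) then show ?case using ac_add[of "%t. \<Sum>k<n. f k t"] by simp
qed

text \<open>The chain rule is obtained by passing to the limit in the exponential series.\<close>

lemma ac_exp: assumes u: "ac u u'" shows "ac (%t. exp (u t)) (%t. exp (u t) * u' t)"
proof -
 \<comment> \<open>\<open>f\<close> has one term more than \<open>f'\<close>: the derivative of a
   partial sum of the exponential series is the previous partial sum.\<close>
 define f where "f n t = (\<Sum>k<Suc n. (1 / fact k) * u t ^ k)" for n t
 define f' where "f' n t = (\<Sum>k<n. (1 / fact k) * u t ^ k) * u' t" for n t
 have A: "ac (f n) (f' n)" for n
 proof -
  have "ac (%t. \<Sum>k<Suc n. (1 / fact k) * u t ^ k) (%t. \<Sum>k<Suc n. (1 / fact k) * (real k * u t ^ (k - 1) * u' t))"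
   by (intro ac_sum ac_cmult ac_power u)
  then have "ac (f n) (%t. \<Sum>k<Suc n. (1 / fact k) * (real k * u t ^ (k - 1) * u' t))" unfolding f_def .
  moreover have "(\<Sum>k<Suc n. (1 / fact k) * (real k * u t ^ (k - 1) * u' t)) = f' n t" for t
   unfolding f'_def sum.lessThan_Suc_shift sum_distrib_right
  proof -
   have "1 / fact (Suc k) * (real (Suc k) * u t ^ k * u' t) = 1 / fact k * u t ^ k * u' t" for k
    by (simp del: of_nat_Suc add: divide_simps)
   then show "(1 / fact 0) * (real 0 * u t ^ (0 - 1) * u' t)
     + (\<Sum>k<n. (1 / fact (Suc k)) * (real (Suc k) * u t ^ (Suc k - 1) * u' t)) = (\<Sum>k<n. 1 / fact k * u t ^ k * u' t)"
    by simp
  qed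
  ultimately show ?thesis by simp
 qed
 obtain K where K: "K >= 0" "!!t. t \<in> I ==> \<bar>u t\<bar> <= K" using continuous_bounded_UI[OF ac_continuous[OF u]] by blast
 have [measurable]: "u \<in> bm UI" "u' \<in> bm UI"
  using continuous_measurable_UI[OF ac_continuous[OF u]] ac_integrable[OF u] by auto
 have ser: "(%n. \<Sum>k<n. (1 / fact k) * x ^ k) ----> exp x" for x :: real
  using exp_converges[of x] by (simp add: sums_def scaleR_conv_of_real field_simps)
 have bnd: "\<bar>\<Sum>k<n. (1 / fact k) * x ^ k\<bar> <= exp \<bar>x\<bar>" for n and x :: real
 proof -
  have "\<bar>\<Sum>k<n. (1 / fact k) * x ^ k\<bar> <= (\<Sum>k<n. \<bar>(1 / fact k) * x ^ k\<bar>)" by (rule sum_abs)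
  also have "... = (\<Sum>k<n. \<bar>x\<bar> ^ k /\<^sub>R fact k)"
   by (intro sum.cong) (auto simp: abs_mult power_abs field_simps)
  also have "... <= exp \<bar>x\<bar>"
   unfolding exp_def by (rule sum_le_suminf) (use summable_exp_generic[of "\<bar>x\<bar>"] in auto)
  finally show ?thesis .
 qed
 have int: "integrable UI (%t. exp (u t) * u' t)"
  by (intro continuous_mult_integrable continuous_intros ac_continuous[OF u] ac_integrable[OF u])
 show ?thesis unfolding ac_def
 proof (intro conjI ballI int)
  fix t :: real assume t: "t \<in> I"
  have "(%n. LINT s|UI. (if s <= t then f' n s else 0)) ----> (LINT s|UI. (if s <= t then exp (u s) * u' s else 0))"
  proof (rule integral_dominated_convergence[where w="%s. exp K * \<bar>u' s\<bar>"])
   show "(%s. if s <= t then f' n s else 0) \<in> bm UI" for n unfolding f'_def by measurable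
   show "AE s in UI. (%n. if s <= t then f' n s else 0) ----> (if s <= t then exp (u s) * u' s else 0)"
    unfolding f'_def by (intro AE_I2) (auto intro!: tendsto_intros ser[simplified])
   show "AE s in UI. norm (if s <= t then f' n s else 0) <= exp K * \<bar>u' s\<bar>" for n
   proof (intro AE_I2)
    fix s assume "s \<in> space UI"
    then have "exp \<bar>u s\<bar> <= exp K" using K by auto
    then show "norm (if s <= t then f' n s else 0) <= exp K * \<bar>u' s\<bar>"
     unfolding f'_def using order_trans[OF bnd[where n=n and x="u s"]]
     by (auto simp: abs_mult intro!: mult_right_mono)
   qed
  qed (use ac_integrable[OF u] in auto)
  then have "(%n. f n 0 + prim (f' n) t) ----> exp (u 0) + prim (%t. exp (u t) * u' t) t"
   using t LIMSEQ_Suc[OF ser[of "u 0"]] by (intro tendsto_add) (auto simp: prim_eq f_def)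
  moreover have "f n 0 + prim (f' n) t = f n t" for n using ac_eq[OF A t] by simp
  moreover have "(%n. f n t) ----> exp (u t)" using LIMSEQ_Suc[OF ser[of "u t"]] by (simp add: f_def)
  ultimately show "exp (u t) = exp (u 0) + prim (%t. exp (u t) * u' t) t"
   using LIMSEQ_unique by auto
 qed
qed

text \<open>The product of u with exp of minus the primitive of u'/u has density zero and is
  therefore constant. With u = theta this identifies theta as the eta of the perturbed
  curve.\<close>

lemma ac_exp_quotient:
 assumes u: "ac u u'" and pos: "!!t. t \<in> I ==> u t > 0" and t: "t \<in> I"
 shows "exp (prim (%s. u' s / u s) t) = u t / u 0"
proof -
 have c: "continuous_on I (%t. 1 / u t)"
  using ac_continuous[OF u] pos by (intro continuous_intros) force+
 have int: "integrable UI (%s. u' s / u s)"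
  using continuous_mult_integrable[OF c ac_integrable[OF u]] by simp
 have l: "ac (%t. - prim (%s. u' s / u s) t) (%s. - (u' s / u s))"
  by (rule ac_minus) (rule ac_prim[OF int])
 have m: "ac (%t. u t * exp (- prim (%s. u' s / u s) t)) (%_. 0)"
  by (rule ac_cong[OF ac_mult[OF u ac_exp[OF l]]]) (use pos in force)+
 have "u t * exp (- prim (%s. u' s / u s) t) = u 0"
  using ac_eq[OF m t] prim_const[OF t, of 0] by simp
 then show ?thesis using pos[of 0] by (simp add: exp_minus field_simps)
qed

text \<open>By \<open>ac_exp_quotient\<close> the reciprocal is a multiple of an exponential, so the
  chain rule for \<open>exp\<close> suffices.\<close>

lemma ac_inverse:
 assumes u: "ac u u'" and pos: "!!t. t \<in> I ==> u t > 0"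
 shows "ac (%t. 1 / u t) (%t. - u' t / (u t)^2)"
proof -
 have c: "continuous_on I (%t. 1 / u t)"
  using ac_continuous[OF u] pos by (intro continuous_intros) force+
 have int: "integrable UI (%s. u' s / u s)"
  using continuous_mult_integrable[OF c ac_integrable[OF u]] by simp
 have l: "ac (%t. - prim (%s. u' s / u s) t) (%s. - (u' s / u s))"
  by (rule ac_minus) (rule ac_prim[OF int])
 have e: "exp (- prim (%s. u' s / u s) t) = u 0 / u t" if "t \<in> I" for t
  using ac_exp_quotient[OF u pos that] by (simp add: exp_minus)
 show ?thesis
  by (rule ac_cong[OF ac_cmult[OF ac_exp[OF l], of "1 / u 0"]])
    (use pos[of 0] in "auto simp: e field_simps power2_eq_square dest: pos")
qed

section \<open>A sign pattern on a grid whose first two primitives vanish at the nodes\<close>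

subsection \<open>Cellwise oscillation\<close>

text \<open>Index of the cell of a point for the partition of the unit interval into \<open>N\<close> half-open cells of
 equal length, the last one being closed so that the partition includes the endpoint \<open>1\<close>.\<close>

definition idx :: "nat => real => nat" where
 "idx N x = min (N - 1) (nat \<lfloor>real N * x\<rfloor>)"

text \<open>The signs are +, -, -, + on the four quarters of each cell. A simple +, - pattern would
  have mean zero but a primitive of one sign; here the primitive has mean zero on every cell as
  well.\<close>

definition walsh :: "nat => real => real" where
 "walsh N x = (if nat \<lfloor>4 * real N * x\<rfloor> mod 4 \<in> {0, 3} then 1 else -1)"

definition osc :: "nat => (nat => real) => real => real" where
 "osc N F x = F (idx N x) * walsh N x"

lemma walsh_square [simp]: "walsh N x * walsh N x = 1" "(walsh N x)^2 = 1" "\<bar>walsh N x\<bar> = 1"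
 by (auto simp: walsh_def)

lemma measurable_walsh [measurable]: "walsh N \<in> bm borel"
 unfolding walsh_def by measurable

lemma measurable_idx [measurable]: "idx N \<in> measurable borel (count_space UNIV)"
 unfolding idx_def by measurable

lemma measurable_walsh_UI [measurable]: "walsh N \<in> bm UI"
 and measurable_idx_UI [measurable]: "idx N \<in> measurable UI (count_space UNIV)"
 by (rule measurable_UI; measurable)+

lemma measurable_of_idx [measurable]: "(%x. F (idx N x)) \<in> bm UI" for F :: "nat => real"
 by (rule measurable_compose[OF measurable_idx_UI]) simp

lemma continuous_integrable_UI: "continuous_on I u ==> integrable UI u" for u :: "real => real"
 using continuous_mult_integrable[of u "%_. 1"] by simp

lemma measurable_osc [measurable]: "osc N F \<in> bm UI"
 unfolding osc_def by (intro borel_measurable_times measurable_of_idx measurable_walsh_UI)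

lemma idx_less: "N >= 1 ==> idx N x < N"
 by (auto simp: idx_def)

lemma idx_bounds:
 assumes "N >= 1" "x \<in> I"
 shows "real (idx N x) / N <= x" "x <= (real (idx N x) + 1) / N"
proof -
 have f: "real (nat \<lfloor>real N * x\<rfloor>) = of_int \<lfloor>real N * x\<rfloor>" using assms by simp
 have "real (idx N x) <= real N * x"
 proof -
  have "real (idx N x) <= real (nat \<lfloor>real N * x\<rfloor>)" by (simp add: idx_def)
  then show ?thesis using f by linarith
 qed
 then show "real (idx N x) / N <= x" using assms by (simp add: field_simps)
 have "real N * x <= real (idx N x) + 1"
 proof (cases "nat \<lfloor>real N * x\<rfloor> <= N - 1")
  case True
  then show ?thesis using f by (simp add: idx_def)
 next
  case False
  then have "real (idx N x) + 1 = real N" using assms by (simp add: idx_def of_nat_diff)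
  then show ?thesis using assms by (simp add: mult_left_le)
 qed
 then show "x <= (real (idx N x) + 1) / N" using assms by (simp add: field_simps)
qed

lemma idx_dist:
 assumes "N >= 1" "x \<in> I"
 shows "\<bar>x - real (idx N x) / N\<bar> <= 1 / N" "real (idx N x) / N \<in> I"
 using idx_bounds[OF assms] idx_less[OF assms(1), of x] assms by (auto simp: add_divide_distrib)

lemma floor_div_cell:
 assumes "M >= 1" "real j / real M < y" "y < (real j + 1) / real M"
 shows "nat \<lfloor>real M * y\<rfloor> = j"
proof -
 have "real j < real M * y" "real M * y < real j + 1" using assms by (auto simp: field_simps)
 then have "\<lfloor>real M * y\<rfloor> = int j" by (intro floor_unique) auto
 then show ?thesis by simp
qed

lemma idx_eq:
 assumes "k < N" "real k / N < y" "y < (real k + 1) / N"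
 shows "idx N y = k"
 using floor_div_cell[of N k y] assms by (simp add: idx_def)

lemma osc_eq:
 assumes k: "k < N" and r: "r < 4" and y: "real (4 * k + r) / real (4 * N) < y" "y < (real (4 * k + r) + 1) / real (4 * N)"
 shows "osc N F y = F k * (if r \<in> {0, 3} then 1 else -1)"
proof -
 have q: "nat \<lfloor>real (4 * N) * y\<rfloor> = 4 * k + r"
  using floor_div_cell[of "4 * N" "4 * k + r" y] k y by simp
 have "4 * real k < real N * 4 * y" "real N * 4 * y < 4 * real k + 4"
  using y k r by (auto simp: field_simps)
 then have "idx N y = k" using k by (intro idx_eq) (auto simp: field_simps)
 moreover have "(4 * k + r) mod 4 = r" using r by simp
 ultimately show ?thesis using q by (simp add: osc_def walsh_def)
qed

lemma prim_affine: "t \<in> I ==> prim (%y. a + b * y) t = a * t + b * t^2 / 2"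
proof -
 assume t: "t \<in> I"
 have one: "ac (%t. t) (%_. 1)" by (rule acI) (use prim_const[of _ 1] in auto)
 have "ac (%t. t * t) (%t. 2 * t)" by (rule ac_cong[OF ac_mult[OF one one]]) auto
 from ac_eq[OF this t] have "prim (%y. b / 2 * (2 * y)) t = b / 2 * (t * t)" by (subst prim_cmult) simp
 then have "prim (%y. b * y) t = b * t^2 / 2" by (simp add: power2_eq_square)
 moreover have "prim (%y. a + b * y) t = prim (%_. a) t + prim (%y. b * y) t"
  using t by (intro prim_add continuous_integrable_UI continuous_intros) auto
 ultimately show ?thesis using t by (simp add: prim_const)
qed

lemma prim_affine_piece:
 assumes ab: "0 <= a" "a <= b" "b <= 1" and v: "integrable UI v"
  and e: "!!y. a < y ==> y < b ==> v y = \<alpha> + \<beta> * (y - a)"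
 shows "prim v b = prim v a + \<alpha> * (b - a) + \<beta> * (b - a)^2 / 2"
proof -
 let ?w = "%y. (\<alpha> - \<beta> * a) + \<beta> * y"
 have w: "integrable UI ?w"
  by (intro continuous_integrable_UI continuous_intros)
 have [measurable]: "v \<in> bm UI" using v by auto
 have "prim v b - prim v a = (LINT y|UI. (if a < y & y <= b then v y else 0))"
  by (rule prim_increment) (use ab v in auto)
 also have "... = (LINT y|UI. (if a < y & y <= b then ?w y else 0))"
  by (intro integral_cong_AE eventually_mono[OF AE_UI_neq[of b]]) (auto simp: e algebra_simps)
 also have "... = prim ?w b - prim ?w a"
  by (rule prim_increment[symmetric]) (use ab w in auto)
 also have "... = \<alpha> * (b - a) + \<beta> * (b - a)^2 / 2"
 proof -
  have p: "prim ?w a = (\<alpha> - \<beta> * a) * a + \<beta> * a^2 / 2" "prim ?w b = (\<alpha> - \<beta> * a) * b + \<beta> * b^2 / 2"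
   using ab by (auto intro!: prim_affine)
  show ?thesis unfolding p by (simp add: power2_eq_square field_simps)
 qed
 finally show ?thesis by simp
qed

lemma osc_integrable: assumes "N >= 1" shows "integrable UI (osc N F)"
proof (rule UI.integrable_const_bound[where B="\<Sum>k<N. \<bar>F k\<bar>"])
 have "\<bar>F (idx N x)\<bar> <= (\<Sum>k<N. \<bar>F k\<bar>)" for x
  using idx_less[OF assms, of x] by (intro member_le_sum) auto
 then show "AE x in UI. norm (osc N F x) <= (\<Sum>k<N. \<bar>F k\<bar>)" by (simp add: osc_def abs_mult)
qed measurable

lemma prim_osc_quarter:
 assumes k: "k < N" and r: "r < 4" and x: "real (4 * k + r) / real (4 * N) <= x" "x <= (real (4 * k + r) + 1) / real (4 * N)"
 shows "prim (osc N F) x = prim (osc N F) (real (4 * k + r) / real (4 * N))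
  + F k * (if r \<in> {0, 3} then 1 else -1) * (x - real (4 * k + r) / real (4 * N))"
proof -
 have "(real (4 * k + r) + 1) / real (4 * N) <= 1" using k r by (simp add: field_simps)
 then have x1: "x <= 1" using x by simp
 show ?thesis
  by (subst prim_affine_piece[where v="osc N F" and a="real (4 * k + r) / real (4 * N)" and b=x and \<beta>=0
    and \<alpha>="F k * (if r \<in> {0, 3} then 1 else -1)"])
   (use k r x x1 osc_integrable[of N F] osc_eq[OF k r, of _ F] in auto)
qed

text \<open>With h a quarter of the cell length, the primitive climbs to F h, returns to 0 at the
  midpoint, descends to - F h and returns to 0. The tents on the two halves are opposite, so its own
  primitive is unchanged across the cell.\<close>

lemma prim_osc_cell:
 assumes k: "k < N" and x: "real k / N <= x" "x <= (real k + 1) / N" and 0: "prim (osc N F) (real k / N) = 0"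
 shows "\<bar>prim (osc N F) x\<bar> <= \<bar>F k\<bar> / N" "prim (osc N F) ((real k + 1) / N) = 0"
  "prim (prim (osc N F)) ((real k + 1) / N) = prim (prim (osc N F)) (real k / N)"
proof -
 define h where "h = 1 / (4 * real N)"
 define c where "c = real k / N"
 have N: "N > 0" using k by simp
 have h: "h > 0" "1 / N = 4 * h" using N by (auto simp: h_def)
 define G where "G = prim (osc N F)"
 have pt: "real (4 * k + r) / real (4 * N) = c + r * h" for r using N by (simp add: c_def h_def field_simps)
 have pt': "(real (4 * k + r) + 1) / real (4 * N) = c + (r + 1) * h" for r using N by (simp add: c_def h_def field_simps)
 have G: "G x = G (c + real r * h) + F k * (if r \<in> {0, 3} then 1 else -1) * (x - (c + real r * h))"
  if "r < 4" "c + real r * h <= x" "x <= c + (real r + 1) * h" for r x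
  using prim_osc_quarter[OF k that(1), of x F] that unfolding pt pt' G_def by simp
 have e: "(real k + 1) / N = c + 4 * h" using h by (simp add: c_def add_divide_distrib)
 have G0: "G c = 0" using 0 by (simp add: G_def c_def)
 have A: "G x = F k * (x - c)" if "c <= x" "x <= c + h" for x using G[of 0 x] that G0 by simp
 have G1: "G (c + h) = F k * h" using A[of "c + h"] h by simp
 have B: "G x = F k * (2 * h - (x - c))" if "c + h <= x" "x <= c + 2 * h" for x
  using G[of 1 x] that G1 by (simp add: algebra_simps)
 have G2: "G (c + 2 * h) = 0" using B[of "c + 2 * h"] h by simp
 have C: "G x = F k * (2 * h - (x - c))" if "c + 2 * h <= x" "x <= c + 3 * h" for x
  using G[of 2 x] that G2 by (simp add: algebra_simps)
 have G3: "G (c + 3 * h) = - F k * h" using C[of "c + 3 * h"] h by (simp add: algebra_simps)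
 have D: "G x = F k * ((x - c) - 4 * h)" if "c + 3 * h <= x" "x <= c + 4 * h" for x
  using G[of 3 x] that G3 by (simp add: algebra_simps)
 show "prim (osc N F) ((real k + 1) / N) = 0" using D[of "c + 4 * h"] h unfolding e G_def by simp
 have "c + 4 * h <= 1" using k unfolding e[symmetric] by (simp add: field_simps)
 have c0: "c >= 0" by (simp add: c_def)
 have "\<bar>G x\<bar> <= \<bar>F k\<bar> * h"
 proof -
  have x': "c <= x" "x <= c + 4 * h" using x e by (auto simp: c_def)
  obtain u where "G x = F k * u" "\<bar>u\<bar> <= h"
  proof -
   consider "x <= c + h" | "c + h <= x" "x <= c + 2 * h" | "c + 2 * h <= x" "x <= c + 3 * h" | "c + 3 * h <= x"
    using h by linarith
   then show ?thesis
   proof cases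
    case 1 then show ?thesis using that[of "x - c"] A[of x] x' by auto
   next
    case 2 then show ?thesis using that[of "2 * h - (x - c)"] B[of x] by auto
   next
    case 3 then show ?thesis using that[of "2 * h - (x - c)"] C[of x] by auto
   next
    case 4 then show ?thesis using that[of "(x - c) - 4 * h"] D[of x] x' by auto
   qed
  qed
  then show ?thesis by (simp add: abs_mult mult_left_mono)
 qed
 also have "... <= \<bar>F k\<bar> * (1 / N)" unfolding h(2) using h(1) by (intro mult_left_mono) auto
 finally show "\<bar>prim (osc N F) x\<bar> <= \<bar>F k\<bar> / N" by (simp add: G_def)
 have i: "integrable UI G"
  unfolding G_def using N by (intro continuous_integrable_UI prim_continuous osc_integrable) simp
 \<comment> \<open>The four quarters contribute F h^2 / 2 with signs +, +, -, -.\<close>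
 have "prim G (c + h) = prim G c + F k * h^2 / 2"
  by (subst prim_affine_piece[where a=c and \<alpha>=0 and \<beta>="F k"])
    (use c0 h \<open>c + 4 * h <= 1\<close> i A in auto)
 moreover have "prim G (c + 2 * h) = prim G (c + h) + F k * h^2 / 2"
  by (subst prim_affine_piece[where a="c + h" and \<alpha>="F k * h" and \<beta>="- F k"])
    (use c0 h \<open>c + 4 * h <= 1\<close> i B in "auto simp: algebra_simps power2_eq_square")
 moreover have "prim G (c + 3 * h) = prim G (c + 2 * h) - F k * h^2 / 2"
  by (subst prim_affine_piece[where a="c + 2 * h" and \<alpha>=0 and \<beta>="- F k"])
    (use c0 h \<open>c + 4 * h <= 1\<close> i C in "auto simp: algebra_simps power2_eq_square")
 moreover have "prim G (c + 4 * h) = prim G (c + 3 * h) - F k * h^2 / 2"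
  by (subst prim_affine_piece[where a="c + 3 * h" and \<alpha>="- F k * h" and \<beta>="F k"])
    (use c0 h \<open>c + 4 * h <= 1\<close> i D in "auto simp: algebra_simps power2_eq_square")
 ultimately show "prim (prim (osc N F)) ((real k + 1) / N) = prim (prim (osc N F)) (real k / N)"
  unfolding e G_def[symmetric] c_def[symmetric] by simp
qed

lemma prim_osc_grid:
 assumes "k <= N"
 shows "prim (osc N F) (real k / N) = 0 & prim (prim (osc N F)) (real k / N) = 0"
 using assms
proof (induction k)
 case (Suc k)
 then show ?case
  using prim_osc_cell(2,3)[of k N "real k / N" F] by (simp add: divide_right_mono add.commute)
qed simp

text \<open>The primitive restarts from 0 at each node, so it sees only the amplitude of the current
  cell and the distance travelled in it.\<close>

lemma prim_osc_bound:
 assumes "N >= 1" "x \<in> I"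
 shows "\<bar>prim (osc N F) x\<bar> <= \<bar>F (idx N x)\<bar> / N"
 using prim_osc_cell(1)[OF idx_less[OF assms(1)] idx_bounds[OF assms]]
  prim_osc_grid[of "idx N x" N F] idx_less[OF assms(1), of x] by simp

lemma osc_mean_zero: "N >= 1 ==> prim (osc N F) 1 = 0" "N >= 1 ==> prim (prim (osc N F)) 1 = 0"
 using prim_osc_grid[of N N F] by auto

lemma integral_idx:
 fixes F :: "nat => real"
 assumes "N >= 1" shows "(LINT x|UI. F (idx N x)) = (\<Sum>k<N. F k) / N"
proof -
 let ?f = "%x. F (idx N x)"
 have i: "integrable UI ?f"
 proof (rule UI.integrable_const_bound[where B="\<Sum>k<N. \<bar>F k\<bar>"])
  show "AE x in UI. norm (F (idx N x)) <= (\<Sum>k<N. \<bar>F k\<bar>)"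
   using idx_less[OF assms] by (auto intro!: AE_I2 member_le_sum)
 qed measurable
 have "prim ?f (real k / N) = (\<Sum>j<k. F j) / N" if "k <= N" for k
  using that
 proof (induction k)
  case (Suc k)
  have "prim ?f ((real k + 1) / N) = prim ?f (real k / N) + F k * ((real k + 1) / N - real k / N)"
   by (subst prim_affine_piece[where a="real k / N" and \<alpha>="F k" and \<beta>=0])
     (use Suc.prems i idx_eq[of k N] in "auto simp: divide_right_mono")
  then show ?case using Suc by (simp add: add_divide_distrib[symmetric] diff_divide_distrib[symmetric] add.commute)
 qed simp
 from this[of N] show ?thesis using assms by (simp add: prim_1)
qed

lemma l2_idx: "N >= 1 ==> l2 UI (%x. F (idx N x))"
 unfolding l2_def
proof
 assume N: "N >= 1"
 show "integrable UI (%x. (F (idx N x))^2)"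
 proof (rule UI.integrable_const_bound[where B="\<Sum>k<N. (F k)^2"])
  have "(F (idx N x))^2 <= (\<Sum>k<N. (F k)^2)" for x
   using idx_less[OF N, of x] by (intro member_le_sum) auto
  then show "AE x in UI. norm ((F (idx N x))^2) <= (\<Sum>k<N. (F k)^2)" by simp
 qed measurable
qed measurable

lemma l2_osc: "N >= 1 ==> l2 UI (osc N F)"
 by (rule l2_bound[OF l2_idx[of N F]]) (auto simp: osc_def abs_mult)

lemma nrm_osc: "nrm UI (osc N F) = nrm UI (%x. F (idx N x))"
 by (simp add: nrm_def osc_def power_mult_distrib)

lemma nrm_idx: "N >= 1 ==> (nrm UI (%x. F (idx N x)))^2 = (\<Sum>k<N. (F k)^2) / N"
 unfolding nrm_square by (rule integral_idx)

text \<open>A cell has length 1/N, so an amplitude of L2 norm one may reach sqrt N on a single cell.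
  Together with \<open>prim_osc_bound\<close> the primitive of an oscillation is of order 1/sqrt
  N.\<close>

lemma cell_value_bound:
 assumes "N >= 1" shows "\<bar>F (idx N x)\<bar> <= sqrt N * nrm UI (%x. F (idx N x))"
proof (rule power2_le_imp_le)
 have "(F (idx N x))^2 <= (\<Sum>k<N. (F k)^2)"
  using idx_less[OF assms] by (intro member_le_sum) auto
 then show "\<bar>F (idx N x)\<bar>^2 <= (sqrt N * nrm UI (%x. F (idx N x)))^2"
  using assms by (simp add: power_mult_distrib nrm_idx)
qed (use assms in simp)

section \<open>Oscillations with L2-bounded amplitudes converge weakly to zero\<close>

subsection \<open>Weak convergence of oscillating sequences\<close>

lemma nrm_dominated_convergence:
 assumes g: "l2 M g" and m: "!!n. f n \<in> bm M" "f' \<in> bm M"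
  and c: "AE x in M. (%n. f n x) ----> f' x" and b: "!!n. AE x in M. \<bar>f n x\<bar> <= \<bar>g x\<bar>"
 shows "(%n::nat. nrm M (%x. f n x - f' x)) ----> 0"
proof -
 note [measurable] = m
 have b': "AE x in M. \<forall>n. \<bar>f n x\<bar> <= \<bar>g x\<bar>" using b by (simp add: AE_all_countable)
 have f': "AE x in M. \<bar>f' x\<bar> <= \<bar>g x\<bar>"
  using c b'
 proof eventually_elim
  case (elim x)
  show ?case by (rule LIMSEQ_le_const2[OF tendsto_rabs[OF elim(1)]]) (use elim(2) in auto)
 qed
 have "(%n. LINT x|M. (f n x - f' x)^2) ----> (LINT x|M. 0)"
 proof (rule integral_dominated_convergence[where w="%x. 4 * (g x)^2"])
  show "integrable M (%x. 4 * (g x)^2)" using g by (auto simp: l2_def)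
  show "AE x in M. (%n. (f n x - f' x)^2) ----> 0"
   using c
  proof eventually_elim
   case (elim x)
   have "(%n. (f n x - f' x)^2) ----> (f' x - f' x)^2" by (intro tendsto_intros elim)
   then show ?case by simp
  qed
  show "AE x in M. norm ((f n x - f' x)^2) <= 4 * (g x)^2" for n
   using f' b[of n]
  proof eventually_elim
   case (elim x)
   then have "\<bar>f n x - f' x\<bar> <= \<bar>2 * g x\<bar>" by linarith
   then have "(f n x - f' x)^2 <= (2 * g x)^2" by (simp only: abs_le_square_iff)
   then show ?case by (simp add: power_mult_distrib)
  qed
 qed measurable
 then have "(%n. sqrt (LINT x|M. (f n x - f' x)^2)) ----> sqrt 0"
  by (intro tendsto_real_sqrt) simp
 then show ?thesis by (simp add: nrm_def)
qed

lemma over_sqrt_tendsto: "(%N. c / sqrt (real N)) ----> 0"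
 by (rule real_tendsto_divide_at_top[OF tendsto_const filterlim_compose[OF sqrt_at_top filterlim_real_sequentially]])

locale bounded_osc =
 fixes F :: "nat => nat => real" and A :: real
 assumes bounded: "!!N. N >= 1 ==> nrm UI (%x. F N (idx N x)) <= A"
begin

definition null :: "(real => real) => bool" where
 "null \<psi> \<longleftrightarrow> (%N. LINT x|UI. \<psi> x * osc N (F N) x) ----> 0"

lemma A_nonneg: "A >= 0"
 using bounded[of 1] nrm_nonneg[of UI] order_trans by blast

text \<open>The uniform bound A on the amplitudes makes the pairing equicontinuous in the test
  function, so the good test functions are closed in L2.\<close>

lemma null_closed:
 assumes l: "!!n. l2 UI (f n)" and l': "l2 UI f'" and n: "!!n. null (f n)"
  and c: "(%n::nat. nrm UI (%x. f n x - f' x)) ----> 0"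
 shows "null f'"
 unfolding null_def
proof (rule LIMSEQ_I)
 fix e :: real assume e: "e > 0"
 have "\<forall>\<^sub>F n in sequentially. nrm UI (%x. f n x - f' x) < e / (2 * (A + 1))"
  \<comment> \<open>A + 1 in the denominator keeps the quotient meaningful when A = 0.\<close>
  using c e A_nonneg by (intro order_tendstoD) auto
 then obtain n where n1: "nrm UI (%x. f n x - f' x) < e / (2 * (A + 1))"
  by (auto simp: eventually_sequentially)
 obtain K where K: "!!N. N >= K ==> \<bar>LINT x|UI. f n x * osc N (F N) x\<bar> < e / 2"
  using LIMSEQ_D[OF n[unfolded null_def, of n], of "e / 2"] e by auto
 show "\<exists>no. \<forall>N\<ge>no. norm ((LINT x|UI. f' x * osc N (F N) x) - 0) < e"
 proof (intro exI allI impI)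
  fix N assume "N >= max 1 K"
  then have N: "N >= 1" "N >= K" by auto
  note o = l2_osc[OF N(1), of "F N"]
  have "(LINT x|UI. f' x * osc N (F N) x) = (LINT x|UI. f n x * osc N (F N) x) - (LINT x|UI. (f n x - f' x) * osc N (F N) x)"
   by (subst LINT_diff[symmetric])
     (auto intro!: l2_mult_integrable l2_diff l l' o LINT_cong simp: algebra_simps)
  moreover have "\<bar>LINT x|UI. (f n x - f' x) * osc N (F N) x\<bar> <= e / (2 * (A + 1)) * A"
  proof -
   have "\<bar>LINT x|UI. (f n x - f' x) * osc N (F N) x\<bar> <= nrm UI (%x. f n x - f' x) * nrm UI (osc N (F N))"
    by (intro Cauchy_Schwarz_l2 l2_diff l l' o)
   also have "... <= e / (2 * (A + 1)) * A"
    using n1 bounded[OF N(1)] A_nonneg e by (intro mult_mono) (auto simp: nrm_osc)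
   finally show ?thesis .
  qed
  moreover have "e / (2 * (A + 1)) * A <= e / 2" using e A_nonneg by (simp add: field_simps)
  ultimately show "norm ((LINT x|UI. f' x * osc N (F N) x) - 0) < e" using K[OF N(2)]
   unfolding real_norm_def diff_0_right by linarith
 qed
qed

lemma null_add:
 assumes "l2 UI f" "l2 UI g" "null f" "null g" shows "null (%x. f x + g x)"
proof -
 have "(%N. (LINT x|UI. f x * osc N (F N) x) + (LINT x|UI. g x * osc N (F N) x)) ----> 0 + 0"
  using assms unfolding null_def by (intro tendsto_add)
 moreover have "\<forall>\<^sub>F N in sequentially. (LINT x|UI. f x * osc N (F N) x) + (LINT x|UI. g x * osc N (F N) x)
   = (LINT x|UI. (f x + g x) * osc N (F N) x)"
  using eventually_ge_at_top[of 1]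
 proof eventually_elim
  case (elim N)
  show ?case
   by (subst LINT_add[symmetric])
     (auto intro!: l2_mult_integrable assms l2_osc elim LINT_cong simp: algebra_simps)
 qed
 ultimately show ?thesis unfolding null_def by (simp add: Lim_transform_eventually)
qed

lemma null_cmult: "null f ==> null (%x. c * f x)"
 unfolding null_def using tendsto_mult_left[of _ 0 _ c] by (simp add: mult.assoc)

text \<open>The pairing with an initial interval is a value of the primitive, which is at most A /
  sqrt N.\<close>

lemma null_atMost: "null (indicator {..b})"
 unfolding null_def
proof (rule Lim_null_comparison)
 show "(%N. A / sqrt (real N)) ----> 0"
  by (intro tendsto_divide_0[OF tendsto_const] filterlim_at_top_imp_at_infinity
   filterlim_compose[OF sqrt_at_top filterlim_real_sequentially])
 show "\<forall>\<^sub>F N in sequentially. norm (LINT x|UI. indicator {..b} x * osc N (F N) x) <= A / sqrt (real N)"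
  using eventually_ge_at_top[of 1]
 proof eventually_elim
  case (elim N)
  show ?case
  proof (cases "b < 0")
   case True
   have "(LINT x|UI. indicator {..b} x * osc N (F N) x) = (LINT x|UI. 0)"
    by (intro LINT_cong) (use True in "auto split: split_indicator")
   then show ?thesis using A_nonneg elim by simp
  next
   case False
   define b' where "b' = min b 1"
   have b': "b' \<in> I" using False by (auto simp: b'_def)
   have "(LINT x|UI. indicator {..b} x * osc N (F N) x) = prim (osc N (F N)) b'"
    using b' unfolding b'_def
    by (subst prim_eq) (auto intro!: LINT_cong split: split_indicator)
   also have "\<bar>...\<bar> <= \<bar>F N (idx N b')\<bar> / N" by (rule prim_osc_bound[OF elim b'])
   also have "... <= (sqrt N * A) / N"
   proof (rule divide_right_mono)
    have "\<bar>F N (idx N b')\<bar> <= sqrt N * nrm UI (%x. F N (idx N x))" by (rule cell_value_bound[OF elim])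
    also have "... <= sqrt N * A" using bounded[OF elim] by (intro mult_left_mono) auto
    finally show "\<bar>F N (idx N b')\<bar> <= sqrt N * A" .
   qed simp
   also have "... = A / sqrt N" using elim by (simp add: field_simps)
   finally show ?thesis by simp
  qed
 qed
qed

lemma l2_indicator: "S \<in> sets borel ==> l2 UI (indicator S)"
 by (rule l2_bound[OF UI.l2_const[of 1]]) (auto split: split_indicator intro: measurable_UI)

text \<open>Initial intervals are stable under intersection and generate the Borel sets; complements
  and disjoint unions preserve weak nullity, the latter by \<open>null_closed\<close>.\<close>

lemma null_indicator:
 assumes "S \<in> sets borel" shows "null (indicator S)"
proof -
 have S: "S \<in> sigma_sets UNIV (range (%b::real. {..b}))"
  using assms unfolding borel_eq_atMost by simp
 have borel: "sigma_sets UNIV (range (%b::real. {..b})) = sets borel"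
  unfolding borel_eq_atMost by simp
 have "Int_stable (range (%b::real. {..b}))" "range (%b::real. {..b}) \<subseteq> Pow UNIV"
  by (auto simp: Int_stable_def)
 from this S show ?thesis
 proof (induction rule: sigma_sets_induct_disjoint)
  case (basic S) then show ?case using null_atMost by auto
 next
  case empty then show ?case by (simp add: null_def)
 next
  case (compl S)
  have "null (%_. 1)"
   using null_atMost[of 1] unfolding null_def
   by (rule Lim_transform_eventually) (auto intro!: always_eventually LINT_cong)
  then have "null (%x. 1 + (-1) * indicator S x)"
   using compl by (intro null_add null_cmult l2_cmult UI.l2_const l2_indicator) (auto simp: borel)
  moreover have "(%x. 1 + (-1) * indicator S x) = (indicator (UNIV - S) :: real => real)"
   by (auto simp: fun_eq_iff split: split_indicator)
  ultimately show ?case by simp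
 next
  case (union S)
  have m: "S i \<in> sets borel" for i using union(2) by (auto simp: borel)
  have n: "null (indicator (\<Union>i<n. S i))" for n
  proof (induction n)
   case 0 show ?case by (simp add: null_def)
  next
   case (Suc n)
   have "null (%x. indicator (\<Union>i<n. S i) x + indicator (S n) x)"
    using m by (intro null_add Suc union l2_indicator) auto
   moreover have "(%x. indicator (\<Union>i<n. S i) x + indicator (S n) x) = (indicator (\<Union>i<Suc n. S i) :: real => real)"
   proof -
    have "x \<in> S n ==> i < n ==> x \<notin> S i" for x i
     using union(1) unfolding disjoint_family_on_def by (metis Int_iff UNIV_I emptyE less_irrefl)
    then show ?thesis by (auto simp: fun_eq_iff lessThan_Suc split: split_indicator)
   qed
   ultimately show ?case by simp
  qed
  show ?case
  proof (rule null_closed[OF _ _ n])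
   show "(%n. nrm UI (%x. indicator (\<Union>i<n. S i) x - indicator (\<Union>i. S i) x)) ----> 0"
   proof (rule nrm_dominated_convergence[OF UI.l2_const[of 1]])
    show "AE x in UI. (%n. indicator (\<Union>i<n. S i) x :: real) ----> indicator (\<Union>i. S i) x"
     by (intro AE_I2 LIMSEQ_indicator_UN)
   qed (use m in "auto split: split_indicator intro!: measurable_UI")
  qed (use m in "auto intro!: l2_indicator")
 qed
qed

lemma null_nonneg:
 assumes "f \<in> bm UI" "!!x. 0 <= f x" "l2 UI f" shows "null f"
 using assms
proof (induction rule: borel_measurable_induct_real)
 case (set S)
 then show ?case by (intro null_indicator) (auto simp: sets_UI sets_restrict_space_iff)
next
 case (mult u c)
 show ?case
 proof (cases "c = 0")
  case False
  then have "l2 UI u" using l2_cmult[OF mult.prems, of "1 / c"] by simp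
  then show ?thesis using mult null_cmult by blast
 qed (simp add: null_def)
next
 case (add u v)
 have "l2 UI u" "l2 UI v"
  by (rule l2_bound[OF add.prems]; use add in auto)+
 then show ?case using add null_add by blast
next
 case (seq U)
 have le: "U i x <= f x" if "x \<in> space UI" for i x
  by (rule incseq_le[OF _ seq.hyps(4)[OF that]]) (use seq.hyps(3) in "auto simp: incseq_def le_fun_def")
 have l: "l2 UI (U i)" for i
  by (rule l2_bound[OF seq.prems seq.hyps(1)]) (use le seq.hyps(2) in "auto intro!: AE_I2 intro: order_trans[OF _ abs_ge_self]")
 show ?case
  by (rule null_closed[OF l seq.prems], use seq.IH l in blast)
    (rule nrm_dominated_convergence[OF seq.prems, where f=U],
     use seq le in "auto simp: l2_def intro!: AE_I2 intro: order_trans[OF _ abs_ge_self]")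
qed

text \<open>Used twice: for the weak convergence of the curves at the final time, and to remove the
  mixed term 2 p a walsh from the square of the perturbed momentum.\<close>

lemma osc_weak_null:
 assumes "l2 UI f" shows "(%N. LINT x|UI. f x * osc N (F N) x) ----> 0"
proof -
 have [measurable]: "f \<in> bm UI" using assms by (simp add: l2_def)
 have l: "l2 UI (%x. max 0 (f x))" "l2 UI (%x. max 0 (- f x))"
  by (rule l2_bound[OF assms]; auto)+
 have "null (%x. max 0 (f x) + (-1) * max 0 (- f x))"
  by (intro null_add null_cmult l2_cmult l null_nonneg) auto
 moreover have "(%x. max 0 (f x) + (-1) * max 0 (- f x)) = f" by (auto simp: fun_eq_iff max_def)
 ultimately show ?thesis by (simp only: null_def)
qed

end

section \<open>Signed measures, densities and the dual form of the Fisher-Rao functional\<close>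

subsection \<open>Finite measures on the square\<close>

lemma finite_radonD:
 assumes "finite_radon M"
 shows "sets M = sets (restrict_space borel unit_square)" "finite_measure M" "space M = unit_square"
 using assms sets_eq_imp_space_eq[of M "restrict_space borel unit_square"]
 by (auto simp: finite_radon_def space_restrict_space)

lemma unit_square_borel [measurable]: "unit_square \<in> sets borel"
 unfolding borel_prod[symmetric] by (auto simp: unit_square_def)

lemma unit_square_sets: "finite_radon M ==> A \<in> sets M \<longleftrightarrow> A \<in> sets borel & A \<subseteq> unit_square"
 by (auto simp: finite_radonD(1) sets_restrict_space_iff)

lemma finite_radon_measurable: "finite_radon M ==> f \<in> bm borel ==> f \<in> bm M"
 unfolding measurable_cong_sets[OF finite_radonD(1) refl] by (rule measurable_restrict_space1)

lemma finite_radon_measurable_prod: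
 "finite_radon M ==> f \<in> borel_measurable (borel \<Otimes>\<^sub>M borel) ==> f \<in> bm M"
 unfolding borel_prod by (rule finite_radon_measurable)

lemma finite_radon_integrable:
 fixes u :: "real \<times> real => real"
 assumes M: "finite_radon M" and u: "u \<in> bm M" "!!z. z \<in> unit_square ==> \<bar>u z\<bar> <= C"
 shows "integrable M u"
proof -
 interpret finite_measure M using finite_radonD[OF M] by simp
 show ?thesis by (rule integrable_const_bound[where B=C]) (use finite_radonD(3)[OF M] u in auto)
qed

text \<open>The sum of two measures. It serves as a common dominating measure, it replaces
  subtraction in identities between signed measures, and it assembles the time slices of
  \<mu>.\<close>

definition add_measure :: "'a measure => 'a measure => 'a measure" where
 "add_measure M N = measure_of (space M) (sets M) (%A. emeasure M A + emeasure N A)"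

lemma add_measure_simps [simp]: "space (add_measure M N) = space M" "sets (add_measure M N) = sets M"
 by (auto simp: add_measure_def)

lemma emeasure_add_measure:
 assumes "sets M = sets N" and A: "A \<in> sets M"
 shows "emeasure (add_measure M N) A = emeasure M A + emeasure N A"
 unfolding add_measure_def
proof (rule emeasure_measure_of_sigma)
 show "sigma_algebra (space M) (sets M)" ..
 show "positive (sets M) (%A. emeasure M A + emeasure N A)" by (simp add: positive_def)
 show "countably_additive (sets M) (%A. emeasure M A + emeasure N A)"
  by (rule countably_additiveI)
    (use assms in "auto simp: suminf_emeasure suminf_add[symmetric]")
qed fact

lemma finite_add_measure:
 assumes "sets M = sets N" "finite_measure M" "finite_measure N" shows "finite_measure (add_measure M N)"
proof (rule finite_measureI)
 have "space M \<in> sets M" by auto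
 then show "emeasure (add_measure M N) (space (add_measure M N)) ~= \<infinity>"
  using assms sets_eq_imp_space_eq[OF assms(1)]
  by (simp add: emeasure_add_measure finite_measure.emeasure_finite)
qed

lemma nn_integral_add_measure:
 assumes s: "sets M = sets N" and f: "f \<in> bm M"
 shows "(\<integral>\<^sup>+ x. f x \<partial>add_measure M N) = (\<integral>\<^sup>+ x. f x \<partial>M) + (\<integral>\<^sup>+ x. f x \<partial>N)"
 using f
proof (induction rule: borel_measurable_induct)
 case (cong f g)
 have "(\<integral>\<^sup>+ x. f x \<partial>L) = (\<integral>\<^sup>+ x. g x \<partial>L)" if "space L = space M" for L
  by (rule nn_integral_cong) (use cong that in auto)
 from this[of M] this[of N] this[of "add_measure M N"] show ?case
  using cong(4) sets_eq_imp_space_eq[OF s] by simp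
next
 case (set A)
 then show ?case using s by (simp add: emeasure_add_measure)
next
 case (mult u c)
 have "u \<in> bm N" "u \<in> borel_measurable (add_measure M N)"
  using mult s by (auto simp: measurable_cong_sets[OF s[symmetric] refl] measurable_cong_sets[of "add_measure M N" M])
 then show ?case using mult by (simp add: nn_integral_cmult distrib_left)
next
 case (add u v)
 have "u \<in> bm N" "u \<in> borel_measurable (add_measure M N)" "v \<in> bm N" "v \<in> borel_measurable (add_measure M N)"
  using add s by (auto simp: measurable_cong_sets[OF s[symmetric] refl] measurable_cong_sets[of "add_measure M N" M])
 then show ?case using add by (simp add: nn_integral_add ac_simps)
next
 case (seq U)
 have m: "U i \<in> bm N" "U i \<in> borel_measurable (add_measure M N)" for i
  using seq s by (auto simp: measurable_cong_sets[OF s[symmetric] refl] measurable_cong_sets[of "add_measure M N" M])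
 have inc: "incseq (%i. \<integral>\<^sup>+ x. U i x \<partial>L)" for L
  using seq(3) by (auto simp: incseq_def le_fun_def intro!: nn_integral_mono)
 show ?case
  unfolding SUP_apply image_comp using seq m inc
  by (simp add: nn_integral_monotone_convergence_SUP ennreal_SUP_add)
qed

lemma integral_add_measure:
 fixes f :: "'a => real"
 assumes s: "sets M = sets N" and f: "integrable M f" "integrable N f" and pos: "!!x. 0 <= f x"
 shows "(LINT x|add_measure M N. f x) = (LINT x|M. f x) + (LINT x|N. f x)"
proof -
 have [measurable]: "f \<in> bm M" using f by auto
 have m: "f \<in> borel_measurable (add_measure M N)"
  by (simp add: measurable_cong_sets[of "add_measure M N" M])
 have "(\<integral>\<^sup>+ x. ennreal (f x) \<partial>add_measure M N) = ennreal ((LINT x|M. f x) + (LINT x|N. f x))"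
  using pos f by (simp add: nn_integral_add_measure[OF s] nn_integral_eq_integral)
 moreover have "(LINT x|add_measure M N. f x) = enn2real (\<integral>\<^sup>+ x. ennreal (f x) \<partial>add_measure M N)"
  by (rule integral_eq_nn_integral) (use pos m in auto)
 moreover have "0 <= (LINT x|M. f x) + (LINT x|N. f x)" using pos by simp
 ultimately show ?thesis by simp
qed

lemma finite_radon_add: "finite_radon M ==> finite_radon N ==> finite_radon (add_measure M N)"
 by (auto simp: finite_radon_def intro!: finite_add_measure)

lemma finite_diff_measure:
 assumes "finite_measure M" "finite_measure N" "N <= M" "sets M = sets N"
 shows "finite_measure (diff_measure M N)"
  and "A \<in> sets M ==> measure (diff_measure M N) A = measure M A - measure N A"
proof -
 interpret M: finite_measure M by fact
 interpret N: finite_measure N by fact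
 have le: "emeasure N A <= emeasure M A" for A
  using assms by (intro le_measureD3) auto
 have e: "emeasure (diff_measure M N) A = emeasure M A - emeasure N A" if "A \<in> sets M" for A
  by (rule emeasure_diff_measure) (use assms le that in auto)
 then show "finite_measure (diff_measure M N)"
  by (intro finite_measureI) (auto simp: M.emeasure_eq_measure N.emeasure_eq_measure ennreal_minus)
 show "measure (diff_measure M N) A = measure M A - measure N A" if "A \<in> sets M"
 proof (rule measure_eq_emeasure_eq_ennreal)
  show "0 <= measure M A - measure N A"
   using le[of A] by (simp add: M.emeasure_eq_measure N.emeasure_eq_measure)
  show "emeasure (diff_measure M N) A = ennreal (measure M A - measure N A)"
   by (simp only: e[OF that] M.emeasure_eq_measure N.emeasure_eq_measure ennreal_minus[OF measure_nonneg])
 qed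
qed

text \<open>A density prescribed on sets determines the integral of bounded functions. Moving the
  negative parts to the other side turns the identity into an equality of positive measures, after
  which positive and negative parts of u are treated separately.\<close>

lemma signed_integral_eq_density:
 assumes m: "signed_radon m" and l: "finite_radon l" and d: "has_signed_density m l g"
  and u: "u \<in> bm l" "!!z. z \<in> unit_square ==> \<bar>u z\<bar> <= C"
 shows "integrable l (%z. u z * g z)" "signed_integral m u = (LINT z|l. u z * g z)"
proof -
 note m' = m[unfolded signed_radon_def, THEN conjunct1] m[unfolded signed_radon_def, THEN conjunct2]
 have g: "integrable l g" and gA: "!!A. A \<in> sets l ==> measure (fst m) A - measure (snd m) A = (LINT z:A|l. g z)"
  using d by (auto simp: has_signed_density_def)
 have [measurable]: "g \<in> bm l" using g by auto
 have sp: "space l = unit_square" by (rule finite_radonD[OF l])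
 have ms: "v \<in> bm l ==> v \<in> borel_measurable (fst m)" "v \<in> bm l ==> v \<in> borel_measurable (snd m)" for v :: "real \<times> real => real"
  using measurable_cong_sets[OF trans[OF finite_radonD(1)[OF l] finite_radonD(1)[OF m'(1), symmetric]], of borel borel]
   measurable_cong_sets[OF trans[OF finite_radonD(1)[OF l] finite_radonD(1)[OF m'(2), symmetric]], of borel borel] by auto
 have i: "integrable l (%z. v z * g z)" "integrable (fst m) v" "integrable (snd m) v"
  if "v \<in> bm l" "!!z. z \<in> unit_square ==> \<bar>v z\<bar> <= C" for v C
 proof -
  show "integrable l (%z. v z * g z)"
  proof (rule intble_bound[of _ "%z. C * g z"])
   have "\<bar>v z\<bar> <= \<bar>C\<bar>" if "z \<in> unit_square" for z using \<open>!!z. z \<in> unit_square ==> \<bar>v z\<bar> <= C\<close>[OF that] by simp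
   then show "AE z in l. norm (v z * g z) <= norm (C * g z)"
    using sp by (intro AE_I2) (auto simp: abs_mult intro!: mult_right_mono)
  qed (use g that in auto)
  show "integrable (fst m) v" "integrable (snd m) v"
   by (rule finite_radon_integrable[OF m'(1) ms(1)[OF that(1)] that(2)] finite_radon_integrable[OF m'(2) ms(2)[OF that(1)] that(2)]; assumption)+
 qed
 have pos: "signed_integral m v = (LINT z|l. v z * g z)"
  if v: "v \<in> bm l" "!!z. 0 <= v z" "!!z. z \<in> unit_square ==> v z <= C" for v C
 proof -
  have "\<bar>v z\<bar> <= C" if "z \<in> unit_square" for z using v(2)[of z] v(3)[OF that] by simp
  note iv = i[OF v(1) this]
  \<comment> \<open>For c = 1 and c = -1 these are the positive and the negative part of g.\<close>
  let ?G = "%c z. max 0 (c * g z)"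
  let ?d = "%c. density l (%z. ennreal (?G c z))"
  have s: "sets (fst m) = sets (?d c)" "sets (snd m) = sets (?d c)" for c
   using finite_radonD(1) l m' by simp_all
  have Gi: "integrable l (?G c)" for c using g by auto
  have Gv: "integrable l (%z. ?G c z * v z)" for c
  proof (rule intble_bound[OF integrable_mult_right[OF iv(1), of c]], use v in measurable, rule AE_I2)
   fix z
   have "\<bar>?G c z\<bar> * \<bar>v z\<bar> <= \<bar>c * g z\<bar> * \<bar>v z\<bar>" by (rule mult_right_mono) auto
   then show "norm (?G c z * v z) <= norm (c * (v z * g z))" by (simp add: abs_mult mult_ac)
  qed
  \<comment> \<open>Adding the opposite parts makes both sides positive measures, which are compared
    set by set.\<close>
  have "add_measure (fst m) (?d (-1)) = add_measure (snd m) (?d 1)"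
  proof (rule measure_eqI)
   fix A assume "A \<in> sets (add_measure (fst m) (?d (-1)))"
   then have A: "A \<in> sets l" "A \<in> sets (fst m)" "A \<in> sets (snd m)" using s by auto
   have iA: "integrable l (%z. indicator A z * ?G c z)" for c
    using integrable_mult_indicator[OF A(1) Gi[of c]] by simp
   have "emeasure (?d c) A = (\<integral>\<^sup>+ z. ennreal (indicator A z * ?G c z) \<partial>l)" for c
    using A by (subst emeasure_density) (auto intro!: nn_integral_cong split: split_indicator)
   also have "... c = ennreal (LINT z|l. indicator A z * ?G c z)" for c
    by (rule nn_integral_eq_integral[OF iA]) auto
   finally have dA: "emeasure (?d c) A = ennreal (LINT z|l. indicator A z * ?G c z)" for c .
   have "measure (fst m) A - measure (snd m) A = (LINT z|l. indicator A z * ?G 1 z - indicator A z * ?G (-1) z)"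
    unfolding gA[OF A(1)] set_lebesgue_integral_def by (intro LINT_cong) (auto simp: max_def)
   then have "measure (fst m) A + (LINT z|l. indicator A z * ?G (-1) z) = measure (snd m) A + (LINT z|l. indicator A z * ?G 1 z)"
    unfolding LINT_diff[OF iA iA] by linarith
   then show "emeasure (add_measure (fst m) (?d (-1))) A = emeasure (add_measure (snd m) (?d 1)) A"
    unfolding emeasure_add_measure[OF s(1) A(2)] emeasure_add_measure[OF s(2) A(3)] dA
     finite_measure.emeasure_eq_measure[OF finite_radonD(2)[OF m'(1)]] finite_measure.emeasure_eq_measure[OF finite_radonD(2)[OF m'(2)]]
    by (subst (1 2) ennreal_plus[symmetric]) (auto intro!: integral_nonneg_AE)
  qed (use s in simp)
  then have "(LINT z|fst m. v z) + (LINT z|?d (-1). v z) = (LINT z|snd m. v z) + (LINT z|?d 1. v z)"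
   using integral_add_measure[OF s(1)[of "-1"] iv(2) _ v(2)] integral_add_measure[OF s(2)[of 1] iv(3) _ v(2)] Gv[of 1] Gv[of "-1"] v(1)
   by (simp add: integrable_density)
  moreover have dv: "(LINT z|?d c. v z) = (LINT z|l. ?G c z * v z)" for c using v(1) by (subst integral_density) auto
  moreover have "(LINT z|l. v z * g z) = (LINT z|l. ?G 1 z * v z - ?G (-1) z * v z)"
   by (intro LINT_cong) (auto simp: max_def)
  ultimately show ?thesis using dv[of 1] dv[of "-1"] unfolding signed_integral_def LINT_diff[OF Gv Gv] by simp
 qed
 show "integrable l (%z. u z * g z)" by (rule i(1)[OF u])
 have uv: "(%z. max 0 (u z)) \<in> bm l" "(%z. max 0 (- u z)) \<in> bm l" using u by auto
 have b: "max 0 (u z) <= C" "max 0 (- u z) <= C" if "z \<in> unit_square" for z using u(2)[OF that] by auto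
 have b': "\<bar>max 0 (u z)\<bar> <= C" "\<bar>max 0 (- u z)\<bar> <= C" if "z \<in> unit_square" for z using u(2)[OF that] by auto
 note i1 = i[OF uv(1) b'(1)] and i2 = i[OF uv(2) b'(2)]
 have eq: "u = (%z. max 0 (u z) - max 0 (- u z))" by (auto simp: fun_eq_iff max_def)
 have "signed_integral m u = signed_integral m (%z. max 0 (u z)) - signed_integral m (%z. max 0 (- u z))"
  using i1 i2 by (subst eq) (simp add: signed_integral_def)
 also have "... = (LINT z|l. max 0 (u z) * g z) - (LINT z|l. max 0 (- u z) * g z)"
  by (subst pos[OF uv(1) _ b(1)], simp, simp, subst pos[OF uv(2) _ b(2)], simp_all)
 also have "... = (LINT z|l. max 0 (u z) * g z - max 0 (- u z) * g z)" using i1 i2 by simp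
 also have "... = (LINT z|l. u z * g z)" by (intro LINT_cong) (auto simp: max_def)
 finally show "signed_integral m u = (LINT z|l. u z * g z)" .
qed

lemma finite_radon_density:
 assumes M: "finite_radon M" and l: "finite_radon l" and le: "!!A. A \<in> sets l ==> emeasure M A <= emeasure l A"
 obtains D where "integrable l D" "!!A. A \<in> sets l ==> measure M A = (LINT z:A|l. D z)"
proof -
 interpret l: finite_measure l using finite_radonD[OF l] by simp
 interpret M: finite_measure M using finite_radonD[OF M] by simp
 have s: "sets M = sets l" using finite_radonD(1)[OF l] finite_radonD(1)[OF M] by simp
 have ac: "absolutely_continuous l M" unfolding absolutely_continuous_def
 proof
  fix A assume "A \<in> null_sets l"
  then show "A \<in> null_sets M" using le[of A] s by (auto simp: null_sets_def)
 qed
 obtain D where D: "D \<in> bm l" "AE x in l. RN_deriv l M x = ennreal (D x)" "!!x. 0 <= D x"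
  using l.real_RN_deriv[OF M.finite_measure_axioms ac s] by blast
 have [measurable]: "D \<in> bm l" by fact
 have "M = density l (RN_deriv l M)" by (rule l.density_RN_deriv[OF ac s, symmetric])
 also have "... = density l (%x. ennreal (D x))" by (rule density_cong) (use D in auto)
 finally have e: "emeasure M A = (\<integral>\<^sup>+ x. ennreal (indicator A x * D x) \<partial>l)" if "A \<in> sets l" for A
  using that by (auto simp: emeasure_density intro!: nn_integral_cong split: split_indicator)
 have i: "integrable l D"
 proof (rule integrableI_nonneg)
  have "(\<integral>\<^sup>+ x. ennreal (D x) \<partial>l) = emeasure M (space l)"
   using e[of "space l"] by (auto intro!: nn_integral_cong)
  then show "(\<integral>\<^sup>+ x. ennreal (D x) \<partial>l) < \<infinity>" by (simp add: M.emeasure_eq_measure)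
 qed (use D in auto)
 have "measure M A = (LINT z:A|l. D z)" if "A \<in> sets l" for A
 proof -
  have "ennreal (measure M A) = ennreal (LINT z|l. indicator A z * D z)"
   unfolding M.emeasure_eq_measure[symmetric] e[OF that]
   using integrable_mult_indicator[OF that i] D(3) by (intro nn_integral_eq_integral) auto
  then show ?thesis using D(3) by (simp add: set_lebesgue_integral_def)
 qed
 with i show ?thesis by (rule that)
qed

text \<open>\<open>FR\<close> is a choice among values. The sum of the four component measures
  dominates everything, so by Radon-Nikodym the choice is not void, and the chosen value has some
  dominating measure and densities.\<close>

lemma FR_representation:
 assumes m: "signed_radon m" and n: "signed_radon n"
 obtains l g h where "finite_radon l" "has_signed_density m l g" "has_signed_density n l h"
  "FR f m n = (\<integral>\<^sup>+ z. fr_r (g z) (h z) * ennreal (f z) \<partial>l)"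
proof -
 let ?l = "add_measure (add_measure (fst m) (snd m)) (add_measure (fst n) (snd n))"
 have fr: "finite_radon (fst m)" "finite_radon (snd m)" "finite_radon (fst n)" "finite_radon (snd n)"
  using m n by (auto simp: signed_radon_def)
 have l: "finite_radon ?l" by (intro finite_radon_add fr)
 note s = fr[THEN finite_radonD(1)]
 have e: "emeasure ?l A = (emeasure (fst m) A + emeasure (snd m) A) + (emeasure (fst n) A + emeasure (snd n) A)"
  if "A \<in> sets ?l" for A
  using that s by (subst emeasure_add_measure | simp)+
 have le: "emeasure M A <= emeasure ?l A" if "M \<in> {fst m, snd m, fst n, snd n}" "A \<in> sets ?l" for M A
  unfolding e[OF that(2)] using that(1) by (auto intro: add_increasing add_increasing2)
 have si: "set_integrable ?l A D" if "integrable ?l D" "A \<in> sets ?l" for A and D :: "real \<times> real => real"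
  unfolding set_integrable_def using that integrable_mult_indicator by blast
 have dens: "\<exists>g. has_signed_density k ?l g" if k: "k \<in> {m, n}" for k
 proof -
  have fk: "finite_radon (fst k)" "finite_radon (snd k)" and lk: "fst k \<in> {fst m, snd m, fst n, snd n}" "snd k \<in> {fst m, snd m, fst n, snd n}"
   using k fr by auto
  obtain D where D: "integrable ?l D" "!!A. A \<in> sets ?l ==> measure (fst k) A = (LINT z:A|?l. D z)"
   using finite_radon_density[OF fk(1) l le[OF lk(1)]] by blast
  obtain D' where D': "integrable ?l D'" "!!A. A \<in> sets ?l ==> measure (snd k) A = (LINT z:A|?l. D' z)"
   using finite_radon_density[OF fk(2) l le[OF lk(2)]] by blast
  show ?thesis unfolding has_signed_density_def using D D' si by (intro exI[of _ "%z. D z - D' z"]) (auto simp: set_integral_diff)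
 qed
 then obtain g h where "has_signed_density m ?l g" "has_signed_density n ?l h" by blast
 with l have "\<exists>v l g h. finite_radon l & has_signed_density m l g & has_signed_density n l h
   & v = (\<integral>\<^sup>+ z. fr_r (g z) (h z) * ennreal (f z) \<partial>l)" by blast
 from someI_ex[OF this] show ?thesis unfolding FR_def[symmetric] using that by blast
qed

text \<open>The Legendre dual form of the Fisher-Rao functional, in which the dominating measure has disappeared:
 \<open>b y - b^2 x <= r(x, y)\<close> for every \<open>b\<close>.\<close>

lemma FR_dual:
 assumes m: "signed_radon m" and n: "signed_radon n" and c: "enn2ereal (FR f m n) <= ereal c"
  and f: "f \<in> borel_measurable (restrict_space borel unit_square)" "!!z. z \<in> unit_square ==> 0 <= f z & f z <= F"
  and b: "b \<in> borel_measurable (restrict_space borel unit_square)" "!!z. z \<in> unit_square ==> \<bar>b z\<bar> <= C"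
 shows "signed_integral n (%z. b z * f z) - signed_integral m (%z. (b z)^2 * f z) <= c"
proof -
 obtain l g h where l: "finite_radon l" and g: "has_signed_density m l g" and h: "has_signed_density n l h"
  and v: "FR f m n = (\<integral>\<^sup>+ z. fr_r (g z) (h z) * ennreal (f z) \<partial>l)"
  using FR_representation[OF m n] by blast
 have fb: "f \<in> bm l" "b \<in> bm l"
  using f b unfolding measurable_cong_sets[OF finite_radonD(1)[OF l] refl] by auto
 have bf: "\<bar>b z * f z\<bar> <= C * F" and b2f: "\<bar>(b z)^2 * f z\<bar> <= C^2 * F" if "z \<in> unit_square" for z
  using f(2)[OF that] b(2)[OF that]
  by (auto simp: abs_mult abs_le_square_iff[symmetric] intro!: mult_mono intro: order_trans[OF _ abs_ge_self])
 note 1 = signed_integral_eq_density[OF n l h, of "%z. b z * f z" "C * F"]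
 note 2 = signed_integral_eq_density[OF m l g, of "%z. (b z)^2 * f z" "C^2 * F"]
 have i: "integrable l (%z. b z * f z * h z)" "integrable l (%z. (b z)^2 * f z * g z)"
  using 1(1) 2(1) fb bf b2f by auto
 have "signed_integral n (%z. b z * f z) - signed_integral m (%z. (b z)^2 * f z)
   = (LINT z|l. b z * f z * h z) - (LINT z|l. (b z)^2 * f z * g z)"
  using 1(2) 2(2) fb bf b2f by auto
 also have "... = (LINT z|l. b z * f z * h z - (b z)^2 * f z * g z)"
  using i by simp
 also have "... <= c"
 proof (rule integral_real_bounded)
  have "0 <= enn2ereal (FR f m n)" by simp
  with c have "0 <= ereal c" by (rule order_trans[rotated])
  then show c0: "0 <= c" by simp
  have "(\<integral>\<^sup>+ z. ennreal (b z * f z * h z - (b z)^2 * f z * g z) \<partial>l) <= FR f m n"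
   unfolding v
  proof (rule nn_integral_mono)
   fix z assume "z \<in> space l"
   then have fz: "0 <= f z" using f(2) finite_radonD(3)[OF l] by auto
   show "ennreal (b z * f z * h z - (b z)^2 * f z * g z) <= fr_r (g z) (h z) * ennreal (f z)"
   proof (cases "g z > 0")
    case True
    \<comment> \<open>The square is the gap in the Legendre inequality, up to the factor 1 / (4
      g).\<close>
    have "0 <= (h z - 2 * b z * g z)^2" by simp
    then have "b z * h z - (b z)^2 * g z <= 1/4 * ((h z)^2 / g z)"
     using True by (simp add: field_simps power2_eq_square)
    from mult_right_mono[OF this fz]
    have "b z * f z * h z - (b z)^2 * f z * g z <= 1/4 * ((h z)^2 / g z) * f z"
     by (simp add: algebra_simps)
    then show ?thesis using True fz
     by (simp add: fr_r_def ennreal_mult[symmetric] ennreal_leI)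
   next
    case False
    \<comment> \<open>Off the set g > 0 the function r is infinite unless both densities vanish.
      Where f = 0 the left side is 0, which the product of infinity and 0 respects.\<close>
    then show ?thesis using fz
     by (cases "f z = 0"; cases "g z = 0 & h z = 0") (auto simp: fr_r_def ennreal_top_mult)
   qed
  qed
  also have "FR f m n <= ennreal c"
   using c c0 by (metis e2ennreal_enn2ereal e2ennreal_mono e2ennreal_ereal)
  finally show "(\<integral>\<^sup>+ z. ennreal (b z * f z * h z - (b z)^2 * f z * g z) \<partial>l) <= ennreal c" .
 qed
 finally show ?thesis .
qed

text \<open>When N is below M, the pair (M, N) has the constant density 1 with respect to the
  positive measure M - N.\<close>

lemma signed_integral_diff_measure:
 assumes M: "finite_radon M" and N: "finite_radon N" and le: "N <= M"
  and u: "u \<in> borel_measurable (restrict_space borel unit_square)" "!!z. z \<in> unit_square ==> \<bar>u z\<bar> <= C"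
 shows "signed_integral (M, N) u = (LINT z|diff_measure M N. u z)" "finite_radon (diff_measure M N)"
proof -
 note d = finite_diff_measure[OF finite_radonD(2)[OF M] finite_radonD(2)[OF N] le
   trans[OF finite_radonD(1)[OF M] finite_radonD(1)[OF N, symmetric]]]
 show fr: "finite_radon (diff_measure M N)" using d finite_radonD[OF M] by (auto simp: finite_radon_def)
 have "has_signed_density (M, N) (diff_measure M N) (%_. 1)"
  unfolding has_signed_density_def
 proof (intro conjI ballI)
  show "integrable (diff_measure M N) (%_. 1::real)" by (rule finite_radon_integrable[OF fr, where C=1]) auto
  fix A assume A: "A \<in> sets (diff_measure M N)"
  then show "measure (fst (M, N)) A - measure (snd (M, N)) A = (LINT z:A|diff_measure M N. (1::real))"
   using d sets.sets_into_space[OF A] by (auto simp: set_lebesgue_integral_def Int_absorb2)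
 qed
 from signed_integral_eq_density(2)[OF _ fr this, of u C]
 show "signed_integral (M, N) u = (LINT z|diff_measure M N. u z)"
  using M N u by (simp add: signed_radon_def measurable_cong_sets[OF finite_radonD(1)[OF fr] refl])
qed

section \<open>Regularity of the defect measure \<Delta> forced by the Fisher-Rao bound\<close>

subsection \<open>Consequences of Fisher-Rao domination\<close>

lemma finite_radon_tendsto:
 fixes u :: "nat => real \<times> real => real"
 assumes M: "finite_radon M" and u: "!!n. u n \<in> bm borel" "v \<in> bm borel"
  and b: "!!n z. z \<in> unit_square ==> \<bar>u n z\<bar> <= C"
  and c: "!!z. z \<in> unit_square ==> (%n. u n z) ----> v z"
 shows "(%n. LINT z|M. u n z) ----> (LINT z|M. v z)"
proof (rule integral_dominated_convergence[where w="%_. C"])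
 show "integrable M (%_. C)" by (rule finite_radon_integrable[OF M, where C="\<bar>C\<bar>"]) auto
 show "AE z in M. (%n. u n z) ----> v z"
  by (intro AE_I2 c) (simp add: finite_radonD(3)[OF M])
 show "AE z in M. norm (u n z) <= C" for n
  unfolding real_norm_def by (intro AE_I2 b) (simp add: finite_radonD(3)[OF M])
qed (intro finite_radon_measurable[OF M] u)+

lemma signed_tendsto:
 fixes u :: "nat => real \<times> real => real"
 assumes "signed_radon m" "!!n. u n \<in> bm borel" "v \<in> bm borel"
  "!!n z. z \<in> unit_square ==> \<bar>u n z\<bar> <= C" "!!z. z \<in> unit_square ==> (%n. u n z) ----> v z"
 shows "(%n. signed_integral m (u n)) ----> signed_integral m v"
 unfolding signed_integral_def
 by (intro tendsto_diff finite_radon_tendsto) (use assms in "unfold signed_radon_def, blast+")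

lemma signed_integral_cong:
 assumes m: "signed_radon m" and e: "!!z. z \<in> unit_square ==> u z = v z"
 shows "signed_integral m u = signed_integral m v"
proof -
 have "space (fst m) = unit_square" "space (snd m) = unit_square"
  using m finite_radonD(3) by (auto simp: signed_radon_def)
 then show ?thesis unfolding signed_integral_def
  by (intro arg_cong2[where f="(-)"] LINT_cong refl) (simp_all add: e)
qed

lemma signed_integral_add:
 fixes u v :: "real \<times> real => real"
 assumes m: "signed_radon m" and "u \<in> bm borel" "v \<in> bm borel"
  "!!z. z \<in> unit_square ==> \<bar>u z\<bar> <= C" "!!z. z \<in> unit_square ==> \<bar>v z\<bar> <= C'"
 shows "signed_integral m (%z. u z + v z) = signed_integral m u + signed_integral m v"
proof -
 have f: "finite_radon (fst m)" "finite_radon (snd m)" using m by (auto simp: signed_radon_def)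
 have "integrable M u" "integrable M v" if "finite_radon M" for M
  using assms by (intro finite_radon_integrable[OF that] finite_radon_measurable[OF that]; blast)+
 then show ?thesis using f by (simp add: signed_integral_def)
qed

lemma signed_integral_cmult: "signed_integral m (%z. c * u z) = c * signed_integral m u"
 by (simp add: signed_integral_def right_diff_distrib)

lemma prim_tendsto:
 assumes "x <= 1" "!!n. h n \<in> bm UI" "k \<in> bm UI"
  "!!n y. y \<in> I ==> \<bar>h n y\<bar> <= C" "AE y in UI. (%n. h n y) ----> k y"
 shows "(%n. prim (h n) x) ----> prim k x"
 unfolding prim_eq[OF assms(1)]
proof (rule integral_dominated_convergence[where w="%_. C"])
 note [measurable] = assms(2,3)
 show "(%y. if y <= x then k y else 0) \<in> bm UI" by measurable
 show "(%y. if y <= x then h n y else 0) \<in> bm UI" for n by measurable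
 show "AE y in UI. (%n. if y <= x then h n y else 0) ----> (if y <= x then k y else 0)"
  using assms(5) by eventually_elim auto
 have "0 <= C" using assms(4)[of 0 0] by (rule order_trans[OF abs_ge_zero]) simp
 then show "AE y in UI. norm (if y <= x then h n y else 0) <= C" for n
  using assms(4) by (intro AE_I2) auto
qed simp

lemma prim_derivative:
 fixes h :: "real => real"
 assumes h: "continuous_on I h" and t: "t \<in> I"
 shows "(prim h has_real_derivative h t) (at t within I)"
proof -
 have "prim h x = integral {0..x} h" if "x \<in> I" for x
 proof -
  have "set_integrable lborel {0..x} h"
   by (rule set_integrable_subset[of _ "I"]) (use continuous_integrable_UI[OF h] that in "auto simp: UI_integrable_iff")
  then show ?thesis unfolding prim_def by (rule set_borel_integral_eq_integral)
 qed
 then show ?thesis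
  using integral_has_real_derivative[OF h t] t
  by (subst has_field_derivative_cong_eventually[where g="%x. integral {0..x} h"])
    (auto simp: eventually_at_filter)
qed

lemma prim_increment':
 assumes r: "0 <= r" "r <= t" "t <= 1" and v: "integrable UI v"
 shows "prim v t - prim v r = (LINT u|UI. (if r <= u & u <= t then v u else 0))"
proof -
 have [measurable]: "v \<in> bm UI" using v by auto
 have "prim v t - prim v r = (LINT u|UI. (if r < u & u <= t then v u else 0))"
  by (rule prim_increment) (use r v in auto)
 also have "... = (LINT u|UI. (if r <= u & u <= t then v u else 0))"
  by (intro integral_cong_AE eventually_mono[OF AE_UI_neq[of r]]) auto
 finally show ?thesis .
qed

lemma rectangle_measurable [measurable]:
 "B \<in> sets borel ==> ({s<..t} \<times> B :: (real \<times> real) set) \<in> sets borel"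
 unfolding borel_prod[symmetric] by auto

text \<open>Fubini for \<beta> u on the set s < fst z <= u <= t, snd z in B: integrating in u first
  gives an increment of the primitive, integrating in z first gives the mass of (s,u] x B.\<close>

lemma integration_by_parts_measure:
 assumes M: "finite_radon M" and B: "B \<in> sets borel" and t: "t \<in> I"
  and \<beta>: "\<beta> \<in> bm UI" "!!u. u \<in> I ==> \<bar>\<beta> u\<bar> <= C"
 shows "integrable UI (%u. if s < u & u <= t then \<beta> u * (LINT z|M. indicator ({s<..u} \<times> B) z) else 0)"
  and "(LINT z|M. indicator ({s<..t} \<times> B) z * (prim \<beta> t - prim \<beta> (fst z)))
   = (LINT u|UI. (if s < u & u <= t then \<beta> u * (LINT z|M. indicator ({s<..u} \<times> B) z) else 0))"
proof -
 interpret M: finite_measure M using finite_radonD[OF M] by simp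
 interpret P: pair_sigma_finite M UI ..
 have sp: "space M = unit_square" by (rule finite_radonD[OF M])
 note [measurable] = \<beta>(1) B
 have [measurable]: "fst \<in> bm M" "snd \<in> bm M"
  by (auto intro!: finite_radon_measurable_prod M)
 interpret PP: finite_measure "M \<Otimes>\<^sub>M UI"
 proof (rule finite_measureI)
  have "emeasure (M \<Otimes>\<^sub>M UI) (space M \<times> space UI) = emeasure M (space M) * emeasure UI (space UI)"
   by (rule UI.emeasure_pair_measure_Times) (rule sets.top)+
  then show "emeasure (M \<Otimes>\<^sub>M UI) (space (M \<Otimes>\<^sub>M UI)) ~= \<infinity>"
   by (simp add: space_pair_measure M.emeasure_eq_measure UI.emeasure_eq_measure ennreal_mult[symmetric])
 qed
 \<comment> \<open>The two iterated integrals of \<open>H\<close> are the two sides of the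
   claim.\<close>
 define H where "H z u = (if s < fst z & fst z <= u & u <= t & snd z \<in> B then \<beta> u else 0)" for z :: "real \<times> real" and u
 have C: "C >= 0" using \<beta>(2)[of 0] by (rule order_trans[OF abs_ge_zero]) simp
 have i: "integrable (M \<Otimes>\<^sub>M UI) (case_prod H)"
 proof (rule PP.integrable_const_bound[where B=C])
  show "AE x in M \<Otimes>\<^sub>M UI. norm (case x of (z, u) => H z u) <= C"
   using \<beta>(2) C by (intro AE_I2) (auto simp: H_def space_pair_measure)
  show "(%(z, u). H z u) \<in> borel_measurable (M \<Otimes>\<^sub>M UI)" unfolding H_def by measurable
 qed
 have e1: "(LINT z|M. H z u) = (if s < u & u <= t then \<beta> u * (LINT z|M. indicator ({s<..u} \<times> B) z) else 0)" for u
 proof -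
  have "(LINT z|M. H z u) = (LINT z|M. (if s < u & u <= t then \<beta> u else 0) * indicator ({s<..u} \<times> B) z)"
   by (intro LINT_cong) (auto simp: H_def split: split_indicator)
  then show ?thesis by simp
 qed
 have e2: "(LINT u|UI. H z u) = indicator ({s<..t} \<times> B) z * (prim \<beta> t - prim \<beta> (fst z))" if z: "z \<in> space M" for z
 proof (cases "s < fst z & fst z <= t & snd z \<in> B")
  case True
  have "\<beta> u = \<beta> u" for u ..
  have "integrable UI \<beta>" by (rule UI.integrable_const_bound[where B=C]) (use \<beta> in auto)
  then have "prim \<beta> t - prim \<beta> (fst z) = (LINT u|UI. (if fst z <= u & u <= t then \<beta> u else 0))"
   using True t z sp by (intro prim_increment') (auto simp: unit_square_def)
  also have "... = (LINT u|UI. H z u)"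
   using True by (intro LINT_cong) (auto simp: H_def)
  finally show ?thesis using True by (cases z) simp
 next
  case False
  then have "(LINT u|UI. H z u) = (LINT u|UI. 0)"
   by (intro LINT_cong) (auto simp: H_def)
  with False show ?thesis by (cases z) (auto split: split_indicator)
 qed
 show "integrable UI (%u. if s < u & u <= t then \<beta> u * (LINT z|M. indicator ({s<..u} \<times> B) z) else 0)"
  using P.integrable_snd[OF i] unfolding e1 .
 show "(LINT z|M. indicator ({s<..t} \<times> B) z * (prim \<beta> t - prim \<beta> (fst z)))
   = (LINT u|UI. (if s < u & u <= t then \<beta> u * (LINT z|M. indicator ({s<..u} \<times> B) z) else 0))"
  using P.Fubini_integral[OF i] unfolding e1
  by (subst LINT_cong[OF refl e2[symmetric]]) simp_all
qed

text \<open>Increasing unions of closed sets are the class to which the dual inequality is carried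
  over by approximation. The cells of the grid and half-open rectangles over them belong to
  it.\<close>

definition Fsigma :: "'a::topological_space set => bool" where
 "Fsigma A \<longleftrightarrow> (\<exists>K. (\<forall>n::nat. closed (K n)) & incseq K & A = (\<Union>n. K n))"

lemma Fsigma_closed: "closed A ==> Fsigma A"
 unfolding Fsigma_def by (rule exI[of _ "%_. A"]) auto

lemma Fsigma_rectangle:
 fixes B :: "real set"
 assumes "Fsigma B" shows "Fsigma ({s<..t::real} \<times> B)"
proof -
 obtain K where K: "!!n::nat. closed (K n)" "incseq K" "B = (\<Union>n. K n)" using assms by (auto simp: Fsigma_def)
 let ?K = "%n. {s + 1 / real (Suc n)..t} \<times> K n"
 have "incseq ?K"
 proof (rule incseq_SucI)
  fix n
  have "1 / real (Suc (Suc n)) <= 1 / real (Suc n)" by (simp add: field_simps)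
  moreover have "K n \<subseteq> K (Suc n)" using K(2) by (simp add: incseq_SucD)
  ultimately show "?K n \<subseteq> ?K (Suc n)" by auto
 qed
 moreover have "{s<..t} \<times> B = (\<Union>n. ?K n)"
 proof (intro equalityI subsetI)
  fix z assume "z \<in> {s<..t} \<times> B"
  then obtain r x n where z: "z = (r, x)" "s < r" "r <= t" "x \<in> K n" using K(3) by auto
  obtain m where m: "inverse (real (Suc m)) < r - s" using reals_Archimedean[of "r - s"] z by auto
  have "1 / real (Suc (max m n)) <= 1 / real (Suc m)" by (simp add: field_simps)
  then have "s + 1 / real (Suc (max m n)) <= r" using m by (simp add: inverse_eq_divide)
  moreover have "x \<in> K (max m n)" using z(4) K(2) by (meson incseqD max.cobounded2 subsetD)
  ultimately show "z \<in> (\<Union>n. ?K n)" using z by (intro UN_I[of "max m n"]) auto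
 next
  fix z assume "z \<in> (\<Union>n. ?K n)"
  then obtain n where n: "s + 1 / real (Suc n) <= fst z" "fst z <= t" "snd z \<in> K n" by auto
  moreover have "0 < 1 / real (Suc n)" by simp
  ultimately have "s < fst z" by linarith
  then show "z \<in> {s<..t} \<times> B" using n K(3) by (cases z) auto
 qed
 ultimately show ?thesis unfolding Fsigma_def using K(1) by (intro exI[of _ ?K]) (auto intro!: closed_Times)
qed

text \<open>In the application \<pi> and \<rho> are the measures p^2 and pdot^2, so that \<Delta> is
  the defect of the squares and \<sigma> the energy available for it.\<close>

locale fisher_rao_dominated =
 fixes \<mu> \<pi> \<nu> \<rho> :: "(real \<times> real) measure" and d :: signed_measure
 assumes radon: "finite_radon \<mu>" "finite_radon \<pi>" "finite_radon \<nu>" "finite_radon \<rho>"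
  and d: "signed_radon d" and le: "\<pi> <= \<mu>" "\<rho> <= \<nu>"
  and weak: "weak_tderiv_zero_init (\<mu>, \<pi>) d"
  and dominated: "FR_dominated (\<mu>, \<pi>) d (\<nu>, \<rho>)"
begin

abbreviation "\<Delta> \<equiv> diff_measure \<mu> \<pi>"
abbreviation "\<sigma> \<equiv> diff_measure \<nu> \<rho>"

lemma radon_\<Delta>: "finite_radon \<Delta>" and radon_\<sigma>: "finite_radon \<sigma>"
 using signed_integral_diff_measure(2)[OF radon(1,2) le(1), of "%_. 0" 0]
  signed_integral_diff_measure(2)[OF radon(3,4) le(2), of "%_. 0" 0] by auto

lemma integral_\<Delta>:
 "u \<in> bm borel ==> (!!z. z \<in> unit_square ==> \<bar>u z\<bar> <= C) ==> signed_integral (\<mu>, \<pi>) u = (LINT z|\<Delta>. u z)"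
 by (rule signed_integral_diff_measure(1)[OF radon(1,2) le(1) measurable_restrict_space1])

lemma integral_\<sigma>:
 "u \<in> bm borel ==> (!!z. z \<in> unit_square ==> \<bar>u z\<bar> <= C) ==> signed_integral (\<nu>, \<rho>) u = (LINT z|\<sigma>. u z)"
 by (rule signed_integral_diff_measure(1)[OF radon(3,4) le(2) measurable_restrict_space1])

text \<open>Admissible test functions are continuous and strictly positive; they approximate the
  indicator of K while the weight b is merely Borel and bounded, which \<open>FR_dual\<close>
  permits.\<close>

lemma dual_closed:
 assumes K: "closed K" and b: "b \<in> bm borel" "!!z. z \<in> unit_square ==> \<bar>b z\<bar> <= C"
 shows "signed_integral d (%z. b z * indicator K z) - (LINT z|\<Delta>. (b z)^2 * indicator K z) <= (LINT z|\<sigma>. indicator K z)"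
proof (cases "K = {}")
 \<comment> \<open>The distance to the empty set is 0 by convention, so the approximation used
   otherwise would tend to 1 instead of 0.\<close>
 case True then show ?thesis by (simp add: signed_integral_def)
next
 case False
 \<comment> \<open>The vanishing summand keeps the test function strictly positive off K.\<close>
 define f where "f n z = 1 / real (Suc n) + max 0 (1 - real n * infdist z K)" for n z
 have fc: "continuous_on UNIV (f n)" for n unfolding f_def by (intro continuous_intros)
 have fm [measurable]: "f n \<in> bm borel" for n by (rule borel_measurable_continuous_onI[OF fc])
 have f0: "0 < f n z" for n z unfolding f_def by (intro add_pos_nonneg) auto
 have f2: "f n z <= 2" for n z
 proof -
  have "1 / real (Suc n) <= 1" by simp
  moreover have "max 0 (1 - real n * infdist z K) <= 1" using infdist_nonneg[of z K] by simp
  ultimately show ?thesis unfolding f_def by linarith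
 qed
 have flim: "(%n. f n z) ----> indicator K z" for z
 proof -
  have "(%n. max 0 (1 - real n * infdist z K)) ----> indicator K z"
  proof (cases "z \<in> K")
   case True then show ?thesis by simp
  next
   case False
   then have pos: "infdist z K > 0" using K \<open>K ~= {}\<close> by (metis in_closed_iff_infdist_zero infdist_nonneg less_eq_real_def)
   have "\<forall>\<^sub>F n in sequentially. real n * infdist z K >= 1"
   proof -
    obtain k :: nat where "1 / infdist z K < k" using reals_Archimedean2 by blast
    then have "real n * infdist z K >= 1" if "n >= k" for n
    proof -
     have "1 / infdist z K <= real n" using that \<open>1 / infdist z K < k\<close> by linarith
     then show ?thesis using pos by (simp add: field_simps)
    qed
    then show ?thesis by (auto simp: eventually_sequentially)
   qed
   then have "\<forall>\<^sub>F n in sequentially. max 0 (1 - real n * infdist z K) = 0" by eventually_elim auto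
   then show ?thesis using False by (simp add: tendsto_eventually)
  qed
  from tendsto_add[OF LIMSEQ_inverse_real_of_nat this] show ?thesis by (simp add: f_def inverse_eq_divide)
 qed
 have C: "C >= 0" using b(2)[of "(0,0)"] by (auto simp: unit_square_def)
 have bn: "\<bar>b z * f n z\<bar> <= C * 2" "\<bar>(b z)^2 * f n z\<bar> <= C^2 * 2" "\<bar>f n z\<bar> <= 2" if "z \<in> unit_square" for n z
  using b(2)[OF that] f2[of n z] f0[of n z] C
  by (auto simp: abs_mult abs_le_square_iff[symmetric] intro!: mult_mono)
 note [measurable] = b(1)
 have [measurable]: "K \<in> sets borel" using K by simp
 have ineq: "signed_integral d (%z. b z * f n z) - (LINT z|\<Delta>. (b z)^2 * f n z) <= (LINT z|\<sigma>. f n z)" for n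
 proof -
  have "enn2ereal (FR (f n) (\<mu>, \<pi>) d) <= ereal (signed_integral (\<nu>, \<rho>) (f n))"
   using dominated f0 continuous_on_subset[OF fc] unfolding FR_dominated_def by blast
  then have "enn2ereal (FR (f n) (\<mu>, \<pi>) d) <= ereal (LINT z|\<sigma>. f n z)"
   using integral_\<sigma>[OF fm bn(3)] by simp
  from FR_dual[OF _ d this measurable_restrict_space1[OF fm] _ measurable_restrict_space1[OF b(1)] b(2), where F=2]
  have "signed_integral d (%z. b z * f n z) - signed_integral (\<mu>, \<pi>) (%z. (b z)^2 * f n z) <= (LINT z|\<sigma>. f n z)"
   using radon f0 f2 by (simp add: signed_radon_def less_imp_le)
  moreover have "signed_integral (\<mu>, \<pi>) (%z. (b z)^2 * f n z) = (LINT z|\<Delta>. (b z)^2 * f n z)"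
   by (rule integral_\<Delta>[OF _ bn(2)]) auto
  ultimately show ?thesis by simp
 qed
 show ?thesis
 proof (rule LIMSEQ_le[OF tendsto_diff])
  show "(%n. signed_integral d (%z. b z * f n z)) ----> signed_integral d (%z. b z * indicator K z)"
   by (rule signed_tendsto[OF d _ _ bn(1)]) (auto intro!: tendsto_mult flim)
  show "(%n. LINT z|\<Delta>. (b z)^2 * f n z) ----> (LINT z|\<Delta>. (b z)^2 * indicator K z)"
   by (rule finite_radon_tendsto[OF radon_\<Delta> _ _ bn(2)]) (auto intro!: tendsto_mult flim)
  show "(%n. LINT z|\<sigma>. f n z) ----> (LINT z|\<sigma>. indicator K z)"
   by (rule finite_radon_tendsto[OF radon_\<sigma> _ _ bn(3)]) (auto intro!: flim)
 qed (use ineq in blast)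
qed

lemma dual_Fsigma:
 assumes A: "Fsigma A" and b: "b \<in> bm borel" "!!z. z \<in> unit_square ==> \<bar>b z\<bar> <= C"
 shows "signed_integral d (%z. b z * indicator A z) - (LINT z|\<Delta>. (b z)^2 * indicator A z) <= (LINT z|\<sigma>. indicator A z)"
proof -
 obtain K where K: "!!n::nat. closed (K n)" "incseq K" "A = (\<Union>n. K n)" using A by (auto simp: Fsigma_def)
 have [measurable]: "K n \<in> sets borel" for n using K(1) by simp
 have [measurable]: "A \<in> sets borel" unfolding K(3) by measurable
 note [measurable] = b(1)
 have lim: "(%n. indicator (K n) z :: real) ----> indicator A z" for z
  unfolding K(3) by (rule LIMSEQ_indicator_incseq[OF K(2)])
 have bn: "\<bar>b z * indicator (K n) z\<bar> <= C" "\<bar>(b z)^2 * indicator (K n) z\<bar> <= C^2" "\<bar>indicator (K n) z :: real\<bar> <= 1"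
  if "z \<in> unit_square" for n z
  using b(2)[OF that] by (auto simp: abs_le_square_iff[symmetric] split: split_indicator)
 show ?thesis
 proof (rule LIMSEQ_le[OF tendsto_diff])
  show "(%n. signed_integral d (%z. b z * indicator (K n) z)) ----> signed_integral d (%z. b z * indicator A z)"
   by (rule signed_tendsto[OF d _ _ bn(1)]) (auto intro!: tendsto_mult lim)
  show "(%n. LINT z|\<Delta>. (b z)^2 * indicator (K n) z) ----> (LINT z|\<Delta>. (b z)^2 * indicator A z)"
   by (rule finite_radon_tendsto[OF radon_\<Delta> _ _ bn(2)]) (auto intro!: tendsto_mult lim)
  show "(%n. LINT z|\<sigma>. indicator (K n) z) ----> (LINT z|\<sigma>. indicator A z :: real)"
   by (rule finite_radon_tendsto[OF radon_\<sigma> _ _ bn(3)]) (auto intro!: lim)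
 qed (use dual_closed[OF K(1) b] in blast)
qed

text \<open>The mass at time u that d has produced on B; it turns out to be the slice of \<Delta>.
  Starting at -1 includes a possible mass of d at time 0, and closing the interval at u makes the
  function right-continuous.\<close>

definition cum :: "real set => real => real" where
 "cum B u = signed_integral d (indicator ({-1<..u} \<times> B))"

lemma signed_by_parts:
 assumes B: "B \<in> sets borel" and t: "t \<in> I"
  and \<beta>: "\<beta> \<in> bm UI" "!!u. u \<in> I ==> \<bar>\<beta> u\<bar> <= C"
 shows "integrable UI (%u. if s < u & u <= t then \<beta> u * signed_integral d (indicator ({s<..u} \<times> B)) else 0)"
  and "signed_integral d (%z. indicator ({s<..t} \<times> B) z * (prim \<beta> t - prim \<beta> (fst z)))
   = (LINT u|UI. (if s < u & u <= t then \<beta> u * signed_integral d (indicator ({s<..u} \<times> B)) else 0))"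
proof -
 have d': "finite_radon (fst d)" "finite_radon (snd d)" using d by (auto simp: signed_radon_def)
 note p1 = integration_by_parts_measure[OF d'(1) B t \<beta>, of s] and p2 = integration_by_parts_measure[OF d'(2) B t \<beta>, of s]
 have e: "(if s < u & u <= t then \<beta> u * signed_integral d (indicator ({s<..u} \<times> B)) else 0)
   = (if s < u & u <= t then \<beta> u * (LINT z|fst d. indicator ({s<..u} \<times> B) z) else 0)
   - (if s < u & u <= t then \<beta> u * (LINT z|snd d. indicator ({s<..u} \<times> B) z) else 0)" for u
  by (simp add: signed_integral_def right_diff_distrib)
 show "integrable UI (%u. if s < u & u <= t then \<beta> u * signed_integral d (indicator ({s<..u} \<times> B)) else 0)"
  unfolding e using p1(1) p2(1) by (rule intble_diff)
 show "signed_integral d (%z. indicator ({s<..t} \<times> B) z * (prim \<beta> t - prim \<beta> (fst z)))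
   = (LINT u|UI. (if s < u & u <= t then \<beta> u * signed_integral d (indicator ({s<..u} \<times> B)) else 0))"
  unfolding e unfolding signed_integral_def
  by (rule trans[OF arg_cong2[where f="(-)", OF p1(2) p2(2)] LINT_diff[OF p1(1) p2(1), symmetric]])
qed

text \<open>Measurability in u comes for free from Fubini, with the constant weight 1.\<close>

lemma integrable_cum: assumes "B \<in> sets borel" shows "integrable UI (cum B)"
proof -
 have "integrable UI (%u. if -1 < u & u <= 1 then 1 * cum B u else 0)"
  unfolding cum_def by (rule signed_by_parts(1)[OF assms, where C=1]) auto
 then show ?thesis by (rule intble_cong[THEN iffD1, rotated -1]) auto
qed

lemma cum_increment:
 assumes "B \<in> sets borel" "-1 <= s" "s <= t"
 shows "signed_integral d (indicator ({s<..t} \<times> B)) = cum B t - cum B s"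
proof -
 have "signed_integral d (%z. indicator ({s<..t} \<times> B) z + indicator ({-1<..s} \<times> B) z)
  = signed_integral d (indicator ({s<..t} \<times> B)) + cum B s"
  unfolding cum_def
  by (rule signed_integral_add[OF d, where C=1 and C'=1]) (use assms in "auto split: split_indicator")
 moreover have "(%z. indicator ({s<..t} \<times> B) z + indicator ({-1<..s} \<times> B) z) = (indicator ({-1<..t} \<times> B) :: _ => real)"
  using assms by (auto simp: fun_eq_iff split: split_indicator)
 ultimately show ?thesis by (simp add: cum_def)
qed

definition total :: real where "total = measure (fst d) unit_square + measure (snd d) unit_square"

lemma cum_bounded: assumes "B \<in> sets borel" shows "\<bar>cum B u\<bar> <= total"
proof -
 have *: "0 <= (LINT z|M. indicator ({-1<..u} \<times> B) z :: real) & (LINT z|M. indicator ({-1<..u} \<times> B) z) <= measure M unit_square"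
  if M: "finite_radon M" for M
 proof
  interpret finite_measure M by (rule finite_radonD[OF M])
  have "(LINT z|M. indicator ({-1<..u} \<times> B) z) = measure M (({-1<..u} \<times> B) Int unit_square)"
   by (simp add: finite_radonD[OF M])
  also have "... <= measure M unit_square"
   by (rule finite_measure_mono) (auto simp: unit_square_sets[OF M])
  finally show "(LINT z|M. indicator ({-1<..u} \<times> B) z) <= measure M unit_square" .
 qed simp
 show ?thesis
  using *[of "fst d"] *[of "snd d"] d unfolding cum_def signed_integral_def total_def signed_radon_def by linarith
qed

text \<open>The weak equation is tested with H(t) psi(x), where psi tends to the indicator of B, h
  tends to the indicator of times up to s, and H is the primitive of h that vanishes at time 1. In
  the limit the \<Delta> side is the mass of the rectangle, and integration by parts turns the d
  side into the integral of \<open>cum\<close>.\<close>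

lemma \<Delta>_density_closed:
 assumes B: "closed B" and s: "s \<in> I"
 shows "(LINT z|\<Delta>. indicator ({-1<..s} \<times> B) z) = prim (cum B) s"
proof (cases "B = {}")
 case True
 then show ?thesis by (simp add: cum_def[abs_def] signed_integral_def prim_def)
next
 case False
 \<comment> \<open>The max and min with affine functions give continuous approximations of
   indicators of closed sets from above.\<close>
 define h where "h n t = max 0 (min 1 (1 - real n * (t - s)))" for n t
 define \<psi> where "\<psi> n x = max 0 (1 - real n * infdist x B)" for n and x :: real
 define ch where "ch t = (if t <= s then 1 else 0 :: real)" for t
 have hc: "continuous_on X (h n)" for X n unfolding h_def by (intro continuous_intros)
 have \<psi>c: "continuous_on X (\<psi> n)" for X n unfolding \<psi>_def by (intro continuous_intros)
 have hb: "0 <= h n t" "h n t <= 1" for n t by (auto simp: h_def)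
 have \<psi>b: "0 <= \<psi> n x" "\<psi> n x <= 1" for n x using infdist_nonneg[of x B] by (auto simp: \<psi>_def)
 have arch: "\<forall>\<^sub>F n in sequentially. real n * e >= 1" if "e > 0" for e :: real
 proof -
  obtain k :: nat where k: "1 / e < k" using reals_Archimedean2 by blast
  have "real n * e >= 1" if "n >= k" for n
  proof -
   have "1 / e <= real n" using that k by linarith
   then show ?thesis using \<open>e > 0\<close> by (simp add: field_simps)
  qed
  then show ?thesis by (auto simp: eventually_sequentially)
 qed
 have hl: "(%n. h n t) ----> ch t" for t
 proof (cases "t <= s")
  case True
  then have "h n t = 1" for n using mult_nonneg_nonpos[of "real n" "t - s"] by (simp add: h_def)
  then show ?thesis using True by (simp add: ch_def)
 next
  case False
  then have "\<forall>\<^sub>F n in sequentially. real n * (t - s) >= 1" by (intro arch) auto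
  then have "\<forall>\<^sub>F n in sequentially. h n t = 0" by eventually_elim (auto simp: h_def)
  then show ?thesis using False by (simp add: ch_def tendsto_eventually)
 qed
 have \<psi>l: "(%n. \<psi> n x) ----> indicator B x" for x
 proof (cases "x \<in> B")
  case True then show ?thesis by (simp add: \<psi>_def)
 next
  case False
  then have "infdist x B > 0" using B \<open>B ~= {}\<close> by (metis in_closed_iff_infdist_zero infdist_nonneg less_eq_real_def)
  then have "\<forall>\<^sub>F n in sequentially. real n * infdist x B >= 1" by (rule arch)
  then have "\<forall>\<^sub>F n in sequentially. \<psi> n x = 0" by eventually_elim (auto simp: \<psi>_def)
  then show ?thesis using False by (simp add: tendsto_eventually)
 qed
 have [measurable]: "B \<in> sets borel" using B by simp
 have [measurable]: "h n \<in> bm borel" "\<psi> n \<in> bm borel" "ch \<in> bm borel" for n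
  using hc \<psi>c by (auto intro!: borel_measurable_continuous_onI simp: ch_def[abs_def])
 have ih: "integrable UI (h n)" for n by (rule continuous_integrable_UI[OF hc])
 have ich: "integrable UI ch" by (rule UI.integrable_const_bound[where B=1]) (auto simp: ch_def measurable_UI)
 \<comment> \<open>Clamping t to the unit interval makes \<open>H n\<close> continuous on the whole
   line, hence Borel there.\<close>
 define H where "H n t = prim (h n) (min 1 (max 0 t)) - prim (h n) 1" for n t
 define H' where "H' t = prim ch (min 1 (max 0 t)) - prim ch 1" for t
 have pc: "continuous_on UNIV (%t. prim v (min 1 (max 0 t)) - prim v 1)" if "integrable UI v" for v
  by (intro continuous_on_diff continuous_on_const continuous_on_compose2[OF prim_continuous[OF that]] continuous_intros) auto
 have [measurable]: "H n \<in> bm borel" "H' \<in> bm borel" for n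
  unfolding H_def[abs_def] H'_def[abs_def] by (intro borel_measurable_continuous_onI pc ih ich)+
 have ps: "(%z. f (fst z) * g (snd z)) \<in> bm borel"
  if "f \<in> bm borel" "g \<in> bm borel" for f g :: "real => real"
  unfolding borel_prod[symmetric] using that by measurable
 have Hl: "(%n. H n t) ----> H' t" for t
  unfolding H_def H'_def using hl hb
  by (intro tendsto_diff prim_tendsto[where C=1]) (auto intro!: measurable_UI)
 have Hb: "\<bar>H n t\<bar> <= 1" for n t
 proof -
  have *: "0 <= prim (h n) r & prim (h n) r <= 1" if "r \<in> I" for r
   using prim_mono[of r "%_. 0" "h n"] prim_mono[of r "h n" "%_. 1"] that hb ih prim_const[OF that, of 0] prim_const[OF that, of 1]
   by auto
  show ?thesis using *[of "min 1 (max 0 t)"] *[of 1] by (auto simp: H_def)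
 qed
 have "signed_integral (\<mu>, \<pi>) (%z. h n (fst z) * \<psi> n (snd z)) + signed_integral d (%z. H n (fst z) * \<psi> n (snd z)) = 0" for n
 proof (rule weak[unfolded weak_tderiv_zero_init_def, rule_format], intro conjI ballI)
  show "continuous_on unit_square (%z. H n (fst z) * \<psi> n (snd z))"
   unfolding H_def by (intro continuous_on_mult continuous_on_compose2[OF pc[OF ih]] continuous_on_compose2[OF \<psi>c[of UNIV]] continuous_intros) auto
  show "continuous_on unit_square (%z. h n (fst z) * \<psi> n (snd z))"
   by (intro continuous_on_mult continuous_on_compose2[OF hc[of UNIV]] continuous_on_compose2[OF \<psi>c[of UNIV]] continuous_intros) auto
  fix t x :: real assume t: "t \<in> I"
  have "((%s. (prim (h n) s - prim (h n) 1) * \<psi> n x) has_real_derivative (h n t - 0) * \<psi> n x) (at t within I)"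
   by (intro DERIV_cmult_right DERIV_diff prim_derivative[OF hc t] DERIV_const)
  then show "((%s. H n (fst (s, x)) * \<psi> n (snd (s, x))) has_real_derivative h n (fst (t, x)) * \<psi> n (snd (t, x))) (at t within I)"
   by (subst has_field_derivative_cong_eventually[where g="%s. (prim (h n) s - prim (h n) 1) * \<psi> n x"])
     (use t in "auto simp: eventually_at_filter H_def")
 next
  fix x :: real show "H n (fst (1, x)) * \<psi> n (snd (1, x)) = 0" by (simp add: H_def)
 qed
 moreover have "signed_integral (\<mu>, \<pi>) (%z. h n (fst z) * \<psi> n (snd z)) = (LINT z|\<Delta>. h n (fst z) * \<psi> n (snd z))" for n
  by (rule integral_\<Delta>[where C=1]) (use hb \<psi>b in "auto simp: ps abs_mult intro!: mult_le_one")
 ultimately have eq: "(LINT z|\<Delta>. h n (fst z) * \<psi> n (snd z)) = - signed_integral d (%z. H n (fst z) * \<psi> n (snd z))" for n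
  by (simp add: add_eq_0_iff)
 have "(%n. LINT z|\<Delta>. h n (fst z) * \<psi> n (snd z)) ----> (LINT z|\<Delta>. ch (fst z) * indicator B (snd z))"
  by (rule finite_radon_tendsto[OF radon_\<Delta>, where C=1]) (use hb \<psi>b in "auto simp: ps abs_mult intro!: mult_le_one tendsto_mult hl \<psi>l")
 moreover have "(%n. - signed_integral d (%z. H n (fst z) * \<psi> n (snd z))) ----> - signed_integral d (%z. H' (fst z) * indicator B (snd z))"
  by (rule tendsto_minus, rule signed_tendsto[OF d, where C=1]) (use Hb \<psi>b in "auto simp: ps abs_mult intro!: mult_le_one tendsto_mult Hl \<psi>l")
 ultimately have "(LINT z|\<Delta>. ch (fst z) * indicator B (snd z)) = - signed_integral d (%z. H' (fst z) * indicator B (snd z))"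
  unfolding eq using LIMSEQ_unique by blast
 also have "- signed_integral d (%z. H' (fst z) * indicator B (snd z))
  = signed_integral d (%z. indicator ({-1<..1} \<times> B) z * (prim ch 1 - prim ch (fst z)))"
  unfolding signed_integral_cmult[of d "-1", simplified, symmetric]
  by (rule signed_integral_cong[OF d]) (auto simp: H'_def unit_square_def split: split_indicator)
 also have "... = (LINT u|UI. (if -1 < u & u <= 1 then ch u * cum B u else 0))"
  unfolding cum_def by (rule signed_by_parts(2)[where C=1]) (auto simp: ch_def measurable_UI)
 also have "... = prim (cum B) s"
  using s by (subst prim_eq) (auto intro!: LINT_cong simp: ch_def)
 also have "(LINT z|\<Delta>. ch (fst z) * indicator B (snd z)) = (LINT z|\<Delta>. indicator ({-1<..s} \<times> B) z)"
  by (intro LINT_cong)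
    (auto simp: finite_radonD(3)[OF radon(1)] ch_def unit_square_def split: split_indicator)
 finally show ?thesis .
qed

end

text \<open>The left side a + b - b / u - u a is maximal at u = sqrt (b / a), where it is the square
  of the increment of the roots. Shifting a and b by e > 0 keeps that u defined and positive; then e
  tends to 0.\<close>

lemma sqrt_increment_bound:
 assumes ab: "0 <= a" "0 <= b" and X: "!!u. u > 0 ==> (u - 1) * (b / u - a) <= X"
 shows "(sqrt b - sqrt a)^2 <= (X :: real)"
proof -
 have *: "a + b - 2 * sqrt ((b + e) * (a + e)) <= X" if e: "e > 0" for e
 proof -
  define u where "u = sqrt (b + e) / sqrt (a + e)"
  have p: "sqrt (a + e) > 0" "sqrt (b + e) > 0" using ab e by auto
  then have u: "u > 0" by (simp add: u_def)
  have alg: "P * P / (P / Q) = P * Q" "P / Q * (Q * Q) = P * Q" if "Q > 0" "P > 0" for P Q :: real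
   using that by auto
  have "b / u <= (b + e) / u" "u * a <= u * (a + e)" using u e by (auto simp: divide_right_mono)
  moreover have "(b + e) / u = sqrt ((b + e) * (a + e))"
  proof -
   have "(b + e) / u = (sqrt (b + e) * sqrt (b + e)) / (sqrt (b + e) / sqrt (a + e))"
    using ab e by (simp add: u_def)
   also have "... = sqrt (b + e) * sqrt (a + e)" by (rule alg) (rule p)+
   finally show ?thesis by (simp add: real_sqrt_mult)
  qed
  moreover have "u * (a + e) = sqrt ((b + e) * (a + e))"
  proof -
   have "u * (a + e) = (sqrt (b + e) / sqrt (a + e)) * (sqrt (a + e) * sqrt (a + e))"
    using ab e by (simp add: u_def)
   also have "... = sqrt (b + e) * sqrt (a + e)" by (rule alg) (rule p)+
   finally show ?thesis by (simp add: real_sqrt_mult)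
  qed
  moreover have "(u - 1) * (b / u - a) = a + b - b / u - u * a" using u by (simp add: field_simps)
  ultimately show ?thesis using X[OF u] by linarith
 qed
 have "(%n. a + b - 2 * sqrt ((b + inverse (real (Suc n))) * (a + inverse (real (Suc n))))) ----> a + b - 2 * sqrt ((b + 0) * (a + 0))"
  by (intro tendsto_intros LIMSEQ_inverse_real_of_nat)
 then have "a + b - 2 * sqrt ((b + 0) * (a + 0)) <= X"
  by (rule LIMSEQ_le_const2) (use * in auto)
 then show ?thesis using ab by (simp add: power2_diff real_sqrt_mult)
qed

context fisher_rao_dominated
begin

lemma cum_tendsto:
 assumes B: "B' \<in> sets borel" "!!n. B n \<in> sets borel"
  and c: "!!t x. t \<in> I ==> (%n. indicator ({-1<..u n} \<times> B n) (t, x) :: real) ----> indicator ({-1<..v} \<times> B') (t, x)"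
 shows "(%n. cum (B n) (u n)) ----> cum B' v"
 unfolding cum_def
proof (rule signed_tendsto[OF d, where C=1])
 show "(%n. indicator ({-1<..u n} \<times> B n) z :: real) ----> indicator ({-1<..v} \<times> B') z" if "z \<in> unit_square" for z
  using c[of "fst z" "snd z"] that by (cases z) (auto simp: unit_square_def)
qed (use B in "auto split: split_indicator")

lemma cum_Un:
 assumes "A \<in> sets borel" "B \<in> sets borel" "A Int B = {}"
 shows "cum (A \<union> B) u = cum A u + cum B u"
proof -
 have "(%z. indicator ({-1<..u} \<times> A) z + indicator ({-1<..u} \<times> B) z) = (indicator ({-1<..u} \<times> (A \<union> B)) :: _ => real)"
  using assms(3) by (auto simp: fun_eq_iff split: split_indicator)
 moreover have "signed_integral d (%z. indicator ({-1<..u} \<times> A) z + indicator ({-1<..u} \<times> B) z) = cum A u + cum B u"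
  unfolding cum_def by (rule signed_integral_add[OF d, where C=1 and C'=1]) (use assms in "auto split: split_indicator")
 ultimately show ?thesis by (simp add: cum_def)
qed

text \<open>Both sides are additive in B and continuous along increasing unions, so the identity
  passes from the closed half-lines to all Borel sets.\<close>

lemma \<Delta>_density:
 assumes B: "B \<in> sets borel" and s: "s \<in> I"
 shows "(LINT z|\<Delta>. indicator ({-1<..s} \<times> B) z) = prim (cum B) s"
proof -
 let ?L = "%B. (LINT z|\<Delta>. indicator ({-1<..s} \<times> B) z) :: real"
 have i: "integrable \<Delta> (indicator ({-1<..s} \<times> B) :: _ => real)" if "B \<in> sets borel" for B
  by (rule finite_radon_integrable[OF radon_\<Delta>, where C=1])
    (use that in "auto intro!: finite_radon_measurable[OF radon_\<Delta>] split: split_indicator")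
 have L_Un: "?L (A \<union> B) = ?L A + ?L B" if "A \<in> sets borel" "B \<in> sets borel" "A Int B = {}" for A B
 proof -
  have "(indicator ({-1<..s} \<times> (A \<union> B)) :: _ => real) = (%z. indicator ({-1<..s} \<times> A) z + indicator ({-1<..s} \<times> B) z)"
   using that(3) by (auto simp: fun_eq_iff split: split_indicator)
  then show ?thesis by (simp only: LINT_add[OF i[OF that(1)] i[OF that(2)]])
 qed
 have R_Un: "prim (cum (A \<union> B)) s = prim (cum A) s + prim (cum B) s"
  if "A \<in> sets borel" "B \<in> sets borel" "A Int B = {}" for A B
  using s by (simp add: cum_Un[OF that, abs_def] cum_Un[OF that] prim_add[symmetric] integrable_cum that)
 have borel: "sigma_sets UNIV (range (%b::real. {..b})) = sets borel"
  unfolding borel_eq_atMost by simp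
 have "Int_stable (range (%b::real. {..b}))" "range (%b::real. {..b}) \<subseteq> Pow UNIV"
  by (auto simp: Int_stable_def)
 moreover have "B \<in> sigma_sets UNIV (range (%b::real. {..b}))" using B borel by simp
 ultimately show ?thesis
 proof (induction rule: sigma_sets_induct_disjoint)
  case (basic A)
  then show ?case using \<Delta>_density_closed[of A s] s by auto
 next
  case empty
  show ?case using \<Delta>_density_closed[of "{}" s] s by auto
 next
  case (compl A)
  then have A: "A \<in> sets borel" "UNIV - A \<in> sets borel" by (auto simp: borel)
  have "?L (A \<union> (UNIV - A)) = prim (cum (A \<union> (UNIV - A))) s"
   using \<Delta>_density_closed[of UNIV s] s by simp
  then show ?case using compl(2) L_Un[OF A] R_Un[OF A] by simp
 next
  case (union S)
  have m: "S i \<in> sets borel" for i using union(2) by (auto simp: borel)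
  have m': "(\<Union>i<n. S i) \<in> sets borel" for n using m by auto
  have fin: "?L (\<Union>i<n. S i) = prim (cum (\<Union>i<n. S i)) s" for n
  proof (induction n)
   case 0 show ?case using \<Delta>_density_closed[of "{}" s] s by simp
  next
   case (Suc n)
   have "(\<Union>i<n. S i) Int S n = {}"
    using union(1) unfolding disjoint_family_on_def by (auto) (metis Int_iff UNIV_I emptyE less_irrefl)
   from L_Un[OF m' m this] R_Un[OF m' m this] show ?case
    using Suc union(3) by (simp add: lessThan_Suc Un_commute)
  qed
  have lim: "(%n. indicator ({-1<..r} \<times> (\<Union>i<n. S i)) z :: real) ----> indicator ({-1<..r} \<times> (\<Union>i. S i)) z" for r and z :: "real \<times> real"
  proof -
   have "(%n. indicator {-1<..r} (fst z) * indicator (\<Union>i<n. S i) (snd z) :: real) ----> indicator {-1<..r} (fst z) * indicator (\<Union>i. S i) (snd z)"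
    by (intro tendsto_mult tendsto_const LIMSEQ_indicator_UN)
   then show ?thesis by (cases z) (simp add: indicator_times)
  qed
  have "(%n. ?L (\<Union>i<n. S i)) ----> ?L (\<Union>i. S i)"
   by (rule finite_radon_tendsto[OF radon_\<Delta>, where C=1]) (use m lim in "auto split: split_indicator")
  moreover have "(%n. prim (cum (\<Union>i<n. S i)) s) ----> prim (cum (\<Union>i. S i)) s"
  proof (rule prim_tendsto)
   show "AE y in UI. (%n. cum (\<Union>i<n. S i) y) ----> cum (\<Union>i. S i) y"
    by (intro AE_I2 cum_tendsto lim) (use m in auto)
   show "\<bar>cum (\<Union>i<n. S i) y\<bar> <= total" for n y by (rule cum_bounded[OF m'])
  qed (use s m in "auto intro!: borel_measurable_integrable integrable_cum")
  ultimately show ?case unfolding fin using LIMSEQ_unique by blast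
 qed
qed

lemma \<Delta>_increment:
 assumes B: "B \<in> sets borel" and s: "0 <= s" "s <= t" "t <= 1"
 shows "(LINT z|\<Delta>. indicator ({s<..t} \<times> B) z) = prim (cum B) t - prim (cum B) s"
proof -
 have i: "integrable \<Delta> (indicator ({a<..b} \<times> B) :: _ => real)" for a b
  by (rule finite_radon_integrable[OF radon_\<Delta>, where C=1])
    (use B in "auto intro!: finite_radon_measurable[OF radon_\<Delta>] split: split_indicator")
 have "(indicator ({-1<..t} \<times> B) :: _ => real) = (%z. indicator ({-1<..s} \<times> B) z + indicator ({s<..t} \<times> B) z)"
  using s by (auto simp: fun_eq_iff split: split_indicator)
 then have "(LINT z|\<Delta>. indicator ({-1<..t} \<times> B) z :: real) = (LINT z|\<Delta>. indicator ({-1<..s} \<times> B) z) + (LINT z|\<Delta>. indicator ({s<..t} \<times> B) z)"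
  by (simp only: LINT_add[OF i i])
 then show ?thesis using \<Delta>_density[OF B] s by simp
qed

text \<open>\<open>cum B\<close> is right-continuous and its integrals over intervals are masses of
  \<Delta>. A negative value would persist on an interval to the right, which requires room after u
  and hence u < 1.\<close>

lemma cum_nonneg:
 assumes B: "B \<in> sets borel" and u: "0 <= u" "u < 1"
 shows "0 <= cum B u"
proof (rule ccontr)
 assume neg: "\<not> 0 <= cum B u"
 \<comment> \<open>Right-continuity, extracted from a sequence of violating times.\<close>
 have "\<exists>e>0. \<forall>r. u <= r & r <= u + e --> cum B r < cum B u / 2"
 proof (rule ccontr)
  assume "\<not> ?thesis"
  then have "\<forall>n. \<exists>r. u <= r & r <= u + inverse (real (Suc n)) & cum B u / 2 <= cum B r"
   by (metis inverse_positive_iff_positive not_le of_nat_0_less_iff zero_less_Suc)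
  then obtain r where r: "!!n. u <= r n" "!!n. r n <= u + inverse (real (Suc n))" "!!n. cum B u / 2 <= cum B (r n)"
   by metis
  have rl: "r ----> u"
   by (rule tendsto_sandwich[OF _ _ tendsto_const, where h="%n. u + inverse (real (Suc n))"])
     (use r tendsto_add[OF tendsto_const LIMSEQ_inverse_real_of_nat, of u] in auto)
  have "(%n. cum B (r n)) ----> cum B u"
  proof (rule cum_tendsto)
   fix t x :: real
   show "(%n. indicator ({-1<..r n} \<times> B) (t, x) :: real) ----> indicator ({-1<..u} \<times> B) (t, x)"
   proof (cases "t <= u")
    case True
    have "indicator ({-1<..r n} \<times> B) (t, x) = (indicator ({-1<..u} \<times> B) (t, x) :: real)" for n
     using True r(1)[of n] by (auto split: split_indicator)
    then show ?thesis by simp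
   next
    case False
    then have "\<forall>\<^sub>F n in sequentially. r n < t" using rl by (auto simp: order_tendsto_iff)
    then have "\<forall>\<^sub>F n in sequentially. indicator ({-1<..r n} \<times> B) (t, x) = (indicator ({-1<..u} \<times> B) (t, x) :: real)"
     by eventually_elim (use False in "auto split: split_indicator")
    then show ?thesis by (rule tendsto_eventually)
   qed
  qed (use B in auto)
  then have "cum B u / 2 <= cum B u" by (rule LIMSEQ_le_const) (use r in auto)
  with neg show False by simp
 qed
 then obtain e where e: "e > 0" "!!r. u <= r ==> r <= u + e ==> cum B r < cum B u / 2" by blast
 define v where "v = min 1 (u + e)"
 have v: "u < v" "v <= 1" "v <= u + e" using u e by (auto simp: v_def)
 have "0 <= (LINT z|\<Delta>. indicator ({u<..v} \<times> B) z :: real)" by simp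
 also have "... = (LINT r|UI. (if u < r & r <= v then cum B r else 0))"
  using \<Delta>_increment[OF B, of u v] prim_increment[of u v "cum B"] u v integrable_cum[OF B] by simp
 also have "... <= (LINT r|UI. (if u < r & r <= v then cum B u / 2 else 0))"
 proof (rule integral_mono)
  have [measurable]: "cum B \<in> bm UI" using integrable_cum[OF B] by auto
  show "integrable UI (%r. if u < r & r <= v then cum B r else 0)"
   by (rule intble_bound[OF integrable_cum[OF B]]) auto
  show "integrable UI (%r. if u < r & r <= v then cum B u / 2 else 0)"
   by (rule UI.integrable_const_bound[where B="\<bar>cum B u / 2\<bar>"]) auto
 qed (use e v in "auto simp: less_imp_le")
 also have "... = (v - u) * (cum B u / 2)"
  using prim_increment[of u v "%_. cum B u / 2"] v u by (simp add: prim_const algebra_simps)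
 finally show False using v neg by (simp add: zero_le_mult_iff)
qed

text \<open>At the final time d might have a negative atom that \<Delta> does not see. The dual
  inequality on (s,1] with a large constant weight excludes it as s tends to 1.\<close>

lemma cum_nonneg_Fsigma:
 assumes B: "B \<in> sets borel" "Fsigma B" and u: "0 <= u" "u <= 1"
 shows "0 <= cum B u"
proof (cases "u < 1")
 case True then show ?thesis using cum_nonneg[OF B(1)] u by simp
next
 case False
 then have u1: "u = 1" using u by simp
 interpret \<sigma>: finite_measure \<sigma> by (rule finite_radonD[OF radon_\<sigma>])
 define S where "S = measure \<sigma> unit_square"
 have "- cum B 1 <= sqrt (1 - s) * (total + S)" if s: "0 <= s" "s < 1" for s
 proof -
  \<comment> \<open>This scale balances the terms: c^2 (1 - s) = 1 keeps the cost bounded, while the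
    increment of \<open>cum\<close> is multiplied by 1 / sqrt (1 - s).\<close>
  define c where "c = - 1 / sqrt (1 - s)"
  have p: "sqrt (1 - s) > 0" using s by simp
  have "signed_integral d (%z. c * indicator ({s<..1} \<times> B) z) - (LINT z|\<Delta>. c^2 * indicator ({s<..1} \<times> B) z)
    <= (LINT z|\<sigma>. indicator ({s<..1} \<times> B) z)"
   by (rule dual_Fsigma[OF Fsigma_rectangle[OF B(2)], of "%_. c" "\<bar>c\<bar>"]) auto
  also have "... = measure \<sigma> (({s<..1} \<times> B) Int unit_square)"
   using finite_radonD(3)[OF radon_\<sigma>] by simp
  also have "... <= S"
   unfolding S_def by (rule \<sigma>.finite_measure_mono) (auto simp: unit_square_sets[OF radon(3)])
  finally have 1: "c * (cum B 1 - cum B s) - c^2 * (prim (cum B) 1 - prim (cum B) s) <= S"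
   using cum_increment[OF B(1), of s 1] \<Delta>_increment[OF B(1), of s 1] s by (simp add: signed_integral_cmult)
  have "prim (cum B) 1 - prim (cum B) s = (LINT r|UI. (if s < r & r <= 1 then cum B r else 0))"
   by (rule prim_increment) (use s integrable_cum[OF B(1)] in auto)
  also have "... <= (LINT r|UI. (if s < r & r <= 1 then total else 0))"
  proof (rule integral_mono)
   have [measurable]: "cum B \<in> bm UI" using integrable_cum[OF B(1)] by auto
   show "integrable UI (%r. if s < r & r <= 1 then cum B r else 0)"
    by (rule intble_bound[OF integrable_cum[OF B(1)]]) auto
   show "integrable UI (%r. if s < r & r <= 1 then total else 0)"
    by (rule UI.integrable_const_bound[where B="\<bar>total\<bar>"]) auto
  qed (use cum_bounded[OF B(1)] in "auto simp: abs_le_iff")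
  also have "... = (1 - s) * total"
   using prim_increment[of s 1 "%_. total"] s by (simp add: prim_const algebra_simps)
  finally have 2: "prim (cum B) 1 - prim (cum B) s <= (1 - s) * total" .
  have c2: "c^2 * (1 - s) = 1" using s by (simp add: c_def power_divide)
  have "c * (cum B 1 - cum B s) <= S + c^2 * ((1 - s) * total)"
   using 1 mult_left_mono[OF 2, of "c^2"] by simp
  also have "... = S + total" using c2 by (simp add: mult.assoc[symmetric])
  finally have "cum B s - cum B 1 <= sqrt (1 - s) * (total + S)"
   using p by (simp add: c_def field_simps)
  then show ?thesis using cum_nonneg[OF B(1) s] by linarith
 qed
 then have "- cum B 1 <= sqrt (1 - (1 - inverse (real (Suc n)))) * (total + S)" for n
 proof -
  have "inverse (real (Suc n)) <= 1" "0 < inverse (real (Suc n))" by (auto simp: inverse_le_1_iff)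
  then show ?thesis
   using \<open>!!s. 0 <= s ==> s < 1 ==> - cum B 1 <= sqrt (1 - s) * (total + S)\<close>[of "1 - inverse (real (Suc n))"] by linarith
 qed
 then have "\<exists>N. \<forall>n\<ge>N. - cum B 1 <= sqrt (1 - (1 - inverse (real (Suc n)))) * (total + S)" by blast
 moreover have "(%n. sqrt (1 - (1 - inverse (real (Suc n)))) * (total + S)) ----> sqrt (1 - (1 - 0)) * (total + S)"
  by (intro tendsto_intros LIMSEQ_inverse_real_of_nat)
 ultimately have "- cum B 1 <= sqrt (1 - (1 - 0)) * (total + S)" by (intro LIMSEQ_le_const)
 then show ?thesis by (simp add: u1)
qed

text \<open>The dual inequality with the weight \<open>b\<close> that solves \<open>b' = - b^2\<close>.\<close>

lemma hellinger_increment: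
 assumes B: "B \<in> sets borel" "Fsigma B" and st: "0 <= s" "s < t" "t <= 1"
 shows "(sqrt (cum B t) - sqrt (cum B s))^2 <= (t - s) * (LINT z|\<sigma>. indicator ({s<..t} \<times> B) z)"
proof (rule sqrt_increment_bound)
 show "0 <= cum B s" "0 <= cum B t" using cum_nonneg_Fsigma[OF B] st by auto
 fix u :: real assume u: "u > 0"
 \<comment> \<open>\<open>L\<close> runs affinely from 1 at s to u at t and is constant outside, so
   b = \<beta> / L satisfies b' = - b^2 between s and t, with b s = \<beta> and b t = \<beta> / u.
   The number u is the free parameter of \<open>sqrt_increment_bound\<close>.\<close>
 define \<beta> where "\<beta> = (u - 1) / (t - s)"
 define w where "w r = (if s < r & r <= t then 1 else 0 :: real)" for r
 define L where "L r = 1 + \<beta> * prim w r" for r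
 define b where "b r = \<beta> * (1 / L r)" for r
 define b' where "b' r = \<beta> * (- (0 + \<beta> * w r) / (L r)^2)" for r
 have [measurable]: "w \<in> bm UI" unfolding w_def by measurable
 have wi: "integrable UI w" by (rule UI.integrable_const_bound[where B=1]) (auto simp: w_def)
 have pw: "prim w r = min t (max s r) - s" if r: "r \<in> I" for r
 proof -
  have "prim w r = (LINT y|UI. (if s < y & y <= min t (max s r) then 1 else 0))"
   using r by (subst prim_eq) (auto simp: w_def intro!: LINT_cong)
  also have "... = prim (%_. 1) (min t (max s r)) - prim (%_. 1) s"
   by (rule prim_increment[symmetric]) (use st r in auto)
  also have "... = min t (max s r) - s"
  proof -
   have "min t (max s r) \<in> I" "s \<in> I" using st r by auto
   then show ?thesis by (simp only: prim_const mult_1_left)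
  qed
  finally show ?thesis .
 qed
 have L_lower: "min 1 u <= L r" if r: "r \<in> I" for r
 proof -
  define \<tau> where "\<tau> = prim w r / (t - s)"
  have "0 <= \<tau>" "\<tau> <= 1" using st r by (auto simp: \<tau>_def pw)
  moreover have "L r = (1 - \<tau>) * 1 + \<tau> * u"
  proof -
   have "\<beta> * prim w r = (u - 1) * \<tau>" by (simp add: \<beta>_def \<tau>_def)
   then show ?thesis by (simp add: L_def algebra_simps)
  qed
  moreover have "(1 - \<tau>) * min 1 u + \<tau> * min 1 u <= (1 - \<tau>) * 1 + \<tau> * u"
   using \<open>0 <= \<tau>\<close> \<open>\<tau> <= 1\<close> by (intro add_mono mult_left_mono) auto
  ultimately show ?thesis by (simp add: algebra_simps)
 qed
 have Lpos: "L r > 0" if "r \<in> I" for r using L_lower[OF that] u by (simp add: min_def split: if_splits)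
 have acL: "ac L (%r. 0 + \<beta> * w r)"
  unfolding L_def[abs_def] by (intro ac_add ac_const ac_cmult ac_prim wi)
 have acb: "ac b b'"
  unfolding b_def[abs_def] b'_def[abs_def] by (intro ac_cmult ac_inverse[OF acL Lpos])
 define V where "V r = prim (%y. w y * cum B y) r" for r
 have [measurable]: "cum B \<in> bm UI" using integrable_cum[OF B(1)] by auto
 have iwc: "integrable UI (%y. w y * cum B y)"
  by (rule intble_bound[OF integrable_cum[OF B(1)]]) (auto simp: w_def)
 have acV: "ac V (%y. w y * cum B y)" unfolding V_def[abs_def] by (rule ac_prim[OF iwc])
 have V_incr: "V r = prim (cum B) r - prim (cum B) s" if "s <= r" "r <= t" for r
 proof -
  have "V r = (LINT y|UI. (if s < y & y <= r then cum B y else 0))"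
   unfolding V_def using that st by (subst prim_eq) (auto simp: w_def intro!: LINT_cong)
  then show ?thesis using prim_increment[of s r "cum B"] that st integrable_cum[OF B(1)] by simp
 qed
 have b'm [measurable]: "b' \<in> bm UI" using ac_integrable[OF acb] by auto
 have bm: "(%r. b (min 1 (max 0 r))) \<in> bm borel"
  by (intro borel_measurable_continuous_onI continuous_on_compose2[OF ac_continuous[OF acb]] continuous_intros) auto
 obtain K where K: "K >= 0" "!!r. r \<in> I ==> \<bar>b r\<bar> <= K"
  using continuous_bounded_UI[OF ac_continuous[OF acb]] by blast
 have b'_eq: "b' r = (- ((b r)^2)) * w r" for r
  by (auto simp: b'_def b_def power_divide power2_eq_square w_def)
 have b'K: "\<bar>b' r\<bar> <= K^2" if "r \<in> I" for r
  using K(2)[OF that] K(1) by (auto simp: b'_eq w_def abs_le_square_iff[symmetric])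
 have bt: "b r + prim b' t - prim b' r = b t" if "r \<in> I" for r
  using ac_eq[OF acb that] ac_eq[OF acb, of t] st by auto
 have bs: "b s = \<beta>" "b t = \<beta> / u"
  using st by (auto simp: b_def L_def pw \<beta>_def)
 let ?A = "{s<..t} \<times> B"
 have Am: "?A \<in> sets borel" using B by simp
 define bb where "bb z = b (min 1 (max 0 (fst z)))" for z :: "real \<times> real"
 have bbm: "bb \<in> bm borel"
  unfolding bb_def[abs_def] borel_prod[symmetric] by (rule measurable_compose[OF measurable_fst bm])
 have bbK: "\<bar>bb z\<bar> <= K" for z unfolding bb_def by (rule K(2)) auto
 have dual: "signed_integral d (%z. bb z * indicator ?A z) - (LINT z|\<Delta>. (bb z)^2 * indicator ?A z) <= (LINT z|\<sigma>. indicator ?A z)"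
  by (rule dual_Fsigma[OF Fsigma_rectangle[OF B(2)] bbm bbK])
 have ind: "(%z. indicator ?A z :: real) \<in> bm borel" using Am by simp
 \<comment> \<open>The weight is its value at t minus an increment, and integration by parts trades
   the increment for an integral of b' times \<open>cum\<close>.\<close>
 have "signed_integral d (%z. bb z * indicator ?A z)
   = signed_integral d (%z. b t * indicator ?A z + (-1) * (indicator ?A z * (b t - bb z)))"
  by (simp add: algebra_simps)
 also have "... = signed_integral d (%z. b t * indicator ?A z) + signed_integral d (%z. (-1) * (indicator ?A z * (b t - bb z)))"
 proof (rule signed_integral_add[OF d, where C=K and C'="2 * K"])
  have "\<bar>b t\<bar> <= K" using K(2)[of t] st by auto
  then show "\<bar>b t * indicator ?A z\<bar> <= K" "\<bar>(-1) * (indicator ?A z * (b t - bb z))\<bar> <= 2 * K" for z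
   using bbK[of z] K(1) by (auto split: split_indicator)
 qed (use Am bbm in auto)
 also have "signed_integral d (%z. (-1) * (indicator ?A z * (b t - bb z))) = - signed_integral d (%z. indicator ?A z * (prim b' t - prim b' (fst z)))"
  unfolding signed_integral_cmult
 proof (simp, rule signed_integral_cong[OF d])
  fix z assume "z \<in> unit_square"
  then have "fst z \<in> I" by (auto simp: unit_square_def)
  with bt[OF this] show "indicator ?A z * (b t - bb z) = indicator ?A z * (prim b' t - prim b' (fst z))"
   by (auto simp: bb_def split: split_indicator)
 qed
 also have "signed_integral d (%z. indicator ?A z * (prim b' t - prim b' (fst z)))
  = (LINT u|UI. (if s < u & u <= t then b' u * signed_integral d (indicator ({s<..u} \<times> B)) else 0))"
  by (rule signed_by_parts(2)[OF B(1) _ b'm b'K]) (use st in auto)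
 also have "... = (LINT u|UI. b' u * cum B u - b' u * cum B s)"
  using st cum_increment[OF B(1), of s]
  by (intro LINT_cong) (auto simp: b'_eq w_def right_diff_distrib)
 also have "... = (LINT u|UI. b' u * cum B u) - (LINT u|UI. b' u) * cum B s"
 proof -
  have "integrable UI (%u. b' u * cum B u)"
   by (rule UI.integrable_const_bound[where B="K^2 * total"])
     (use b'K cum_bounded[OF B(1)] in "auto intro!: AE_I2 mult_mono simp: abs_mult")
  then show ?thesis using ac_integrable[OF acb] by simp
 qed
 also have "(LINT u|UI. b' u) = b t - b s"
 proof -
  have "b t - b s = prim b' t - prim b' s" using bt[of s] st by simp
  also have "... = (LINT u|UI. (if s < u & u <= t then b' u else 0))"
   by (rule prim_increment) (use st ac_integrable[OF acb] in auto)
  also have "... = (LINT u|UI. b' u)"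
   by (intro LINT_cong) (auto simp: b'_eq w_def)
  finally show ?thesis by simp
 qed
 also have "signed_integral d (%z. b t * indicator ?A z) = b t * (cum B t - cum B s)"
  using cum_increment[OF B(1), of s t] st by (simp add: signed_integral_cmult)
 finally have 1: "signed_integral d (%z. bb z * indicator ?A z) = b t * cum B t - b s * cum B s - (LINT u|UI. b' u * cum B u)"
  by (simp add: algebra_simps)
 define c' where "c' r = b' r * b r + b r * b' r" for r
 have acbb: "ac (%r. b r * b r) c'" unfolding c'_def[abs_def] by (rule ac_mult[OF acb acb])
 have c'm: "c' \<in> bm UI" using ac_integrable[OF acbb] by auto
 have c'K: "\<bar>c' r\<bar> <= 2 * (K^2 * K)" if "r \<in> I" for r
 proof -
  have "\<bar>b' r * b r\<bar> <= K^2 * K" unfolding abs_mult using b'K[OF that] K(2)[OF that] by (intro mult_mono) auto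
  then show ?thesis by (simp add: c'_def mult.commute)
 qed
 have c't: "b r * b r + prim c' t - prim c' r = b t * b t" if "r \<in> I" for r
  using ac_eq[OF acbb that] ac_eq[OF acbb, of t] st by auto
 have i1: "integrable \<Delta> (%z. (b t * b t) * indicator ?A z)"
  by (rule finite_radon_integrable[OF radon_\<Delta> finite_radon_measurable[OF radon_\<Delta>], where C="\<bar>b t * b t\<bar>"])
    (use Am in "auto split: split_indicator")
 have i0: "integrable \<Delta> (%z. indicator ?A z * (b t * b t - (bb z)^2))"
 proof (rule finite_radon_integrable[OF radon_\<Delta> finite_radon_measurable[OF radon_\<Delta>], where C="\<bar>b t * b t\<bar> + K^2"])
  show "(%z. indicator ?A z * (b t * b t - (bb z)^2)) \<in> bm borel" using Am bbm by measurable
  fix z :: "real \<times> real"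
  have "(bb z)^2 <= K^2" using power_mono[OF bbK[of z], of 2] by simp
  then have "\<bar>b t * b t - (bb z)^2\<bar> <= \<bar>b t * b t\<bar> + K^2" using zero_le_power2[of "bb z"] by linarith
  then show "\<bar>indicator ?A z * (b t * b t - (bb z)^2)\<bar> <= \<bar>b t * b t\<bar> + K^2"
   by (simp add: abs_mult split: split_indicator)
 qed
 have "(LINT z|\<Delta>. (bb z)^2 * indicator ?A z) = (b t * b t) * (LINT z|\<Delta>. indicator ?A z) - (LINT z|\<Delta>. indicator ?A z * (b t * b t - (bb z)^2))"
  unfolding integral_mult_right_zero[symmetric] LINT_diff[OF i1 i0, symmetric] by (simp add: algebra_simps)
 also have "(LINT z|\<Delta>. indicator ?A z * (b t * b t - (bb z)^2)) = (LINT z|\<Delta>. indicator ?A z * (prim c' t - prim c' (fst z)))"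
 proof (intro LINT_cong refl)
  fix z assume "z \<in> space \<Delta>"
  then have "fst z \<in> I" using finite_radonD(3)[OF radon_\<Delta>] by (auto simp: unit_square_def)
  with c't[OF this] show "indicator ?A z * (b t * b t - (bb z)^2) = indicator ?A z * (prim c' t - prim c' (fst z))"
   by (auto simp: bb_def power2_eq_square split: split_indicator)
 qed
 also have "(LINT z|\<Delta>. indicator ?A z * (prim c' t - prim c' (fst z)))
  = (LINT u|UI. (if s < u & u <= t then c' u * (LINT z|\<Delta>. indicator ({s<..u} \<times> B) z) else 0))"
  by (rule integration_by_parts_measure(2)[OF radon_\<Delta> B(1) _ c'm c'K]) (use st in auto)
 also have "... = prim (%u. c' u * V u) t"
  using st \<Delta>_increment[OF B(1), of s] V_incr
  by (subst prim_eq) (auto intro!: LINT_cong simp: c'_def b'_eq w_def)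
 \<comment> \<open>The boundary term and the integral of c' V recombine by the product rule for b^2
   V.\<close>
 also have "(b t * b t) * (LINT z|\<Delta>. indicator ?A z) - prim (%u. c' u * V u) t = prim (%u. (b u * b u) * (w u * cum B u)) t"
 proof -
  have "(b t * b t) * V t = prim (%u. c' u * V u + (b u * b u) * (w u * cum B u)) t"
   using ac_eq[OF ac_mult[OF acbb acV], of t] st by (simp add: V_def)
  also have "... = prim (%u. c' u * V u) t + prim (%u. (b u * b u) * (w u * cum B u)) t"
  proof (rule prim_add)
   show "integrable UI (%u. c' u * V u)"
    using continuous_mult_integrable[OF ac_continuous[OF acV] ac_integrable[OF acbb]] by (simp add: mult.commute)
   show "integrable UI (%u. (b u * b u) * (w u * cum B u))"
    by (rule continuous_mult_integrable[OF ac_continuous[OF acbb] iwc])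
  qed (use st in auto)
  finally show ?thesis using V_incr[of t] \<Delta>_increment[OF B(1), of s t] st by simp
 qed
 also have "... = - (LINT u|UI. b' u * cum B u)"
 proof -
  have "prim (%u. (b u * b u) * (w u * cum B u)) t = (LINT u|UI. - (b' u * cum B u))"
   using st by (subst prim_eq) (auto intro!: LINT_cong simp: b'_eq w_def power2_eq_square)
  then show ?thesis by simp
 qed
 finally have 2: "(LINT z|\<Delta>. (bb z)^2 * indicator ?A z) = - (LINT u|UI. b' u * cum B u)" .
 \<comment> \<open>The integrals of b' times \<open>cum\<close> cancel between \<open>1\<close> and
   \<open>2\<close>; only boundary values remain.\<close>
 have "b t * cum B t - b s * cum B s <= (LINT z|\<sigma>. indicator ?A z)"
  using dual unfolding 1 2 by simp
 then have "(t - s) * (b t * cum B t - b s * cum B s) <= (t - s) * (LINT z|\<sigma>. indicator ?A z)"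
  using st by (intro mult_left_mono) auto
 moreover have "(t - s) * (b t * cum B t - b s * cum B s) = (u - 1) * (cum B t / u - cum B s)"
 proof -
  have "(t - s) * \<beta> = u - 1" using st by (simp add: \<beta>_def)
  then show ?thesis unfolding bs by (simp add: right_diff_distrib mult.assoc[symmetric])
 qed
 ultimately show "(u - 1) * (cum B t / u - cum B s) <= (t - s) * (LINT z|\<sigma>. indicator ?A z)" by simp
qed

end

section \<open>Disintegration of \<Delta> in time and uniqueness of slices\<close>

subsection \<open>Time slices\<close>

text \<open>Rational end points suffice because distribution functions are right-continuous.
  Countability is what allows slices to be compared outside one null set of times.\<close>

lemma interval_measure_eqI:
 assumes M: "sets M = sets (restrict_space borel {0..1::real})" "finite_measure M"
  and N: "sets N = sets (restrict_space borel I)"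
  and e: "!!b. b \<in> \<rat> ==> emeasure M ({..b} Int I) = emeasure N ({..b} Int I)"
 shows "M = N"
proof -
 interpret M: finite_measure M by fact
 have sp: "space M = I" "space N = I"
  using sets_eq_imp_space_eq[OF M(1)] sets_eq_imp_space_eq[OF N] by (auto simp: space_restrict_space)
 have sM: "A \<in> sets M \<longleftrightarrow> A \<in> sets borel & A \<subseteq> I" and sN: "A \<in> sets N \<longleftrightarrow> A \<in> sets borel & A \<subseteq> I" for A
  using M N by (auto simp: sets_restrict_space_iff)
 interpret N: finite_measure N
  by (rule finite_measureI) (use e[of 1] M.emeasure_finite[of "I"] sp in "simp add: Int_absorb1")
 let ?A = "%b::real. I Int {..b}"
 have A1: "?A b \<in> sets borel" for b by (rule sets.Int) simp_all
 have A: "?A b \<in> sets M" "?A b \<in> sets N" for b using A1[of b] Int_lower1 unfolding sM sN by blast+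
 have le: "measure L (?A b) <= measure L' (?A b)"
  if L: "finite_measure L" "finite_measure L'" "!!b. ?A b \<in> sets L" "!!b. ?A b \<in> sets L'"
   and r: "!!r. r \<in> \<rat> ==> measure L (?A r) = measure L' (?A r)" for L L' b
 proof (rule LIMSEQ_le_const)
  interpret L: finite_measure L by fact
  interpret L': finite_measure L' by fact
  have "(\<Inter>n. ?A (b + inverse (real (Suc n)))) = ?A b"
  proof (intro equalityI subsetI)
   fix x assume "x \<in> (\<Inter>n. ?A (b + inverse (real (Suc n))))"
   then have x: "x \<in> I" "!!n. x <= b + inverse (real (Suc n))" by auto
   have "(%n. b + inverse (real (Suc n))) ----> b + 0" by (intro tendsto_intros LIMSEQ_inverse_real_of_nat)
   then have "x <= b + 0" by (rule LIMSEQ_le_const) (use x in blast)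
   then show "x \<in> ?A b" using x by simp
  qed (auto intro: order_trans)
  moreover have "decseq (%n. ?A (b + inverse (real (Suc n))))"
  proof (intro decseq_SucI Int_mono order_refl)
   fix n
   have "inverse (real (Suc (Suc n))) <= inverse (real (Suc n))" by (rule le_imp_inverse_le) auto
   then show "{..b + inverse (real (Suc (Suc n)))} \<subseteq> {..b + inverse (real (Suc n))}" by simp
  qed
  ultimately show "(%n. measure L' (?A (b + inverse (real (Suc n))))) ----> measure L' (?A b)"
   using L'.finite_Lim_measure_decseq[of "%n. ?A (b + inverse (real (Suc n)))"] L(4) by auto
  show "\<exists>N. \<forall>n\<ge>N. measure L (?A b) <= measure L' (?A (b + inverse (real (Suc n))))"
  proof (intro exI allI impI)
   fix n
   obtain q where q: "q \<in> \<rat>" "b < q" "q < b + inverse (real (Suc n))" using Rats_dense_in_real[of b "b + inverse (real (Suc n))"] by auto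
   have "measure L (?A b) <= measure L (?A q)" by (rule L.finite_measure_mono[OF _ L(3)]) (use q in auto)
   also have "... <= measure L' (?A (b + inverse (real (Suc n))))"
    unfolding r[OF q(1)] by (rule L'.finite_measure_mono[OF _ L(4)]) (use q in auto)
   finally show "measure L (?A b) <= measure L' (?A (b + inverse (real (Suc n))))" .
  qed
 qed
 have r: "measure M (?A q) = measure N (?A q)" if "q \<in> \<rat>" for q using e[OF that] by (simp add: measure_def Int_commute)
 have e': "emeasure M (?A b) = emeasure N (?A b)" for b
  using le[OF M.finite_measure_axioms N.finite_measure_axioms A r, of b] le[OF N.finite_measure_axioms M.finite_measure_axioms A(2,1) r[symmetric], of b]
  by (simp add: M.emeasure_eq_measure N.emeasure_eq_measure)
 have s: "sets (restrict_space borel {0..1::real}) = sigma_sets I (range ?A)"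
 proof -
  have b: "sets borel = sigma_sets UNIV (range (%b::real. {..b}))" unfolding borel_eq_atMost by simp
  have "{0..1::real} \<in> sigma_sets UNIV (range (%b. {..b}))" unfolding b[symmetric] by simp
  from sigma_sets_Int[OF this subset_UNIV] show ?thesis unfolding sets_restrict_space b image_image .
 qed
 show ?thesis
 proof (rule measure_eqI_generator_eq[where A="%_. ?A 1"])
  show "Int_stable (range ?A)"
  proof (rule Int_stableI)
   fix X Y assume "X \<in> range ?A" "Y \<in> range ?A"
   then obtain a b where "X = ?A a" "Y = ?A b" by blast
   then show "X Int Y \<in> range ?A" by (intro image_eqI[of _ _ "min a b"]) auto
  qed
 qed (use M(1) N s e' in auto)
qed

lemma section_sets:
 assumes "A \<in> sets (borel :: (real \<times> real) measure)" "t \<in> I"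
 shows "{x. (t, x) \<in> A Int unit_square} \<in> sets (restrict_space borel I)"
proof -
 have "A \<in> sets (borel \<Otimes>\<^sub>M borel)" using assms(1) by (simp only: borel_prod)
 then have "Pair t -` A Int space borel \<in> sets (borel :: real measure)"
  by (rule measurable_sets[rotated]) simp
 moreover have "{x. (t, x) \<in> A Int unit_square} = (Pair t -` A) Int I"
  using assms(2) by (auto simp: unit_square_def)
 ultimately show ?thesis by (simp add: sets_restrict_space_iff)
qed

lemma disintegrates_UI:
 "disintegrates M \<kappa> \<longleftrightarrow> (\<forall>t\<in>I. sets (\<kappa> t) = sets (restrict_space borel I) & finite_measure (\<kappa> t)) &
   (\<forall>B\<in>sets (restrict_space borel I). (%t. emeasure (\<kappa> t) B) \<in> bm UI) &
   (\<forall>A\<in>sets M. emeasure M A = (\<integral>\<^sup>+ t. emeasure (\<kappa> t) {x. (t, x) \<in> A} \<partial>UI))"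
proof -
 have "(\<integral>\<^sup>+ t. f t \<partial>UI) = (\<integral>\<^sup>+ t\<in>I. f t \<partial>lborel)" for f
  by (simp add: UI_def nn_integral_restrict_space)
 then show ?thesis unfolding disintegrates_def measurable_cong_sets[OF sets_UI refl] by simp
qed

text \<open>For a fixed B the slice masses are densities of the same time marginal, hence agree
  almost everywhere; countably many B determine the slice. This controls the arbitrary choice made
  by \<open>slices\<close>.\<close>

lemma disintegrates_unique:
 assumes M: "finite_radon M" and k: "disintegrates M \<kappa>" and k': "disintegrates M \<kappa>'"
 shows "AE t in UI. \<kappa> t = \<kappa>' t"
proof -
 have one: "AE t in UI. emeasure (\<kappa> t) B = emeasure (\<kappa>' t) B" if B: "B \<in> sets borel" "B \<subseteq> I" for B
 proof -
  have B': "B \<in> sets (restrict_space borel I)" using B by (simp add: sets_restrict_space_iff)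
  have m [measurable]: "(%t. emeasure (\<kappa> t) B) \<in> bm UI" "(%t. emeasure (\<kappa>' t) B) \<in> bm UI"
   using k k' B' by (auto simp: disintegrates_UI)
  have "density UI (%t. emeasure (\<kappa> t) B) = density UI (%t. emeasure (\<kappa>' t) B)"
  proof (rule measure_eqI)
   fix J assume "J \<in> sets (density UI (%t. emeasure (\<kappa> t) B))"
   then have J: "J \<in> sets UI" "J \<in> sets borel" "J \<subseteq> I" by (auto simp: sets_UI sets_restrict_space_iff)
   have "J \<times> B \<in> sets borel" unfolding borel_prod[symmetric] using J B by auto
   then have JB: "J \<times> B \<in> sets M"
    using J B unfolding unit_square_sets[OF M] unit_square_def by blast
   have *: "emeasure M (J \<times> B) = (\<integral>\<^sup>+ t. emeasure (l t) B * indicator J t \<partial>UI)" if "disintegrates M l" for l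
   proof -
    have "emeasure M (J \<times> B) = (\<integral>\<^sup>+ t. emeasure (l t) {x. (t, x) \<in> J \<times> B} \<partial>UI)"
     using that JB by (auto simp: disintegrates_UI)
    also have "... = (\<integral>\<^sup>+ t. emeasure (l t) B * indicator J t \<partial>UI)"
     by (intro nn_integral_cong) (auto split: split_indicator)
    finally show ?thesis .
   qed
   show "emeasure (density UI (%t. emeasure (\<kappa> t) B)) J = emeasure (density UI (%t. emeasure (\<kappa>' t) B)) J"
    using *[OF k] *[OF k'] J m by (simp add: emeasure_density)
  qed simp
  then show ?thesis using UI.density_unique_iff[OF m] by simp
 qed
 have "AE t in UI. \<forall>b\<in>\<rat>. emeasure (\<kappa> t) ({..b} Int I) = emeasure (\<kappa>' t) ({..b} Int I)"
  by (subst AE_ball_countable[OF countable_rat]) (intro ballI one, auto)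
 then show ?thesis
 proof (rule AE_mp, intro AE_I2 impI)
  fix t assume t: "t \<in> space UI" and e: "\<forall>b\<in>\<rat>. emeasure (\<kappa> t) ({..b} Int I) = emeasure (\<kappa>' t) ({..b} Int I)"
  show "\<kappa> t = \<kappa>' t"
   by (rule interval_measure_eqI) (use t e k k' in "auto simp: disintegrates_def")
 qed
qed

text \<open>Its mass on B is the component of \<open>cum B t\<close> coming from one half of the
  signed measure d.\<close>

definition marg :: "(real \<times> real) measure => real => real measure" where
 "marg M t = distr (density M (indicator ({-1<..t} \<times> UNIV))) (restrict_space borel I) snd"

lemma marg:
 assumes M: "finite_radon M"
 shows "sets (marg M t) = sets (restrict_space borel I)" "finite_measure (marg M t)"
  and "B \<in> sets (restrict_space borel I) ==> measure (marg M t) B = (LINT z|M. indicator ({-1<..t} \<times> B) z)"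
proof -
 interpret M: finite_measure M by (rule finite_radonD[OF M])
 have sp: "space M = unit_square" by (rule finite_radonD[OF M])
 show s: "sets (marg M t) = sets (restrict_space borel I)" by (simp add: marg_def)
 have sn: "snd \<in> measurable M (restrict_space borel I)"
  by (rule measurable_restrict_space2[OF _ finite_radon_measurable_prod[OF M measurable_snd]])
    (auto simp: sp unit_square_def)
 have m: "(indicator ({-1<..t} \<times> UNIV) :: _ => ennreal) \<in> bm M"
  unfolding measurable_cong_sets[OF finite_radonD(1)[OF M] refl] by (intro measurable_restrict_space1) simp
 have e: "emeasure (marg M t) B = emeasure M (({-1<..t} \<times> B) Int unit_square)" if B: "B \<in> sets (restrict_space borel I)" for B
 proof -
  have B': "B \<in> sets borel" "B \<subseteq> I" using B by (auto simp: sets_restrict_space_iff)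
  have s: "snd -` B Int space M \<in> sets M" by (rule measurable_sets[OF sn B])
  have sn': "snd \<in> measurable (density M (indicator ({-1<..t} \<times> UNIV))) (restrict_space borel I)"
   using sn by (simp only: measurable_density_eq1)
  have "emeasure (marg M t) B = emeasure (density M (indicator ({-1<..t} \<times> UNIV))) (snd -` B Int space M)"
   unfolding marg_def emeasure_distr[OF sn' B] by (simp only: space_density)
  also have "... = (\<integral>\<^sup>+ z. indicator ({-1<..t} \<times> UNIV) z * indicator (snd -` B Int space M) z \<partial>M)"
   by (rule emeasure_density[OF m s])
  also have "... = (\<integral>\<^sup>+ z. indicator (({-1<..t} \<times> B) Int unit_square) z \<partial>M)"
   by (intro nn_integral_cong) (auto simp: sp split: split_indicator)
  also have "... = emeasure M (({-1<..t} \<times> B) Int unit_square)"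
   using B' by (intro nn_integral_indicator) (auto simp: unit_square_sets[OF M])
  finally show ?thesis .
 qed
 show "finite_measure (marg M t)"
  using e[of "I"] by (intro finite_measureI) (simp add: marg_def space_restrict_space sets_restrict_space_iff)
 show "measure (marg M t) B = (LINT z|M. indicator ({-1<..t} \<times> B) z)" if "B \<in> sets (restrict_space borel I)"
  using e[OF that] by (simp add: sp measure_def)
qed

context fisher_rao_dominated
begin

text \<open>\<open>cum B t\<close> as a measure in B. Time 1 is set to zero because nonnegativity on
  all Borel sets has been shown before time 1; a single time is negligible.\<close>

definition \<kappa> :: "real => real measure" where
 "\<kappa> t = (if 0 <= t & t < 1 then diff_measure (marg (fst d) t) (marg (snd d) t) else null_measure (restrict_space borel I))"

lemma \<kappa>: "sets (\<kappa> t) = sets (restrict_space borel I)" "finite_measure (\<kappa> t)"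
 and \<kappa>_measure: "0 <= t ==> t < 1 ==> B \<in> sets borel ==> B \<subseteq> I ==> measure (\<kappa> t) B = cum B t"
proof -
 have d': "finite_radon (fst d)" "finite_radon (snd d)" using d by (auto simp: signed_radon_def)
 note m1 = marg[OF d'(1), where t=t] and m2 = marg[OF d'(2), where t=t]
 show "sets (\<kappa> t) = sets (restrict_space borel I)" by (simp add: \<kappa>_def m1)
 have le: "marg (snd d) t <= marg (fst d) t" if t: "0 <= t" "t < 1"
 proof (subst le_measure)
  show "\<forall>A\<in>sets (marg (snd d) t). emeasure (marg (snd d) t) A <= emeasure (marg (fst d) t) A"
  proof
   fix A assume "A \<in> sets (marg (snd d) t)"
   then have A: "A \<in> sets (restrict_space borel I)" "A \<in> sets borel" using m2 by (auto simp: sets_restrict_space_iff)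
   have "measure (marg (snd d) t) A <= measure (marg (fst d) t) A"
    using cum_nonneg[OF A(2) t] by (simp add: m1(3)[OF A(1)] m2(3)[OF A(1)] cum_def signed_integral_def)
   then show "emeasure (marg (snd d) t) A <= emeasure (marg (fst d) t) A"
    by (simp add: finite_measure.emeasure_eq_measure m1 m2)
  qed
 qed (simp add: m1 m2)
 note f = finite_diff_measure[OF m1(2) m2(2) le trans[OF m1(1) m2(1)[symmetric]]]
 show "finite_measure (\<kappa> t)"
  using f(1) by (auto simp: \<kappa>_def intro!: finite_measureI)
 show "measure (\<kappa> t) B = cum B t" if "0 <= t" "t < 1" "B \<in> sets borel" "B \<subseteq> I"
  using that f(2)[of B] m1 m2(3)[of B] by (simp add: \<kappa>_def cum_def signed_integral_def sets_restrict_space_iff)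
qed

lemma \<kappa>_emeasure_measurable:
 assumes B: "B \<in> sets (restrict_space borel I)"
 shows "(%t. emeasure (\<kappa> t) B) \<in> bm UI"
proof -
 have B': "B \<in> sets borel" "B \<subseteq> I" using B by (auto simp: sets_restrict_space_iff)
 have [measurable]: "cum B \<in> bm UI" using integrable_cum[OF B'(1)] by auto
 have "(%t. if t < 1 then ennreal (cum B t) else 0) \<in> bm UI" by measurable
 moreover have "emeasure (\<kappa> t) B = (if t < 1 then ennreal (cum B t) else 0)" if "t \<in> space UI" for t
  using that \<kappa>_measure[of t B] B' finite_measure.emeasure_eq_measure[OF \<kappa>(2), of t B]
  by (auto simp: \<kappa>_def)
 ultimately show ?thesis by (rule measurable_cong[THEN iffD2, rotated])
qed

text \<open>On lower quadrants the formula is \<open>\<Delta>_density\<close>. Quadrants are stable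
  under intersection and generate the Borel sets of the plane; measurability of the slice masses is
  carried along in the same induction.\<close>

lemma \<Delta>_disintegration:
 assumes "A \<in> sets borel"
 shows "(%t. emeasure (\<kappa> t) {x. (t, x) \<in> A Int unit_square}) \<in> bm UI &
  emeasure \<Delta> (A Int unit_square) = (\<integral>\<^sup>+ t. emeasure (\<kappa> t) {x. (t, x) \<in> A Int unit_square} \<partial>UI)"
proof -
 interpret \<Delta>: finite_measure \<Delta> by (rule finite_radonD[OF radon_\<Delta>])
 have D\<Delta>: "A Int unit_square \<in> sets \<Delta>" if "A \<in> sets borel" for A
  using that by (auto simp: unit_square_sets[OF radon_\<Delta>] simp del: sets_diff_measure)
 have rect: "(%t. emeasure (\<kappa> t) {x. (t, x) \<in> {..(s, b)} Int unit_square}) \<in> bm UI &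
  emeasure \<Delta> ({..(s, b)} Int unit_square) = (\<integral>\<^sup>+ t. emeasure (\<kappa> t) {x. (t, x) \<in> {..(s, b)} Int unit_square} \<partial>UI)" for s b :: real
 proof (cases "0 <= s")
  case False
  then have "{..(s, b)} Int unit_square = {}" by (auto simp: unit_square_def less_eq_prod_def)
  then show ?thesis by simp
 next
  case True
  define s' where "s' = min s 1"
  have s': "s' \<in> I" using True by (auto simp: s'_def)
  let ?B = "{..b} Int I"
  have Bm: "?B \<in> sets borel" "?B \<subseteq> I" "?B \<in> sets (restrict_space borel I)" by (auto simp: sets_restrict_space_iff simp del: Int_atLeastAtMostL1 Int_atLeastAtMostL2 Int_atLeastAtMostR1 Int_atLeastAtMostR2)
  have sec: "{x. (t, x) \<in> {..(s, b)} Int unit_square} = (if t <= s' then ?B else {})" if "t \<in> I" for t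
   using that by (auto simp: unit_square_def less_eq_prod_def s'_def)
  note [measurable] = \<kappa>_emeasure_measurable[OF Bm(3)]
  have "(%t. if t <= s' then emeasure (\<kappa> t) ?B else 0) \<in> bm UI" by measurable
  then have m: "(%t. emeasure (\<kappa> t) {x. (t, x) \<in> {..(s, b)} Int unit_square}) \<in> bm UI"
   by (rule measurable_cong[THEN iffD2, rotated]) (use sec in "auto simp del: Int_iff")
  have "(\<integral>\<^sup>+ t. emeasure (\<kappa> t) {x. (t, x) \<in> {..(s, b)} Int unit_square} \<partial>UI)
   = (\<integral>\<^sup>+ t. ennreal (if t <= s' then cum ?B t else 0) \<partial>UI)"
  proof (rule nn_integral_cong_AE, use AE_UI_neq[of 1] AE_space in eventually_elim)
   case (elim t)
   then have "t \<in> I" "0 <= t" "t < 1" by auto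
   then show ?case using \<kappa>_measure[OF _ _ Bm(1,2), of t] finite_measure.emeasure_eq_measure[OF \<kappa>(2), of t ?B]
    unfolding sec[OF \<open>t \<in> I\<close>] by auto
  qed
  also have "... = ennreal (LINT t|UI. (if t <= s' then cum ?B t else 0))"
  proof (rule nn_integral_eq_integral)
   show "integrable UI (%t. if t <= s' then cum ?B t else 0)" by (rule integrable_prim_aux[OF integrable_cum[OF Bm(1)]])
   show "AE t in UI. 0 <= (if t <= s' then cum ?B t else 0)"
    using AE_UI_neq[of 1] AE_space by eventually_elim (use cum_nonneg[OF Bm(1)] in auto)
  qed
  also have "... = ennreal (prim (cum ?B) s')" using s' by (subst prim_eq) auto
  also have "... = ennreal (LINT z|\<Delta>. indicator ({-1<..s'} \<times> ?B) z)" by (subst \<Delta>_density[OF Bm(1) s']) simp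
  also have "... = ennreal (LINT z|\<Delta>. indicator ({..(s, b)} Int unit_square) z)"
   by (intro arg_cong[where f=ennreal] LINT_cong)
     (auto simp: finite_radonD(3)[OF radon(1)] unit_square_def less_eq_prod_def s'_def split: split_indicator)
  also have "... = emeasure \<Delta> ({..(s, b)} Int unit_square)"
   using sets.sets_into_space[OF D\<Delta>, of "{..(s, b)}"] by (simp add: \<Delta>.emeasure_eq_measure Int_absorb2)
  finally show ?thesis using m by simp
 qed
 have UN: "{..(1, 1)} Int unit_square = UNIV Int unit_square" by (auto simp: unit_square_def less_eq_prod_def)
 note all = rect[of 1 1, unfolded UN]
 have borel: "sigma_sets UNIV (range (%b::real \<times> real. {..b})) = sets borel"
  unfolding borel_eq_atMost by simp
 have sec: "{x. (t, x) \<in> A Int unit_square} \<in> sets (\<kappa> t)" if "A \<in> sets borel" "t \<in> space UI" for A t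
  using section_sets[OF that(1), of t] that(2) \<kappa>(1) by auto
 have "Int_stable (range (%b::real \<times> real. {..b}))"
 proof (rule Int_stableI_image)
  fix i j :: "real \<times> real"
  show "\<exists>k\<in>UNIV. {..i} Int {..j} = {..k}"
   by (rule bexI[of _ "(min (fst i) (fst j), min (snd i) (snd j))"]) (auto simp: less_eq_prod_def)
 qed
 moreover have "range (%b::real \<times> real. {..b}) \<subseteq> Pow UNIV" by auto
 moreover have "A \<in> sigma_sets UNIV (range (%b::real \<times> real. {..b}))" using assms borel by simp
 ultimately show ?thesis
 proof (induction rule: sigma_sets_induct_disjoint)
  case (basic A)
  then obtain s b where "A = {..(s, b)}" by (metis imageE surj_pair)
  then show ?case using rect by blast
 next
  case empty show ?case by simp
 next
  case (compl A)
  then have A: "A \<in> sets borel" by (simp add: borel)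
  let ?U = "%t. emeasure (\<kappa> t) {x. (t, x) \<in> UNIV Int unit_square}" and ?A = "%t. emeasure (\<kappa> t) {x. (t, x) \<in> A Int unit_square}"
  have e: "emeasure (\<kappa> t) {x. (t, x) \<in> (UNIV - A) Int unit_square} = ?U t - ?A t" if t: "t \<in> space UI" for t
  proof -
   have "{x. (t, x) \<in> (UNIV - A) Int unit_square} = {x. (t, x) \<in> UNIV Int unit_square} - {x. (t, x) \<in> A Int unit_square}" by auto
   then show ?thesis
    using sec[OF A t] sec[of UNIV, OF _ t] finite_measure.emeasure_finite[OF \<kappa>(2)]
    by (simp only:) (rule emeasure_Diff, auto)
  qed
  have [measurable]: "?U \<in> bm UI" "?A \<in> bm UI" using all compl(2) by auto
  have "(%t. ?U t - ?A t) \<in> bm UI" by measurable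
  then have m: "(%t. emeasure (\<kappa> t) {x. (t, x) \<in> (UNIV - A) Int unit_square}) \<in> bm UI"
   by (rule measurable_cong[THEN iffD2, rotated]) (rule e)
  have "(\<integral>\<^sup>+ t. emeasure (\<kappa> t) {x. (t, x) \<in> (UNIV - A) Int unit_square} \<partial>UI) = (\<integral>\<^sup>+ t. ?U t - ?A t \<partial>UI)"
   by (intro nn_integral_cong e)
  also have "... = (\<integral>\<^sup>+ t. ?U t \<partial>UI) - (\<integral>\<^sup>+ t. ?A t \<partial>UI)"
  proof (rule nn_integral_diff)
   show "(\<integral>\<^sup>+ t. ?A t \<partial>UI) ~= \<infinity>" using \<Delta>.emeasure_finite[of "A Int unit_square"] unfolding compl(2)[THEN conjunct2] by simp
   show "AE t in UI. ?A t <= ?U t"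
    by (intro AE_I2 emeasure_mono sec[of UNIV]) auto
  qed (rule \<open>?U \<in> bm UI\<close> \<open>?A \<in> bm UI\<close>)+
  also have "... = emeasure \<Delta> (UNIV Int unit_square) - emeasure \<Delta> (A Int unit_square)"
   by (simp only: all[THEN conjunct2] compl(2)[THEN conjunct2])
  also have "... = emeasure \<Delta> ((UNIV Int unit_square) - (A Int unit_square))"
   by (rule emeasure_Diff[symmetric]) (use D\<Delta>[of UNIV] D\<Delta>[OF A] \<Delta>.emeasure_finite in auto)
  also have "(UNIV Int unit_square) - (A Int unit_square) = (UNIV - A) Int unit_square" by auto
  finally show ?case using m by simp
 next
  case (union S)
  have S: "S i \<in> sets borel" for i using union(2) by (auto simp: borel)
  have e: "emeasure (\<kappa> t) {x. (t, x) \<in> (\<Union>i. S i) Int unit_square} = (\<Sum>i. emeasure (\<kappa> t) {x. (t, x) \<in> S i Int unit_square})" if t: "t \<in> space UI" for t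
  proof -
   have "{x. (t, x) \<in> (\<Union>i. S i) Int unit_square} = (\<Union>i. {x. (t, x) \<in> S i Int unit_square})" by auto
   moreover have "disjoint_family (%i. {x. (t, x) \<in> S i Int unit_square})" using union(1) by (auto simp: disjoint_family_on_def)
   ultimately show ?thesis using sec[OF S t] by (simp only:) (rule suminf_emeasure[symmetric], auto)
  qed
  note [measurable] = union(3)[THEN conjunct1]
  have "(%t. \<Sum>i. emeasure (\<kappa> t) {x. (t, x) \<in> S i Int unit_square}) \<in> bm UI" by measurable
  then have m: "(%t. emeasure (\<kappa> t) {x. (t, x) \<in> (\<Union>i. S i) Int unit_square}) \<in> bm UI"
   by (rule measurable_cong[THEN iffD2, rotated]) (rule e)
  have "(\<integral>\<^sup>+ t. emeasure (\<kappa> t) {x. (t, x) \<in> (\<Union>i. S i) Int unit_square} \<partial>UI) = (\<Sum>i. \<integral>\<^sup>+ t. emeasure (\<kappa> t) {x. (t, x) \<in> S i Int unit_square} \<partial>UI)"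
   unfolding nn_integral_suminf[OF union(3)[THEN conjunct1], symmetric] by (intro nn_integral_cong e)
  also have "... = (\<Sum>i. emeasure \<Delta> (S i Int unit_square))" using union(3) by simp
  also have "... = emeasure \<Delta> (\<Union>i. S i Int unit_square)"
   by (rule suminf_emeasure) (use D\<Delta>[OF S] union(1) in "auto simp: disjoint_family_on_def")
  also have "(\<Union>i. S i Int unit_square) = (\<Union>i. S i) Int unit_square" by auto
  finally show ?case using m by simp
 qed
qed

end

section \<open>Joint measurability, sections, and good representatives of H1 curves\<close>

subsection \<open>Curves of class \<open>H\<^sup>1\<close>\<close>

abbreviation UU where "UU \<equiv> UI \<Otimes>\<^sub>M UI"

definition m2 :: "(real => real => real) => bool" where
 "m2 u \<longleftrightarrow> (%z. u (fst z) (snd z)) \<in> bm UU"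

lemma m2_iff: "m2 u \<longleftrightarrow> case_prod u \<in> bm UU"
 by (simp add: m2_def case_prod_beta')

lemma m2_compose:
 assumes "m2 u" "f \<in> measurable M UI" "g \<in> measurable M UI"
 shows "(%a. u (f a) (g a)) \<in> bm M"
 using measurable_compose[OF measurable_Pair[OF assms(2,3)] assms(1)[unfolded m2_def]] by simp

lemma m2_section: "m2 u ==> t \<in> I ==> u t \<in> bm UI"
 and m2_section': "m2 u ==> x \<in> I ==> (%t. u t x) \<in> bm UI"
 by (rule m2_compose; simp)+

lemma m2_fun:
 assumes "f \<in> bm UI" shows "m2 (%t x. f x)" "m2 (%t x. f t)"
 unfolding m2_def using assms by measurable

lemma m2_arith:
 assumes "m2 u" "m2 v"
 shows "m2 (%t x. u t x + v t x)" "m2 (%t x. u t x - v t x)" "m2 (%t x. u t x * v t x)" "m2 (%t x. u t x / v t x)"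
 using assms unfolding m2_def by measurable

lemma m2_unary:
 assumes "m2 u"
 shows "m2 (%t x. c * u t x)" "m2 (%t x. - u t x)" "m2 (%t x. \<bar>u t x\<bar>)" "m2 (%t x. (u t x)^2)" "m2 (%t x. exp (u t x))" "m2 (%t x. 1 / u t x)"
 using assms unfolding m2_def by measurable

lemma m2_prim_x: assumes "m2 u" shows "m2 (%t x. prim (u t) x)"
proof -
 have [measurable]: "(%w. u (fst (fst w)) (snd w)) \<in> borel_measurable (UU \<Otimes>\<^sub>M UI)"
  by (rule m2_compose[OF assms]) measurable
 have "(%z. LINT y|UI. (if y <= snd z then u (fst z) y else 0)) \<in> bm UU" by measurable
 then show ?thesis unfolding m2_def
  by (rule measurable_cong[THEN iffD2, rotated]) (rule prim_eq, auto simp: space_pair_measure)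
qed

lemma m2_prim_t: assumes "m2 u" shows "m2 (%t x. prim (%s. u s x) t)"
proof -
 have [measurable]: "(%w. u (snd w) (snd (fst w))) \<in> borel_measurable (UU \<Otimes>\<^sub>M UI)"
  by (rule m2_compose[OF assms]) measurable
 have "(%z. LINT s|UI. (if s <= fst z then u s (snd z) else 0)) \<in> bm UU" by measurable
 then show ?thesis unfolding m2_def
  by (rule measurable_cong[THEN iffD2, rotated]) (rule prim_eq, auto simp: space_pair_measure)
qed

lemma m2_integral_x: assumes "m2 u" shows "(%t. LINT x|UI. u t x) \<in> bm UI"
 using assms unfolding m2_iff by measurable

lemma m2_nrm: assumes "m2 u" shows "(%t. nrm UI (u t)) \<in> bm UI"
 unfolding nrm_def using m2_integral_x[OF m2_unary(4)[OF assms]] by measurable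

lemma AE_UU:
 assumes "{z \<in> space UU. P (fst z) (snd z)} \<in> sets UU" and "AE t in UI. AE x in UI. P t x"
 shows "AE z in UU. P (fst z) (snd z)" "AE x in UI. AE t in UI. P t x"
proof -
 have m: "{z \<in> space UU. (case z of (t, x) => P t x)} \<in> sets UU"
  using assms(1) by (simp add: case_prod_beta')
 have "AE z in UU. (case z of (t, x) => P t x)"
  by (rule UU.AE_pair_measure[OF m]) (use assms(2) in simp)
 then show "AE z in UU. P (fst z) (snd z)" by (simp add: case_prod_beta')
 show "AE x in UI. AE t in UI. P t x"
  using UU.AE_commute[of P] m assms(2) by (simp add: case_prod_beta' split_beta')
qed

lemma AE_UU_sections:
 assumes "AE z in UU. P (fst z) (snd z)"
 shows "AE t in UI. AE x in UI. P t x" "AE x in UI. AE t in UI. P t x"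
proof -
 show "AE t in UI. AE x in UI. P t x" using UU.AE_pair[OF assms] by simp
 have "AE z in UU. P (snd (case z of (x, y) => (y, x))) (fst (case z of (x, y) => (y, x)))"
  using assms by (simp add: case_prod_beta')
 have "AE z in distr UU UU (%(x, y). (y, x)). P (fst z) (snd z)"
  using assms unfolding UU.distr_pair_swap[symmetric] .
 then have "AE z in UU. P (fst (case z of (x, y) => (y, x))) (snd (case z of (x, y) => (y, x)))"
  by (rule AE_distrD[rotated]) measurable
 from UU.AE_pair[OF this] show "AE x in UI. AE t in UI. P t x" by simp
qed

lemma l2_UU_sections:
 assumes "l2 UU (%z. u (fst z) (snd z))"
 shows "AE t in UI. l2 UI (u t)" "AE x in UI. l2 UI (%t. u t x)"
  "integrable UI (%t. LINT x|UI. (u t x)^2)" "integrable UI (%x. LINT t|UI. (u t x)^2)"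
  "(LINT t|UI. LINT x|UI. (u t x)^2) = (nrm UU (%z. u (fst z) (snd z)))^2"
  "(LINT x|UI. LINT t|UI. (u t x)^2) = (nrm UU (%z. u (fst z) (snd z)))^2"
  "m2 u"
proof -
 show m: "m2 u" using assms by (simp add: l2_def m2_def)
 have i: "integrable UU (%(t, x). (u t x)^2)" using assms by (simp add: l2_def case_prod_beta')
 show "integrable UI (%t. LINT x|UI. (u t x)^2)" "integrable UI (%x. LINT t|UI. (u t x)^2)"
  using UU.integrable_fst[OF i] UU.integrable_snd[OF i] by auto
 show "(LINT t|UI. LINT x|UI. (u t x)^2) = (nrm UU (%z. u (fst z) (snd z)))^2"
  "(LINT x|UI. LINT t|UI. (u t x)^2) = (nrm UU (%z. u (fst z) (snd z)))^2"
  using UU.integral_fst[OF i] UU.integral_snd[OF i] by (auto simp: nrm_square case_prod_beta')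
 show "AE t in UI. l2 UI (u t)"
  using UU.AE_integrable_fst[OF i] AE_space
  by eventually_elim (use m2_section[OF m] in "auto simp: l2_def")
 show "AE x in UI. l2 UI (%t. u t x)"
  using UU.AE_integrable_snd[OF i] AE_space
  by eventually_elim (use m2_section'[OF m] in "auto simp: l2_def")
qed

lemma l2_UU_I:
 assumes "m2 u" "AE t in UI. l2 UI (u t)" "integrable UI (%t. LINT x|UI. (u t x)^2)"
 shows "l2 UU (%z. u (fst z) (snd z))"
proof -
 have "integrable UU (%(t, x). (u t x)^2)"
 proof (rule UU.Fubini_integrable)
  show "(%(t, x). (u t x)^2) \<in> bm UU" using m2_unary(4)[OF assms(1)] by (simp add: m2_iff)
  show "integrable UI (%t. LINT x|UI. norm (case (t, x) of (t, x) => (u t x)^2))" using assms(3) by simp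
  show "AE t in UI. integrable UI (%x. case (t, x) of (t, x) => (u t x)^2)"
   using assms(2) by eventually_elim (simp add: l2_def)
 qed
 then show ?thesis using assms(1) by (simp add: l2_def m2_def case_prod_beta')
qed

lemma l2_UU_bounded_sections:
 assumes "m2 u" "!!t. t \<in> I ==> l2 UI (u t)" "!!t. t \<in> I ==> nrm UI (u t) <= C"
 shows "l2 UU (%z. u (fst z) (snd z))"
proof (rule l2_UU_I[OF assms(1)])
 show "AE t in UI. l2 UI (u t)" using assms(2) by (intro AE_I2) auto
 show "integrable UI (%t. LINT x|UI. (u t x)^2)"
 proof (rule UI.integrable_const_bound[where B="C^2"])
  show "AE t in UI. norm (LINT x|UI. (u t x)^2) <= C^2"
   using assms(3) by (intro AE_I2) (auto simp: nrm_square[symmetric] intro!: power_mono)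
  show "(%t. LINT x|UI. (u t x)^2) \<in> bm UI" by (rule m2_integral_x[OF m2_unary(4)[OF assms(1)]])
 qed
qed

lemma prim_swap:
 assumes u: "integrable UU (%(s, y). u s y)" and "t <= 1" "x <= 1"
 shows "prim (%y. prim (%s. u s y) t) x = prim (%s. prim (u s) x) t"
proof -
 let ?f = "%s y. if s <= t & y <= x then u s y else 0"
 have [measurable]: "(%(s, y). u s y) \<in> bm UU" using u by auto
 have f: "integrable UU (%(s, y). ?f s y)"
  by (rule intble_bound[OF u]) auto
 have "prim (%y. prim (%s. u s y) t) x = (LINT y|UI. LINT s|UI. ?f s y)"
  unfolding prim_eq[OF assms(2)] prim_eq[OF assms(3)]
  by (intro LINT_cong) auto
 also have "... = (LINT s|UI. LINT y|UI. ?f s y)" by (rule UU.Fubini_integral[OF f])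
 also have "... = prim (%s. prim (u s) x) t"
  unfolding prim_eq[OF assms(2)] prim_eq[OF assms(3)]
  by (intro LINT_cong) auto
 finally show ?thesis .
qed

lemma l2_UU_integrable: "l2 UU (%z. u (fst z) (snd z)) ==> integrable UU (%(s, y). u s y)"
 using UUf.l2_integrable[of "%z. u (fst z) (snd z)"] by (simp add: case_prod_beta')

lemma nrm_const_UI [simp]: "nrm UI (%_. c) = \<bar>c\<bar>"
 by (simp add: nrm_def)

lemma integral_abs_le_nrm: "l2 UI f ==> (LINT x|UI. \<bar>f x\<bar>) <= nrm UI f"
 using Cauchy_Schwarz_l2[of UI "%_. 1" "%x. \<bar>f x\<bar>"] by (auto simp: l2_abs)

lemma prim_abs_le_nrm: assumes "l2 UI f" "x \<in> I" shows "\<bar>prim f x\<bar> <= nrm UI f"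
proof -
 have i: "integrable UI f" by (rule UI.l2_integrable[OF assms(1)])
 have "\<bar>prim f x\<bar> <= prim (%y. \<bar>f y\<bar>) x" by (rule prim_abs_le) (use assms i in auto)
 also have "... <= (LINT y|UI. \<bar>f y\<bar>)" by (rule prim_le_integral) (use assms i in auto)
 also have "... <= nrm UI f" by (rule integral_abs_le_nrm[OF assms(1)])
 finally show ?thesis .
qed

text \<open>Cauchy-Schwarz against the indicator of the interval. The exponent 1/2 is what limits
  the rate of the construction to 1/sqrt N.\<close>

lemma prim_Hoelder:
 assumes f: "l2 UI f" and xy: "x \<in> I" "y \<in> I"
 shows "\<bar>prim f x - prim f y\<bar> <= sqrt \<bar>x - y\<bar> * nrm UI f"
proof -
 have *: "\<bar>prim f b - prim f a\<bar> <= sqrt (b - a) * nrm UI f" if ab: "0 <= a" "a <= b" "b <= 1" for a b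
 proof -
  let ?k = "%y. if a < y & y <= b then 1 else 0 :: real"
  have k: "l2 UI ?k" by (rule l2_bound[OF UI.l2_const[of 1]]) auto
  have "(nrm UI ?k)^2 = (LINT y|UI. (if a < y & y <= b then 1 else 0))"
   unfolding nrm_square by (intro LINT_cong) auto
  also have "... = b - a"
   using prim_increment[of a b "%_. 1"] ab by (simp add: prim_const)
  finally have nk: "nrm UI ?k = sqrt (b - a)" by (rule real_sqrt_unique[OF _ nrm_nonneg, symmetric])
  have "prim f b - prim f a = (LINT y|UI. (if a < y & y <= b then f y else 0))"
   by (rule prim_increment) (use ab UI.l2_integrable[OF f] in auto)
  also have "... = (LINT y|UI. ?k y * f y)" by (intro LINT_cong) auto
  finally show ?thesis using Cauchy_Schwarz_l2[OF k f] by (simp add: nk)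
 qed
 show ?thesis
  using *[of y x] *[of x y] xy by (cases "y <= x") (auto simp: abs_minus_commute)
qed

text \<open>Equal primitives with opposite signs moved across give two positive measures with the
  same distribution function, hence equal densities.\<close>

lemma ac_unique:
 assumes "ac u v" "ac u v'" shows "AE t in UI. v t = v' t"
proof -
 have i: "integrable UI v" "integrable UI v'" using assms by (auto dest: ac_integrable)
 note [measurable] = borel_measurable_integrable[OF i(1)] borel_measurable_integrable[OF i(2)]
 have e: "prim v t = prim v' t" if "t \<in> I" for t
  using ac_eq[OF assms(1) that] ac_eq[OF assms(2) that] by linarith
 let ?M = "density UI (%t. ennreal (max 0 (v t) + max 0 (- v' t)))" and ?N = "density UI (%t. ennreal (max 0 (v' t) + max 0 (- v t)))"
 have ii: "integrable UI (%t. max 0 (v t) + max 0 (- v' t))" "integrable UI (%t. max 0 (v' t) + max 0 (- v t))"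
  using i by (auto intro!: Bochner_Integration.integrable_max)
 have em: "emeasure (density UI (%t. ennreal (f t))) ({..b} Int I) = ennreal (prim f b)"
  if b: "b \<in> I" and f: "integrable UI f" "!!t. 0 <= f t" for b f
 proof -
  have bs: "{..b} Int I \<in> sets UI" by (auto simp: sets_UI sets_restrict_space_iff simp del: Int_atLeastAtMostL1 Int_atLeastAtMostL2 Int_atLeastAtMostR1 Int_atLeastAtMostR2)
  have "emeasure (density UI (%t. ennreal (f t))) ({..b} Int I) = (\<integral>\<^sup>+ t. ennreal (f t) * indicator ({..b} Int I) t \<partial>UI)"
   by (rule emeasure_density) (use f bs in auto)
  also have "... = (\<integral>\<^sup>+ t. ennreal (if t <= b then f t else 0) \<partial>UI)"
   by (intro nn_integral_cong) (auto split: split_indicator)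
  also have "... = ennreal (LINT t|UI. (if t <= b then f t else 0))"
   by (rule nn_integral_eq_integral) (use f in "auto intro!: integrable_prim_aux")
  finally show ?thesis using b by (simp add: prim_eq)
 qed
 have "?M = ?N"
 proof (rule interval_measure_eqI)
  show "sets ?M = sets (restrict_space borel I)" "sets ?N = sets (restrict_space borel I)" by (auto simp: sets_UI)
  have "emeasure ?M I = ennreal (prim (%t. max 0 (v t) + max 0 (- v' t)) 1)"
   using em[OF _ ii(1), of 1] by (simp add: Int_absorb1)
  then show "finite_measure ?M" by (intro finite_measureI) simp
  fix b :: real
  have eq: "emeasure ?M ({..b} Int I) = emeasure ?N ({..b} Int I)" if b: "b \<in> I" for b
  proof -
   have "prim (%t. max 0 (v t) + max 0 (- v' t)) b - prim (%t. max 0 (v' t) + max 0 (- v t)) b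
    = prim (%t. (max 0 (v t) + max 0 (- v' t)) - (max 0 (v' t) + max 0 (- v t))) b"
    using b ii by (simp add: prim_diff)
   also have "... = prim (%t. v t - v' t) b" by (rule prim_cong) (use b in "auto simp: max_def")
   also have "... = 0" using b i e[OF b] by (simp add: prim_diff)
   finally show ?thesis using em[OF b ii(1)] em[OF b ii(2)] by simp
  qed
  show "emeasure ?M ({..b} Int I) = emeasure ?N ({..b} Int I)"
  proof (cases "b < 0")
   case True then have "{..b} Int I = {}" by auto
   then show ?thesis by (simp only: emeasure_empty)
  next
   case False
   then have "{..b} Int I = {..min b 1} Int I" "min b 1 \<in> I" by auto
   then show ?thesis using eq[of "min b 1"] by (simp only:)
  qed
 qed
 then have "AE t in UI. ennreal (max 0 (v t) + max 0 (- v' t)) = ennreal (max 0 (v' t) + max 0 (- v t))"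
  by (subst (asm) UI.density_unique_iff) auto
 then show ?thesis
  by eventually_elim (auto simp: max_def split: if_splits)
qed

text \<open>Stronger than \<open>has_tderiv\<close>: for almost every x the whole trajectory is
  absolutely continuous in t, with one null set for all times. This lets the one-dimensional
  calculus be applied at fixed x.\<close>

definition H1 :: "(real => real => real) => (real => real => real) => bool" where
 "H1 u v \<longleftrightarrow> m2 u & l2 UU (%z. v (fst z) (snd z)) & (\<forall>t\<in>I. l2 UI (u t)) &
   (AE x in UI. ac (%t. u t x) (%t. v t x))"

lemma H1D:
 assumes "H1 u v"
 shows "m2 u" "m2 v" "l2 UU (%z. v (fst z) (snd z))" "t \<in> I ==> l2 UI (u t)"
  "AE x in UI. ac (%t. u t x) (%t. v t x)"
 using assms by (auto simp: H1_def l2_def m2_def)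

lemma H1_dominated:
 assumes H: "H1 u v"
 obtains G where "l2 UI G" "!!x. G x >= 0" "!!t. t \<in> I ==> AE x in UI. \<bar>u t x\<bar> <= G x"
proof -
 note h = H1D[OF H]
 define F where "F x = (LINT s|UI. \<bar>v s x\<bar>)" for x
 have Fm: "F \<in> bm UI"
  unfolding F_def using m2_unary(3)[OF h(2)] unfolding m2_iff by measurable
 note sec = l2_UU_sections[OF h(3)]
 have F2: "AE x in UI. (F x)^2 <= (LINT s|UI. (v s x)^2)"
  using sec(2)
 proof eventually_elim
  case (elim x)
  have "0 <= F x" by (simp add: F_def)
  moreover have "F x <= nrm UI (%s. v s x)" unfolding F_def by (rule integral_abs_le_nrm[OF elim])
  ultimately show ?case by (metis nrm_square power_mono)
 qed
 have F: "l2 UI F" unfolding l2_def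
 proof
  show "integrable UI (%x. (F x)^2)"
   by (rule intble_bound[OF sec(4)])
     (use Fm F2 in "auto elim!: eventually_mono")
 qed fact
 have u0: "l2 UI (u 0)" by (rule h(4)) simp
 show ?thesis
 proof (rule that)
  show "l2 UI (%x. \<bar>u 0 x\<bar> + F x)" by (intro l2_add l2_abs u0 F)
  show "0 <= \<bar>u 0 x\<bar> + F x" for x by (simp add: F_def)
  fix t :: real assume t: "t \<in> I"
  show "AE x in UI. \<bar>u t x\<bar> <= \<bar>u 0 x\<bar> + F x"
   using h(5)
  proof eventually_elim
   case (elim x)
   have i: "integrable UI (%t. v t x)" by (rule ac_integrable[OF elim])
   have "\<bar>prim (%t. v t x) t\<bar> <= prim (%t. \<bar>v t x\<bar>) t" by (rule prim_abs_le) (use t i in auto)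
   also have "... <= F x" unfolding F_def by (rule prim_le_integral) (use t i in auto)
   finally show ?case using ac_eq[OF elim t] by linarith
  qed
 qed
qed

lemma H1_bounded:
 assumes H: "H1 u v"
 obtains C where "C >= 0" "!!t. t \<in> I ==> nrm UI (u t) <= C"
proof -
 obtain G where G: "l2 UI G" "!!x. G x >= 0" "!!t. t \<in> I ==> AE x in UI. \<bar>u t x\<bar> <= G x"
  using H1_dominated[OF H] by blast
 show ?thesis
 proof (rule that)
  show "nrm UI (u t) <= nrm UI G" if t: "t \<in> I" for t
   by (rule nrm_mono[OF G(1)]) (use G H1D(4)[OF H t] t in "auto simp: l2_def")
 qed simp
qed

lemma H1_l2: assumes "H1 u v" shows "l2 UU (%z. u (fst z) (snd z))"
proof -
 obtain C where "!!t. t \<in> I ==> nrm UI (u t) <= C" using H1_bounded[OF assms] by blast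
 then show ?thesis using H1D[OF assms] by (intro l2_UU_bounded_sections) auto
qed

lemma H1_has_tderiv:
 assumes H: "H1 u v" shows "has_tderiv u v"
 unfolding has_tderiv_def L2_curve_iff case_prod_beta' L2_iff
proof (intro conjI ballI)
 show "l2 UU (%z. u (fst z) (snd z))" by (rule H1_l2[OF H])
 show "l2 UU (%z. v (fst z) (snd z))" by (rule H1D[OF H])
 fix t :: real assume t: "t \<in> I"
 show "l2 UI (u t)" by (rule H1D(4)[OF H t])
 show "AE x\<in>I in lborel. u t x = u 0 x + (LINT s:{0..t}|lborel. v s x)"
  unfolding UI_AE[symmetric] using H1D(5)[OF H]
 proof eventually_elim
  case (elim x) from ac_eq[OF elim t] show ?case by (simp add: prim_def)
 qed
qed

text \<open>The initial value plus the pointwise time primitive is the representative with good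
  trajectories.\<close>

lemma has_tderiv_H1:
 assumes H: "has_tderiv u v"
 shows "H1 (%t x. u 0 x + prim (%s. v s x) t) v"
  and "t \<in> I ==> AE x in UI. u t x = u 0 x + prim (%s. v s x) t"
proof -
 have v: "l2 UU (%z. v (fst z) (snd z))" and u: "!!t. t \<in> I ==> l2 UI (u t)"
  and e: "!!t. t \<in> I ==> AE x in UI. u t x = u 0 x + prim (%s. v s x) t"
  using H by (auto simp: has_tderiv_def L2_curve_iff case_prod_beta' L2_iff UI_AE prim_def)
 show "t \<in> I ==> AE x in UI. u t x = u 0 x + prim (%s. v s x) t" by (rule e)
 have u0: "u 0 \<in> bm UI" using u[of 0] by (simp add: l2_def)
 have m: "m2 (%t x. u 0 x + prim (%s. v s x) t)"
  by (intro m2_arith m2_prim_t m2_fun u0 l2_UU_sections(7)[OF v])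
 show "H1 (%t x. u 0 x + prim (%s. v s x) t) v"
  unfolding H1_def
 proof (intro conjI ballI m v)
  fix t :: real assume t: "t \<in> I"
  show "l2 UI (%x. u 0 x + prim (%s. v s x) t)"
   by (rule l2_cong_AE[OF u[OF t] m2_section[OF m t] e[OF t]])
 next
  show "AE x in UI. ac (%t. u 0 x + prim (%s. v s x) t) (%t. v t x)"
   using l2_UU_sections(2)[OF v]
  proof eventually_elim
   case (elim x)
   show ?case by (rule acI) (use UI.l2_integrable[OF elim] in auto)
  qed
 qed
qed

lemma has_tderiv_cong:
 assumes H: "has_tderiv u v" and v': "l2 UU (%z. v' (fst z) (snd z))"
  and e: "AE t in UI. AE x in UI. v t x = v' t x"
 shows "has_tderiv u v'"
proof -
 have v: "l2 UU (%z. v (fst z) (snd z))" using H by (auto simp: has_tderiv_def L2_curve_iff case_prod_beta')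
 note m = l2_UU_sections(7)[OF v] l2_UU_sections(7)[OF v']
 have s: "{z \<in> space UU. v (fst z) (snd z) = v' (fst z) (snd z)} \<in> sets UU"
  using m unfolding m2_def by measurable
 have e': "AE x in UI. AE t in UI. v t x = v' t x" by (rule AE_UU(2)[OF s e])
 have "AE x in UI. \<forall>t\<in>I. prim (%s. v s x) t = prim (%s. v' s x) t"
  using e' AE_space
 proof eventually_elim
  case (elim x)
  show ?case
   by (intro ballI prim_cong_AE) (use elim m2_section'[OF m(1)] m2_section'[OF m(2)] in auto)
 qed
 then have p: "AE x in UI. prim (%s. v s x) t = prim (%s. v' s x) t" if "t \<in> I" for t
  by (rule eventually_mono) (use that in blast)
 have "AE x in UI. u t x = u 0 x + prim (%s. v' s x) t" if "t \<in> I" for t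
  using has_tderiv_H1(2)[OF H that] p[OF that] by eventually_elim simp
 moreover have "L2_curve u" "!!t. t \<in> I ==> u t \<in> L2" using H by (auto simp: has_tderiv_def)
 moreover have "L2_curve v'" using v' by (simp add: L2_curve_iff case_prod_beta')
 ultimately show ?thesis unfolding has_tderiv_def UI_AE[symmetric] prim_def by blast
qed

text \<open>\<open>tderiv\<close> is a choice, so it has to be compared with explicit derivatives.
  The exceptional sets depend on t, which is handled by rational times, continuity of the primitives
  and a final exchange of t and x.\<close>

lemma has_tderiv_unique:
 assumes H: "has_tderiv u v" and H': "has_tderiv u v'"
 shows "AE t in UI. AE x in UI. v t x = v' t x"
proof -
 have v: "l2 UU (%z. v (fst z) (snd z))" and v': "l2 UU (%z. v' (fst z) (snd z))"
  using H H' by (auto simp: has_tderiv_def L2_curve_iff case_prod_beta')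
 note m = l2_UU_sections(7)[OF v] l2_UU_sections(7)[OF v']
 have r: "AE x in UI. \<forall>r\<in>\<rat> Int I. prim (%s. v s x) r = prim (%s. v' s x) r"
 proof (subst AE_ball_countable)
  show "countable (\<rat> Int {0..1 :: real})" using countable_rat by auto
  show "\<forall>r\<in>\<rat> Int I. AE x in UI. prim (%s. v s x) r = prim (%s. v' s x) r"
  proof
   fix r :: real assume "r \<in> \<rat> Int I"
   then show "AE x in UI. prim (%s. v s x) r = prim (%s. v' s x) r"
    using has_tderiv_H1(2)[OF H, of r] has_tderiv_H1(2)[OF H', of r] by (auto elim: eventually_elim2)
  qed
 qed
 have "AE x in UI. AE t in UI. v t x = v' t x"
  using r l2_UU_sections(2)[OF v] l2_UU_sections(2)[OF v']
 proof eventually_elim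
  case (elim x)
  have i: "integrable UI (%s. v s x)" "integrable UI (%s. v' s x)" using elim UI.l2_integrable by auto
  have "prim (%s. v s x) t = prim (%s. v' s x) t" if t: "t \<in> I" for t
  proof -
   have "closure (\<rat> Int I) = {0..1 :: real}"
   proof -
    have "closure ({0<..<1} Int \<rat>) = closure {0<..<1 :: real}"
     by (rule closure_open_Int_superset) (auto simp: Rats_closure_real)
    moreover have "closure ({0<..<1} Int \<rat>) \<subseteq> closure (\<rat> Int {0..1 :: real})" by (intro closure_mono) auto
    moreover have "closure (\<rat> Int {0..1 :: real}) \<subseteq> I" by (intro closure_minimal) auto
    ultimately show ?thesis by auto
   qed
   note cl = this
   have "prim (%s. v s x) t - prim (%s. v' s x) t = 0"
   proof (rule continuous_constant_on_closure[where S="\<rat> Int I" and f="%t. prim (%s. v s x) t - prim (%s. v' s x) t"])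
    show "continuous_on (closure (\<rat> Int I)) (%t. prim (%s. v s x) t - prim (%s. v' s x) t)"
     unfolding cl by (rule continuous_on_diff[OF prim_continuous[OF i(1)] prim_continuous[OF i(2)]])
   qed (use elim(1) t cl in auto)
   then show ?thesis by simp
  qed
  then have "ac (prim (%s. v s x)) (%s. v' s x)" using i by (intro acI) auto
  from ac_unique[OF ac_prim[OF i(1)] this] show ?case .
 qed
 then show ?thesis
 proof (rule AE_UU(2)[rotated])
  have "(%z. v (snd z) (fst z)) \<in> bm UU" "(%z. v' (snd z) (fst z)) \<in> bm UU"
   by (rule m2_compose[OF m(1)] m2_compose[OF m(2)]; measurable)+
  then show "{z \<in> space UU. v (snd z) (fst z) = v' (snd z) (fst z)} \<in> sets UU" by measurable
 qed
qed

text \<open>By Fubini the time derivative commutes with the spatial primitive, and the result holds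
  for every x instead of almost every x.\<close>

lemma H1_prim:
 assumes H: "H1 u v" and x: "x \<in> I"
 shows "ac (%t. prim (u t) x) (%t. prim (v t) x)"
proof (rule acI)
 note h = H1D[OF H]
 have iv: "integrable UU (%(s, y). v s y)" by (rule l2_UU_integrable[OF h(3)])
 have "integrable UU (%(s, y). if y <= x then v s y else 0)"
  by (rule intble_bound[OF iv]) (use h(2) in "auto simp: m2_iff")
 from UU.integrable_fst[OF this] show "integrable UI (%t. prim (v t) x)" using x by (simp add: prim_eq)
 fix t :: real assume t: "t \<in> I"
 have "prim (u t) x = prim (%y. u 0 y + prim (%s. v s y) t) x"
 proof (rule prim_cong_AE)
  have "m2 (%t y. u 0 y + prim (%s. v s y) t)"
   by (intro m2_arith m2_prim_t h(2) m2_fun m2_section[OF h(1)]) auto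
  then show "(%y. u 0 y + prim (%s. v s y) t) \<in> bm UI" by (rule m2_section[OF _ t])
  show "AE y in UI. u t y = u 0 y + prim (%s. v s y) t"
   using h(5)
  proof eventually_elim
   case (elim y) show ?case by (rule ac_eq[OF elim t])
  qed
 qed (use x t m2_section[OF h(1)] in auto)
 also have "... = prim (u 0) x + prim (%y. prim (%s. v s y) t) x"
 proof (rule prim_add)
  show "integrable UI (u 0)" using h(4)[of 0] by (auto intro: UI.l2_integrable)
  have "integrable UU (%(s, y). if s <= t then v s y else 0)"
   by (rule intble_bound[OF iv]) (use h(2) in "auto simp: m2_iff")
  from UU.integrable_snd[OF this] show "integrable UI (%y. prim (%s. v s y) t)" using t by (simp add: prim_eq)
 qed (use x in auto)
 also have "prim (%y. prim (%s. v s y) t) x = prim (%t. prim (v t) x) t"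
  by (rule prim_swap[OF iv]) (use t x in auto)
 finally show "prim (u t) x = prim (u 0) x + prim (%t. prim (v t) x) t" .
qed

lemma l2_section_sets: assumes "m2 z" shows "{t \<in> space UI. l2 UI (z t)} \<in> sets UI"
proof -
 have [measurable]: "(%t. \<integral>\<^sup>+ x. ennreal ((z t x)^2) \<partial>UI) \<in> bm UI"
 proof -
  have [measurable]: "(%(t, x). (z t x)^2) \<in> bm UU"
   using m2_unary(4)[OF assms] by (simp add: m2_iff)
  show ?thesis by measurable
 qed
 have "{t \<in> space UI. l2 UI (z t)} = {t \<in> space UI. (\<integral>\<^sup>+ x. ennreal ((z t x)^2) \<partial>UI) < \<infinity>}"
  using m2_section[OF assms] by (auto simp: l2_def integrable_iff_bounded)
 then show ?thesis by (simp only:) measurable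
qed

section \<open>An arithmetic of approximate equalities with pointwise majorants\<close>

subsection \<open>Asymptotic equality at rate \<open>1 / \<surd>N\<close>\<close>

text \<open>u0 = O(X) and u = u0 + O(X / sqrt N), with one constant on the whole region G. Requiring
  the size bound together with the error bound is what makes the relation stable under products. The
  limit u0 may itself depend on N, since it contains oscillations.\<close>

definition ap :: "(nat => real => real => bool) => (nat => real => real => real) =>
  (nat => real => real => real) => (nat => real => real => real) => bool" where
 "ap G X u u0 \<longleftrightarrow> (\<exists>c\<ge>0. \<forall>N t x. G N t x -->
   \<bar>u0 N t x\<bar> <= c * X N t x & \<bar>u N t x - u0 N t x\<bar> <= c * X N t x / sqrt (real N))"

lemma apI:
 assumes "c >= 0" "!!N t x. G N t x ==> \<bar>u0 N t x\<bar> <= c * X N t x"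
  "!!N t x. G N t x ==> \<bar>u N t x - u0 N t x\<bar> <= c * X N t x / sqrt (real N)"
 shows "ap G X u u0"
 unfolding ap_def using assms by blast

lemma ap_refl:
 assumes "c >= 0" "!!N t x. G N t x ==> \<bar>u N t x\<bar> <= c * X N t x"
 shows "ap G X u u"
proof (rule apI[OF assms])
 fix N t x assume "G N t x"
 from order_trans[OF abs_ge_zero assms(2)[OF this]]
 show "\<bar>u N t x - u N t x\<bar> <= c * X N t x / sqrt (real N)" by simp
qed

lemma ap_cong:
 assumes "ap G X u u0" "!!N t x. G N t x ==> u' N t x = u N t x" "!!N t x. G N t x ==> u0' N t x = u0 N t x"
 shows "ap G X u' u0'"
 using assms unfolding ap_def by simp

lemma ap_add:
 assumes "ap G X u u0" "ap G X v v0" shows "ap G X (%N t x. u N t x + v N t x) (%N t x. u0 N t x + v0 N t x)"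
proof -
 obtain c d where c: "c >= 0" "!!N t x. G N t x ==> \<bar>u0 N t x\<bar> <= c * X N t x"
   "!!N t x. G N t x ==> \<bar>u N t x - u0 N t x\<bar> <= c * X N t x / sqrt N"
  and d: "d >= 0" "!!N t x. G N t x ==> \<bar>v0 N t x\<bar> <= d * X N t x"
   "!!N t x. G N t x ==> \<bar>v N t x - v0 N t x\<bar> <= d * X N t x / sqrt N"
  using assms unfolding ap_def by metis
 show ?thesis
 proof (rule apI[of "c + d"])
  fix N t x assume G: "G N t x"
  show "\<bar>u0 N t x + v0 N t x\<bar> <= (c + d) * X N t x" using c(2)[OF G] d(2)[OF G] by (simp add: distrib_right)
  show "\<bar>u N t x + v N t x - (u0 N t x + v0 N t x)\<bar> <= (c + d) * X N t x / sqrt N"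
   using c(3)[OF G] d(3)[OF G] unfolding distrib_right add_divide_distrib by linarith
 qed (use c d in auto)
qed

lemma ap_minus: assumes "ap G X u u0" shows "ap G X (%N t x. - u N t x) (%N t x. - u0 N t x)"
 using assms unfolding ap_def by (simp add: abs_minus_commute)

lemma ap_diff:
 assumes "ap G X u u0" "ap G X v v0" shows "ap G X (%N t x. u N t x - v N t x) (%N t x. u0 N t x - v0 N t x)"
 using ap_add[OF assms(1) ap_minus[OF assms(2)]] by simp

text \<open>u v - u0 v0 = (u - u0) v + u0 (v - v0), and for N >= 1 the factor v is at most twice its
  majorant. The majorants multiply.\<close>

lemma ap_mult:
 assumes u: "ap G X u u0" and v: "ap G Y v v0" and N: "\<forall>N t x. G N t x --> N >= 1"
 shows "ap G (%N t x. X N t x * Y N t x) (%N t x. u N t x * v N t x) (%N t x. u0 N t x * v0 N t x)"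
proof -
 obtain c d where c: "c >= 0" "!!N t x. G N t x ==> \<bar>u0 N t x\<bar> <= c * X N t x"
   "!!N t x. G N t x ==> \<bar>u N t x - u0 N t x\<bar> <= c * X N t x / sqrt N"
  and d: "d >= 0" "!!N t x. G N t x ==> \<bar>v0 N t x\<bar> <= d * Y N t x"
   "!!N t x. G N t x ==> \<bar>v N t x - v0 N t x\<bar> <= d * Y N t x / sqrt N"
  using u v unfolding ap_def by metis
 show ?thesis
 proof (rule apI[of "3 * (c * d)"])
  fix N t x assume G: "G N t x"
  define a b where "a = c * X N t x" "b = d * Y N t x"
  have ab: "0 <= a" "0 <= b" "a * b = (c * d) * (X N t x * Y N t x)"
   using order_trans[OF abs_ge_zero c(2)[OF G]] order_trans[OF abs_ge_zero d(2)[OF G]] by (auto simp: a_b_def)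
  define s where "s = sqrt (real N)"
  have s: "s >= 1" using N G by (auto simp: s_def)
  have h: "\<bar>u0 N t x\<bar> <= a" "\<bar>v0 N t x\<bar> <= b" "\<bar>u N t x - u0 N t x\<bar> <= a / s" "\<bar>v N t x - v0 N t x\<bar> <= b / s"
   using c(2,3)[OF G] d(2,3)[OF G] by (auto simp: a_b_def s_def)
  have "\<bar>u0 N t x * v0 N t x\<bar> <= a * b" unfolding abs_mult using h ab by (intro mult_mono) auto
  then show "\<bar>u0 N t x * v0 N t x\<bar> <= 3 * (c * d) * (X N t x * Y N t x)" using ab by simp
  have bs: "b / s <= b" using ab s by (simp add: divide_le_eq mult_le_cancel_left1)
  have vb: "\<bar>v N t x\<bar> <= 2 * b" using h(2,4) bs by linarith
  have "u N t x * v N t x - u0 N t x * v0 N t x = (u N t x - u0 N t x) * v N t x + u0 N t x * (v N t x - v0 N t x)"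
   by (simp add: algebra_simps)
  then have "\<bar>u N t x * v N t x - u0 N t x * v0 N t x\<bar> <= \<bar>u N t x - u0 N t x\<bar> * \<bar>v N t x\<bar> + \<bar>u0 N t x\<bar> * \<bar>v N t x - v0 N t x\<bar>"
   by (metis abs_mult abs_triangle_ineq)
  also have "... <= (a / s) * (2 * b) + a * (b / s)"
   using h vb ab s by (intro add_mono mult_mono) auto
  also have "... = 3 * (a * b) / s" using s by (simp add: field_simps)
  finally show "\<bar>u N t x * v N t x - u0 N t x * v0 N t x\<bar> <= 3 * (c * d) * (X N t x * Y N t x) / sqrt N"
   using ab by (simp add: s_def)
 qed (use c d in auto)
qed

lemma ap_mono:
 assumes u: "ap G X u u0" and le: "!!N t x. G N t x ==> X N t x <= Y N t x"
 shows "ap G Y u u0"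
proof -
 obtain c where c: "c >= 0" "!!N t x. G N t x ==> \<bar>u0 N t x\<bar> <= c * X N t x"
   "!!N t x. G N t x ==> \<bar>u N t x - u0 N t x\<bar> <= c * X N t x / sqrt N"
  using u unfolding ap_def by metis
 show ?thesis
 proof (rule apI[OF c(1)])
  fix N t x assume G: "G N t x"
  have m: "c * X N t x <= c * Y N t x" by (intro mult_left_mono le G c)
  show "\<bar>u0 N t x\<bar> <= c * Y N t x" using c(2)[OF G] m by simp
  show "\<bar>u N t x - u0 N t x\<bar> <= c * Y N t x / sqrt N"
   using c(3)[OF G] divide_right_mono[OF m, of "sqrt N"] by simp
 qed
qed

lemma ap_mult1:
 assumes u: "ap G X u u0" and v: "ap G (%N t x. 1) v v0" and N: "\<forall>N t x. G N t x --> N >= 1"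
 shows "ap G X (%N t x. u N t x * v N t x) (%N t x. u0 N t x * v0 N t x)"
 using ap_mult[OF u v N] by simp

lemma ap_inverse:
 assumes u: "ap G (%N t x. 1) u u0" and m: "m > 0" "!!N t x. G N t x ==> m <= u N t x & m <= u0 N t x"
 shows "ap G (%N t x. 1) (%N t x. 1 / u N t x) (%N t x. 1 / u0 N t x)"
proof -
 obtain c where c: "c >= 0" "!!N t x. G N t x ==> \<bar>u N t x - u0 N t x\<bar> <= c / sqrt N"
  using u unfolding ap_def by auto
 show ?thesis
 proof (rule apI[of "1 / m + c / m^2"])
  fix N t x assume G: "G N t x"
  have p: "u N t x > 0" "u0 N t x > 0" "m^2 <= u N t x * u0 N t x"
   using m(1) m(2)[OF G] by (auto simp: power2_eq_square intro!: mult_mono)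
  have "1 / u0 N t x <= 1 / m" using m(1) m(2)[OF G] by (intro divide_left_mono) auto
  moreover have "0 <= c / m^2" using c by simp
  ultimately show "\<bar>1 / u0 N t x\<bar> <= (1 / m + c / m^2) * 1" using p by simp
  have "\<bar>1 / u N t x - 1 / u0 N t x\<bar> = \<bar>u N t x - u0 N t x\<bar> / (u N t x * u0 N t x)"
   using p by (simp add: diff_frac_eq abs_minus_commute abs_mult)
  also have "... <= (c / sqrt N) / m^2" using c(2)[OF G] p m(1) c(1) by (intro frac_le) auto
  also have "... = (c / m^2) / sqrt N" by (simp add: mult.commute)
  also have "... <= (1 / m + c / m^2) / sqrt N"
   using m(1) by (intro divide_right_mono) auto
  finally show "\<bar>1 / u N t x - 1 / u0 N t x\<bar> <= (1 / m + c / m^2) * 1 / sqrt N" by simp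
 qed (use c m in auto)
qed

section \<open>The unperturbed curve and its bounds\<close>

subsection \<open>The base curve\<close>

locale base_curve =
 fixes q w z :: "real => real => real" and C :: real
 assumes Hq: "H1 q w" and Hw: "H1 w z"
  and C: "C >= 0" "!!t. t \<in> I ==> nrm UI (q t) <= C" "!!t. t \<in> I ==> nrm UI (w t) <= C"
begin

text \<open>In terms of q, w = qdot and z = wdot: \<open>g\<close> is log eta, \<open>et\<close> is
  eta, \<open>R\<close> and \<open>S\<close> are the first and second time derivatives of log eta,
  \<open>p\<close> is the momentum w / eta, and \<open>v\<close> is its time derivative.
  \<open>K\<close> bounds both eta and 1/eta.\<close>

definition "g t x = prim (q t) x"
definition "et t x = exp (g t x)"
definition "R t x = prim (w t) x"
definition "S t x = prim (z t) x"
definition "p t x = w t x / et t x"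
definition "v t x = z t x / et t x - p t x * R t x"
definition "\<zeta> t = nrm UI (z t)"
definition "K = exp C"

lemma K: "K >= 1" using C by (simp add: K_def)

lemma q_l2: "t \<in> I ==> l2 UI (q t)" and w_l2: "t \<in> I ==> l2 UI (w t)"
 using H1D[OF Hq] H1D[OF Hw] by auto

lemma g_bound: "t \<in> I ==> x \<in> I ==> \<bar>g t x\<bar> <= C"
 and R_bound: "t \<in> I ==> x \<in> I ==> \<bar>R t x\<bar> <= C"
 unfolding g_def R_def using prim_abs_le_nrm[OF q_l2] prim_abs_le_nrm[OF w_l2] C order_trans by blast+

lemma et_bounds:
 assumes "t \<in> I" "x \<in> I" shows "1 / K <= et t x" "et t x <= K" "0 < et t x"
proof -
 have "exp (- C) <= et t x" "et t x <= exp C" using g_bound[OF assms] by (auto simp: et_def abs_le_iff)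
 then show "1 / K <= et t x" "et t x <= K" by (auto simp: K_def exp_minus inverse_eq_divide)
qed (simp add: et_def)

lemma et_abs: "t \<in> I ==> x \<in> I ==> \<bar>et t x\<bar> <= K"
 using et_bounds[of t x] by linarith

lemma et_inverse: assumes "t \<in> I" "x \<in> I" shows "1 / et t x <= K" "0 < 1 / et t x"
proof -
 have "1 <= K * et t x" using et_bounds(1)[OF assms] K by (simp add: divide_le_eq mult.commute)
 then show "1 / et t x <= K" using et_bounds(3)[OF assms] by (simp add: divide_le_eq)
qed (use et_bounds(3)[OF assms] in simp)

lemma et_lipschitz_g:
 assumes "t \<in> I" "x \<in> I" "s \<in> I" "y \<in> I"
 shows "\<bar>et t x - et s y\<bar> <= K * \<bar>g t x - g s y\<bar>"
proof -
 have *: "exp a - exp b <= K * (a - b)" if "b <= a" "a <= C" for a b :: real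
 proof -
  have "1 + (b - a) <= exp (b - a)" by (rule exp_ge_add_one_self)
  then have "exp a * (1 + (b - a)) <= exp a * exp (b - a)" by (intro mult_left_mono) auto
  then have "exp a - exp b <= exp a * (a - b)" by (simp add: exp_diff algebra_simps)
  also have "... <= K * (a - b)" using that by (intro mult_right_mono) (auto simp: K_def)
  finally show ?thesis .
 qed
 have b: "g t x <= C" "g s y <= C" using g_bound[of t x] g_bound[of s y] assms by auto
 show ?thesis
 proof (cases "g t x <= g s y")
  case True then show ?thesis using *[OF True b(2)] by (simp add: et_def)
 next
  case False then show ?thesis using *[of "g s y" "g t x"] b by (simp add: et_def)
 qed
qed

lemma g_Hoelder: "t \<in> I ==> x \<in> I ==> y \<in> I ==> \<bar>g t x - g t y\<bar> <= C * sqrt \<bar>x - y\<bar>"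
 and R_Hoelder: "t \<in> I ==> x \<in> I ==> y \<in> I ==> \<bar>R t x - R t y\<bar> <= C * sqrt \<bar>x - y\<bar>"
proof -
 assume a: "t \<in> I" "x \<in> I" "y \<in> I"
 have "sqrt \<bar>x - y\<bar> * nrm UI (q t) <= sqrt \<bar>x - y\<bar> * C" "sqrt \<bar>x - y\<bar> * nrm UI (w t) <= sqrt \<bar>x - y\<bar> * C"
  using C a by (auto intro!: mult_left_mono)
 then show "\<bar>g t x - g t y\<bar> <= C * sqrt \<bar>x - y\<bar>" "\<bar>R t x - R t y\<bar> <= C * sqrt \<bar>x - y\<bar>"
  using prim_Hoelder[OF q_l2[OF a(1)] a(2,3)] prim_Hoelder[OF w_l2[OF a(1)] a(2,3)]
  by (auto simp: g_def R_def mult.commute)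
qed

lemma S_bound: "l2 UI (z t) ==> x \<in> I ==> \<bar>S t x\<bar> <= \<zeta> t"
 unfolding S_def \<zeta>_def by (rule prim_abs_le_nrm)

lemma S_Hoelder: "l2 UI (z t) ==> x \<in> I ==> y \<in> I ==> \<bar>S t x - S t y\<bar> <= \<zeta> t * sqrt \<bar>x - y\<bar>"
 using prim_Hoelder[of "z t" x y] by (simp add: S_def \<zeta>_def mult.commute)

lemma ac_g: "x \<in> I ==> ac (%t. g t x) (%t. R t x)"
 and ac_R: "x \<in> I ==> ac (%t. R t x) (%t. S t x)"
 unfolding g_def R_def S_def using H1_prim[OF Hq] H1_prim[OF Hw] by auto

lemma ac_et: "x \<in> I ==> ac (%t. et t x) (%t. et t x * R t x)"
 unfolding et_def by (rule ac_exp[OF ac_g])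

lemma ac_etR: assumes "x \<in> I" shows "ac (%t. et t x * R t x) (%t. et t x * ((R t x)^2 + S t x))"
 by (rule ac_cong[OF ac_mult[OF ac_et[OF assms] ac_R[OF assms]]]) (auto simp: power2_eq_square algebra_simps)

lemma acx_g: "t \<in> I ==> ac (g t) (q t)" and acx_R: "t \<in> I ==> ac (R t) (w t)"
 unfolding g_def[abs_def] R_def[abs_def] using ac_prim[OF UI.l2_integrable[OF q_l2]] ac_prim[OF UI.l2_integrable[OF w_l2]] by auto

lemma acx_et: "t \<in> I ==> ac (et t) (%x. et t x * q t x)"
 unfolding et_def[abs_def] by (rule ac_exp[OF acx_g])

lemma m2s: "m2 q" "m2 w" "m2 z" "m2 g" "m2 et" "m2 R" "m2 S" "m2 p" "m2 v"
proof -
 show m: "m2 q" "m2 w" "m2 z" using H1D[OF Hq] H1D[OF Hw] by auto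
 show "m2 g" "m2 R" "m2 S" unfolding g_def[abs_def] R_def[abs_def] S_def[abs_def] by (intro m2_prim_x m)+
 note m' = this
 show "m2 et" unfolding et_def[abs_def] by (intro m2_unary m')
 note m'' = this
 show "m2 p" unfolding p_def[abs_def] by (intro m2_arith m m'')
 then show "m2 v" unfolding v_def[abs_def] by (intro m2_arith m m' m'')
qed

lemma z_l2: "l2 UU (%y. z (fst y) (snd y))" and z_sections: "AE t in UI. l2 UI (z t)"
 using H1D[OF Hw] l2_UU_sections(1) by auto

lemma \<zeta>_l2: "l2 UI \<zeta>"
 unfolding l2_def
proof
 show "\<zeta> \<in> bm UI" unfolding \<zeta>_def[abs_def] by (rule m2_nrm[OF m2s(3)])
 show "integrable UI (%t. (\<zeta> t)^2)" using l2_UU_sections(3)[OF z_l2] by (simp add: \<zeta>_def nrm_square)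
qed

lemma S_l2: assumes "x \<in> I" shows "l2 UI (%t. S t x)"
proof (rule l2_bound[OF \<zeta>_l2])
 show "(%t. S t x) \<in> bm UI" by (rule m2_section'[OF m2s(7) assms])
 show "AE t in UI. \<bar>S t x\<bar> <= \<bar>\<zeta> t\<bar>"
  using z_sections by eventually_elim (use S_bound[OF _ assms] in "auto simp: \<zeta>_def")
qed

lemma p_l2: assumes t: "t \<in> I" shows "l2 UI (p t)" "nrm UI (p t) <= K * C"
proof -
 have b: "\<bar>p t x\<bar> <= \<bar>K * w t x\<bar>" if "x \<in> I" for x
 proof -
  have "\<bar>p t x\<bar> = \<bar>w t x\<bar> * (1 / et t x)" using et_bounds[OF t that] by (simp add: p_def)
  also have "... <= \<bar>w t x\<bar> * K"
   by (intro mult_left_mono et_inverse t that) simp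
  finally show ?thesis using K by (simp add: abs_mult mult.commute)
 qed
 have pm: "p t \<in> bm UI" by (rule m2_section[OF m2s(8) t])
 have "l2 UI (%x. K * w t x)" by (rule l2_cmult[OF w_l2[OF t]])
 then show "l2 UI (p t)" "nrm UI (p t) <= K * C"
 proof -
  assume l: "l2 UI (%x. K * w t x)"
  show "l2 UI (p t)" by (rule l2_bound[OF l pm]) (use b in auto)
  have "nrm UI (p t) <= nrm UI (%x. K * w t x)" by (rule nrm_mono[OF l pm]) (use b in auto)
  also have "... <= K * C" using C(3)[OF t] K by (simp add: nrm_cmult mult_left_mono)
  finally show "nrm UI (p t) <= K * C" .
 qed
qed

lemma Hp: "H1 p v"
proof -
 have l1: "l2 UU (%y. (1 / et (fst y) (snd y)) * z (fst y) (snd y))"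
 proof (rule l2_mult_bounded[OF z_l2])
  show "(%y. 1 / et (fst y) (snd y)) \<in> bm UU" by (rule m2_unary(6)[OF m2s(5), unfolded m2_def])
  show "AE y in UU. \<bar>1 / et (fst y) (snd y)\<bar> <= K"
  proof (rule AE_I2)
   fix y assume "y \<in> space UU"
   then have "fst y \<in> I" "snd y \<in> I" by (auto simp: space_pair_measure)
   from et_inverse[OF this] show "\<bar>1 / et (fst y) (snd y)\<bar> <= K" by (simp only: abs_of_pos)
  qed
 qed
 have l2p: "l2 UU (%y. p (fst y) (snd y))"
  by (rule l2_UU_bounded_sections[OF m2s(8)]) (use p_l2 in auto)
 have "l2 UU (%y. R (fst y) (snd y) * p (fst y) (snd y))"
 proof (rule l2_mult_bounded[OF l2p])
  show "(%y. R (fst y) (snd y)) \<in> bm UU" by (rule m2s(6)[unfolded m2_def])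
  show "AE y in UU. \<bar>R (fst y) (snd y)\<bar> <= C"
  proof (rule AE_I2)
   fix y assume "y \<in> space UU"
   then have "fst y \<in> I" "snd y \<in> I" by (auto simp: space_pair_measure)
   then show "\<bar>R (fst y) (snd y)\<bar> <= C" by (rule R_bound)
  qed
 qed
 from l2_diff[OF l1 this] have lv: "l2 UU (%y. v (fst y) (snd y))" by (simp add: v_def mult.commute)
 have "AE x in UI. ac (%t. p t x) (%t. v t x)"
  using H1D(5)[OF Hw] AE_space
 proof eventually_elim
  case (elim x)
  then have x: "x \<in> I" by simp
  have i: "ac (%t. 1 / et t x) (%t. - (et t x * R t x) / (et t x)^2)"
   by (rule ac_inverse[OF ac_et[OF x]]) (use et_bounds x in auto)
  show ?case
   by (rule ac_cong[OF ac_mult[OF elim(1) i]])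
     (use et_bounds(3)[OF _ x] in "auto simp: p_def v_def power2_eq_square")
 qed
 with lv m2s(8) p_l2(1) show ?thesis unfolding H1_def by blast
qed

end

section \<open>Perturbation of eta and asymptotics of the derived curve\<close>

subsection \<open>The perturbed curves\<close>

text \<open>A family indexed by cells is a finite sum of products, which reduces joint measurability
  to the members of the family.\<close>

lemma m2_idx: assumes "!!k. k < N ==> f k \<in> bm UI" "N >= 1" shows "m2 (%t x. f (idx N x) t)"
proof -
 have "(%y. \<Sum>k<N. f k (fst y) * (if idx N (snd y) = k then 1 else 0)) \<in> bm UU"
 proof (intro borel_measurable_sum borel_measurable_times)
  fix k assume "k \<in> {..<N}"
  then have [measurable]: "f k \<in> bm UI" using assms by simp
  show "(%y. f k (fst y)) \<in> bm UU" by measurable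
  show "(%y. if idx N (snd y) = k then 1 else 0 :: real) \<in> bm UU" by measurable
 qed
 moreover have "(\<Sum>k<N. f k t * (if idx N x = k then 1 else 0)) = f (idx N x) t" for t x
  using idx_less[OF assms(2), of x] by (simp add: if_distrib[of "(*) _"] cong: if_cong)
 ultimately show ?thesis by (simp add: m2_def)
qed

lemma l2_UU_product:
 assumes "l2 UI f" "l2 UI h" shows "l2 UU (%y. f (fst y) * h (snd y))"
proof -
 have [measurable]: "f \<in> bm UI" "h \<in> bm UI" using assms by (auto simp: l2_def)
 have "integrable UU (%(s, y). (f s)^2 * (h y)^2)" by (rule integrable_product) (use assms in "auto simp: l2_def")
 then show ?thesis by (auto simp: l2_def power_mult_distrib case_prod_beta')
qed

lemma l2_UU_idx: assumes "!!k. k < N ==> l2 UI (f k)" "N >= 1" shows "l2 UU (%y. f (idx N (snd y)) (fst y))"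
proof -
 have "l2 UU (%y. \<Sum>k<n. f k (fst y) * (if idx N (snd y) = k then 1 else 0))" if "n <= N" for n
  using that
 proof (induction n)
  case 0 show ?case by (simp add: l2_def)
 next
  case (Suc n)
  have h: "l2 UI (%x. if idx N x = n then 1 else 0)" by (rule l2_bound[OF UI.l2_const[of 1]]) auto
  have "l2 UU (%y. f n (fst y) * (if idx N (snd y) = n then 1 else 0))"
   using l2_UU_product[OF assms(1) h] Suc.prems by auto
  with Suc show ?case by (simp add: l2_add)
 qed
 from this[of N] have "l2 UU (%y. \<Sum>k<N. f k (fst y) * (if idx N (snd y) = k then 1 else 0))" by simp
 moreover have "(\<Sum>k<N. f k t * (if idx N x = k then 1 else 0)) = f (idx N x) t" for t x
  using idx_less[OF assms(2), of x] by (simp add: if_distrib[of "(*) _"] cong: if_cong)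
 ultimately show ?thesis by simp
qed

lemma prim_osc_small:
 assumes "N >= 1" "x \<in> I"
 shows "\<bar>prim (osc N F) x\<bar> <= nrm UI (%x. F (idx N x)) / sqrt N"
proof -
 have "\<bar>prim (osc N F) x\<bar> <= \<bar>F (idx N x)\<bar> / N" by (rule prim_osc_bound[OF assms])
 also have "... <= (sqrt N * nrm UI (%x. F (idx N x))) / N"
  by (intro divide_right_mono cell_value_bound assms) simp
 also have "... = nrm UI (%x. F (idx N x)) / sqrt N"
  using assms by (simp add: field_simps)
 finally show ?thesis .
qed

text \<open>a N k is the amplitude on cell k, to be added to the momentum, and ad N k its time
  derivative. The bound \<open>A\<close> is uniform in N; \<open>Bd\<close> is not and serves only
  the integrability of each ad N k.\<close>

locale perturbation = base_curve +
 fixes a ad :: "nat => nat => real => real" and A :: real and Bd :: "nat => nat => real"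
 assumes a_ac: "!!N k. N >= 1 ==> ac (a N k) (ad N k)"
  and a_0: "!!N k. a N k 0 = 0"
  and ad_bd: "!!N k t. N >= 1 ==> t \<in> I ==> \<bar>ad N k t\<bar> <= Bd N k"
  and a_nrm: "!!N t. N >= 1 ==> t \<in> I ==> nrm UI (%x. a N (idx N x) t) <= A"
  and ad_nrm: "!!N. N >= 1 ==> nrm UU (%y. ad N (idx N (snd y)) (fst y)) <= A"
begin

text \<open>The left end of cell k, capped so that it lies in the unit interval for every k.\<close>

definition bp :: "nat => nat => real" where "bp N k = min 1 (real k / real N)"
text \<open>The aim is to add D walsh to q; then eta a walsh is added to w and a walsh to p. Since
  theta_x / theta is to be q + D walsh, the space derivative of theta must receive \<open>e\<close>,
  that is eta times \<open>D\<close>. Coefficients are frozen at the node to make the amplitude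
  constant on the cell; \<open>e1\<close> and \<open>e2\<close> are the time derivatives of
  \<open>e\<close>.\<close>

definition "D N k t = prim (%s. et s (bp N k) * a N k s) t"
definition "e N k t = et t (bp N k) * D N k t"
definition "e1 N k t = et t (bp N k) * R t (bp N k) * D N k t + (et t (bp N k))^2 * a N k t"
definition "e2 N k t = et t (bp N k) * ((R t (bp N k))^2 + S t (bp N k)) * D N k t
  + 3 * (et t (bp N k))^2 * R t (bp N k) * a N k t + (et t (bp N k))^2 * ad N k t"
definition "E0 N t x = prim (osc N (%k. e N k t)) x"
definition "E1 N t x = prim (osc N (%k. e1 N k t)) x"
definition "E2 N t x = prim (osc N (%k. e2 N k t)) x"
text \<open>\<open>\<theta>\<close> is the new eta and \<open>\<rho>\<close> its space derivative.
  The suffixes 1 and 2 count time derivatives.\<close>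

definition "\<theta> N t x = et t x + E0 N t x"
definition "\<theta>1 N t x = et t x * R t x + E1 N t x"
definition "\<theta>2 N t x = et t x * ((R t x)^2 + S t x) + E2 N t x"
definition "\<rho> N t x = et t x * q t x + osc N (%k. e N k t) x"
definition "\<rho>1 N t x = et t x * R t x * q t x + et t x * w t x + osc N (%k. e1 N k t) x"
definition "\<rho>2 N t x = et t x * ((R t x)^2 + S t x) * q t x + 2 * (et t x * R t x * w t x) + et t x * z t x + osc N (%k. e2 N k t) x"
text \<open>The logarithmic space derivative of \<open>\<theta>\<close>. By the quotient rule
  \<open>wn\<close> and \<open>zn\<close> are its first two time derivatives, \<open>pn\<close> is
  the new momentum and \<open>vn\<close> the time derivative of \<open>pn\<close>.\<close>

definition "qn N t x = \<rho> N t x / \<theta> N t x"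
definition "wn N t x = \<rho>1 N t x / \<theta> N t x - \<rho> N t x * \<theta>1 N t x / (\<theta> N t x)^2"
definition "zn N t x = \<rho>2 N t x / \<theta> N t x - 2 * (\<rho>1 N t x * \<theta>1 N t x) / (\<theta> N t x)^2 - \<rho> N t x * \<theta>2 N t x / (\<theta> N t x)^2
  + 2 * \<rho> N t x * (\<theta>1 N t x)^2 / (\<theta> N t x) ^ 3"
definition "pn N t x = wn N t x / \<theta> N t x"
definition "vn N t x = zn N t x / \<theta> N t x - pn N t x * (\<theta>1 N t x / \<theta> N t x)"
definition "Dw N t x = D N (idx N x) t * walsh N x"
definition "aw N t x = a N (idx N x) t * walsh N x"
definition "adw N t x = ad N (idx N x) t * walsh N x"
text \<open>Majorants for the asymptotics. \<open>M\<close> is bounded in L2 at each time,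
  \<open>Y\<close> depends on time alone and controls S, and \<open>W\<close> adds the quantities
  that are square integrable only over the whole square.\<close>

definition "M N t x = \<bar>q t x\<bar> + \<bar>w t x\<bar> + \<bar>Dw N t x\<bar> + \<bar>aw N t x\<bar>"
definition "\<alpha> N t = nrm UI (%x. ad N (idx N x) t)"
definition "Y N t = 1 + \<zeta> t + \<alpha> N t"
definition "W N t x = M N t x * Y N t + \<bar>z t x\<bar> + \<bar>adw N t x\<bar>"
definition "cE = K * (K * A)"
text \<open>From here on the correction of eta, at most cE / sqrt N, is below 1 / (2 K), half the
  lower bound of eta, so \<open>\<theta>\<close> stays away from zero.\<close>

definition "N0 = nat \<lceil>(2 * K * cE)^2\<rceil> + 1"
text \<open>At times where z is not square integrable, \<open>\<zeta>\<close> could be the default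
  value 0 of the integral and would bound nothing.\<close>

definition G :: "nat => real => real => bool" where "G N t x \<longleftrightarrow> N >= N0 & t \<in> I & x \<in> I & l2 UI (z t)"

lemma bp: "bp N k \<in> I" by (auto simp: bp_def)

lemma bp_dist:
 assumes "N >= 1" "x \<in> I" shows "sqrt \<bar>bp N (idx N x) - x\<bar> <= 1 / sqrt N"
proof -
 have "bp N (idx N x) = real (idx N x) / N" using idx_dist(2)[OF assms] by (simp add: bp_def)
 then have "\<bar>bp N (idx N x) - x\<bar> <= 1 / N" using idx_dist(1)[OF assms] by (simp add: abs_minus_commute)
 then have "sqrt \<bar>bp N (idx N x) - x\<bar> <= sqrt (1 / N)" by (rule real_sqrt_le_mono)
 then show ?thesis by (simp add: real_sqrt_divide)
qed

lemma A_nonneg: "A >= 0"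
 by (rule order_trans[OF nrm_nonneg a_nrm[of 1 0]]) simp_all

lemma cE: "cE >= 0" using A_nonneg K by (simp add: cE_def)

lemma N0: assumes "N >= N0" shows "N >= 1" "cE / sqrt N <= 1 / (2 * K)"
proof -
 show n: "N >= 1" using assms by (simp add: N0_def)
 have "(2 * K * cE)^2 <= N" using assms unfolding N0_def by linarith
 then have "sqrt ((2 * K * cE)^2) <= sqrt N" by (rule real_sqrt_le_mono)
 then have "2 * K * cE <= sqrt N" using K cE by simp
 then show "cE / sqrt N <= 1 / (2 * K)" using K n by (simp add: field_simps)
qed

lemma ac_D: assumes "N >= 1" shows "ac (D N k) (%t. et t (bp N k) * a N k t)"
proof -
 have "integrable UI (%t. et t (bp N k) * a N k t)"
  by (intro continuous_mult_integrable continuous_integrable_UI ac_continuous[OF ac_et[OF bp]] ac_continuous[OF a_ac[OF assms]])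
 from ac_prim[OF this] show ?thesis unfolding D_def[abs_def] .
qed

lemma ac_e: assumes "N >= 1" shows "ac (e N k) (e1 N k)"
 unfolding e_def[abs_def]
 by (rule ac_cong[OF ac_mult[OF ac_et[OF bp] ac_D[OF assms]]]) (auto simp: e1_def power2_eq_square)

lemma ac_e1: assumes "N >= 1" shows "ac (e1 N k) (e2 N k)"
proof -
 have 1: "ac (%t. (et t (bp N k) * R t (bp N k)) * D N k t)
   (%t. et t (bp N k) * ((R t (bp N k))^2 + S t (bp N k)) * D N k t + (et t (bp N k) * R t (bp N k)) * (et t (bp N k) * a N k t))"
  by (rule ac_mult[OF ac_etR[OF bp] ac_D[OF assms]])
 have 2: "ac (%t. (et t (bp N k) * et t (bp N k)) * a N k t)
   (%t. (et t (bp N k) * R t (bp N k) * et t (bp N k) + et t (bp N k) * (et t (bp N k) * R t (bp N k))) * a N k t + (et t (bp N k) * et t (bp N k)) * ad N k t)"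
  by (rule ac_mult[OF ac_mult[OF ac_et[OF bp] ac_et[OF bp]] a_ac[OF assms]])
 show ?thesis
  by (rule ac_cong[OF ac_add[OF 1 2]]) (auto simp: e1_def e2_def power2_eq_square algebra_simps)
qed

lemma ac_l2: "ac u u' ==> l2 UI u"
proof -
 assume u: "ac u u'"
 obtain B where "!!t. t \<in> I ==> \<bar>u t\<bar> <= B" using continuous_bounded_UI[OF ac_continuous[OF u]] by blast
 then show "l2 UI u"
  by (intro l2_bound[OF UI.l2_const[of B]] continuous_measurable_UI[OF ac_continuous[OF u]] AE_I2 order_trans[OF _ abs_ge_self])
    auto
qed

lemma ac_mult_l2: assumes "ac u u'" "l2 UI f" shows "l2 UI (%t. u t * f t)"
proof -
 obtain B where "!!t. t \<in> I ==> \<bar>u t\<bar> <= B" using continuous_bounded_UI[OF ac_continuous[OF assms(1)]] by blast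
 then show ?thesis
  by (intro l2_mult_bounded[OF assms(2)] continuous_measurable_UI[OF ac_continuous[OF assms(1)]] AE_I2) auto
qed

lemma ad_l2: assumes "N >= 1" shows "l2 UI (ad N k)"
proof (rule l2_bound[OF UI.l2_const[of "Bd N k"]])
 show "ad N k \<in> bm UI" by (rule borel_measurable_integrable[OF ac_integrable[OF a_ac[OF assms]]])
 show "AE t in UI. \<bar>ad N k t\<bar> <= \<bar>Bd N k\<bar>"
 proof (rule AE_I2)
  fix t assume "t \<in> space UI"
  then have "t \<in> I" by simp
  from ad_bd[OF assms this, of k] show "\<bar>ad N k t\<bar> <= \<bar>Bd N k\<bar>" by linarith
 qed
qed

lemma e2_l2: assumes "N >= 1" shows "l2 UI (e2 N k)"
proof -
 note ae = ac_et[OF bp, of N k] and ar = ac_R[OF bp, of N k]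
 have 1: "l2 UI (%t. (et t (bp N k) * D N k t) * S t (bp N k))"
  by (rule ac_mult_l2[OF ac_mult[OF ae ac_D[OF assms]] S_l2[OF bp]])
 have 2: "l2 UI (%t. (et t (bp N k) * (R t (bp N k) * (R t (bp N k) * D N k t))) + 3 * (et t (bp N k) * (et t (bp N k) * (R t (bp N k) * a N k t))))"
  by (intro l2_add ac_l2[OF ac_mult[OF ae ac_mult[OF ar ac_mult[OF ar ac_D[OF assms]]]]]
    l2_cmult ac_l2[OF ac_mult[OF ae ac_mult[OF ae ac_mult[OF ar a_ac[OF assms]]]]])
 have 3: "l2 UI (%t. (et t (bp N k) * et t (bp N k)) * ad N k t)"
  by (rule ac_mult_l2[OF ac_mult[OF ae ae] ad_l2[OF assms]])
 from l2_add[OF l2_add[OF 1 2] 3] show ?thesis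
  by (rule l2_cong_AE) (use ac_integrable[OF ac_e1[OF assms]] in "auto simp: e2_def power2_eq_square algebra_simps")
qed

lemma m2_osc: assumes "!!k. f k \<in> bm UI" "N >= 1" shows "m2 (%t x. osc N (%k. f k t) x)"
 unfolding osc_def using assms by (intro m2_arith m2_idx m2_fun) auto

lemma H1_osc:
 assumes N: "N >= 1" and f: "!!k. ac (f k) (f' k)" "!!k. l2 UI (f' k)"
 shows "H1 (%t x. osc N (%k. f k t) x) (%t x. osc N (%k. f' k t) x)"
 unfolding H1_def
proof (intro conjI ballI)
 show "m2 (%t x. osc N (%k. f k t) x)"
  by (intro m2_osc N continuous_measurable_UI[OF ac_continuous[OF f(1)]])
 have m: "m2 (%t x. osc N (%k. f' k t) x)" using f(2) by (intro m2_osc N) (auto simp: l2_def)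
 show "l2 UU (%y. osc N (%k. f' k (fst y)) (snd y))"
 proof (rule l2_bound[OF l2_UU_idx[of N f']])
  show "l2 UI (f' k)" for k by (rule f(2))
  show "(%y. osc N (%k. f' k (fst y)) (snd y)) \<in> bm UU" by (rule m[unfolded m2_def])
  show "AE y in UU. \<bar>osc N (%k. f' k (fst y)) (snd y)\<bar> <= \<bar>f' (idx N (snd y)) (fst y)\<bar>"
   by (rule AE_I2) (simp add: osc_def abs_mult)
 qed (rule N)
 show "l2 UI (osc N (%k. f k t))" for t by (rule l2_osc[OF N])
 show "AE x in UI. ac (%t. osc N (%k. f k t) x) (%t. osc N (%k. f' k t) x)"
  unfolding osc_def by (intro AE_I2) (rule ac_cong[OF ac_cmult[OF f(1)]], auto simp: mult.commute)
qed

lemma ac_E: assumes "N >= 1" "x \<in> I"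
 shows "ac (%t. E0 N t x) (%t. E1 N t x)" "ac (%t. E1 N t x) (%t. E2 N t x)"
 unfolding E0_def E1_def E2_def
 by (rule H1_prim[OF H1_osc[OF assms(1) ac_e[OF assms(1)] ac_l2[OF ac_e1[OF assms(1)]]] assms(2)]
      H1_prim[OF H1_osc[OF assms(1) ac_e1[OF assms(1)] e2_l2[OF assms(1)]] assms(2)])+

lemma ac_\<theta>: assumes "N >= 1" "x \<in> I"
 shows "ac (%t. \<theta> N t x) (%t. \<theta>1 N t x)" "ac (%t. \<theta>1 N t x) (%t. \<theta>2 N t x)"
 unfolding \<theta>_def \<theta>1_def \<theta>2_def by (intro ac_add ac_et ac_etR ac_E assms)+

lemma m2_E: assumes "N >= 1" shows "m2 (E0 N)" "m2 (E1 N)" "m2 (E2 N)"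
 unfolding E0_def[abs_def] E1_def[abs_def] E2_def[abs_def]
 by (intro m2_prim_x m2_osc assms borel_measurable_integrable
   ac_integrable[OF ac_e1[OF assms]] ac_integrable[OF ac_e[OF assms]] continuous_integrable_UI ac_continuous[OF ac_e[OF assms]])+

lemma m2n: assumes "N >= 1"
 shows "m2 (\<theta> N)" "m2 (\<theta>1 N)" "m2 (\<theta>2 N)" "m2 (\<rho> N)" "m2 (\<rho>1 N)" "m2 (\<rho>2 N)" "m2 (qn N)" "m2 (wn N)" "m2 (zn N)" "m2 (pn N)" "m2 (vn N)"
proof -
 have o: "m2 (%t x. osc N (%k. e N k t) x)" "m2 (%t x. osc N (%k. e1 N k t) x)" "m2 (%t x. osc N (%k. e2 N k t) x)"
  by (intro m2_osc assms borel_measurable_integrable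
   ac_integrable[OF ac_e1[OF assms]] ac_integrable[OF ac_e[OF assms]] continuous_integrable_UI ac_continuous[OF ac_e[OF assms]])+
 show "m2 (\<theta> N)" unfolding \<theta>_def[abs_def] by (intro m2_arith m2s m2_E assms)
 note 0 = this
 show "m2 (\<theta>1 N)" unfolding \<theta>1_def[abs_def] by (intro m2_arith m2s m2_E assms)
 note 1 = this
 show "m2 (\<theta>2 N)" unfolding \<theta>2_def[abs_def] by (intro m2_arith m2_unary m2s m2_E assms)
 note 2 = this
 show "m2 (\<rho> N)" unfolding \<rho>_def[abs_def] by (intro m2_arith m2s o)
 note r0 = this
 show "m2 (\<rho>1 N)" unfolding \<rho>1_def[abs_def] by (intro m2_arith m2s o)
 note r1 = this
 show "m2 (\<rho>2 N)" unfolding \<rho>2_def[abs_def] by (intro m2_arith m2_unary m2s o)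
 note r2 = this
 show "m2 (qn N)" unfolding qn_def[abs_def] by (intro m2_arith 0 r0)
 show "m2 (wn N)" unfolding wn_def[abs_def] by (intro m2_arith m2_unary 0 1 r0 r1)
 note w = this
 show "m2 (zn N)" unfolding zn_def[abs_def] power3_eq_cube mult.assoc by (intro m2_arith m2_unary 0 1 2 r0 r1 r2)
 note zz = this
 show "m2 (pn N)" unfolding pn_def[abs_def] by (intro m2_arith 0 w)
 then show "m2 (vn N)" unfolding vn_def[abs_def] by (intro m2_arith 0 1 zz)
qed

text \<open>Cauchy-Schwarz in time on each cell, followed by an exchange of the integrals in time
  and space.\<close>

lemma D_nrm: assumes "N >= 1" "t \<in> I" shows "nrm UI (%x. D N (idx N x) t) <= K * A"
proof (rule power2_le_imp_le)
 have al: "l2 UI (a N k)" for k by (rule ac_l2[OF a_ac[OF assms(1)]])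
 have l: "l2 UU (%y. a N (idx N (snd y)) (fst y))" by (rule l2_UU_idx[OF al assms(1)])
 note sec = l2_UU_sections[where u="%t x. a N (idx N x) t", OF l]
 have Dk: "(D N k t)^2 <= K^2 * (LINT s|UI. (a N k s)^2)" for k
 proof -
  have l: "l2 UI (%s. et s (bp N k) * a N k s)" by (rule ac_mult_l2[OF ac_et[OF bp] al])
  have "\<bar>D N k t\<bar> <= nrm UI (%s. et s (bp N k) * a N k s)"
   unfolding D_def by (rule prim_abs_le_nrm[OF l assms(2)])
  also have "... <= nrm UI (%s. K * a N k s)"
   by (rule nrm_mono[OF l2_cmult[OF al]])
     (use l et_abs[OF _ bp] K in "auto simp: l2_def abs_mult intro!: AE_I2 mult_right_mono")
  also have "... = K * nrm UI (a N k)" using K by (simp add: nrm_cmult)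
  finally have "\<bar>D N k t\<bar>^2 <= (K * nrm UI (a N k))^2" by (intro power_mono) auto
  then show ?thesis by (simp add: power_mult_distrib nrm_square)
 qed
 have "(nrm UI (%x. D N (idx N x) t))^2 <= (LINT x|UI. K^2 * (LINT s|UI. (a N (idx N x) s)^2))"
  unfolding nrm_square
  by (rule integral_mono) (use Dk l2_idx[OF assms(1), of "%k. D N k t"] sec(4) in "auto simp: l2_def")
 also have "... = K^2 * (LINT t|UI. LINT x|UI. (a N (idx N x) t)^2)" using sec(5,6) by simp
 also have "... <= K^2 * (LINT t|UI. A^2)"
 proof (intro mult_left_mono integral_mono sec(3))
  fix t assume "t \<in> space UI"
  then have "nrm UI (%x. a N (idx N x) t) <= A" using a_nrm[OF assms(1)] by simp
  from power_mono[OF this nrm_nonneg, of 2] show "(LINT x|UI. (a N (idx N x) t)^2) <= A^2" by (simp add: nrm_square)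
 qed auto
 also have "... = (K * A)^2" by (simp add: power_mult_distrib)
 finally show "(nrm UI (%x. D N (idx N x) t))^2 <= (K * A)^2" .
qed (use A_nonneg K in simp)

lemma nrm_le_cmult_add:
 assumes "N >= 1" "!!k. \<bar>f k\<bar> <= c1 * \<bar>h1 k\<bar> + c2 * \<bar>h2 k\<bar> + c3 * \<bar>h3 k\<bar>" "0 <= c1" "0 <= c2" "0 <= c3"
 shows "nrm UI (%x. f (idx N x)) <= c1 * nrm UI (%x. h1 (idx N x)) + c2 * nrm UI (%x. h2 (idx N x)) + c3 * nrm UI (%x. h3 (idx N x))"
proof -
 note l = l2_cmult[OF l2_abs[OF l2_idx[OF assms(1)]]]
 have "nrm UI (%x. f (idx N x)) <= nrm UI (%x. c1 * \<bar>h1 (idx N x)\<bar> + c2 * \<bar>h2 (idx N x)\<bar> + c3 * \<bar>h3 (idx N x)\<bar>)"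
  by (rule nrm_mono[OF l2_add[OF l2_add[OF l l] l]]) (use assms(2) in "auto intro!: AE_I2 intro: order_trans[OF _ abs_ge_self]")
 also have "... <= nrm UI (%x. c1 * \<bar>h1 (idx N x)\<bar>) + nrm UI (%x. c2 * \<bar>h2 (idx N x)\<bar>) + nrm UI (%x. c3 * \<bar>h3 (idx N x)\<bar>)"
  using nrm_triangle[OF l2_add[OF l l] l] nrm_triangle[OF l l] by (meson add_right_mono order_trans)
 finally show ?thesis using assms(3-5) by (simp add: nrm_cmult)
qed

lemma e_nrm: assumes "N >= 1" "t \<in> I"
 shows "nrm UI (%x. e N (idx N x) t) <= cE"
  and "nrm UI (%x. e1 N (idx N x) t) <= K * C * (K * A) + K^2 * A"
  and "l2 UI (z t) ==> nrm UI (%x. e2 N (idx N x) t) <= (K * (C^2 + 1) * (K * A) + 3 * K^2 * C * A + K^2) * Y N t"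
proof -
 have b: "\<bar>et t (bp N k)\<bar> <= K" "\<bar>R t (bp N k)\<bar> <= C" for k
  using et_bounds[OF assms(2) bp, of N k] R_bound[OF assms(2) bp, of N k] by auto
 have b2: "\<bar>(et t (bp N k))^2\<bar> <= K^2" "\<bar>(R t (bp N k))^2\<bar> <= C^2" for k
  using power_mono[OF b(1)[of k], of 2] power_mono[OF b(2)[of k], of 2] by auto
 have bb: "\<bar>et t (bp N k) * R t (bp N k)\<bar> <= K * C" for k
  unfolding abs_mult using b[of k] K by (intro mult_mono) auto
 have "\<bar>e N k t\<bar> <= K * \<bar>D N k t\<bar> + 0 * \<bar>D N k t\<bar> + 0 * \<bar>D N k t\<bar>" for k
  using b(1)[of k] by (simp add: e_def abs_mult mult_right_mono)
 from nrm_le_cmult_add[OF assms(1) this] have "nrm UI (%x. e N (idx N x) t) <= K * nrm UI (%x. D N (idx N x) t)" using K by simp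
 also have "... <= cE" unfolding cE_def using D_nrm[OF assms] K by (intro mult_left_mono) auto
 finally show "nrm UI (%x. e N (idx N x) t) <= cE" .
 have "\<bar>e1 N k t\<bar> <= (K * C) * \<bar>D N k t\<bar> + K^2 * \<bar>a N k t\<bar> + 0 * \<bar>D N k t\<bar>" for k
 proof -
  have "\<bar>e1 N k t\<bar> <= \<bar>et t (bp N k) * R t (bp N k) * D N k t\<bar> + \<bar>(et t (bp N k))^2 * a N k t\<bar>"
   unfolding e1_def by (rule abs_triangle_ineq)
  also have "... <= (K * C) * \<bar>D N k t\<bar> + K^2 * \<bar>a N k t\<bar>"
   unfolding abs_mult[of "et t (bp N k) * R t (bp N k)"] abs_mult[of "(et t (bp N k))^2"] using bb[of k] b2(1)[of k]
   by (intro add_mono mult_right_mono) auto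
  finally show ?thesis by simp
 qed
 from nrm_le_cmult_add[OF assms(1) this] have "nrm UI (%x. e1 N (idx N x) t) <= (K * C) * nrm UI (%x. D N (idx N x) t) + K^2 * nrm UI (%x. a N (idx N x) t)"
  using K C by simp
 also have "... <= (K * C) * (K * A) + K^2 * A"
  using D_nrm[OF assms] a_nrm[OF assms] K C by (intro add_mono mult_left_mono) auto
 finally show "nrm UI (%x. e1 N (idx N x) t) <= K * C * (K * A) + K^2 * A" .
 assume z: "l2 UI (z t)"
 have \<zeta>0: "0 <= \<zeta> t" by (simp add: \<zeta>_def)
 have \<alpha>0: "0 <= \<alpha> N t" by (simp add: \<alpha>_def)
 have "\<bar>e2 N k t\<bar> <= (K * (C^2 + \<zeta> t)) * \<bar>D N k t\<bar> + (3 * (K^2 * C)) * \<bar>a N k t\<bar> + K^2 * \<bar>ad N k t\<bar>" for k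
 proof -
  have 1: "\<bar>et t (bp N k) * ((R t (bp N k))^2 + S t (bp N k))\<bar> <= K * (C^2 + \<zeta> t)"
   unfolding abs_mult using b(1)[of k] b2(2)[of k] S_bound[OF z bp, of N k] K
   by (intro mult_mono) (auto intro: order_trans[OF abs_triangle_ineq] add_mono)
  have 2: "\<bar>(et t (bp N k))^2 * R t (bp N k)\<bar> <= K^2 * C"
   unfolding abs_mult using b2(1)[of k] b(2)[of k] by (intro mult_mono) auto
  have 3: "\<bar>u + v + w\<bar> <= \<bar>u\<bar> + \<bar>v\<bar> + \<bar>w\<bar>" for u v w :: real by linarith
  have "\<bar>e2 N k t\<bar> <= \<bar>et t (bp N k) * ((R t (bp N k))^2 + S t (bp N k))\<bar> * \<bar>D N k t\<bar>
    + 3 * \<bar>(et t (bp N k))^2 * R t (bp N k)\<bar> * \<bar>a N k t\<bar> + \<bar>(et t (bp N k))^2\<bar> * \<bar>ad N k t\<bar>"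
   unfolding e2_def by (rule order_trans[OF 3]) (simp add: abs_mult mult.assoc)
  also have "... <= (K * (C^2 + \<zeta> t)) * \<bar>D N k t\<bar> + 3 * (K^2 * C) * \<bar>a N k t\<bar> + K^2 * \<bar>ad N k t\<bar>"
   using 1 2 b2(1)[of k] by (intro add_mono mult_right_mono mult_left_mono) auto
  finally show ?thesis .
 qed
 from nrm_le_cmult_add[OF assms(1) this]
 have "nrm UI (%x. e2 N (idx N x) t) <= (K * (C^2 + \<zeta> t)) * nrm UI (%x. D N (idx N x) t) + (3 * (K^2 * C)) * nrm UI (%x. a N (idx N x) t) + K^2 * \<alpha> N t"
  using K C \<zeta>0 by (simp add: \<alpha>_def)
 also have "... <= (K * (C^2 + \<zeta> t)) * (K * A) + (3 * (K^2 * C)) * A + K^2 * \<alpha> N t"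
  using D_nrm[OF assms] a_nrm[OF assms] K C \<zeta>0 by (intro add_mono mult_left_mono) auto
 also have "... <= (K * (C^2 + 1) * (K * A)) * Y N t + (3 * K^2 * C * A) * Y N t + K^2 * Y N t"
 proof (intro add_mono)
  have "C^2 + \<zeta> t <= (C^2 + 1) * Y N t"
  proof -
   have "0 <= C^2 * (\<zeta> t + \<alpha> N t)" using \<zeta>0 \<alpha>0 by simp
   then show ?thesis using \<alpha>0 by (simp add: Y_def algebra_simps)
  qed
  then have "K * (K * A) * (C^2 + \<zeta> t) <= K * (K * A) * ((C^2 + 1) * Y N t)"
   using K A_nonneg by (intro mult_left_mono) auto
  then show "K * (C^2 + \<zeta> t) * (K * A) <= K * (C^2 + 1) * (K * A) * Y N t" by (simp add: algebra_simps)
  have "1 <= Y N t" using \<zeta>0 \<alpha>0 by (simp add: Y_def)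
  then have "(3 * K^2 * C * A) * 1 <= (3 * K^2 * C * A) * Y N t" using C A_nonneg by (intro mult_left_mono) auto
  then show "3 * (K^2 * C) * A <= 3 * K^2 * C * A * Y N t" by (simp add: mult.assoc)
  show "K^2 * \<alpha> N t <= K^2 * Y N t" using \<zeta>0 by (intro mult_left_mono) (auto simp: Y_def)
 qed
 also have "... = (K * (C^2 + 1) * (K * A) + 3 * K^2 * C * A + K^2) * Y N t" by (simp add: algebra_simps)
 finally show "nrm UI (%x. e2 N (idx N x) t) <= (K * (C^2 + 1) * (K * A) + 3 * K^2 * C * A + K^2) * Y N t" .
qed

lemma E_bounds: assumes "N >= 1" "t \<in> I" "x \<in> I"
 shows "\<bar>E0 N t x\<bar> <= cE / sqrt N"
  and "\<bar>E1 N t x\<bar> <= (K * C * (K * A) + K^2 * A) / sqrt N"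
  and "l2 UI (z t) ==> \<bar>E2 N t x\<bar> <= (K * (C^2 + 1) * (K * A) + 3 * K^2 * C * A + K^2) * Y N t / sqrt N"
 unfolding E0_def E1_def E2_def
 using e_nrm[OF assms(1,2)] by (auto intro!: order_trans[OF prim_osc_small[OF assms(1,3)]] divide_right_mono)

lemma \<theta>_pos: assumes "N >= N0" "t \<in> I" "x \<in> I" shows "1 / (2 * K) <= \<theta> N t x" "\<theta> N t x <= 2 * K" "\<theta> N t x > 0"
proof -
 have "\<bar>E0 N t x\<bar> <= 1 / (2 * K)" using E_bounds(1)[OF N0(1)[OF assms(1)] assms(2,3)] N0(2)[OF assms(1)] by simp
 moreover have "1 / (2 * K) + 1 / (2 * K) = 1 / K" using K by simp
 moreover have "1 / (2 * K) <= K"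
 proof -
  have "1 / (2 * K) <= 1" using K by (simp add: divide_le_eq)
  then show ?thesis using K by linarith
 qed
 ultimately show "1 / (2 * K) <= \<theta> N t x" "\<theta> N t x <= 2 * K" using et_bounds[OF assms(2,3)] by (auto simp: \<theta>_def)
 moreover have "1 / (2 * K) > 0" using K by simp
 ultimately show "\<theta> N t x > 0" by linarith
qed

abbreviation "one \<equiv> (%(N::nat) (t::real) (x::real). 1::real)"

lemma GN: "G N t x ==> N >= 1" using N0(1) by (simp add: G_def)

lemma GA: "\<forall>N t x. G N t x --> 1 <= N" using GN by blast

lemma ap_et: "ap G one (%N. et) (%N. et)"
 by (rule ap_refl[of K]) (use K et_abs in "auto simp: G_def")

lemma ap_R: "ap G one (%N. R) (%N. R)"
 by (rule ap_refl[of C]) (use C R_bound in "auto simp: G_def")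

text \<open>Undoes the freezing at the node: the point and its node are at distance at most 1/N, and
  log eta is Hoelder-1/2 in x.\<close>

lemma ap_etb: "ap G one (%N t x. et t (bp N (idx N x))) (%N. et)"
proof (rule apI[of "K + K * C"])
 fix N t x assume G: "G N t x"
 then have x: "t \<in> I" "x \<in> I" by (auto simp: G_def)
 have KC: "0 <= K * C" using K C by simp
 show "\<bar>et t x\<bar> <= (K + K * C) * 1" using et_bounds[OF x] KC by simp
 have "\<bar>et t (bp N (idx N x)) - et t x\<bar> <= K * \<bar>g t (bp N (idx N x)) - g t x\<bar>" by (rule et_lipschitz_g[OF x(1) bp x])
 also have "... <= K * (C * sqrt \<bar>bp N (idx N x) - x\<bar>)" using g_Hoelder[OF x(1) bp x(2)] K by (intro mult_left_mono) auto
 also have "... <= K * (C * (1 / sqrt N))" using bp_dist[OF GN[OF G] x(2)] K C by (intro mult_left_mono) auto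
 also have "... <= (K + K * C) * 1 / sqrt N" using K by (simp add: divide_right_mono)
 finally show "\<bar>et t (bp N (idx N x)) - et t x\<bar> <= (K + K * C) * 1 / sqrt N" .
qed (use K C in auto)

lemma ap_Rb: "ap G one (%N t x. R t (bp N (idx N x))) (%N. R)"
proof (rule apI[of C])
 fix N t x assume G: "G N t x"
 then have x: "t \<in> I" "x \<in> I" by (auto simp: G_def)
 show "\<bar>R t x\<bar> <= C * 1" using R_bound[OF x] by simp
 have "\<bar>R t (bp N (idx N x)) - R t x\<bar> <= C * sqrt \<bar>bp N (idx N x) - x\<bar>" by (rule R_Hoelder[OF x(1) bp x(2)])
 also have "... <= C * (1 / sqrt N)" using bp_dist[OF GN[OF G] x(2)] C by (intro mult_left_mono) auto
 finally show "\<bar>R t (bp N (idx N x)) - R t x\<bar> <= C * 1 / sqrt N" by simp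
qed (use C in auto)

lemma Y_ge: "1 <= Y N t" "\<zeta> t <= Y N t" by (auto simp: Y_def \<zeta>_def \<alpha>_def)

lemma ap_S: "ap G (%N t x. Y N t) (%N. S) (%N. S)"
proof (rule ap_refl[of 1])
 fix N t x assume "G N t x"
 then show "\<bar>S t x\<bar> <= 1 * Y N t" using S_bound[of t x] Y_ge(2)[of t N] by (auto simp: G_def)
qed simp

lemma ap_Sb: "ap G (%N t x. Y N t) (%N t x. S t (bp N (idx N x))) (%N. S)"
proof (rule apI[of 1])
 fix N t x assume G: "G N t x"
 then have x: "t \<in> I" "x \<in> I" "l2 UI (z t)" by (auto simp: G_def)
 show "\<bar>S t x\<bar> <= 1 * Y N t" using S_bound[OF x(3,2)] Y_ge(2)[of t N] by simp
 have "\<bar>S t (bp N (idx N x)) - S t x\<bar> <= \<zeta> t * sqrt \<bar>bp N (idx N x) - x\<bar>" by (rule S_Hoelder[OF x(3) bp x(2)])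
 also have "... <= Y N t * (1 / sqrt N)" using bp_dist[OF GN[OF G] x(2)] Y_ge(1)[of N t] Y_ge(2)[of t N] by (intro mult_mono) (auto simp: \<zeta>_def)
 finally show "\<bar>S t (bp N (idx N x)) - S t x\<bar> <= 1 * Y N t / sqrt N" by simp
qed simp

lemma ap_\<theta>: "ap G one \<theta> (%N. et)"
proof (rule apI[of "K + cE"])
 fix N t x assume G: "G N t x"
 then have x: "t \<in> I" "x \<in> I" by (auto simp: G_def)
 show "\<bar>et t x\<bar> <= (K + cE) * 1" using et_bounds[OF x] cE by simp
 have "cE / sqrt N <= (K + cE) / sqrt N" using K by (intro divide_right_mono) auto
 then show "\<bar>\<theta> N t x - et t x\<bar> <= (K + cE) * 1 / sqrt N" using E_bounds(1)[OF GN[OF G] x] by (simp add: \<theta>_def)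
qed (use K cE in auto)

lemma ap_i\<theta>: "ap G one (%N t x. 1 / \<theta> N t x) (%N t x. 1 / et t x)"
proof (rule ap_inverse[OF ap_\<theta>, of "1 / (2 * K)"])
 show "1 / (2 * K) > 0" using K by simp
 fix N t x assume G: "G N t x"
 then have x: "N >= N0" "t \<in> I" "x \<in> I" by (auto simp: G_def)
 have "1 / (2 * K) <= 1 / K" using K by (simp add: field_simps)
 then show "1 / (2 * K) <= \<theta> N t x & 1 / (2 * K) <= et t x" using \<theta>_pos[OF x] et_bounds[OF x(2,3)] by linarith
qed

lemma ap_small:
 assumes "c >= 0" "!!N t x. G N t x ==> \<bar>u N t x\<bar> <= c * X N t x / sqrt N" "!!N t x. G N t x ==> 0 <= X N t x"
 shows "ap G X u (%N t x. 0)"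
 by (rule apI[OF assms(1)]) (use assms in auto)

lemma ap_\<theta>1: "ap G one \<theta>1 (%N t x. et t x * R t x)"
proof -
 have "ap G one E1 (%N t x. 0)"
 proof (rule ap_small)
  show "0 <= K * C * (K * A) + K^2 * A" using K C A_nonneg by simp
  show "!!N t x. G N t x ==> \<bar>E1 N t x\<bar> <= (K * C * (K * A) + K^2 * A) * 1 / sqrt N"
   using E_bounds(2) GN by (auto simp: G_def)
 qed simp
 from ap_add[OF ap_mult1[OF ap_et ap_R GA] this] show ?thesis unfolding \<theta>1_def[abs_def] by simp
qed

lemma one_le_Y: "ap G one u u0 ==> ap G (%N t x. Y N t) u u0"
 by (erule ap_mono) (rule Y_ge)

lemma ap_\<theta>2: "ap G (%N t x. Y N t) \<theta>2 (%N t x. (R t x * R t x + S t x) * et t x)"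
proof -
 have "ap G (%N t x. Y N t) E2 (%N t x. 0)"
 proof (rule ap_small)
  show "0 <= K * (C^2 + 1) * (K * A) + 3 * K^2 * C * A + K^2" using K C A_nonneg by simp
  show "!!N t x. G N t x ==> \<bar>E2 N t x\<bar> <= (K * (C^2 + 1) * (K * A) + 3 * K^2 * C * A + K^2) * Y N t / sqrt N"
   using E_bounds(3) GN by (auto simp: G_def)
  show "0 <= Y N t" for N t using Y_ge(1)[of N t] by linarith
 qed
 from ap_add[OF ap_mult1[OF ap_add[OF one_le_Y[OF ap_mult1[OF ap_R ap_R GA]] ap_S] ap_et GA] this]
 show ?thesis by (rule ap_cong) (auto simp: \<theta>2_def power2_eq_square mult.commute)
qed

lemma M_nonneg: "0 <= M N t x" by (simp add: M_def)

lemma ap_M: "ap G M (%N. q) (%N. q)" "ap G M (%N. w) (%N. w)" "ap G M Dw Dw" "ap G M aw aw"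
 by (rule ap_refl[of 1]; simp add: M_def)+

lemma M_le_W: "M N t x <= W N t x" "M N t x * Y N t <= W N t x"
proof -
 have "M N t x * 1 <= M N t x * Y N t" by (intro mult_left_mono Y_ge M_nonneg)
 then show "M N t x <= W N t x" "M N t x * Y N t <= W N t x" by (auto simp: W_def)
qed

lemma ap_W: "ap G W (%N. z) (%N. z)" "ap G W adw adw"
proof -
 have "0 <= M N t x * Y N t" for N t x using M_nonneg[of N t x] Y_ge(1)[of N t] by simp
 then show "ap G W (%N. z) (%N. z)" "ap G W adw adw"
  by (auto intro!: ap_refl[of 1] simp: W_def add_nonneg_nonneg)
qed

lemma MW: "ap G M u u0 ==> ap G W u u0"
 by (erule ap_mono) (rule M_le_W)

lemma MY: assumes "ap G M u u0" "ap G (%N t x. Y N t) s s0" shows "ap G W (%N t x. u N t x * s N t x) (%N t x. u0 N t x * s0 N t x)"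
 by (rule ap_mono[OF ap_mult[OF assms GA] M_le_W(2)])

lemma ap_\<rho>: "ap G M \<rho> (%N t x. (q t x + Dw N t x) * et t x)"
 by (rule ap_cong[OF ap_add[OF ap_mult1[OF ap_M(1) ap_et GA] ap_mult1[OF ap_M(3) ap_etb GA]]])
   (auto simp: \<rho>_def osc_def e_def Dw_def algebra_simps)

lemma ap_\<rho>1: "ap G M \<rho>1 (%N t x. (q t x * R t x + w t x + Dw N t x * R t x + aw N t x * et t x) * et t x)"
proof -
 have 1: "ap G M (%N t x. q t x * R t x * et t x + w t x * et t x) (%N t x. q t x * R t x * et t x + w t x * et t x)"
  by (intro ap_add ap_mult1 ap_M ap_et ap_R GA)
 have 2: "ap G M (%N t x. Dw N t x * R t (bp N (idx N x)) * et t (bp N (idx N x)) + aw N t x * et t (bp N (idx N x)) * et t (bp N (idx N x)))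
   (%N t x. Dw N t x * R t x * et t x + aw N t x * et t x * et t x)"
  by (intro ap_add ap_mult1 ap_M ap_etb ap_Rb GA)
 show ?thesis
  by (rule ap_cong[OF ap_add[OF 1 2]]) (auto simp: \<rho>1_def osc_def e1_def Dw_def aw_def power2_eq_square algebra_simps)
qed

lemma ap_\<rho>2: "ap G W \<rho>2 (%N t x. (q t x * (R t x * R t x + S t x) + 2 * (w t x * R t x) + z t x
  + Dw N t x * (R t x * R t x + S t x) + 3 * (aw N t x * R t x * et t x) + adw N t x * et t x) * et t x)"
proof -
 have RS: "ap G (%N t x. Y N t) (%N t x. R t x * R t x + S t x) (%N t x. R t x * R t x + S t x)"
  by (intro ap_add ap_S one_le_Y ap_mult1 ap_R GA)
 have RSb: "ap G (%N t x. Y N t) (%N t x. R t (bp N (idx N x)) * R t (bp N (idx N x)) + S t (bp N (idx N x))) (%N t x. R t x * R t x + S t x)"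
  by (intro ap_add ap_Sb one_le_Y ap_mult1 ap_Rb GA)
 have wR: "ap G W (%N t x. w t x * R t x * et t x) (%N t x. w t x * R t x * et t x)"
  by (intro MW ap_mult1 ap_M ap_R ap_et GA)
 have aR: "ap G W (%N t x. aw N t x * R t (bp N (idx N x)) * et t (bp N (idx N x)) * et t (bp N (idx N x))) (%N t x. aw N t x * R t x * et t x * et t x)"
  by (intro MW ap_mult1 ap_M ap_Rb ap_etb GA)
 have 1: "ap G W (%N t x. q t x * (R t x * R t x + S t x) * et t x + (w t x * R t x * et t x + w t x * R t x * et t x) + z t x * et t x)
   (%N t x. q t x * (R t x * R t x + S t x) * et t x + (w t x * R t x * et t x + w t x * R t x * et t x) + z t x * et t x)"
  by (intro ap_add wR ap_mult1[OF MY[OF ap_M(1) RS] ap_et GA] ap_mult1[OF ap_W(1) ap_et GA])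
 have 2: "ap G W (%N t x. Dw N t x * (R t (bp N (idx N x)) * R t (bp N (idx N x)) + S t (bp N (idx N x))) * et t (bp N (idx N x))
   + (aw N t x * R t (bp N (idx N x)) * et t (bp N (idx N x)) * et t (bp N (idx N x)) + (aw N t x * R t (bp N (idx N x)) * et t (bp N (idx N x)) * et t (bp N (idx N x)) + aw N t x * R t (bp N (idx N x)) * et t (bp N (idx N x)) * et t (bp N (idx N x))))
   + adw N t x * et t (bp N (idx N x)) * et t (bp N (idx N x)))
   (%N t x. Dw N t x * (R t x * R t x + S t x) * et t x + (aw N t x * R t x * et t x * et t x + (aw N t x * R t x * et t x * et t x + aw N t x * R t x * et t x * et t x)) + adw N t x * et t x * et t x)"
  by (intro ap_add aR ap_mult1[OF MY[OF ap_M(3) RSb] ap_etb GA] ap_mult1[OF ap_mult1[OF ap_W(2) ap_etb GA] ap_etb GA])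
 show ?thesis
  by (rule ap_cong[OF ap_add[OF 1 2]]) (auto simp: \<rho>2_def osc_def e2_def Dw_def aw_def adw_def power2_eq_square algebra_simps)
qed

lemma Getpos: "G N t x ==> et t x ~= 0" "G N t x ==> \<theta> N t x ~= 0"
proof -
 assume "G N t x"
 then have "N >= N0" "t \<in> I" "x \<in> I" by (auto simp: G_def)
 from \<theta>_pos(3)[OF this] et_bounds(3)[OF this(2,3)] show "et t x ~= 0" "\<theta> N t x ~= 0" by linarith+
qed

text \<open>The oscillating part of \<open>\<rho>\<close> is eta times D walsh up to the error, so
  dividing by \<open>\<theta>\<close> isolates D walsh.\<close>

lemma ap_qn: "ap G M qn (%N t x. q t x + Dw N t x)"
 by (rule ap_cong[OF ap_mult1[OF ap_\<rho> ap_i\<theta> GA]]) (auto simp: qn_def Getpos)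

lemma ap_Rn: "ap G one (%N t x. \<theta>1 N t x / \<theta> N t x) (%N. R)"
 by (rule ap_cong[OF ap_mult1[OF ap_\<theta>1 ap_i\<theta> GA]]) (auto simp: Getpos)

text \<open>The terms with R cancel: (q R + w + D R walsh + a eta walsh) - (q + D walsh) R leaves w
  and the new part a eta walsh.\<close>

lemma ap_wn: "ap G M wn (%N t x. w t x + aw N t x * et t x)"
 by (rule ap_cong[OF ap_diff[OF ap_mult1[OF ap_\<rho>1 ap_i\<theta> GA] ap_mult1[OF ap_qn ap_Rn GA]]])
   (auto simp: wn_def qn_def Getpos power2_eq_square algebra_simps)

lemma ap_pn: "ap G M pn (%N t x. p t x + aw N t x)"
 by (rule ap_cong[OF ap_mult1[OF ap_wn ap_i\<theta> GA]]) (auto simp: pn_def p_def Getpos field_simps)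

text \<open>All terms with q, D and w multiplied by R or S cancel. Of the three copies of a R eta
  walsh two are removed, and z, one copy and the term with the derivative of a remain.\<close>

lemma ap_zn: "ap G W zn (%N t x. z t x + aw N t x * R t x * et t x + adw N t x * et t x)"
proof -
 have r1: "ap G M (%N t x. \<rho>1 N t x * (1 / \<theta> N t x) * (\<theta>1 N t x / \<theta> N t x))
   (%N t x. (q t x * R t x + w t x + Dw N t x * R t x + aw N t x * et t x) * R t x)"
  by (rule ap_cong[OF ap_mult1[OF ap_mult1[OF ap_\<rho>1 ap_i\<theta> GA] ap_Rn GA]]) (auto simp: Getpos)
 have q2: "ap G W (%N t x. qn N t x * \<theta>2 N t x * (1 / \<theta> N t x)) (%N t x. (q t x + Dw N t x) * (R t x * R t x + S t x))"
  by (rule ap_cong[OF ap_mult1[OF MY[OF ap_qn ap_\<theta>2] ap_i\<theta> GA]]) (auto simp: Getpos)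
 have q3: "ap G M (%N t x. qn N t x * (\<theta>1 N t x / \<theta> N t x) * (\<theta>1 N t x / \<theta> N t x)) (%N t x. (q t x + Dw N t x) * R t x * R t x)"
  by (intro ap_mult1 ap_qn ap_Rn GA)
 have z: "ap G W (%N t x. (\<rho>2 N t x * (1 / \<theta> N t x) - (\<rho>1 N t x * (1 / \<theta> N t x) * (\<theta>1 N t x / \<theta> N t x) + \<rho>1 N t x * (1 / \<theta> N t x) * (\<theta>1 N t x / \<theta> N t x))
    - qn N t x * \<theta>2 N t x * (1 / \<theta> N t x)) + (qn N t x * (\<theta>1 N t x / \<theta> N t x) * (\<theta>1 N t x / \<theta> N t x) + qn N t x * (\<theta>1 N t x / \<theta> N t x) * (\<theta>1 N t x / \<theta> N t x)))
   (%N t x. ((q t x * (R t x * R t x + S t x) + 2 * (w t x * R t x) + z t x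
  + Dw N t x * (R t x * R t x + S t x) + 3 * (aw N t x * R t x * et t x) + adw N t x * et t x) * et t x * (1 / et t x)
   - ((q t x * R t x + w t x + Dw N t x * R t x + aw N t x * et t x) * R t x + (q t x * R t x + w t x + Dw N t x * R t x + aw N t x * et t x) * R t x)
   - (q t x + Dw N t x) * (R t x * R t x + S t x)) + ((q t x + Dw N t x) * R t x * R t x + (q t x + Dw N t x) * R t x * R t x))"
  by (intro ap_add ap_diff MW[OF r1] q2 MW[OF q3] ap_mult1[OF ap_\<rho>2 ap_i\<theta> GA])
 show ?thesis
  by (rule ap_cong[OF z]) (auto simp: zn_def qn_def Getpos power2_eq_square power3_eq_cube algebra_simps)
qed

text \<open>The remaining a R walsh is cancelled by the product of the new momentum with the time
  derivative of log eta.\<close>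

lemma ap_vn: "ap G W vn (%N t x. v t x + adw N t x)"
 by (rule ap_cong[OF ap_diff[OF ap_mult1[OF ap_zn ap_i\<theta> GA] MW[OF ap_mult1[OF ap_pn ap_Rn GA]]]])
   (auto simp: vn_def v_def Getpos field_simps)

end

lemma ap_bound:
 assumes "ap G X u u0" "\<forall>N t x. G N t x --> N >= 1"
 obtains c where "c >= 0" "!!N t x. G N t x ==> \<bar>u N t x\<bar> <= c * X N t x"
proof -
 obtain c where c: "c >= 0" "!!N t x. G N t x ==> \<bar>u0 N t x\<bar> <= c * X N t x"
   "!!N t x. G N t x ==> \<bar>u N t x - u0 N t x\<bar> <= c * X N t x / sqrt N"
  using assms unfolding ap_def by metis
 show ?thesis
 proof (rule that[of "2 * c"])
  fix N t x assume G: "G N t x"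
  have "0 <= c * X N t x" using order_trans[OF abs_ge_zero c(2)[OF G]] .
  moreover have "1 <= sqrt N" using assms(2) G by auto
  ultimately have "c * X N t x / sqrt N <= c * X N t x" by (simp add: divide_le_eq mult_le_cancel_left1)
  then show "\<bar>u N t x\<bar> <= 2 * c * X N t x" using c(2,3)[OF G] by linarith
 qed (use c in simp)
qed

section \<open>L2 bounds for the majorants and exact identities for the perturbed curves\<close>

context perturbation
begin

lemma W_parts: assumes N: "N >= 1"
 shows "m2 (M N)" "t \<in> I ==> l2 UI (M N t)" "t \<in> I ==> nrm UI (M N t) <= 2 * C + K * A + A"
proof -
 have am: "m2 (%t x. a N (idx N x) t)" "m2 (%t x. D N (idx N x) t)"
  by (intro m2_idx N continuous_measurable_UI ac_continuous[OF a_ac[OF N]] ac_continuous[OF ac_D[OF N]])+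
 have "m2 (Dw N)" "m2 (aw N)" unfolding Dw_def[abs_def] aw_def[abs_def] by (intro m2_arith am m2_fun measurable_walsh_UI)+
 then show "m2 (M N)" unfolding M_def[abs_def] by (intro m2_arith m2_unary m2s)
 assume t: "t \<in> I"
 have D: "l2 UI (Dw N t)" "nrm UI (Dw N t) <= K * A"
  using l2_osc[OF N, of "%k. D N k t"] nrm_osc[of N "%k. D N k t"] D_nrm[OF N t] by (auto simp: Dw_def[abs_def] osc_def[abs_def])
 have a: "l2 UI (aw N t)" "nrm UI (aw N t) <= A"
  using l2_osc[OF N, of "%k. a N k t"] nrm_osc[of N "%k. a N k t"] a_nrm[OF N t] by (auto simp: aw_def[abs_def] osc_def[abs_def])
 note l = l2_abs[OF q_l2[OF t]] l2_abs[OF w_l2[OF t]] l2_abs[OF D(1)] l2_abs[OF a(1)]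
 show "l2 UI (M N t)" unfolding M_def[abs_def] by (intro l2_add l)
 have "nrm UI (M N t) <= nrm UI (%x. \<bar>q t x\<bar> + \<bar>w t x\<bar> + \<bar>Dw N t x\<bar>) + nrm UI (aw N t)"
  unfolding M_def[abs_def] using nrm_triangle[OF l2_add[OF l2_add[OF l(1,2)] l(3)] l(4)] by simp
 also have "nrm UI (%x. \<bar>q t x\<bar> + \<bar>w t x\<bar> + \<bar>Dw N t x\<bar>) <= nrm UI (%x. \<bar>q t x\<bar> + \<bar>w t x\<bar>) + nrm UI (Dw N t)"
  using nrm_triangle[OF l2_add[OF l(1,2)] l(3)] by simp
 also have "nrm UI (%x. \<bar>q t x\<bar> + \<bar>w t x\<bar>) <= nrm UI (q t) + nrm UI (w t)"
  using nrm_triangle[OF l(1,2)] by simp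
 finally show "nrm UI (M N t) <= 2 * C + K * A + A" using C(2)[OF t] C(3)[OF t] D(2) a(2) by linarith
qed

definition CM where "CM = 2 * C + K * A + A"
definition CW where "CW = CM * (1 + nrm UI \<zeta> + A) + nrm UU (%y. z (fst y) (snd y)) + A"

lemma CM: "CM >= 0" using C K A_nonneg by (simp add: CM_def)

text \<open>\<open>M\<close> is bounded in L2 uniformly in time and \<open>Y\<close> is square
  integrable in time, so their product is square integrable on the square, uniformly in N.\<close>

lemma W_bound: assumes N: "N >= 1"
 shows "l2 UU (%y. W N (fst y) (snd y))" "nrm UU (%y. W N (fst y) (snd y)) <= CW"
proof -
 have adl: "l2 UU (%y. ad N (idx N (snd y)) (fst y))" by (rule l2_UU_idx[OF ad_l2[OF N] N])
 note sec = l2_UU_sections[where u="%t x. ad N (idx N x) t", OF adl]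
 have \<alpha>l: "l2 UI (\<alpha> N)" unfolding l2_def
 proof
  show "\<alpha> N \<in> bm UI" unfolding \<alpha>_def[abs_def] by (rule m2_nrm[OF sec(7)])
  show "integrable UI (%t. (\<alpha> N t)^2)" unfolding \<alpha>_def nrm_square by (rule sec(3))
 qed
 have "(nrm UI (\<alpha> N))^2 = (nrm UU (%y. ad N (idx N (snd y)) (fst y)))^2"
  using sec(5) by (simp add: \<alpha>_def nrm_square)
 then have \<alpha>n: "nrm UI (\<alpha> N) <= A" using ad_nrm[OF N] by simp
 note l1 = l2_add[OF UI.l2_const[of 1] \<zeta>_l2]
 have Yl: "l2 UI (Y N)" unfolding Y_def[abs_def] by (rule l2_add[OF l1 \<alpha>l])
 have Yn: "nrm UI (Y N) <= 1 + nrm UI \<zeta> + A"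
  unfolding Y_def[abs_def] using nrm_triangle[OF l1 \<alpha>l] nrm_triangle[OF UI.l2_const[of 1] \<zeta>_l2] \<alpha>n by simp
 have Ym: "m2 (%t x. M N t x * Y N t)"
  using Yl by (intro m2_arith W_parts(1) N m2_fun) (simp add: l2_def)
 have sq: "(LINT x|UI. (M N t x * Y N t)^2) = (nrm UI (M N t))^2 * (Y N t)^2" for t
  unfolding nrm_square power_mult_distrib by simp
 have le: "(nrm UI (M N t))^2 * (Y N t)^2 <= CM^2 * (Y N t)^2" if "t \<in> I" for t
  using W_parts(3)[OF N that] by (intro mult_right_mono power_mono) (auto simp: CM_def)
 have mm: "(%t. (LINT x|UI. (M N t x * Y N t)^2)) \<in> bm UI" by (rule m2_integral_x[OF m2_unary(4)[OF Ym]])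
 have MYi: "integrable UI (%t. (LINT x|UI. (M N t x * Y N t)^2))"
  by (rule intble_bound[OF integrable_mult_right[OF l2_square[OF Yl], of "CM^2"] mm])
    (rule AE_I2, use le in "simp add: sq")
 have MYl: "l2 UU (%y. M N (fst y) (snd y) * Y N (fst y))"
 proof (rule l2_UU_I[OF Ym _ MYi])
  show "AE t in UI. l2 UI (%x. M N t x * Y N t)"
  proof (rule AE_I2)
   fix t assume "t \<in> space UI"
   then have "t \<in> I" by simp
   from l2_cmult[OF W_parts(2)[OF N this], of "Y N t"] show "l2 UI (%x. M N t x * Y N t)" by (simp add: mult.commute)
  qed
 qed
 have "(nrm UU (%y. M N (fst y) (snd y) * Y N (fst y)))^2 = (LINT t|UI. (LINT x|UI. (M N t x * Y N t)^2))"
  by (rule l2_UU_sections(5)[where u="%t x. M N t x * Y N t", OF MYl, symmetric])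
 also have "... <= (LINT t|UI. CM^2 * (Y N t)^2)"
  by (rule integral_mono[OF MYi integrable_mult_right[OF l2_square[OF Yl]]]) (use le in "simp add: sq")
 also have "... = (CM * nrm UI (Y N))^2" by (simp add: nrm_square power_mult_distrib)
 finally have "nrm UU (%y. M N (fst y) (snd y) * Y N (fst y)) <= CM * nrm UI (Y N)"
  using CM by (simp add: power2_le_iff_abs_le)
 also have "... <= CM * (1 + nrm UI \<zeta> + A)" by (rule mult_left_mono[OF Yn CM])
 finally have MYn: "nrm UU (%y. M N (fst y) (snd y) * Y N (fst y)) <= CM * (1 + nrm UI \<zeta> + A)" .
 have awm: "m2 (adw N)" unfolding adw_def[abs_def] by (intro m2_arith sec(7) m2_fun measurable_walsh_UI)
 have adwl: "l2 UU (%y. adw N (fst y) (snd y))" "nrm UU (%y. adw N (fst y) (snd y)) <= A"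
 proof -
  have b: "AE y in UU. \<bar>adw N (fst y) (snd y)\<bar> <= \<bar>ad N (idx N (snd y)) (fst y)\<bar>"
   by (rule AE_I2) (simp add: adw_def abs_mult)
  show "l2 UU (%y. adw N (fst y) (snd y))" by (rule l2_bound[OF adl awm[unfolded m2_def] b])
  show "nrm UU (%y. adw N (fst y) (snd y)) <= A"
   using nrm_mono[OF adl awm[unfolded m2_def] b] ad_nrm[OF N] by simp
 qed
 note l2 = l2_add[OF MYl l2_abs[OF z_l2]]
 show "l2 UU (%y. W N (fst y) (snd y))" unfolding W_def by (rule l2_add[OF l2 l2_abs[OF adwl(1)]])
 have "nrm UU (%y. W N (fst y) (snd y)) <= nrm UU (%y. M N (fst y) (snd y) * Y N (fst y) + \<bar>z (fst y) (snd y)\<bar>) + nrm UU (%y. adw N (fst y) (snd y))"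
  unfolding W_def using nrm_triangle[OF l2 l2_abs[OF adwl(1)]] by simp
 also have "nrm UU (%y. M N (fst y) (snd y) * Y N (fst y) + \<bar>z (fst y) (snd y)\<bar>) <= nrm UU (%y. M N (fst y) (snd y) * Y N (fst y)) + nrm UU (%y. z (fst y) (snd y))"
  using nrm_triangle[OF MYl l2_abs[OF z_l2]] by simp
 finally show "nrm UU (%y. W N (fst y) (snd y)) <= CW" using MYn adwl(2) by (simp add: CW_def)
qed

lemma G_AE: assumes "N >= N0" shows "AE y in UU. G N (fst y) (snd y)"
proof (rule AE_UU(1))
 have "{t \<in> space UI. l2 UI (z t)} \<times> space UI \<in> sets UU" by (rule pair_measureI[OF l2_section_sets[OF m2s(3)] sets.top])
 moreover have "{t \<in> space UI. l2 UI (z t)} \<times> space UI = {y \<in> space UU. G N (fst y) (snd y)}"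
  using assms by (auto simp: G_def space_pair_measure)
 ultimately show "{y \<in> space UU. G N (fst y) (snd y)} \<in> sets UU" by (simp only:)
 show "AE t in UI. AE x in UI. G N t x"
  using z_sections AE_space
 proof eventually_elim
  case (elim t)
  then show ?case using assms by (intro AE_I2) (auto simp: G_def)
 qed
qed

lemma ap_l2:
 assumes u: "ap G W u u0" "m2 (u N)" and N: "N >= N0" shows "l2 UU (%y. u N (fst y) (snd y))"
proof -
 obtain c where c: "c >= 0" "!!N t x. G N t x ==> \<bar>u N t x\<bar> <= c * W N t x"
  using ap_bound[OF u(1) GA] by blast
 show ?thesis
 proof (rule l2_bound[OF l2_cmult[OF W_bound(1)[OF N0(1)[OF N]]] u(2)[unfolded m2_def]])
  show "AE y in UU. \<bar>u N (fst y) (snd y)\<bar> <= \<bar>c * W N (fst y) (snd y)\<bar>"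
   using G_AE[OF N] by eventually_elim (use c(2) in "force intro: order_trans[OF _ abs_ge_self]")
 qed
qed

lemma ap_nrm:
 assumes u: "ap G W u u0" "!!N. N >= N0 ==> m2 (u N)" "!!N. N >= N0 ==> m2 (u0 N)"
 obtains c where "c >= 0" "!!N. N >= N0 ==> l2 UU (%y. u N (fst y) (snd y) - u0 N (fst y) (snd y))"
  "!!N. N >= N0 ==> nrm UU (%y. u N (fst y) (snd y) - u0 N (fst y) (snd y)) <= c / sqrt N"
proof -
 obtain c where c: "c >= 0" "!!N t x. G N t x ==> \<bar>u N t x - u0 N t x\<bar> <= c * W N t x / sqrt N"
  using u(1) unfolding ap_def by blast
 have *: "l2 UU (%y. u N (fst y) (snd y) - u0 N (fst y) (snd y)) & nrm UU (%y. u N (fst y) (snd y) - u0 N (fst y) (snd y)) <= (c * CW) / sqrt N"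
  if N: "N >= N0" for N
 proof -
  note l = l2_cmult[OF W_bound(1)[OF N0(1)[OF N]], of "c / sqrt N"]
  have m: "(%y. u N (fst y) (snd y) - u0 N (fst y) (snd y)) \<in> bm UU"
   using m2_arith(2)[OF u(2)[OF N] u(3)[OF N]] unfolding m2_def .
  have b: "AE y in UU. \<bar>u N (fst y) (snd y) - u0 N (fst y) (snd y)\<bar> <= \<bar>c / sqrt N * W N (fst y) (snd y)\<bar>"
   using G_AE[OF N]
  proof eventually_elim
   case (elim y)
   have "c * W N (fst y) (snd y) / sqrt N = c / sqrt N * W N (fst y) (snd y)" by simp
   with c(2)[OF elim] show ?case by linarith
  qed
  have "nrm UU (%y. u N (fst y) (snd y) - u0 N (fst y) (snd y)) <= nrm UU (%y. c / sqrt N * W N (fst y) (snd y))"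
   by (rule nrm_mono[OF l m b])
  also have "... = c / sqrt N * nrm UU (%y. W N (fst y) (snd y))" unfolding nrm_cmult using c(1) by simp
  also have "... <= c / sqrt N * CW" using W_bound(2)[OF N0(1)[OF N]] c(1) by (intro mult_left_mono) auto
  finally show ?thesis using l2_bound[OF l m b] by simp
 qed
 have "CW >= 0" using order_trans[OF nrm_nonneg W_bound(2)[of 1]] by simp
 with * c(1) show ?thesis by (intro that[of "c * CW"]) auto
qed

lemma acx_\<theta>: assumes "N >= 1" "t \<in> I"
 shows "ac (\<theta> N t) (\<rho> N t)" "ac (\<theta>1 N t) (\<rho>1 N t)"
proof -
 note o = ac_prim[OF UI.l2_integrable[OF l2_osc[OF assms(1)]]]
 show "ac (\<theta> N t) (\<rho> N t)"
  unfolding \<theta>_def[abs_def] \<rho>_def[abs_def] E0_def by (intro ac_add acx_et assms(2) o)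
 have "ac (%x. et t x * R t x) (%x. et t x * R t x * q t x + et t x * w t x)"
  by (rule ac_cong[OF ac_mult[OF acx_et[OF assms(2)] acx_R[OF assms(2)]]]) (auto simp: algebra_simps)
 then show "ac (\<theta>1 N t) (\<rho>1 N t)"
  unfolding \<theta>1_def[abs_def] \<rho>1_def[abs_def] E1_def by (intro ac_add o)
qed

lemma \<theta>_0: "\<theta> N t 0 = 1" "\<theta>1 N t 0 = 0"
 by (auto simp: \<theta>_def \<theta>1_def et_def g_def R_def E0_def E1_def)

text \<open>\<open>ac_exp_quotient\<close> with the normalization \<theta> = 1 at x = 0: the
  function perturbed by hand is exactly the eta of the new curve.\<close>

lemma eta_qn: assumes "N >= N0" "t \<in> I" "x \<in> I" shows "exp (prim (qn N t) x) = \<theta> N t x"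
 using ac_exp_quotient[OF acx_\<theta>(1)[OF N0(1)[OF assms(1)] assms(2)] \<theta>_pos(3)[OF assms(1,2)] assms(3)] \<theta>_0
 by (simp add: qn_def[abs_def])

lemma acx_Rn: assumes "N >= N0" "t \<in> I" shows "ac (%x. \<theta>1 N t x / \<theta> N t x) (wn N t)"
proof -
 note p = \<theta>_pos(3)[OF assms]
 have i: "ac (%x. 1 / \<theta> N t x) (%x. - \<rho> N t x / (\<theta> N t x)^2)"
  by (rule ac_inverse[OF acx_\<theta>(1)[OF N0(1)[OF assms(1)] assms(2)] p])
 show ?thesis
  by (rule ac_cong[OF ac_mult[OF acx_\<theta>(2)[OF N0(1)[OF assms(1)] assms(2)] i]])
    (use p in "auto simp: wn_def field_simps power2_eq_square")
qed

lemma prim_wn: assumes "N >= N0" "t \<in> I" "x \<in> I" shows "prim (wn N t) x = \<theta>1 N t x / \<theta> N t x"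
 using ac_eq[OF acx_Rn[OF assms(1,2)] assms(3)] \<theta>_0 by simp

lemma ac_\<rho>: assumes "N >= 1"
 shows "AE x in UI. ac (%t. \<rho> N t x) (%t. \<rho>1 N t x)" "AE x in UI. ac (%t. \<rho>1 N t x) (%t. \<rho>2 N t x)"
proof -
 have o0: "AE x in UI. ac (%t. osc N (%k. e N k t) x) (%t. osc N (%k. e1 N k t) x)"
  by (rule H1D(5)[OF H1_osc[OF assms ac_e[OF assms] ac_l2[OF ac_e1[OF assms]]]])
 have o1: "AE x in UI. ac (%t. osc N (%k. e1 N k t) x) (%t. osc N (%k. e2 N k t) x)"
  by (rule H1D(5)[OF H1_osc[OF assms ac_e1[OF assms] e2_l2[OF assms]]])
 show "AE x in UI. ac (%t. \<rho> N t x) (%t. \<rho>1 N t x)"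
  using H1D(5)[OF Hq] o0 AE_space
 proof eventually_elim
  case (elim x)
  then have x: "x \<in> I" by simp
  show ?case unfolding \<rho>_def \<rho>1_def by (intro ac_add elim(2) ac_mult[OF ac_et[OF x] elim(1)])
 qed
 show "AE x in UI. ac (%t. \<rho>1 N t x) (%t. \<rho>2 N t x)"
  using H1D(5)[OF Hq] H1D(5)[OF Hw] o1 AE_space
 proof eventually_elim
  case (elim x)
  then have x: "x \<in> I" by simp
  show ?case unfolding \<rho>1_def \<rho>2_def
   by (rule ac_cong[OF ac_add[OF ac_add[OF ac_mult[OF ac_etR[OF x] elim(1)] ac_mult[OF ac_et[OF x] elim(2)]] elim(3)]])
     (auto simp: algebra_simps)
 qed
qed

lemma inv_\<theta>: assumes "N >= N0" "t \<in> I" "x \<in> I" shows "\<bar>1 / \<theta> N t x\<bar> <= 2 * K"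
proof -
 note p = \<theta>_pos[OF assms]
 have "1 <= 2 * K * \<theta> N t x" using p(1) K by (simp add: divide_le_eq mult.commute mult.left_commute)
 then show ?thesis using p(3) by (simp add: divide_le_eq)
qed

lemma \<theta>1_bound: assumes "N >= 1" "t \<in> I" "x \<in> I" shows "\<bar>\<theta>1 N t x\<bar> <= K * C + (K * C * (K * A) + K^2 * A)"
proof -
 have 1: "1 <= sqrt N" using assms(1) by simp
 have "0 <= K * C * (K * A) + K^2 * A" using K C A_nonneg by simp
 then have "(K * C * (K * A) + K^2 * A) / sqrt N <= K * C * (K * A) + K^2 * A"
  using 1 by (simp add: divide_le_eq mult_le_cancel_left1)
 moreover have "\<bar>et t x * R t x\<bar> <= K * C" unfolding abs_mult using et_abs[OF assms(2,3)] R_bound[OF assms(2,3)] K by (intro mult_mono) auto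
 ultimately show ?thesis using E_bounds(2)[OF assms] unfolding \<theta>1_def by linarith
qed

lemma n_l2: assumes N: "N >= N0" and t: "t \<in> I"
 shows "l2 UI (qn N t)" "l2 UI (wn N t)" "l2 UI (pn N t)"
proof -
 note N1 = N0(1)[OF N]
 have b: "l2 UI (%x. (1 / \<theta> N t x) * f x)" if "l2 UI f" for f
  by (rule l2_mult_bounded[OF that, of _ "2 * K"])
    (rule m2_section[OF m2_unary(6)[OF m2n(1)[OF N1]] t], rule AE_I2, rule inv_\<theta>[OF N t], simp)
 have b1: "l2 UI (%x. \<theta>1 N t x * f x)" if "l2 UI f" for f
  by (rule l2_mult_bounded[OF that])
    (rule m2_section[OF m2n(2)[OF N1] t], rule AE_I2, rule \<theta>1_bound[OF N1 t], simp)
 have be: "l2 UI (%x. et t x * f x)" if "l2 UI f" for f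
  by (rule l2_mult_bounded[OF that])
    (rule m2_section[OF m2s(5) t], rule AE_I2, rule et_abs[OF t], simp)
 have bR: "l2 UI (%x. R t x * f x)" if "l2 UI f" for f
  by (rule l2_mult_bounded[OF that])
    (rule m2_section[OF m2s(6) t], rule AE_I2, rule R_bound[OF t], simp)
 have r0: "l2 UI (\<rho> N t)" unfolding \<rho>_def[abs_def] by (intro l2_add be q_l2 t l2_osc N1)
 have r1: "l2 UI (\<rho>1 N t)" unfolding \<rho>1_def[abs_def] mult.assoc by (intro l2_add be bR q_l2 w_l2 t l2_osc N1)
 from b[OF r0] show "l2 UI (qn N t)" by (simp add: qn_def[abs_def])
 have "l2 UI (%x. (1 / \<theta> N t x) * \<rho>1 N t x - (1 / \<theta> N t x) * ((1 / \<theta> N t x) * (\<theta>1 N t x * \<rho> N t x)))"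
  by (intro l2_diff b b1 r0 r1)
 then show w: "l2 UI (wn N t)" by (simp add: wn_def[abs_def] power2_eq_square mult.commute)
 from b[OF w] show "l2 UI (pn N t)" by (simp add: pn_def[abs_def])
qed

text \<open>For each large N the perturbed curve is exactly of class H2 in time: the trajectories
  follow from the quotient rule, and square integrability of the last derivatives follows from the
  asymptotics with majorant \<open>W\<close>.\<close>

lemma H1_n: assumes N: "N >= N0"
 shows "H1 (qn N) (wn N)" "H1 (wn N) (zn N)" "H1 (pn N) (vn N)"
proof -
 note N1 = N0(1)[OF N]
 have i: "ac (%t. 1 / \<theta> N t x) (%t. - \<theta>1 N t x / (\<theta> N t x)^2)" if "x \<in> I" for x
  by (rule ac_inverse[OF ac_\<theta>(1)[OF N1 that]]) (rule \<theta>_pos(3)[OF N _ that])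
 have pos: "\<theta> N t x ~= 0" if "t \<in> I" "x \<in> I" for t x using \<theta>_pos(3)[OF N that] by simp
 have lz: "l2 UU (%y. zn N (fst y) (snd y))" by (rule ap_l2[OF ap_zn m2n(9)[OF N1] N])
 have lv: "l2 UU (%y. vn N (fst y) (snd y))" by (rule ap_l2[OF ap_vn m2n(11)[OF N1] N])
 have lw: "l2 UU (%y. wn N (fst y) (snd y))" by (rule ap_l2[OF MW[OF ap_wn] m2n(8)[OF N1] N])
 have aq: "AE x in UI. ac (%t. qn N t x) (%t. wn N t x)"
  using ac_\<rho>(1)[OF N1] AE_space
 proof eventually_elim
  case (elim x)
  then have x: "x \<in> I" by simp
  show ?case
   by (rule ac_cong[OF ac_mult[OF elim(1) i[OF x]]]) (simp_all add: qn_def wn_def)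
 qed
 have aw: "AE x in UI. ac (%t. wn N t x) (%t. zn N t x)"
  using ac_\<rho>(1)[OF N1] ac_\<rho>(2)[OF N1] AE_space
 proof eventually_elim
  case (elim x)
  then have x: "x \<in> I" by simp
  show ?case
   by (rule ac_cong[OF ac_diff[OF ac_mult[OF elim(2) i[OF x]]
      ac_mult[OF ac_mult[OF elim(1) ac_\<theta>(2)[OF N1 x]] ac_mult[OF i[OF x] i[OF x]]]]])
     (use pos[OF _ x] in "simp_all add: wn_def zn_def power2_eq_square power3_eq_cube field_simps")
 qed
 have ap: "AE x in UI. ac (%t. pn N t x) (%t. vn N t x)"
  using aw AE_space
 proof eventually_elim
  case (elim x)
  then have x: "x \<in> I" by simp
  show ?case
   by (rule ac_cong[OF ac_mult[OF elim(1) i[OF x]]])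
     (use pos[OF _ x] in "simp_all add: pn_def vn_def power2_eq_square field_simps")
 qed
 show "H1 (qn N) (wn N)" using aq lw m2n(7)[OF N1] n_l2(1)[OF N] unfolding H1_def by blast
 show "H1 (wn N) (zn N)" using aw lz m2n(8)[OF N1] n_l2(2)[OF N] unfolding H1_def by blast
 show "H1 (pn N) (vn N)" using ap lv m2n(10)[OF N1] n_l2(3)[OF N] unfolding H1_def by blast
qed

text \<open>The amplitudes start at 0, so \<open>e\<close> and \<open>e1\<close> vanish at time 0
  and no correction is present there.\<close>

lemma initial: assumes "N >= 1" "x \<in> I" shows "qn N 0 x = q 0 x" "pn N 0 x = p 0 x"
proof -
 have z: "e N k 0 = 0" "e1 N k 0 = 0" for k by (auto simp: e_def e1_def D_def a_0)
 have o: "prim (osc N (%k. 0)) x = 0" using prim_const[OF assms(2), of 0] by (simp add: osc_def[abs_def])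
 have E: "E0 N 0 x = 0" "E1 N 0 x = 0" using o by (auto simp: E0_def E1_def z)
 have et: "et 0 x ~= 0" using et_bounds(3)[of 0 x] assms by auto
 have "\<rho> N 0 x = et 0 x * q 0 x" "\<rho>1 N 0 x = et 0 x * R 0 x * q 0 x + et 0 x * w 0 x"
  by (auto simp: \<rho>_def \<rho>1_def osc_def z)
 then show "qn N 0 x = q 0 x" "pn N 0 x = p 0 x"
  using et by (auto simp: qn_def pn_def p_def wn_def \<theta>_def \<theta>1_def E field_simps power2_eq_square)
qed

end

section \<open>The constraints of the cotangent bundle are preserved exactly\<close>

locale constrained_perturbation = perturbation +
 assumes constraints: "!!t. t \<in> I ==> g t 1 = 0" "!!t. t \<in> I ==> prim (et t) 1 = 1"
  "!!t. t \<in> I ==> R t 1 = 0" "!!t. t \<in> I ==> prim (%x. et t x * R t x) 1 = 0"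
begin

text \<open>The first and second primitives of the oscillation vanish at x = 1, so the end values
  and means of \<open>\<theta>\<close> and \<open>\<theta>1\<close> are those of the base
  curve.\<close>

lemma \<theta>_end: assumes "N >= 1" "t \<in> I"
 shows "\<theta> N t 1 = 1" "\<theta>1 N t 1 = 0" "prim (\<theta> N t) 1 = 1" "prim (\<theta>1 N t) 1 = 0"
proof -
 show "\<theta> N t 1 = 1" "\<theta>1 N t 1 = 0"
  using constraints[OF assms(2)] osc_mean_zero(1)[OF assms(1)] by (auto simp: \<theta>_def \<theta>1_def E0_def E1_def et_def)
 have i: "integrable UI (prim (osc N F))" for F
  by (intro continuous_integrable_UI prim_continuous osc_integrable assms)
 have "integrable UI (et t)" by (intro continuous_integrable_UI ac_continuous[OF acx_et[OF assms(2)]])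
 then show "prim (\<theta> N t) 1 = 1"
  using constraints(2)[OF assms(2)] osc_mean_zero(2)[OF assms(1)] i
  by (simp add: \<theta>_def[abs_def] E0_def[abs_def] prim_add)
 have "integrable UI (%x. et t x * R t x)"
  by (intro continuous_integrable_UI continuous_on_mult ac_continuous[OF acx_et[OF assms(2)]] ac_continuous[OF acx_R[OF assms(2)]])
 then show "prim (\<theta>1 N t) 1 = 0"
  using constraints(4)[OF assms(2)] osc_mean_zero(2)[OF assms(1)] i
  by (simp add: \<theta>1_def[abs_def] E1_def[abs_def] prim_add)
qed

lemma eta_eq: "N >= N0 ==> t \<in> I ==> x \<in> I ==> eta (qn N t) x = \<theta> N t x"
 using eta_qn by (simp add: eta_def prim_def)

text \<open>End value and mean of \<open>\<theta>\<close> give the two conditions on q_n. The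
  pairing of p_n with 1 is the end value of \<theta>1 / \<theta>. The pairing with phi becomes,
  after integration by parts, minus the mean of \<open>\<theta>1\<close>.\<close>

lemma in_cotangent_bundle: assumes N: "N >= N0" and t: "t \<in> I" shows "(pn N t, qn N t) \<in> cotangent_bundle"
proof -
 note N1 = N0(1)[OF N]
 have int: "(LINT x:I|lborel. f x) = prim f 1" for f by (simp add: prim_def)
 have "exp (prim (qn N t) 1) = 1" using eta_qn[OF N t, of 1] \<theta>_end(1)[OF N1 t] by simp
 then have q1: "prim (qn N t) 1 = 0" by simp
 have "prim (eta (qn N t)) 1 = prim (\<theta> N t) 1" by (rule prim_cong) (use eta_eq[OF N t] in auto)
 then have Q: "qn N t \<in> Q_space" using q1 \<theta>_end(3)[OF N1 t] n_l2(1)[OF N t] by (simp add: Q_space_def L2_iff int)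
 have pe: "pn N t x * eta (qn N t) x = wn N t x" if "x \<in> I" for x
  using eta_eq[OF N t that] \<theta>_pos(3)[OF N t that] by (simp add: pn_def)
 have "eta_inner (qn N t) (pn N t) (%_. 1) = prim (wn N t) 1"
  unfolding eta_inner_def int by (rule prim_cong) (use pe in auto)
 also have "... = 0" using prim_wn[OF N t, of 1] \<theta>_end(2)[OF N1 t] by simp
 finally have 1: "eta_inner (qn N t) (pn N t) (%_. 1) = 0" .
 have ph: "phi (qn N t) x = prim (\<theta> N t) x" if "x \<in> I" for x
  unfolding phi_def prim_def[symmetric] by (rule prim_cong) (use that eta_eq[OF N t] in auto)
 have aph: "ac (prim (\<theta> N t)) (\<theta> N t)"
  by (intro ac_prim continuous_integrable_UI ac_continuous[OF acx_\<theta>(1)[OF N1 t]])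
 \<comment> \<open>The product of \<theta>1 / \<theta> and phi vanishes at both ends, the first
   factor being 0 there.\<close>
 have "0 = prim (%x. wn N t x * prim (\<theta> N t) x + \<theta>1 N t x / \<theta> N t x * \<theta> N t x) 1"
  using ac_eq[OF ac_mult[OF acx_Rn[OF N t] aph], of 1] \<theta>_end(2)[OF N1 t] by simp
 also have "... = prim (%x. wn N t x * prim (\<theta> N t) x) 1 + prim (%x. \<theta>1 N t x / \<theta> N t x * \<theta> N t x) 1"
 proof (rule prim_add)
  show "integrable UI (%x. wn N t x * prim (\<theta> N t) x)"
   using continuous_mult_integrable[OF ac_continuous[OF aph] UI.l2_integrable[OF n_l2(2)[OF N t]]] by (simp add: mult.commute)
  show "integrable UI (%x. \<theta>1 N t x / \<theta> N t x * \<theta> N t x)"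
   by (intro continuous_integrable_UI continuous_on_mult ac_continuous[OF acx_Rn[OF N t]] ac_continuous[OF acx_\<theta>(1)[OF N1 t]])
 qed simp
 also have "prim (%x. \<theta>1 N t x / \<theta> N t x * \<theta> N t x) 1 = prim (\<theta>1 N t) 1"
  by (rule prim_cong) (use \<theta>_pos(3)[OF N t] in force)+
 finally have "prim (%x. wn N t x * prim (\<theta> N t) x) 1 = 0" using \<theta>_end(4)[OF N1 t] by simp
 moreover have "eta_inner (qn N t) (pn N t) (phi (qn N t)) = prim (%x. wn N t x * prim (\<theta> N t) x) 1"
  unfolding eta_inner_def int
 proof (rule prim_cong)
  fix x :: real assume x: "x \<in> I"
  show "pn N t x * phi (qn N t) x * eta (qn N t) x = wn N t x * prim (\<theta> N t) x"
   using pe[OF x] ph[OF x] by (metis mult.assoc mult.commute)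
 qed simp
 ultimately have "pn N t \<in> cotangent (qn N t)" using 1 n_l2(3)[OF N t] by (simp add: cotangent_def L2_iff)
 then show ?thesis using Q by (simp add: cotangent_bundle_def)
qed

lemma in_C0_curves:
 assumes N: "N >= N0" and i: "AE x in UI. q 0 x = q0 x" "AE x in UI. p 0 x = p0 x"
 shows "(pn N, qn N) \<in> C0_curves p0 q0"
proof -
 have "L2_curve (pn N)" "L2_curve (qn N)"
  using H1_has_tderiv[OF H1_n(1)[OF N]] H1_has_tderiv[OF H1_n(3)[OF N]] by (auto simp: has_tderiv_def)
 moreover have "has_tderiv (qn N) (wn N)" "has_tderiv (wn N) (zn N)" by (intro H1_has_tderiv H1_n N)+
 moreover have "AE x\<in>I in lborel. qn N 0 x = q0 x"
  unfolding UI_AE[symmetric] using i(1) AE_space by eventually_elim (use initial(1)[OF N0(1)[OF N]] in auto)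
 moreover have "AE x\<in>I in lborel. pn N 0 x = p0 x"
  unfolding UI_AE[symmetric] using i(2) AE_space by eventually_elim (use initial(2)[OF N0(1)[OF N]] in auto)
 moreover have "AE x\<in>I in lborel. wn N t x = eta (qn N t) x * pn N t x" if t: "t \<in> I" for t
  unfolding UI_AE[symmetric]
 proof (rule AE_I2)
  fix x assume "x \<in> space UI"
  then have x: "x \<in> I" by simp
  show "wn N t x = eta (qn N t) x * pn N t x"
   using eta_eq[OF N t x] \<theta>_pos(3)[OF N t x] by (simp add: pn_def)
 qed
 ultimately show ?thesis
  using in_cotangent_bundle[OF N] unfolding C0_curves_def mem_Collect_eq case_prod_conv by blast
qed

end

section \<open>The force as an operator on eta, and the substitution y = phi(x)\<close>

subsection \<open>The force term\<close>

text \<open>The correction terms are affine in phi with coefficients linear in (c1, c2). The entries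
  \<open>mi\<close> of the inverse matrix stay symbolic; continuity and a bound are what the limit
  takes from them.\<close>

definition lin :: "real => real => real => real" where
 "lin c1 c2 s = (vector [1, s] :: real^2) \<bullet> (matrix_inv H2_mat *v vector [c1, c2])"

definition mi :: "2 => 2 => real" where "mi i j = matrix_inv H2_mat $ i $ j"

lemma lin_eq: "lin c1 c2 s = (mi 1 1 * c1 + mi 1 2 * c2) + s * (mi 2 1 * c1 + mi 2 2 * c2)"
 by (simp add: lin_def mi_def inner_vec_def sum_2 matrix_vector_mult_def)

lemma lin_tendsto:
 assumes "(%n. c1 n) ----> d1" "(%n. c2 n) ----> d2" "(%n. s n) ----> r"
 shows "(%n. lin (c1 n) (c2 n) (s n)) ----> lin d1 d2 r"
 unfolding lin_eq by (intro tendsto_intros assms)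

definition mn :: real where "mn = \<bar>mi 1 1\<bar> + \<bar>mi 1 2\<bar> + \<bar>mi 2 1\<bar> + \<bar>mi 2 2\<bar>"

lemma lin_bound:
 assumes "\<bar>c1\<bar> <= B1" "\<bar>c2\<bar> <= B2" "\<bar>s\<bar> <= B" shows "\<bar>lin c1 c2 s\<bar> <= mn * (B1 + B2) * (1 + B)"
proof -
 have B: "0 <= B1" "0 <= B2" "0 <= B" using assms by linarith+
 have *: "\<bar>x * c1 + y * c2\<bar> <= mn * (B1 + B2)" if "\<bar>x\<bar> <= mn" "\<bar>y\<bar> <= mn" for x y
 proof -
  have "\<bar>x * c1\<bar> <= mn * B1" "\<bar>y * c2\<bar> <= mn * B2" unfolding abs_mult using that assms B by (auto intro!: mult_mono)
  then show ?thesis unfolding distrib_left by linarith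
 qed
 have 1: "\<bar>mi 1 1 * c1 + mi 1 2 * c2\<bar> <= mn * (B1 + B2)" by (rule *) (auto simp: mn_def)
 have 2: "\<bar>mi 2 1 * c1 + mi 2 2 * c2\<bar> <= mn * (B1 + B2)" by (rule *) (auto simp: mn_def)
 have "\<bar>s * (mi 2 1 * c1 + mi 2 2 * c2)\<bar> <= B * (mn * (B1 + B2))"
  unfolding abs_mult using 2 assms(3) B by (intro mult_mono) auto
 with 1 show ?thesis unfolding lin_eq by (simp add: algebra_simps)
qed

text \<open>With h = eta and U the potential this is U - pi2 - pi1, the projection of U minus the
  affine term with scalar b. The momentum and q enter only through h, U and b.\<close>

definition Fop :: "(real => real) => (real => real) => real => real => real" where
 "Fop h U b x = U x - lin (LINT y|UI. U y * h y) (LINT y|UI. U y * prim h y * h y) (prim h x) - lin 0 b (prim h x)"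

lemma Fop_cong:
 assumes "!!x. x \<in> I ==> h x = h' x" "!!x. x \<in> I ==> U x = U' x" "x \<in> I"
 shows "Fop h U b x = Fop h' U' b x"
proof -
 have p: "prim h y = prim h' y" if "y \<in> I" for y by (rule prim_cong) (use that assms in auto)
 have "(LINT y|UI. U y * h y) = (LINT y|UI. U' y * h' y)" "(LINT y|UI. U y * prim h y * h y) = (LINT y|UI. U' y * prim h' y * h' y)"
  by (intro LINT_cong; simp add: assms p)+
 then show ?thesis using assms p[OF assms(3)] by (simp add: Fop_def)
qed

lemma Fop_bound:
 assumes h: "continuous_on I h" "!!x. x \<in> I ==> \<bar>h x\<bar> <= B"
  and U: "U \<in> bm UI" "!!x. x \<in> I ==> \<bar>U x\<bar> <= B'" and b: "\<bar>b\<bar> <= B''" and x: "x \<in> I"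
 shows "\<bar>Fop h U b x\<bar> <= B' + mn * (B' * B + B' * B * B) * (1 + B) + mn * (0 + B'') * (1 + B)"
proof -
 have B: "0 <= B" "0 <= B'" using h(2)[OF x] U(2)[OF x] by linarith+
 have [measurable]: "U \<in> bm UI" "h \<in> bm UI" "prim h \<in> bm UI"
  using U(1) continuous_measurable_UI[OF h(1)] prim_measurable_in by auto
 have ih: "integrable UI h" by (rule continuous_integrable_UI[OF h(1)])
 have ph: "\<bar>prim h y\<bar> <= B" if y: "y \<in> I" for y
 proof -
  have "l2 UI h" by (rule l2_bound[OF UI.l2_const[of B]]) (use h B in auto)
  moreover have "AE x in UI. \<bar>h x\<bar> <= B" by (rule AE_I2) (use h in auto)
  then have "nrm UI h <= B" using nrm_mono[OF UI.l2_const[of B], of h] B by simp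
  ultimately show ?thesis using prim_abs_le_nrm[of h y] y by linarith
 qed
 have *: "\<bar>LINT y|UI. f y\<bar> <= c" if "f \<in> bm UI" "!!y. y \<in> I ==> \<bar>f y\<bar> <= c" for f :: "real => real" and c
 proof -
  have c: "0 <= c" using that(2)[of 0] by (rule order_trans[OF abs_ge_zero]) simp
  have i: "integrable UI f" by (rule UI.integrable_const_bound[where B=c]) (use that in auto)
  have "\<bar>LINT y|UI. f y\<bar> <= (LINT y|UI. \<bar>f y\<bar>)" using integral_norm_bound[of UI f] by simp
  also have "... <= (LINT y|UI. c)" by (rule integral_mono) (use i that in auto)
  finally show ?thesis by simp
 qed
 have 1: "\<bar>LINT y|UI. U y * h y\<bar> <= B' * B"
  by (rule *) (use U h B in "auto simp: abs_mult intro!: mult_mono")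
 have 2: "\<bar>LINT y|UI. U y * prim h y * h y\<bar> <= B' * B * B"
  by (rule *) (use U h ph B in "auto simp: abs_mult intro!: mult_mono")
 have "\<bar>lin (LINT y|UI. U y * h y) (LINT y|UI. U y * prim h y * h y) (prim h x)\<bar> <= mn * (B' * B + B' * B * B) * (1 + B)"
  by (rule lin_bound[OF 1 2 ph[OF x]])
 moreover have "\<bar>lin 0 b (prim h x)\<bar> <= mn * (0 + B'') * (1 + B)"
  by (rule lin_bound[OF _ b ph[OF x]]) simp
 ultimately show ?thesis using U(2)[OF x] unfolding Fop_def by linarith
qed

lemma Fop_tendsto:
 fixes h :: "nat => real => real"
 assumes h: "!!n. h n \<in> bm UI" "!!n x. x \<in> I ==> \<bar>h n x\<bar> <= B" "!!x. x \<in> I ==> (%n. h n x) ----> h' x"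
  and U: "!!n. U n \<in> bm UI" "!!n x. x \<in> I ==> \<bar>U n x\<bar> <= B'" "AE x in UI. (%n. U n x) ----> U' x"
  and m: "h' \<in> bm UI" "U' \<in> bm UI"
  and b: "b ----> b'"
 shows "AE x in UI. (%n. Fop (h n) (U n) (b n) x) ----> Fop h' U' b' x"
proof -
 have B: "0 <= B" "0 <= B'" using h(2)[of 0 0] U(2)[of 0 0] by (auto intro: order_trans[OF abs_ge_zero])
 have ph: "(%n. prim (h n) x) ----> prim h' x" if "x \<in> I" for x
  by (rule prim_tendsto[where C=B]) (use that h m in auto)
 have pb: "\<bar>prim (h n) y\<bar> <= B" if y: "y \<in> I" for n y
 proof -
  have "l2 UI (h n)" by (rule l2_bound[OF UI.l2_const[of B]]) (use h B in auto)
  moreover have "AE x in UI. \<bar>h n x\<bar> <= B" by (rule AE_I2) (use h in auto)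
  then have "nrm UI (h n) <= B" using nrm_mono[OF UI.l2_const[of B], of "h n"] h(1) B by simp
  ultimately show ?thesis using prim_abs_le_nrm[of "h n" y] y by linarith
 qed
 note pm = prim_measurable_in[OF h(1)] prim_measurable_in[OF m(1)]
 have 1: "(%n. LINT y|UI. U n y * h n y) ----> (LINT y|UI. U' y * h' y)"
 proof (rule integral_dominated_convergence[where w="%_. B' * B"])
  show "AE y in UI. (%n. U n y * h n y) ----> U' y * h' y"
   using U(3) AE_space by eventually_elim (auto intro!: tendsto_mult h)
  show "AE y in UI. norm (U n y * h n y) <= B' * B" for n
   using U(2) h(2) B by (intro AE_I2) (auto simp: abs_mult intro!: mult_mono)
 qed (use U h m in auto)
 have 2: "(%n. LINT y|UI. U n y * prim (h n) y * h n y) ----> (LINT y|UI. U' y * prim h' y * h' y)"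
 proof (rule integral_dominated_convergence[where w="%_. B' * B * B"])
  show "AE y in UI. (%n. U n y * prim (h n) y * h n y) ----> U' y * prim h' y * h' y"
   using U(3) AE_space by eventually_elim (auto intro!: tendsto_mult h ph)
  show "AE y in UI. norm (U n y * prim (h n) y * h n y) <= B' * B * B" for n
   using U(2) h(2) pb B by (intro AE_I2) (auto simp: abs_mult intro!: mult_mono)
 qed (use U h m pm in auto)
 show ?thesis
  using U(3) AE_space
 proof eventually_elim
  case (elim x)
  then have x: "x \<in> I" by simp
  show ?case unfolding Fop_def by (intro tendsto_diff elim lin_tendsto 1 2 ph[OF x] b tendsto_const)
 qed
qed

lemma m2_Fop:
 assumes "m2 h" "m2 U" "b \<in> bm UI" shows "m2 (%t x. Fop (h t) (U t) (b t) x)"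
 unfolding Fop_def lin_eq mult.assoc
 by (intro m2_arith m2_prim_x assms m2_fun(2) borel_measurable_const
   borel_measurable_add borel_measurable_times m2_integral_x)

text \<open>The scalar b in \<open>pi1\<close> after the change of variables y = phi(x), where r is
  the primitive of p eta and h = eta is the Jacobian.\<close>

definition bfun :: "(real => real) => (real => real) => real" where
 "bfun r h = 3/2 * (LINT x|UI. (r x)^2 * h x)"

text \<open>The primitive of a positive h with total mass 1 is an increasing homeomorphism of the
  unit interval, and it maps h dx to dx because the distribution functions agree.\<close>

lemma phi_substitution:
 assumes h: "continuous_on I h" "!!x. x \<in> I ==> 0 < h x" "prim h 1 = 1"
  and f: "f \<in> bm UI"
 shows "(LINT y|UI. f (the_inv_into I (prim h) y)) = (LINT x|UI. f x * h x)"
  and "(%y. f (the_inv_into I (prim h) y)) \<in> bm UI"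
  and "x \<in> I ==> the_inv_into I (prim h) (prim h x) = x"
  and "y \<in> I ==> the_inv_into I (prim h) y \<in> I & prim h (the_inv_into I (prim h) y) = y"
proof -
 let ?\<phi> = "prim h" and ?\<psi> = "the_inv_into I (prim h)"
 have ih: "integrable UI h" by (rule continuous_integrable_UI[OF h(1)])
 have hm: "h \<in> bm UI" using ih by auto
 have mono: "?\<phi> x < ?\<phi> y" if xy: "0 <= x" "x < y" "y <= 1" for x y
 proof -
  obtain c where c: "c \<in> {x..y}" "!!u. u \<in> {x..y} ==> h c <= h u"
   using continuous_attains_inf[of "{x..y}" h] continuous_on_subset[OF h(1), of "{x..y}"] xy by fastforce
  have hc: "h c > 0" using c(1) xy h(2) by auto
  have "?\<phi> y - ?\<phi> x = (LINT u|UI. (if x < u & u <= y then h u else 0))" by (rule prim_increment) (use xy ih in auto)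
  also have "... >= (LINT u|UI. (if x < u & u <= y then h c else 0))"
  proof (rule integral_mono)
   show "integrable UI (%u. if x < u & u <= y then h c else 0)" by (rule UI.integrable_const_bound[where B="\<bar>h c\<bar>"]) auto
   show "integrable UI (%u. if x < u & u <= y then h u else 0)"
    by (rule intble_bound[OF ih]) (use hm in auto)
  qed (use c in auto)
  also have "(LINT u|UI. (if x < u & u <= y then h c else 0)) = h c * (y - x)"
   using prim_increment[of x y "%_. h c"] xy by (simp add: prim_const algebra_simps)
  finally show ?thesis using hc xy by (smt (verit) mult_pos_pos)
 qed
 have inj: "inj_on ?\<phi> I"
  by (rule inj_onI) (metis atLeastAtMost_iff linorder_neqE mono order_less_irrefl)
 have cont: "continuous_on I ?\<phi>" by (rule prim_continuous[OF ih])
 have img: "?\<phi> ` I = I"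
 proof
  show "?\<phi> ` I \<subseteq> I"
  proof (clarsimp, intro conjI)
   fix x :: real assume "0 <= x" "x <= 1"
   then show "0 <= ?\<phi> x" using mono[of 0 x] by (cases "x = 0") auto
   show "?\<phi> x <= 1" using mono[of x 1] \<open>0 <= x\<close> \<open>x <= 1\<close> h(3) by (cases "x = 1") auto
  qed
  show "I \<subseteq> ?\<phi> ` I"
  proof
   fix y :: real assume "y \<in> I"
   then obtain x where "0 <= x" "x <= 1" "?\<phi> x = y"
    using IVT'[of ?\<phi> 0 y 1] cont h(3) by auto
   then show "y \<in> ?\<phi> ` I" by auto
  qed
 qed
 show inv1: "?\<psi> (?\<phi> x) = x" if "x \<in> I" for x by (rule the_inv_into_f_f[OF inj that])
 show inv2: "?\<psi> y \<in> I & ?\<phi> (?\<psi> y) = y" if "y \<in> I" for y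
  using the_inv_into_into[OF inj, of y "I"] f_the_inv_into_f[OF inj, of y] img that by auto
 have contp: "continuous_on I ?\<psi>"
  using continuous_on_inv[OF cont compact_Icc, of ?\<psi>] inv1 img by auto
 have \<psi>m: "?\<psi> \<in> measurable UI UI"
  unfolding measurable_cong_sets[OF refl sets_UI]
  by (rule measurable_restrict_space2) (use inv2 continuous_measurable_UI[OF contp] in auto)
 show fm: "(%y. f (?\<psi> y)) \<in> bm UI" by (rule measurable_compose[OF \<psi>m f])
 have \<phi>m: "?\<phi> \<in> measurable (density UI (%x. ennreal (h x))) UI"
  unfolding measurable_cong_sets[OF refl sets_UI] measurable_density_eq1
  by (rule measurable_restrict_space2) (use img continuous_measurable_UI[OF cont] in auto)
 have "distr (density UI (%x. ennreal (h x))) UI ?\<phi> = UI" (is "?D = UI")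
 proof (rule interval_measure_eqI)
  \<comment> \<open>The preimage of the points up to b consists of the points up to the inverse
    image of b, and the h-mass of these is b.\<close>
  have cdf: "emeasure ?D ({..b} Int I) = ennreal b" if b: "b \<in> I" for b
  proof -
   have bs: "{..b} Int I \<in> sets UI" by (auto simp: sets_UI sets_restrict_space_iff simp del: Int_atLeastAtMostL1 Int_atLeastAtMostL2 Int_atLeastAtMostR1 Int_atLeastAtMostR2)
   have vs: "?\<phi> -` ({..b} Int I) Int I = {..?\<psi> b} Int I"
   proof (intro equalityI subsetI)
    fix x assume "x \<in> ?\<phi> -` ({..b} Int I) Int I"
    then show "x \<in> {..?\<psi> b} Int I" using mono[of "?\<psi> b" x] inv2[OF b] by (auto simp: not_le[symmetric])
   next
    fix x assume "x \<in> {..?\<psi> b} Int I"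
    then show "x \<in> ?\<phi> -` ({..b} Int I) Int I" using mono[of x "?\<psi> b"] inv2[OF b] img b
     by (cases "x = ?\<psi> b") force+
   qed
   have vb: "{..?\<psi> b} Int I \<in> sets UI" by (auto simp: sets_UI sets_restrict_space_iff simp del: Int_atLeastAtMostL1 Int_atLeastAtMostL2 Int_atLeastAtMostR1 Int_atLeastAtMostR2)
   have "emeasure ?D ({..b} Int I) = emeasure (density UI (%x. ennreal (h x))) (?\<phi> -` ({..b} Int I) Int I)"
    using emeasure_distr[OF \<phi>m bs] by (simp only: space_density space_UI)
   also have "... = (\<integral>\<^sup>+ x. ennreal (h x) * indicator ({..?\<psi> b} Int I) x \<partial>UI)"
    unfolding vs by (rule emeasure_density) (use hm vb in auto)
   also have "... = (\<integral>\<^sup>+ x. ennreal (if x <= ?\<psi> b then h x else 0) \<partial>UI)"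
    by (intro nn_integral_cong) (auto split: split_indicator)
   also have "... = ennreal (LINT x|UI. (if x <= ?\<psi> b then h x else 0))"
    by (rule nn_integral_eq_integral) (use h ih in "auto intro!: integrable_prim_aux AE_I2 simp: less_imp_le")
   also have "... = ennreal b" using inv2[OF b] prim_eq[of "?\<psi> b" h] by simp
   finally show ?thesis .
  qed
  have cdfU: "emeasure UI ({..b} Int I) = ennreal b" if b: "b \<in> I" for b
   using b by (simp add: emeasure_UI)
  show "sets ?D = sets (restrict_space borel I)" by (simp add: sets_UI)
  show "sets UI = sets (restrict_space borel I)" by (rule sets_UI)
  show "finite_measure ?D" using cdf[of 1] by (intro finite_measureI) (simp add: Int_absorb1)
  fix b :: real
  show "emeasure ?D ({..b} Int I) = emeasure UI ({..b} Int I)"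
  proof (cases "b < 0")
   case True then have "{..b} Int I = {}" by auto
   then show ?thesis by (simp only: emeasure_empty)
  next
   case False
   then have "{..b} Int I = {..min b 1} Int I" "min b 1 \<in> I" by auto
   then show ?thesis using cdf[of "min b 1"] cdfU[of "min b 1"] by (simp only:)
  qed
 qed
 then have "(LINT y|UI. f (?\<psi> y)) = (LINT y|?D. f (?\<psi> y))" by simp
 also have "... = (LINT x|density UI (%x. ennreal (h x)). f (?\<psi> (?\<phi> x)))" by (rule integral_distr[OF \<phi>m fm])
 also have "... = (LINT x|UI. h x *\<^sub>R f (?\<psi> (?\<phi> x)))"
 proof (rule integral_density)
  have "(%x. f (?\<psi> (?\<phi> x))) \<in> borel_measurable (density UI (%x. ennreal (h x)))" by (rule measurable_compose[OF \<phi>m fm])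
  then show "(%x. f (?\<psi> (?\<phi> x))) \<in> bm UI" by (simp only: measurable_density_eq1)
  show "AE x in UI. 0 <= h x" by (rule AE_I2) (use h(2) in "auto simp: less_imp_le")
 qed (rule hm)
 also have "... = (LINT x|UI. f x * h x)" by (intro LINT_cong) (auto simp: inv1 mult.commute)
 finally show "(LINT y|UI. f (?\<psi> y)) = (LINT x|UI. f x * h x)" .
qed

text \<open>Two substitutions: the inner one turns the primitive of p composed with the inverse of
  phi into the primitive of p eta, the outer one produces the weight eta.\<close>

lemma pi1_eq:
 assumes q: "l2 UI q" "prim (eta q) 1 = 1" and p: "p \<in> bm UI"
 shows "pi1 p q x = lin 0 (bfun (prim (%y. p y * eta q y)) (eta q)) (phi q x)"
proof -
 have ph: "phi q = prim (eta q)" by (simp add: phi_def[abs_def] prim_def[abs_def])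
 have c: "continuous_on I (eta q)"
  unfolding eta_def[abs_def] prim_def[symmetric] by (intro continuous_on_exp prim_continuous UI.l2_integrable q)
 have pos: "0 < eta q x" for x by (simp add: eta_def)
 let ?\<psi> = "the_inv_into I (prim (eta q))"
 have [measurable]: "p \<in> bm UI" "eta q \<in> bm UI" using p continuous_measurable_UI[OF c] by auto
 note s = phi_substitution[OF c pos q(2)]
 have inner: "(LINT y:{0..z}|lborel. p (?\<psi> y)) = prim (%y. p y * eta q y) (?\<psi> z)" if z: "z \<in> I" for z
 proof -
  have z': "?\<psi> z \<in> I" "prim (eta q) (?\<psi> z) = z" using s(4)[OF p z] by auto
  \<comment> \<open>The cut-off is expressed through phi, so that the truncated integrand has the
    form required by the substitution.\<close>
  define f where "f u = (if prim (eta q) u <= z then p u else 0)" for u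
  have fm: "f \<in> bm UI"
   unfolding f_def[abs_def] using prim_measurable_in[of "eta q"] by measurable
  have "(LINT y:{0..z}|lborel. p (?\<psi> y)) = prim (%y. p (?\<psi> y)) z" by (simp add: prim_def)
  also have "... = (LINT y|UI. (if y <= z then p (?\<psi> y) else 0))" using z by (simp add: prim_eq)
  also have "... = (LINT y|UI. f (?\<psi> y))"
   by (intro LINT_cong) (use s(4)[OF p] in "auto simp: f_def")
  also have "... = (LINT u|UI. f u * eta q u)" by (rule s(1)[OF fm])
  also have "... = (LINT u|UI. (if u <= ?\<psi> z then p u * eta q u else 0))"
  proof (intro LINT_cong refl)
   fix u assume "u \<in> space UI"
   then have u: "u \<in> I" by simp
   have "prim (eta q) u <= z \<longleftrightarrow> u <= ?\<psi> z"
   proof -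
    have m: "prim (eta q) a <= prim (eta q) b" if "a \<in> I" "b \<in> I" "a <= b" for a b
    proof -
     have "0 <= (LINT y|UI. (if a < y & y <= b then eta q y else 0))" using pos by (intro integral_nonneg_AE AE_I2) (auto simp: less_imp_le)
     then show ?thesis using prim_increment[of a b "eta q"] that continuous_integrable_UI[OF c] by simp
    qed
    show ?thesis
    proof
     assume le: "prim (eta q) u <= z"
     show "u <= ?\<psi> z"
     proof (rule ccontr)
      assume n: "\<not> u <= ?\<psi> z"
      then have "z <= prim (eta q) u" using m[OF z'(1) u] z'(2) by simp
      with le have "prim (eta q) u = z" by simp
      with s(3)[OF p u] n show False by simp
     qed
    next
     assume "u <= ?\<psi> z" then show "prim (eta q) u <= z" using m[OF u z'(1)] z'(2) by simp
    qed
   qed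
   then show "f u * eta q u = (if u <= ?\<psi> z then p u * eta q u else 0)" by (simp add: f_def)
  qed
  also have "... = prim (%y. p y * eta q y) (?\<psi> z)" using z' by (simp add: prim_eq)
  finally show ?thesis .
 qed
 have pm: "(%y. (prim (%y. p y * eta q y) y)^2) \<in> bm UI"
  using prim_measurable_in[of "%y. p y * eta q y"] by measurable
 have "(LINT z:I|lborel. (LINT y:{0..z}|lborel. p (?\<psi> y))^2) = (LINT z|UI. (LINT y:{0..z}|lborel. p (?\<psi> y))^2)"
  by (simp add: UI_integral)
 also have "... = (LINT z|UI. (prim (%y. p y * eta q y) (?\<psi> z))^2)"
  by (intro LINT_cong) (auto simp: inner)
 also have "... = (LINT x|UI. (prim (%y. p y * eta q y) x)^2 * eta q x)" by (rule s(1)[OF pm])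
 finally have e: "(LINT z:I|lborel. (LINT y:{0..z}|lborel. p (?\<psi> y))^2) = (LINT x|UI. (prim (%y. p y * eta q y) x)^2 * eta q x)" .
 show ?thesis unfolding pi1_def Let_def ph e lin_def bfun_def ..
qed

lemma proj_star_eq:
 assumes "x \<in> I"
 shows "proj_star q U x - lin 0 b (phi q x) = Fop (eta q) U b x"
proof -
 have ph: "phi q = prim (eta q)" by (simp add: phi_def[abs_def] prim_def[abs_def])
 show ?thesis
  unfolding proj_star_def lin_def[symmetric] eta_inner_def ph Fop_def UI_integral by simp
qed

section \<open>Convergence of the curves, the forces and the functional\<close>

subsection \<open>Passage to the limit\<close>

lemma set_integral_tail:
 fixes f :: "real => real"
 assumes "x \<in> I" shows "(LINT y:{x..1}|lborel. f y) = (LINT y|UI. (if x <= y then f y else 0))"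
 unfolding UI_integral set_lebesgue_integral_def using assms
 by (intro LINT_cong refl) (auto split: split_indicator)

lemma m2_tail: assumes "m2 u" shows "m2 (%t x. LINT y|UI. (if x <= y then u t y else 0))"
proof -
 have [measurable]: "(%w. u (fst (fst w)) (snd w)) \<in> borel_measurable (UU \<Otimes>\<^sub>M UI)"
  by (rule m2_compose[OF assms]) measurable
 show ?thesis unfolding m2_def by measurable
qed

lemma tail_integrable:
 fixes f :: "real => real"
 assumes "integrable UI f" shows "integrable UI (%y. if x <= y then f y else 0)"
 by (rule intble_bound[OF assms]) (use borel_measurable_integrable[OF assms] in auto)

lemma tail_le:
 fixes f :: "real => real"
 assumes "integrable UI f" shows "\<bar>LINT y|UI. (if x <= y then f y else 0)\<bar> <= (LINT y|UI. \<bar>f y\<bar>)"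
proof -
 have "\<bar>LINT y|UI. (if x <= y then f y else 0)\<bar> <= (LINT y|UI. \<bar>if x <= y then f y else 0\<bar>)"
  using integral_norm_bound[of UI "%y. if x <= y then f y else 0"] by simp
 also have "... <= (LINT y|UI. \<bar>f y\<bar>)"
  by (rule integral_mono) (use assms in "auto intro!: tail_integrable integrable_abs")
 finally show ?thesis .
qed

lemma ap_tendsto:
 assumes "ap G (%N t x. X t x) u (%N. u0)" "!!N. N >= n0 ==> G N t x"
 shows "(%N. u N t x) ----> u0 t x"
proof -
 obtain c where c: "!!N. N >= n0 ==> \<bar>u N t x - u0 t x\<bar> <= c * X t x / sqrt N"
  using assms unfolding ap_def by blast
 have "(%N. u N t x - u0 t x) ----> 0"
 proof (rule Lim_null_comparison)
  show "\<forall>\<^sub>F N in sequentially. norm (u N t x - u0 t x) <= c * X t x / sqrt N"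
   using c unfolding eventually_sequentially by auto
  show "(%N. c * X t x / sqrt (real N)) ----> 0"
   by (rule over_sqrt_tendsto)
 qed
 then show ?thesis by (simp add: LIM_zero_iff)
qed

context base_curve
begin

definition "Up t x = (LINT y|UI. (if x <= y then et t y * (p t y)^2 else 0))"
text \<open>The limit force. The argument is a function of (t, x), the tail integral of eta against
  the slice of the defect; \<open>Up\<close> is the corresponding tail for p^2, and 1/2 is the
  factor in the definition of the potential.\<close>

definition "force \<kappa> t x = Fop (et t) (%x. 1/2 * (Up t x + \<kappa> t x)) (bfun (R t) (et t)) x"

lemma m2_Up: "m2 Up"
 unfolding Up_def[abs_def] by (intro m2_tail m2_arith m2_unary m2s)

lemma m2_force: assumes "m2 \<kappa>" shows "m2 (force \<kappa>)"
 unfolding force_def[abs_def] bfun_def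
 by (intro m2_Fop m2_unary m2_arith m2_Up assms m2s borel_measurable_times borel_measurable_const m2_integral_x)

end

text \<open>Square integrability of z at every time makes the asymptotics valid at every time,
  including t = 1 where the penalization is evaluated.\<close>

locale regular_perturbation = constrained_perturbation +
 assumes z_all: "!!t. t \<in> I ==> l2 UI (z t)"
begin

lemma G_all: "N >= N0 ==> t \<in> I ==> x \<in> I ==> G N t x"
 by (simp add: G_def z_all)

lemma M_l2: "N >= N0 ==> t \<in> I ==> l2 UI (M N t)" and M_nrm: "N >= N0 ==> t \<in> I ==> nrm UI (M N t) <= CM"
 using W_parts(2,3) N0(1) by (auto simp: CM_def)

lemma M_square: assumes "N >= N0" "t \<in> I" shows "(LINT x|UI. M N t x * M N t x) <= CM^2"
proof -
 have "(LINT x|UI. M N t x * M N t x) = (nrm UI (M N t))^2" unfolding nrm_square by (simp add: power2_eq_square)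
 also have "... <= CM^2" by (rule power_mono[OF M_nrm[OF assms]]) simp
 finally show ?thesis .
qed

lemma quadratic_bound:
 assumes N: "N >= N0" and t: "t \<in> I" and d: "d \<in> bm UI"
  and b: "!!x. x \<in> I ==> \<bar>d x\<bar> <= c * (M N t x * M N t x)" and c: "c >= 0"
 shows "integrable UI d" "(LINT x|UI. \<bar>d x\<bar>) <= c * CM^2"
proof -
 have i: "integrable UI (%x. c * (M N t x * M N t x))"
  by (intro integrable_mult_right l2_mult_integrable M_l2 N t)
 show id: "integrable UI d"
  by (rule intble_bound[OF i d]) (use b in "auto intro!: AE_I2 order_trans[OF _ abs_ge_self]")
 have "(LINT x|UI. \<bar>d x\<bar>) <= (LINT x|UI. c * (M N t x * M N t x))"
  by (rule integral_mono[OF integrable_abs[OF id] i]) (use b in auto)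
 also have "... <= c * CM^2" using M_square[OF N t] c by (simp add: mult_left_mono)
 finally show "(LINT x|UI. \<bar>d x\<bar>) <= c * CM^2" .
qed

lemma a_osc: "t \<in> I ==> bounded_osc (%N k. a N k t) A"
 by unfold_locales (rule a_nrm)

lemma D_osc: "t \<in> I ==> bounded_osc (%N k. D N k t) (K * A)"
 by unfold_locales (rule D_nrm)

text \<open>The deviation from u0 plus oscillation is O(M / sqrt N), hence small in L2, and the
  oscillation itself is weakly null.\<close>

lemma weak_limit:
 assumes u: "ap G M u (%N t x. u0 t x + b N (idx N x) t * walsh N x)" and t: "t \<in> I"
  and l: "!!N. N >= N0 ==> l2 UI (u N t)" "l2 UI (u0 t)" and b: "bounded_osc (%N k. b N k t) B" and f: "l2 UI f"
 shows "(%N. LINT x|UI. u N t x * f x) ----> (LINT x|UI. u0 t x * f x)"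
proof -
 obtain c where c: "c >= 0" "!!N t x. G N t x ==> \<bar>u N t x - (u0 t x + b N (idx N x) t * walsh N x)\<bar> <= c * M N t x / sqrt N"
  using u unfolding ap_def by blast
 let ?o = "%N. osc N (%k. b N k t)"
 let ?d = "%N x. (u N t x - u0 t x) - ?o N x"
 have ld: "l2 UI (?d N)" if N: "N >= N0" for N by (intro l2_diff l l2_osc N0 N)
 have *: "\<bar>LINT x|UI. ?d N x * f x\<bar> <= c * CM * nrm UI f / sqrt N" if N: "N >= N0" for N
 proof -
  have "nrm UI (?d N) <= nrm UI (%x. (c / sqrt N) * M N t x)"
  proof (rule nrm_mono[OF l2_cmult[OF M_l2[OF N t]] l2_measurable[OF ld[OF N]]], rule AE_I2)
   fix x assume "x \<in> space UI"
   then have "\<bar>?d N x\<bar> <= (c / sqrt N) * M N t x" using c(2)[OF G_all[OF N t], of x] by (simp add: osc_def algebra_simps)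
   then show "\<bar>?d N x\<bar> <= \<bar>(c / sqrt N) * M N t x\<bar>" by linarith
  qed
  also have "... <= (c / sqrt N) * CM"
   unfolding nrm_cmult using c(1) M_nrm[OF N t] by (auto intro!: mult_left_mono divide_right_mono)
  finally have "nrm UI (?d N) * nrm UI f <= (c / sqrt N) * CM * nrm UI f" by (rule mult_right_mono) simp
  with Cauchy_Schwarz_l2[OF ld[OF N] f] show ?thesis by simp
 qed
 have "(%N. LINT x|UI. ?d N x * f x) ----> 0"
  by (rule Lim_null_comparison[OF _ over_sqrt_tendsto[of "c * CM * nrm UI f"]])
    (use * in "auto simp: eventually_sequentially")
 from tendsto_add[OF tendsto_add[OF this bounded_osc.osc_weak_null[OF b f]] tendsto_const[of "LINT x|UI. u0 t x * f x"]]
 have L: "(%N. (LINT x|UI. ?d N x * f x) + (LINT x|UI. f x * ?o N x) + (LINT x|UI. u0 t x * f x)) ----> (LINT x|UI. u0 t x * f x)" by simp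
 show ?thesis
 proof (rule Lim_transform_eventually[OF L], unfold eventually_sequentially, intro exI allI impI)
  fix N assume N: "N >= N0"
  have i: "integrable UI (%x. ?d N x * f x)" "integrable UI (%x. f x * ?o N x)" "integrable UI (%x. u0 t x * f x)"
   by (intro l2_mult_integrable ld f l l2_osc N0 N)+
  show "(LINT x|UI. ?d N x * f x) + (LINT x|UI. f x * ?o N x) + (LINT x|UI. u0 t x * f x) = (LINT x|UI. u N t x * f x)"
   unfolding LINT_add[OF i(1,2), symmetric]
   unfolding LINT_add[OF intble_add[OF i(1,2)] i(3), symmetric]
   by (simp add: algebra_simps)
 qed
qed

lemma pn_weak: assumes "t \<in> I" "l2 UI f"
 shows "(%N. LINT x|UI. pn N t x * f x) ----> (LINT x|UI. p t x * f x)"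
 by (rule weak_limit[where u=pn and ?u0.0=p and b=a, OF _ assms(1) n_l2(3)[OF _ assms(1)] p_l2(1)[OF assms(1)] a_osc[OF assms(1)] assms(2)])
   (use ap_pn in "simp_all add: aw_def")

lemma qn_weak: assumes "t \<in> I" "l2 UI f"
 shows "(%N. LINT x|UI. qn N t x * f x) ----> (LINT x|UI. q t x * f x)"
 by (rule weak_limit[where u=qn and ?u0.0=q and b=D, OF _ assms(1) n_l2(1)[OF _ assms(1)] q_l2[OF assms(1)] D_osc[OF assms(1)] assms(2)])
   (use ap_qn in "simp_all add: Dw_def")

definition "uN N t x = 1/2 * (LINT y|UI. (if x <= y then pn N t y * pn N t y * \<theta> N t y else 0))"
text \<open>Since walsh squares to 1, this is all that the square of the oscillation leaves in the
  tail integral.\<close>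

definition "Ea N t x = (LINT y|UI. (if x <= y then et t y * (a N (idx N y) t)^2 else 0))"

lemma ap_U: "ap G (%N t x. M N t x * M N t x) (%N t x. pn N t x * pn N t x * \<theta> N t x)
  (%N t x. (p t x + aw N t x) * (p t x + aw N t x) * et t x)"
 by (intro ap_mult1[OF ap_mult[OF ap_pn ap_pn GA] ap_\<theta> GA])

lemma pp_m: assumes "N >= N0" "t \<in> I"
 shows "(%x. pn N t x * pn N t x * \<theta> N t x) \<in> bm UI"
  "(%x. (p t x + aw N t x) * (p t x + aw N t x) * et t x) \<in> bm UI"
proof -
 note [measurable] = m2_section[OF m2n(10)[OF N0(1)[OF assms(1)]] assms(2)] m2_section[OF m2n(1)[OF N0(1)[OF assms(1)]] assms(2)]
  m2_section[OF m2s(8) assms(2)] m2_section[OF m2s(5) assms(2)] l2_measurable[OF l2_osc[OF N0(1)[OF assms(1)], of "%k. a N k t"]]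
 show "(%x. pn N t x * pn N t x * \<theta> N t x) \<in> bm UI"
  "(%x. (p t x + aw N t x) * (p t x + aw N t x) * et t x) \<in> bm UI"
  unfolding aw_def osc_def[of N "%k. a N k t", symmetric] by measurable
qed

lemma uN_bound: obtains B where "B >= 0" "!!N t x. N >= N0 ==> t \<in> I ==> \<bar>uN N t x\<bar> <= B"
proof -
 obtain c where c: "c >= 0" "!!N t x. G N t x ==> \<bar>pn N t x * pn N t x * \<theta> N t x\<bar> <= c * (M N t x * M N t x)"
  using ap_bound[OF ap_U GA] by blast
 show thesis
 proof (rule that[of "c * CM^2"])
  show "0 <= c * CM^2" using c by simp
  fix N t x assume N: "N >= N0" and t: "t \<in> {0..1 :: real}"
  note qb = quadratic_bound[OF N t pp_m(1)[OF N t] c(2)[OF G_all[OF N t]] c(1)]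
  have "\<bar>LINT y|UI. (if x <= y then pn N t y * pn N t y * \<theta> N t y else 0)\<bar> <= c * CM^2"
   by (rule order_trans[OF tail_le[OF qb(1)] qb(2)])
  then show "\<bar>uN N t x\<bar> <= c * CM^2" unfolding uN_def by linarith
 qed
qed

text \<open>Expand (p + a walsh)^2. The mixed term pairs an oscillation with the fixed function eta
  p cut off below x and tends to 0; the square of the oscillation gives \<open>Ea\<close>; the error
  is O(M^2 / sqrt N), integrable uniformly in N.\<close>

lemma uN_limit:
 assumes t: "t \<in> I" and k: "(%N. Ea N t x) ----> k"
 shows "(%N. uN N t x) ----> 1/2 * (Up t x + k)"
proof -
 obtain c where c: "c >= 0" "!!N t x. G N t x ==> \<bar>pn N t x * pn N t x * \<theta> N t x
   - (p t x + aw N t x) * (p t x + aw N t x) * et t x\<bar> <= c * (M N t x * M N t x) / sqrt N"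
  using ap_U unfolding ap_def by blast
 obtain c' where c': "c' >= 0" "!!N t x. G N t x ==> \<bar>pn N t x * pn N t x * \<theta> N t x\<bar> <= c' * (M N t x * M N t x)"
  using ap_bound[OF ap_U GA] by blast
 let ?P = "%N y. pn N t y * pn N t y * \<theta> N t y" and ?Pz = "%N y. (p t y + aw N t y) * (p t y + aw N t y) * et t y"
 let ?o = "%N. osc N (%k. a N k t)"
 note [measurable] = m2_section[OF m2s(8) t] m2_section[OF m2s(5) t]
 have ol: "l2 UI (?o N)" if "N >= N0" for N by (rule l2_osc[OF N0(1)[OF that]])
 have etl: "l2 UI (%y. et t y * f y)" if "l2 UI f" for f
  by (rule l2_mult_bounded[OF that, where c=K]) (use t et_abs in auto)
 let ?\<psi> = "%y. (if x <= y then et t y * p t y else 0)"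
 have \<psi>l: "l2 UI ?\<psi>" by (rule l2_bound[OF etl[OF p_l2(1)[OF t]]]) auto
 have i0: "integrable UI (%y. et t y * (p t y)^2)" "!!N. N >= N0 ==> integrable UI (%y. et t y * (a N (idx N y) t)^2)"
  using l2_mult_integrable[OF etl[OF p_l2(1)[OF t]] p_l2(1)[OF t]]
   l2_mult_integrable[OF etl[OF l2_idx[OF N0(1)]] l2_idx[OF N0(1)]] by (auto simp: power2_eq_square mult.assoc)
 have d: "\<bar>2 * uN N t x - (Up t x + 2 * (LINT y|UI. ?\<psi> y * ?o N y) + Ea N t x)\<bar> <= c * CM^2 / sqrt N" if N: "N >= N0" for N
 proof -
  have e: "(if x <= y then ?Pz N y else 0) = (if x <= y then et t y * (p t y)^2 else 0) + 2 * (?\<psi> y * ?o N y)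
    + (if x <= y then et t y * (a N (idx N y) t)^2 else 0)" for y
   using walsh_square(2)[of N y]
   by (auto simp: aw_def osc_def power2_eq_square algebra_simps)
  have i\<psi>: "integrable UI (%y. 2 * (?\<psi> y * ?o N y))" by (intro integrable_mult_right l2_mult_integrable \<psi>l ol N)
  note ip = tail_integrable[OF i0(1), of x] and ia = tail_integrable[OF i0(2)[OF N], of x]
  have I0: "(LINT y|UI. (if x <= y then ?Pz N y else 0)) = Up t x + 2 * (LINT y|UI. ?\<psi> y * ?o N y) + Ea N t x"
   unfolding e Up_def Ea_def
   by (simp only: LINT_add[OF intble_add[OF ip i\<psi>] ia]
     LINT_add[OF ip i\<psi>] integral_mult_right_zero)
  note qb = quadratic_bound(1)[OF N t pp_m(1)[OF N t] c'(2)[OF G_all[OF N t]] c'(1)]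
  have qd: "integrable UI (%y. ?P N y - ?Pz N y)" "(LINT y|UI. \<bar>?P N y - ?Pz N y\<bar>) <= c / sqrt N * CM^2"
   by (rule quadratic_bound[OF N t, where c="c / sqrt N"]; use pp_m[OF N t] c(1) c(2)[OF G_all[OF N t]] in simp)+
  have "(LINT y|UI. (if x <= y then ?P N y else 0)) - (LINT y|UI. (if x <= y then ?Pz N y else 0))
    = (LINT y|UI. (if x <= y then ?P N y - ?Pz N y else 0))"
  proof -
   have "integrable UI (%y. if x <= y then ?Pz N y else 0)"
    unfolding e by (intro intble_add ip i\<psi> ia)
   then have "(LINT y|UI. (if x <= y then ?P N y else 0)) - (LINT y|UI. (if x <= y then ?Pz N y else 0))
     = (LINT y|UI. (if x <= y then ?P N y else 0) - (if x <= y then ?Pz N y else 0))"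
    by (subst LINT_diff[OF tail_integrable[OF qb]]) simp_all
   also have "... = (LINT y|UI. (if x <= y then ?P N y - ?Pz N y else 0))"
    by (rule LINT_cong[OF refl]) simp
   finally show ?thesis .
  qed
  with tail_le[OF qd(1), of x] qd(2)
  have "\<bar>(LINT y|UI. (if x <= y then ?P N y else 0)) - (LINT y|UI. (if x <= y then ?Pz N y else 0))\<bar> <= c / sqrt N * CM^2"
   by linarith
  moreover have "2 * uN N t x = (LINT y|UI. (if x <= y then ?P N y else 0))" unfolding uN_def by linarith
  ultimately show ?thesis unfolding I0[symmetric] by (simp only: times_divide_eq_left)
 qed
 have D0: "(%N. 2 * uN N t x - (Up t x + 2 * (LINT y|UI. ?\<psi> y * ?o N y) + Ea N t x)) ----> 0"
  by (rule Lim_null_comparison[OF _ over_sqrt_tendsto[of "c * CM^2"]]) (use d in "auto simp: eventually_sequentially")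
 have "(%N. Up t x + 2 * (LINT y|UI. ?\<psi> y * ?o N y) + Ea N t x) ----> Up t x + 2 * 0 + k"
  by (intro tendsto_add tendsto_mult tendsto_const bounded_osc.osc_weak_null[OF a_osc[OF t] \<psi>l] k)
 from tendsto_add[OF D0 this] have "(%N. 2 * uN N t x) ----> Up t x + k" by simp
 from tendsto_mult[OF tendsto_const[of "1/2"] this] show ?thesis by simp
qed

definition "bN N t = bfun (%x. \<theta>1 N t x / \<theta> N t x) (\<theta> N t)"
definition "FN N t x = Fop (\<theta> N t) (uN N t) (bN N t) x"

lemma force_eq:
 assumes N: "N >= N0" and t: "t \<in> I" and x: "x \<in> I"
 shows "U_fun (%y. (pn N t y)^2) (qn N t) x - pi1 (pn N t) (qn N t) x - pi2_fun (%y. (pn N t y)^2) (qn N t) x = FN N t x"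
proof -
 note N1 = N0(1)[OF N]
 have m1: "prim (eta (qn N t)) 1 = 1"
  using \<theta>_end(3)[OF N1 t] prim_cong[of 1 "eta (qn N t)" "\<theta> N t"] eta_eq[OF N t] by simp
 have pr: "prim (%y. pn N t y * eta (qn N t) y) y = \<theta>1 N t y / \<theta> N t y" if y: "y \<in> I" for y
 proof -
  have "prim (%y. pn N t y * eta (qn N t) y) y = prim (wn N t) y"
   by (rule prim_cong) (use y in "auto simp: eta_eq[OF N t] pn_def \<theta>_pos(3)[OF N t, THEN less_imp_neq, symmetric]")
  then show ?thesis using prim_wn[OF N t y] by simp
 qed
 have b: "bfun (prim (%y. pn N t y * eta (qn N t) y)) (eta (qn N t)) = bN N t"
  unfolding bfun_def bN_def by (auto simp: pr eta_eq[OF N t] intro!: LINT_cong)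
 have p1: "pi1 (pn N t) (qn N t) x = lin 0 (bN N t) (phi (qn N t) x)"
  using pi1_eq[OF n_l2(1)[OF N t] m1 l2_measurable[OF n_l2(3)[OF N t]]] unfolding b .
 have U: "U_fun (%y. (pn N t y)^2) (qn N t) y = uN N t y" if y: "y \<in> I" for y
  unfolding U_fun_def uN_def set_integral_tail[OF y]
  by (auto simp: eta_eq[OF N t] power2_eq_square algebra_simps intro!: LINT_cong arg_cong[where f="%u. u / 2"])
 have "U_fun (%y. (pn N t y)^2) (qn N t) x - pi1 (pn N t) (qn N t) x - pi2_fun (%y. (pn N t y)^2) (qn N t) x
   = proj_star (qn N t) (U_fun (%y. (pn N t y)^2) (qn N t)) x - lin 0 (bN N t) (phi (qn N t) x)"
  unfolding pi2_fun_def p1 by simp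
 also have "... = Fop (eta (qn N t)) (U_fun (%y. (pn N t y)^2) (qn N t)) (bN N t) x" by (rule proj_star_eq[OF x])
 also have "... = FN N t x" unfolding FN_def by (rule Fop_cong) (use x U eta_eq[OF N t] in auto)
 finally show ?thesis .
qed

lemma m2_uN: "N >= N0 ==> m2 (uN N)"
 unfolding uN_def[abs_def] by (intro m2_unary m2_tail m2_arith m2n N0)

lemma m2_FN: assumes "N >= N0" shows "m2 (FN N)"
proof -
 have "bN N \<in> bm UI"
  unfolding bN_def[abs_def] bfun_def
  by (intro borel_measurable_times borel_measurable_const m2_integral_x m2_arith m2_unary m2n N0 assms)
 then show ?thesis unfolding FN_def[abs_def] by (intro m2_Fop m2_uN m2n N0 assms)
qed

lemma Rn_bound: obtains B where "B >= 0" "!!N t x. N >= N0 ==> t \<in> I ==> x \<in> I ==> \<bar>\<theta>1 N t x / \<theta> N t x\<bar> <= B"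
proof -
 obtain c where c: "c >= 0" "!!N t x. G N t x ==> \<bar>\<theta>1 N t x / \<theta> N t x\<bar> <= c * 1" using ap_bound[OF ap_Rn GA] by blast
 show thesis by (rule that[OF c(1)]) (use c(2)[OF G_all] in simp)
qed

lemma bN_bound: obtains B where "B >= 0" "!!N t. N >= N0 ==> t \<in> I ==> \<bar>bN N t\<bar> <= B"
proof -
 obtain B where B: "B >= 0" "!!N t x. N >= N0 ==> t \<in> I ==> x \<in> I ==> \<bar>\<theta>1 N t x / \<theta> N t x\<bar> <= B"
  using Rn_bound by blast
 show thesis
 proof (rule that[of "3/2 * (B^2 * (2 * K))"])
  show "0 <= 3/2 * (B^2 * (2 * K))" using B K by simp
  fix N and t :: real assume N: "N >= N0" and t: "t \<in> I"
  have m: "(%x. (\<theta>1 N t x / \<theta> N t x)^2 * \<theta> N t x) \<in> bm UI"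
   by (rule m2_section[OF _ t]) (intro m2_arith m2_unary m2n N0 N)
  have b: "\<bar>(\<theta>1 N t x / \<theta> N t x)^2 * \<theta> N t x\<bar> <= B^2 * (2 * K)" if x: "x \<in> I" for x
  proof -
   have "(\<theta>1 N t x / \<theta> N t x)^2 <= B^2" using power_mono[OF B(2)[OF N t x] abs_ge_zero, of 2] by (simp only: power2_abs)
   then show ?thesis unfolding abs_mult using \<theta>_pos[OF N t x] by (intro mult_mono) auto
  qed
  have i: "integrable UI (%x. (\<theta>1 N t x / \<theta> N t x)^2 * \<theta> N t x)"
   by (rule UI.integrable_const_bound[where B="B^2 * (2 * K)"]) (use b m in auto)
  have "\<bar>LINT x|UI. (\<theta>1 N t x / \<theta> N t x)^2 * \<theta> N t x\<bar> <= (LINT x|UI. \<bar>(\<theta>1 N t x / \<theta> N t x)^2 * \<theta> N t x\<bar>)"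
   using integral_norm_bound[of UI "%x. (\<theta>1 N t x / \<theta> N t x)^2 * \<theta> N t x"] by simp
  also have "... <= (LINT x|UI. B^2 * (2 * K))" by (rule integral_mono[OF integrable_abs[OF i]]) (use b in auto)
  finally have "\<bar>LINT x|UI. (\<theta>1 N t x / \<theta> N t x)^2 * \<theta> N t x\<bar> <= B^2 * (2 * K)" by simp
  then show "\<bar>bN N t\<bar> <= 3/2 * (B^2 * (2 * K))" unfolding bN_def bfun_def abs_mult by (simp add: mult.commute mult.left_commute)
 qed
qed

lemma bN_limit: assumes t: "t \<in> I" shows "(%N. bN N t) ----> bfun (R t) (et t)"
proof -
 obtain B where B: "B >= 0" "!!N t x. N >= N0 ==> t \<in> I ==> x \<in> I ==> \<bar>\<theta>1 N t x / \<theta> N t x\<bar> <= B"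
  using Rn_bound by blast
 \<comment> \<open>Shifting the index by \<open>N0\<close> makes the bounds hold for every term of
   the sequence.\<close>
 have "(%N. LINT x|UI. (\<theta>1 (N + N0) t x / \<theta> (N + N0) t x)^2 * \<theta> (N + N0) t x) ----> (LINT x|UI. (R t x)^2 * et t x)"
 proof (rule integral_dominated_convergence[where w="%_. B^2 * (2 * K)"])
  show "(%x. (R t x)^2 * et t x) \<in> bm UI"
   by (rule m2_section[OF _ t]) (intro m2_arith m2_unary m2s)
  show "(%x. (\<theta>1 (N + N0) t x / \<theta> (N + N0) t x)^2 * \<theta> (N + N0) t x) \<in> bm UI" for N
   by (rule m2_section[OF _ t]) (intro m2_arith m2_unary m2n N0, simp_all)
  show "AE x in UI. (%N. (\<theta>1 (N + N0) t x / \<theta> (N + N0) t x)^2 * \<theta> (N + N0) t x) ----> (R t x)^2 * et t x"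
  proof (rule AE_I2)
   fix x assume "x \<in> space UI" then have x: "x \<in> I" by simp
   note G = G_all[OF _ t x]
   show "(%N. (\<theta>1 (N + N0) t x / \<theta> (N + N0) t x)^2 * \<theta> (N + N0) t x) ----> (R t x)^2 * et t x"
    by (rule LIMSEQ_ignore_initial_segment[of "%N. (\<theta>1 N t x / \<theta> N t x)^2 * \<theta> N t x" _ N0])
      (intro tendsto_mult tendsto_power ap_tendsto[OF ap_Rn G] ap_tendsto[OF ap_\<theta> G])
  qed
  show "AE x in UI. norm ((\<theta>1 (N + N0) t x / \<theta> (N + N0) t x)^2 * \<theta> (N + N0) t x) <= B^2 * (2 * K)" for N
  proof (rule AE_I2)
   fix x assume "x \<in> space UI" then have x: "x \<in> I" by simp
   have N: "N0 <= N + N0" by simp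
   have "(\<theta>1 (N + N0) t x / \<theta> (N + N0) t x)^2 <= B^2" using power_mono[OF B(2)[OF N t x] abs_ge_zero, of 2] by (simp only: power2_abs)
   then show "norm ((\<theta>1 (N + N0) t x / \<theta> (N + N0) t x)^2 * \<theta> (N + N0) t x) <= B^2 * (2 * K)"
    unfolding real_norm_def abs_mult using \<theta>_pos[OF N t x] by (intro mult_mono) auto
  qed
 qed simp
 from tendsto_mult[OF tendsto_const[of "3/2"] this] show ?thesis
  unfolding bN_def bfun_def by (rule LIMSEQ_offset)
qed

lemma FN_bound: obtains B where "B >= 0" "!!N t x. N >= N0 ==> t \<in> I ==> x \<in> I ==> \<bar>FN N t x\<bar> <= B"
proof -
 obtain B where B: "B >= 0" "!!N t. N >= N0 ==> t \<in> I ==> \<bar>bN N t\<bar> <= B" using bN_bound by blast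
 obtain B' where B': "B' >= 0" "!!N t x. N >= N0 ==> t \<in> I ==> \<bar>uN N t x\<bar> <= B'" using uN_bound by blast
 let ?c = "B' + mn * (B' * (2 * K) + B' * (2 * K) * (2 * K)) * (1 + 2 * K) + mn * (0 + B) * (1 + 2 * K)"
 have *: "\<bar>FN N t x\<bar> <= ?c" if N: "N >= N0" and t: "t \<in> I" and x: "x \<in> I" for N t x
  unfolding FN_def
  by (rule Fop_bound[OF ac_continuous[OF acx_\<theta>(1)[OF N0(1)[OF N] t]] _ m2_section[OF m2_uN[OF N] t] B'(2)[OF N t] B(2)[OF N t] x])
    (use \<theta>_pos[OF N t] in "auto simp: abs_of_pos")
 show thesis
  by (rule that[OF _ *]) (use order_trans[OF abs_ge_zero *[of N0 0 0]] in auto)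
qed

lemma FN_limit:
 assumes t: "t \<in> I" and k: "AE x in UI. (%N. Ea N t x) ----> Kt x" and m: "Kt \<in> bm UI"
 shows "AE x in UI. (%N. FN N t x) ----> Fop (et t) (%x. 1/2 * (Up t x + Kt x)) (bfun (R t) (et t)) x"
proof -
 obtain B' where B': "B' >= 0" "!!N t x. N >= N0 ==> t \<in> I ==> \<bar>uN N t x\<bar> <= B'" using uN_bound by blast
 have N: "N0 <= N + N0" for N by simp
 have "AE x in UI. (%N. Fop (\<theta> (N + N0) t) (uN (N + N0) t) (bN (N + N0) t) x) ---->
   Fop (et t) (%x. 1/2 * (Up t x + Kt x)) (bfun (R t) (et t)) x"
 proof (rule Fop_tendsto[where B="2 * K" and B'=B'])
  show "\<theta> (N + N0) t \<in> bm UI" "uN (N + N0) t \<in> bm UI" for N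
   by (rule m2_section[OF m2n(1)[OF N0(1)[OF N]] t] m2_section[OF m2_uN[OF N] t])+
  show "\<bar>\<theta> (N + N0) t x\<bar> <= 2 * K" if "x \<in> I" for N x using \<theta>_pos[OF N[of N] t that] by simp
  show "\<bar>uN (N + N0) t x\<bar> <= B'" for N x by (rule B'(2)[OF N t])
  show "(%N. \<theta> (N + N0) t x) ----> et t x" if x: "x \<in> I" for x
   by (rule LIMSEQ_ignore_initial_segment[OF ap_tendsto[OF ap_\<theta> G_all[OF _ t x]]])
  show "AE x in UI. (%N. uN (N + N0) t x) ----> 1/2 * (Up t x + Kt x)"
   using k by eventually_elim (rule LIMSEQ_ignore_initial_segment[OF uN_limit[OF t]])
  show "et t \<in> bm UI" by (rule m2_section[OF m2s(5) t])
  have "Up t \<in> bm UI" by (rule m2_section[OF m2_Up t])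
  with m show "(%x. 1/2 * (Up t x + Kt x)) \<in> bm UI" by measurable
  show "(%N. bN (N + N0) t) ----> bfun (R t) (et t)" by (rule LIMSEQ_ignore_initial_segment[OF bN_limit[OF t]])
 qed
 then show ?thesis unfolding FN_def[symmetric] by eventually_elim (rule LIMSEQ_offset)
qed

end

section \<open>Convergence of the acceleration functional along the perturbed curves\<close>

text \<open>What the amplitudes have to satisfy: their squares converge to the defect in the sense
  of tail integrals, their time derivatives have controlled energy, and the mixed term is
  nonpositive for each N.\<close>

locale force_limit = regular_perturbation +
 fixes \<kappa> :: "real => real => real" and en :: "nat => real" and e_inf :: real
 assumes \<kappa>_m2: "m2 \<kappa>" and Ea_lim: "AE t in UI. AE x in UI. (%N. Ea N t x) ----> \<kappa> t x"
  and energy: "!!N. N >= 1 ==> (LINT y|UU. et (fst y) (snd y) * (ad N (idx N (snd y)) (fst y))^2) <= en N"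
  and en_lim: "en ----> e_inf"
  and cross: "!!N. N >= 1 ==> (LINT y|UU. et (fst y) (snd y) * (v (fst y) (snd y) + force \<kappa> (fst y) (snd y)) * adw N (fst y) (snd y)) <= 0"
begin

text \<open>The force sees the squared momentum only through integrals in space, so weak convergence
  of the squares already gives convergence at almost every point.\<close>

lemma FN_AE: "AE y in UU. (%N. FN N (fst y) (snd y)) ----> force \<kappa> (fst y) (snd y)"
proof -
 have m: "m2 (FN (N + N0))" for N by (rule m2_FN) simp
 have [measurable]: "(%y. FN (N + N0) (fst y) (snd y) - force \<kappa> (fst y) (snd y)) \<in> bm UU" for N
  using m2_arith(2)[OF m[of N] m2_force[OF \<kappa>_m2]] by (simp add: m2_def)
 have "AE y in UU. (%N. FN (N + N0) (fst y) (snd y) - force \<kappa> (fst y) (snd y)) ----> 0"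
 proof (rule AE_UU(1))
  have "Measurable.pred UU (%y. (%N. FN (N + N0) (fst y) (snd y) - force \<kappa> (fst y) (snd y)) ----> 0)"
   by (rule measurable_limit) measurable
  then show "{y \<in> space UU. (%N. FN (N + N0) (fst y) (snd y) - force \<kappa> (fst y) (snd y)) ----> 0} \<in> sets UU"
   by (simp add: pred_def)
  show "AE t in UI. AE x in UI. (%N. FN (N + N0) t x - force \<kappa> t x) ----> 0"
   using Ea_lim AE_space
  proof eventually_elim
   case (elim t)
   then have t: "t \<in> I" by simp
   from FN_limit[OF t elim(1) m2_section[OF \<kappa>_m2 t]] show ?case
   proof eventually_elim
    case (elim x)
    from LIMSEQ_ignore_initial_segment[OF this, of N0] show ?case
     unfolding force_def by (simp add: LIM_zero_iff)
   qed
  qed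
 qed
 then show ?thesis by eventually_elim (simp add: LIM_zero_iff LIMSEQ_offset)
qed

text \<open>The forces are bounded uniformly in N, so dominated convergence upgrades the pointwise
  limit to convergence in L2.\<close>

lemma force_l2: "l2 UU (%y. force \<kappa> (fst y) (snd y))"
 and FN_l2: "N >= N0 ==> l2 UU (%y. FN N (fst y) (snd y))"
 and FN_nrm: "(%N. nrm UU (%y. FN (N + N0) (fst y) (snd y) - force \<kappa> (fst y) (snd y))) ----> 0"
proof -
 obtain B where B: "B >= 0" "!!N t x. N >= N0 ==> t \<in> I ==> x \<in> I ==> \<bar>FN N t x\<bar> <= B" using FN_bound by blast
 have b: "AE y in UU. \<bar>FN N (fst y) (snd y)\<bar> <= \<bar>B\<bar>" if "N >= N0" for N
  by (rule AE_I2) (use B(2)[OF that] in "auto simp: space_pair_measure intro: order_trans[OF _ abs_ge_self]")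
 have m: "(%y. force \<kappa> (fst y) (snd y)) \<in> bm UU"
  using m2_force[OF \<kappa>_m2] by (simp add: m2_def)
 have m': "(%y. FN N (fst y) (snd y)) \<in> bm UU" if "N >= N0" for N
  using m2_FN[OF that] by (simp add: m2_def)
 show "l2 UU (%y. FN N (fst y) (snd y))" if "N >= N0" for N
  by (rule l2_bound[OF UUf.l2_const m'[OF that] b[OF that]])
 have "AE y in UU. \<bar>force \<kappa> (fst y) (snd y)\<bar> <= \<bar>B\<bar>"
  using FN_AE AE_space
 proof eventually_elim
  case (elim y)
  have "\<forall>N\<ge>N0. \<bar>FN N (fst y) (snd y)\<bar> <= B" using B(2) elim(2) by (auto simp: space_pair_measure)
  then have "\<bar>force \<kappa> (fst y) (snd y)\<bar> <= B"
   by (intro Lim_bounded[OF tendsto_rabs[OF elim(1)], of N0]) auto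
  then show ?case by linarith
 qed
 from l2_bound[OF UUf.l2_const m this] show "l2 UU (%y. force \<kappa> (fst y) (snd y))" .
 show "(%N. nrm UU (%y. FN (N + N0) (fst y) (snd y) - force \<kappa> (fst y) (snd y))) ----> 0"
 proof (rule nrm_dominated_convergence[OF UUf.l2_const[of B] m' m])
  show "AE y in UU. (%N. FN (N + N0) (fst y) (snd y)) ----> force \<kappa> (fst y) (snd y)"
   using FN_AE by eventually_elim (rule LIMSEQ_ignore_initial_segment)
 qed (use b in auto)
qed

definition "limit_energy = (LINT y|UU. et (fst y) (snd y) * (v (fst y) (snd y) + force \<kappa> (fst y) (snd y))^2)"

lemma et_UU: "(%y. et (fst y) (snd y)) \<in> bm UU" "AE y in UU. \<bar>et (fst y) (snd y)\<bar> <= K"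
 "(%y. sqrt (et (fst y) (snd y))) \<in> bm UU" "AE y in UU. \<bar>sqrt (et (fst y) (snd y))\<bar> <= sqrt K"
proof -
 show [measurable]: "(%y. et (fst y) (snd y)) \<in> bm UU" using m2s(5) by (simp add: m2_def)
 show "(%y. sqrt (et (fst y) (snd y))) \<in> bm UU" by measurable
 show "AE y in UU. \<bar>et (fst y) (snd y)\<bar> <= K" "AE y in UU. \<bar>sqrt (et (fst y) (snd y))\<bar> <= sqrt K"
  using et_bounds et_abs by (auto intro!: AE_I2 simp: space_pair_measure less_imp_le)
qed

lemma v_l2: "l2 UU (%y. v (fst y) (snd y))" by (rule H1D(3)[OF Hp])

lemma adw_l2: assumes "N >= 1" shows "l2 UU (%y. adw N (fst y) (snd y))"
proof -
 have "l2 UU (%y. walsh N (snd y) * ad N (idx N (snd y)) (fst y))"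
  by (rule l2_mult_bounded[OF l2_UU_idx[OF ad_l2[OF assms] assms], where c=1]) auto
 then show ?thesis unfolding adw_def by (simp add: mult.commute)
qed

text \<open>Expansion of the square: the mixed term is nonpositive by \<open>cross\<close>, and
  walsh^2 = 1 turns the last term into the energy of the amplitudes.\<close>

lemma limit_energy_perturbed: assumes N: "N >= 1"
 shows "(nrm UU (%y. sqrt (et (fst y) (snd y)) * ((v (fst y) (snd y) + force \<kappa> (fst y) (snd y)) + adw N (fst y) (snd y))))^2
  <= limit_energy + en N"
proof -
 let ?h = "%y. et (fst y) (snd y)" and ?f = "%y. v (fst y) (snd y) + force \<kappa> (fst y) (snd y)" and ?a = "%y. adw N (fst y) (snd y)"
 have f: "l2 UU ?f" by (intro l2_add v_l2 force_l2)
 note a = adw_l2[OF N]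
 have hm: "l2 UU u ==> l2 UU (%y. ?h y * u y)" for u by (rule l2_mult_bounded[OF _ et_UU(1,2)])
 have i: "integrable UU (%y. ?h y * (?f y)^2)" "integrable UU (%y. ?h y * ?f y * ?a y)" "integrable UU (%y. ?h y * (?a y)^2)"
  using l2_mult_integrable[OF hm[OF f] f] l2_mult_integrable[OF hm[OF f] a] l2_mult_integrable[OF hm[OF a] a]
  by (simp_all add: power2_eq_square mult.assoc)
 have "(nrm UU (%y. sqrt (?h y) * (?f y + ?a y)))^2 = (LINT y|UU. (sqrt (?h y) * (?f y + ?a y))^2)" by (rule nrm_square)
 also have "... = (LINT y|UU. (?h y * (?f y)^2 + 2 * (?h y * ?f y * ?a y)) + ?h y * (?a y)^2)"
 proof (rule LINT_cong[OF refl])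
  fix y assume "y \<in> space UU"
  then have "?h y >= 0" using et_bounds by (auto simp: space_pair_measure less_imp_le)
  then show "(sqrt (?h y) * (?f y + ?a y))^2 = (?h y * (?f y)^2 + 2 * (?h y * ?f y * ?a y)) + ?h y * (?a y)^2"
   unfolding power_mult_distrib by (simp add: power2_eq_square algebra_simps)
 qed
 also have "... = (limit_energy + 2 * (LINT y|UU. ?h y * ?f y * ?a y)) + (LINT y|UU. ?h y * (?a y)^2)"
  unfolding limit_energy_def using i
  by (simp only: LINT_add integrable_mult_right intble_add integral_mult_right_zero)
 also have "(LINT y|UU. ?h y * (?a y)^2) = (LINT y|UU. ?h y * (ad N (idx N (snd y)) (fst y))^2)"
  by (simp add: adw_def power_mult_distrib)
 finally show ?thesis using cross[OF N] energy[OF N] by linarith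
qed

text \<open>The chosen \<open>tderiv\<close> of the new momentum agrees with \<open>vn\<close>
  almost everywhere by uniqueness.\<close>

lemma J0_eq: assumes N: "N >= N0"
 shows "J0 (pn N) (qn N) = (LINT y|UU. \<theta> N (fst y) (snd y) * (vn N (fst y) (snd y) + FN N (fst y) (snd y))^2)"
proof -
 have Hn: "has_tderiv (pn N) (vn N)" by (rule H1_has_tderiv[OF H1_n(3)[OF N]])
 then have Ht: "has_tderiv (pn N) (tderiv (pn N))" unfolding tderiv_def by (rule someI[of "has_tderiv (pn N)" "vn N"])
 have m: "m2 (tderiv (pn N))" using Ht by (auto simp: has_tderiv_def L2_curve_iff l2_def m2_iff)
 note m' = m2n(1,11)[OF N0(1)[OF N]] m2_FN[OF N]
 note ms = m'(1)[unfolded m2_def] m'(2)[unfolded m2_def] m'(3)[unfolded m2_def] m[unfolded m2_def]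
 note [measurable] = ms
 have "J0 (pn N) (qn N) = (LINT y|UU. (case y of (t, x) => eta (qn N t) x *
   (tderiv (pn N) t x + U_fun (%y. (pn N t y)^2) (qn N t) x - pi1 (pn N t) (qn N t) x
    - pi2_fun (%y. (pn N t y)^2) (qn N t) x)^2))"
  unfolding J0_def UU_integral ..
 also have "... = (LINT y|UU. \<theta> N (fst y) (snd y) * (tderiv (pn N) (fst y) (snd y) + FN N (fst y) (snd y))^2)"
 proof (rule LINT_cong[OF refl])
  fix y assume "y \<in> space UU"
  then obtain t x where y: "y = (t, x)" and tx: "t \<in> I" "x \<in> I" by (auto simp: space_pair_measure)
  have e: "tderiv (pn N) t x + U_fun (%y. (pn N t y)^2) (qn N t) x - pi1 (pn N t) (qn N t) x
    - pi2_fun (%y. (pn N t y)^2) (qn N t) x = tderiv (pn N) t x + FN N t x"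
   unfolding force_eq[OF N tx, symmetric] by simp
  show "(case y of (t, x) => eta (qn N t) x * (tderiv (pn N) t x + U_fun (%y. (pn N t y)^2) (qn N t) x - pi1 (pn N t) (qn N t) x
    - pi2_fun (%y. (pn N t y)^2) (qn N t) x)^2) = \<theta> N (fst y) (snd y) * (tderiv (pn N) (fst y) (snd y) + FN N (fst y) (snd y))^2"
   unfolding y prod.case e fst_conv snd_conv eta_eq[OF N tx] ..
 qed
 also have "... = (LINT y|UU. \<theta> N (fst y) (snd y) * (vn N (fst y) (snd y) + FN N (fst y) (snd y))^2)"
 proof (rule integral_cong_AE)
  have "{z \<in> space UU. tderiv (pn N) (fst z) (snd z) = vn N (fst z) (snd z)} \<in> sets UU" by measurable
  from AE_UU(1)[OF this has_tderiv_unique[OF Ht Hn]]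
  show "AE y in UU. \<theta> N (fst y) (snd y) * (tderiv (pn N) (fst y) (snd y) + FN N (fst y) (snd y))^2
   = \<theta> N (fst y) (snd y) * (vn N (fst y) (snd y) + FN N (fst y) (snd y))^2"
   by eventually_elim simp
 qed measurable
 finally show ?thesis .
qed

text \<open>Minkowski in L2 weighted by eta: the actual integrand differs from (v + force) + adw by
  terms that tend to 0 in L2, and passing from \<theta> to eta costs a factor tending to 1.\<close>

lemma J0_limit:
 obtains B where "!!N. N >= N0 ==> J0 (pn N) (qn N) <= B N" "B ----> limit_energy + e_inf"
proof -
 obtain c where c: "c >= 0" "!!N. N >= N0 ==> l2 UU (%y. vn N (fst y) (snd y) - (v (fst y) (snd y) + adw N (fst y) (snd y)))"
  "!!N. N >= N0 ==> nrm UU (%y. vn N (fst y) (snd y) - (v (fst y) (snd y) + adw N (fst y) (snd y))) <= c / sqrt N"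
 proof (rule ap_nrm[OF ap_vn])
  show "m2 (vn N)" if "N >= N0" for N by (rule m2n(11)[OF N0(1)[OF that]])
  show "m2 (%t x. v t x + adw N t x)" if "N >= N0" for N
   using l2_measurable[OF l2_add[OF v_l2 adw_l2[OF N0(1)[OF that]]]] by (simp add: m2_def)
 qed blast
 obtain d where d: "d >= 0" "!!N t x. G N t x ==> \<bar>\<theta> N t x - et t x\<bar> <= d / sqrt N"
  using ap_\<theta> unfolding ap_def by auto
 define \<delta> where "\<delta> N = nrm UU (%y. FN N (fst y) (snd y) - force \<kappa> (fst y) (snd y))" for N
 have \<delta>: "\<delta> ----> 0" by (rule LIMSEQ_offset[of _ N0]) (use FN_nrm in "simp add: \<delta>_def")
 \<comment> \<open>The first factor pays for replacing \<theta> by eta, the second adds the L2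
   errors of \<open>vn\<close> and of the force.\<close>
 define B where "B N = (1 + K * d / sqrt N) * (sqrt \<bar>limit_energy + en N\<bar> + sqrt K * (c / sqrt N + \<delta> N))^2" for N
 show thesis
 proof (rule that[of B])
  have "B ----> (1 + 0) * (sqrt \<bar>limit_energy + e_inf\<bar> + sqrt K * (0 + 0))^2"
   unfolding B_def by (intro tendsto_intros en_lim \<delta> over_sqrt_tendsto)
  \<comment> \<open>Removes the absolute value that keeps the square root in \<open>B\<close>
    defined.\<close>
  moreover have "limit_energy + e_inf >= 0"
  proof (rule LIMSEQ_le_const[OF tendsto_add[OF tendsto_const en_lim]], intro exI allI impI)
   fix N :: nat assume "1 <= N"
   show "0 <= limit_energy + en N" by (rule order_trans[OF zero_le_power2 limit_energy_perturbed[OF \<open>1 <= N\<close>]])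
  qed
  ultimately show "B ----> limit_energy + e_inf" by simp
  fix N assume N: "N >= N0"
  note N1 = N0(1)[OF N]
  let ?h = "%y. et (fst y) (snd y)" and ?fz = "%y. (v (fst y) (snd y) + force \<kappa> (fst y) (snd y)) + adw N (fst y) (snd y)"
  let ?f = "%y. vn N (fst y) (snd y) + FN N (fst y) (snd y)"
  let ?ga = "%y. vn N (fst y) (snd y) - (v (fst y) (snd y) + adw N (fst y) (snd y))"
  let ?gb = "%y. FN N (fst y) (snd y) - force \<kappa> (fst y) (snd y)"
  have sm: "l2 UU u ==> l2 UU (%y. sqrt (?h y) * u y)" for u by (rule l2_mult_bounded[OF _ et_UU(3,4)])
  have hm: "l2 UU u ==> l2 UU (%y. ?h y * u y)" for u by (rule l2_mult_bounded[OF _ et_UU(1,2)])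
  have l: "l2 UU ?fz" "l2 UU ?ga" "l2 UU ?gb"
   by (intro l2_add l2_diff v_l2 force_l2 adw_l2 N1 c(2) FN_l2 N)+
  have lv: "l2 UU (%y. vn N (fst y) (snd y))" by (rule H1D(3)[OF H1_n(3)[OF N]])
  have lf: "l2 UU ?f" by (rule l2_add[OF lv FN_l2[OF N]])
  have "nrm UU (%y. sqrt (?h y) * ?f y) = nrm UU (%y. sqrt (?h y) * ?fz y + sqrt (?h y) * (?ga y + ?gb y))"
   by (simp add: algebra_simps)
  also have "... <= nrm UU (%y. sqrt (?h y) * ?fz y) + nrm UU (%y. sqrt (?h y) * (?ga y + ?gb y))"
   by (intro nrm_triangle sm l l2_add)
  also have "nrm UU (%y. sqrt (?h y) * ?fz y) <= sqrt \<bar>limit_energy + en N\<bar>"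
   using limit_energy_perturbed[OF N1] by (intro real_le_rsqrt) linarith
  also have "nrm UU (%y. sqrt (?h y) * (?ga y + ?gb y)) <= nrm UU (%y. sqrt K * (?ga y + ?gb y))"
  proof (rule nrm_mono)
   show "l2 UU (%y. sqrt K * (?ga y + ?gb y))" by (intro l2_cmult l2_add l)
   show "(%y. sqrt (?h y) * (?ga y + ?gb y)) \<in> bm UU" by (intro l2_measurable sm l2_add l)
   show "AE y in UU. \<bar>sqrt (?h y) * (?ga y + ?gb y)\<bar> <= \<bar>sqrt K * (?ga y + ?gb y)\<bar>"
    using et_UU(4) by eventually_elim (unfold abs_mult, rule mult_right_mono, auto)
  qed
  also have "... <= sqrt K * (c / sqrt N + \<delta> N)"
  proof -
   have "nrm UU (%y. ?ga y + ?gb y) <= c / sqrt N + \<delta> N"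
    using nrm_triangle[OF l(2,3)] c(3)[OF N] unfolding \<delta>_def by linarith
   then show ?thesis unfolding nrm_cmult using K by (simp add: mult_left_mono)
  qed
  finally have n: "nrm UU (%y. sqrt (?h y) * ?f y) <= sqrt \<bar>limit_energy + en N\<bar> + sqrt K * (c / sqrt N + \<delta> N)" by simp
  have if2: "integrable UU (%y. ?h y * (?f y)^2)" using l2_mult_integrable[OF hm[OF lf] lf] by (simp add: power2_eq_square mult.assoc)
  have "(LINT y|UU. \<theta> N (fst y) (snd y) * (?f y)^2) <= (LINT y|UU. (1 + K * d / sqrt N) * (?h y * (?f y)^2))"
  proof (rule integral_mono')
   show "integrable UU (%y. (1 + K * d / sqrt N) * (?h y * (?f y)^2))" by (intro integrable_mult_right if2)
   fix y assume "y \<in> space UU"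
   then have y: "fst y \<in> I" "snd y \<in> I" by (auto simp: space_pair_measure)
   \<comment> \<open>Turns the additive error d / sqrt N of \<theta> into a relative one.\<close>
   have "1 <= K * ?h y" using et_bounds[OF y] K by (simp add: field_simps)
   then have "d / sqrt N * 1 <= d / sqrt N * (K * ?h y)" using d(1) by (intro mult_left_mono) auto
   moreover have "\<theta> N (fst y) (snd y) <= ?h y + d / sqrt N" using d(2)[OF G_all[OF N y]] by linarith
   ultimately have "\<theta> N (fst y) (snd y) <= (1 + K * d / sqrt N) * ?h y" by (simp add: algebra_simps)
   from mult_right_mono[OF this, of "(?f y)^2"]
   show "\<theta> N (fst y) (snd y) * (?f y)^2 <= (1 + K * d / sqrt N) * (?h y * (?f y)^2)" by (simp add: mult.assoc)
   show "0 <= (1 + K * d / sqrt N) * (?h y * (?f y)^2)" using et_bounds[OF y] K d(1) by (intro mult_nonneg_nonneg) auto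
  qed
  also have "... = (1 + K * d / sqrt N) * (nrm UU (%y. sqrt (?h y) * ?f y))^2"
  proof -
   have "(nrm UU (%y. sqrt (?h y) * ?f y))^2 = (LINT y|UU. ?h y * (?f y)^2)"
    unfolding nrm_square power_mult_distrib using et_bounds
    by (intro LINT_cong) (auto simp: space_pair_measure less_imp_le)
   then show ?thesis by simp
  qed
  also have "... <= B N" unfolding B_def using n K d(1) by (intro mult_left_mono power_mono) auto
  finally show "J0 (pn N) (qn N) <= B N" unfolding J0_eq[OF N] .
 qed
qed

end

section \<open>Amplitudes interpolating the square roots of the slice masses\<close>

subsection \<open>The coefficients\<close>

lemma Fsigma_Ico: "Fsigma {a..<b::real}"
 unfolding Fsigma_def
proof (intro exI conjI allI)
 let ?K = "%n::nat. {a..b - 1 / real (Suc n)}"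
 show "closed (?K n)" for n by simp
 show "incseq ?K" by (intro incseq_SucI) (auto simp: field_simps)
 show "{a..<b} = (\<Union>n. ?K n)"
 proof (intro equalityI subsetI)
  fix x assume x: "x \<in> {a..<b}"
  then obtain n where "inverse (real (Suc n)) < b - x" using reals_Archimedean[of "b - x"] by auto
  then show "x \<in> (\<Union>n. ?K n)" using x by (auto simp: inverse_eq_divide intro!: exI[of _ n])
 next
  fix x assume "x \<in> (\<Union>n. ?K n)"
  then obtain n :: nat where n: "a <= x" "x <= b - 1 / real (Suc n)" by auto
  have "1 / real (Suc n) > 0" by simp
  with n show "x \<in> {a..<b}" by (intro atLeastLessThan_iff[THEN iffD2] conjI) linarith+
 qed
qed

definition cell :: "nat => nat => real set" where "cell N k = {x \<in> I. idx N x = k}"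

lemma cell_eq:
 assumes "k < N" shows "cell N k = (if k = N - 1 then {real k / N..1} else {real k / N..<(real k + 1) / N})"
proof (intro set_eqI)
 fix x :: real
 have N: "real N > 0" using assms by simp
 have f: "real_of_int \<lfloor>real N * x\<rfloor> <= real N * x" "real N * x < real_of_int \<lfloor>real N * x\<rfloor> + 1" by linarith+
 have k1: "x < (real k + 1) / N \<longleftrightarrow> real N * x < real k + 1" and k2: "real k / N <= x \<longleftrightarrow> real k <= real N * x"
  using N by (auto simp: field_simps)
 show "x \<in> cell N k \<longleftrightarrow> x \<in> (if k = N - 1 then {real k / N..1} else {real k / N..<(real k + 1) / N})"
 proof (cases "x \<in> I")
  case True
  have z: "0 <= \<lfloor>real N * x\<rfloor>" using True N by simp
  show ?thesis
  proof (cases "k = N - 1")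
   case k: True
   have "idx N x = k \<longleftrightarrow> k <= nat \<lfloor>real N * x\<rfloor>" by (auto simp: idx_def k)
   also have "... \<longleftrightarrow> real k <= real N * x" using z f by linarith
   finally show ?thesis using True k k2 by (simp add: cell_def)
  next
   case k: False
   then have "idx N x = k \<longleftrightarrow> nat \<lfloor>real N * x\<rfloor> = k" using assms by (auto simp: idx_def)
   also have "... \<longleftrightarrow> real k <= real N * x & real N * x < real k + 1" using z f by linarith
   finally show ?thesis using True k k1 k2 by (simp add: cell_def)
  qed
 next
  case False
  have k: "(real k + 1) / N <= 1" "0 <= real k / N" using assms by (auto simp: field_simps)
  have "x \<notin> (if k = N - 1 then {real k / N..1} else {real k / N..<(real k + 1) / N})"
  proof
   assume "x \<in> (if k = N - 1 then {real k / N..1} else {real k / N..<(real k + 1) / N})"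
   then have "real k / N <= x & (x <= 1 \<or> x < (real k + 1) / N)" by (cases "k = N - 1") (simp_all only: if_True if_False atLeastAtMost_iff atLeastLessThan_iff simp_thms)
   with k have "0 <= x & x <= 1" by linarith
   with False show False by simp
  qed
  then show ?thesis using False by (simp only: cell_def mem_Collect_eq simp_thms)
 qed
qed

lemma cell: assumes "k < N" shows "cell N k \<in> sets borel" "Fsigma (cell N k)"
 unfolding cell_eq[OF assms] using Fsigma_Ico Fsigma_closed[OF closed_atLeastAtMost] by auto

lemma cell_sub: "cell N k \<subseteq> I" by (auto simp: cell_def)

lemma sum_cells:
 fixes F :: "nat => real"
 assumes "N >= 1" "x \<in> I" shows "(\<Sum>k<N. F k * indicator (cell N k) x) = F (idx N x)"
proof -
 have "(\<Sum>k<N. F k * indicator (cell N k) x) = (\<Sum>k<N. if k = idx N x then F k else 0)"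
  using assms by (intro sum.cong) (auto simp: cell_def split: split_indicator)
 also have "... = F (idx N x)" using idx_less[OF assms(1), of x] by simp
 finally show ?thesis .
qed

text \<open>Half-open from the left, as in the increments of \<open>cum\<close>.\<close>

definition slab :: "nat => nat => real set" where "slab N j = {real j / N<..(real j + 1) / N}"

text \<open>The slabs are disjoint, so at most one summand survives. They miss t = 0, where the sum
  is empty; nonnegativity of c covers that case.\<close>

lemma slab_sum_le:
 assumes N: "N >= 1" and F: "!!j. j < N ==> t \<in> slab N j ==> F j <= c" and c: "0 <= (c :: real)"
 shows "(\<Sum>j<N. F j * indicator (slab N j) t) <= c"
proof (cases "\<exists>j<N. t \<in> slab N j")
 case True
 then obtain j where j: "j < N" "t \<in> slab N j" by blast
 have u: "i = j" if "t \<in> slab N i" for i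
 proof -
  have "real i < real N * t" "real N * t <= real i + 1" "real j < real N * t" "real N * t <= real j + 1"
   using that j N by (auto simp: slab_def field_simps)
  then have "real i < real j + 1" "real j < real i + 1" by linarith+
  then show "i = j" by linarith
 qed
 have "(\<Sum>i<N. F i * indicator (slab N i) t) = (\<Sum>i<N. if i = j then F j else 0)"
 proof (rule sum.cong[OF refl])
  fix i show "F i * indicator (slab N i) t = (if i = j then F j else 0)"
   using u[of i] j(2) by (cases "i = j") (auto simp: indicator_def)
 qed
 then show ?thesis using F[OF j] j(1) by simp
next
 case False
 then have "(\<Sum>j<N. F j * indicator (slab N j) t) = 0" by (intro sum.neutral) (auto simp: indicator_def)
 then show ?thesis using c by simp
qed

lemma node:
 fixes N :: nat
 assumes "j < N"
 shows "(real j + 1) / N <= 1" "(real j + 1) / N - real j / N = 1 / N" "real j / N <= (real j + 1) / N" "0 <= real j / N"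
 using assms by (auto simp: diff_divide_distrib[symmetric] divide_right_mono)

context fisher_rao_dominated
begin

text \<open>\<Delta> gives no mass to time 0 because it has a density in time. There the dual
  inequality with a constant weight c bounds c times \<open>cum B 0\<close> for every real c. This
  makes the amplitudes start at 0.\<close>

lemma cum_0: assumes B: "B \<in> sets borel" "Fsigma B" shows "cum B 0 = 0"
proof -
 let ?A = "{-1<..0} \<times> B :: (real \<times> real) set"
 have Z: "(LINT z|\<Delta>. indicator ?A z :: real) = 0"
 proof -
  have "0 \<in> {0..1::real}" by simp
  from \<Delta>_density[OF B(1) this] show ?thesis unfolding prim_0 .
 qed
 have le: "c * cum B 0 <= (LINT z|\<sigma>. indicator ?A z)" for c
 proof -
  have "signed_integral d (%z. c * indicator ?A z) - (LINT z|\<Delta>. c^2 * indicator ?A z) <= (LINT z|\<sigma>. indicator ?A z)"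
   by (rule dual_Fsigma[OF Fsigma_rectangle[OF B(2)], where b="%_. c" and C="\<bar>c\<bar>"]) auto
  then show ?thesis unfolding signed_integral_cmult cum_def integral_mult_right_zero Z by simp
 qed
 show ?thesis
 proof (rule ccontr)
  assume n: "cum B 0 ~= 0"
  have "(\<bar>LINT z|\<sigma>. indicator ?A z\<bar> + 1) / cum B 0 * cum B 0 <= (LINT z|\<sigma>. indicator ?A z)" by (rule le)
  then show False using n by simp
 qed
qed

text \<open>1/N is the length of a cell, so the square of \<open>val\<close> is the mean density of
  the slice over the cell at time j/N. \<open>slope\<close> and \<open>coef\<close> are the
  piecewise affine interpolation in time.\<close>

definition val :: "nat => nat => nat => real" where
 "val N k j = sqrt (real N * cum (cell N k) (real j / N))"
definition slope :: "nat => nat => real => real" where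
 "slope N k t = real N * (val N k (idx N t + 1) - val N k (idx N t))"
definition coef :: "nat => nat => real => real" where
 "coef N k t = prim (slope N k) t"
definition sig :: "nat => nat => nat => real" where
 "sig N j k = (LINT z|\<sigma>. indicator (slab N j \<times> cell N k) z)"
definition \<sigma>tot :: real where "\<sigma>tot = measure \<sigma> unit_square"

lemma \<sigma>_int: assumes "A \<in> sets borel" shows "integrable \<sigma> (indicator A :: _ => real)"
 by (rule finite_radon_integrable[OF radon_\<sigma>, where C=1])
   (use assms in "auto intro!: finite_radon_measurable[OF radon_\<sigma>] split: split_indicator")

lemma slab_cell [measurable]: "k < N ==> slab N j \<times> cell N k \<in> sets borel"
 unfolding slab_def by (intro rectangle_measurable cell)

lemma sig_nonneg: "0 <= sig N j k" unfolding sig_def by (rule integral_nonneg_AE) auto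

lemma slope_integrable: "integrable UI (slope N k)"
 unfolding slope_def
proof (rule UI.integrable_const_bound)
 let ?F = "%j. real N * (val N k (j + 1) - val N k j)"
 show "AE t in UI. norm (?F (idx N t)) <= (\<Sum>j\<le>N. \<bar>?F j\<bar>)"
 proof (rule AE_I2)
  fix t
  have "idx N t <= N" by (auto simp: idx_def)
  then show "norm (?F (idx N t)) <= (\<Sum>j\<le>N. \<bar>?F j\<bar>)" by (auto intro!: member_le_sum)
 qed
qed (rule measurable_of_idx[where F="%j. real N * (val N k (j + 1) - val N k j)"])

lemma coef_ac: "ac (coef N k) (slope N k)" unfolding coef_def by (rule ac_prim[OF slope_integrable])

lemma coef_piece:
 assumes j: "j < N" and t: "real j / N <= t" "t <= (real j + 1) / N"
 shows "coef N k t = coef N k (real j / N) + real N * (val N k (j + 1) - val N k j) * (t - real j / N)"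
proof -
 have "(real j + 1) / N <= 1" using j by (simp add: field_simps)
 then have "t <= 1" using t by linarith
 with prim_affine_piece[of "real j / N" t "slope N k" "real N * (val N k (j + 1) - val N k j)" 0]
 show ?thesis using t slope_integrable unfolding coef_def
  by (auto simp: slope_def idx_eq[OF j])
qed

lemma coef_node: assumes k: "k < N" shows "j <= N ==> coef N k (real j / N) = val N k j"
proof (induction j)
 case 0
 show ?case using cum_0[OF cell[OF k]] by (simp add: coef_def val_def)
next
 case (Suc j)
 then have j: "j < N" by simp
 have d: "(real j + 1) / N - real j / N = 1 / N" by (simp add: diff_divide_distrib[symmetric])
 have "coef N k ((real j + 1) / N) = coef N k (real j / N) + real N * (val N k (j + 1) - val N k j) * ((real j + 1) / N - real j / N)"
  by (rule coef_piece[OF j]) (auto simp: divide_right_mono)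
 then show ?case unfolding d using Suc j by (simp add: add.commute)
qed

text \<open>The factor N from the mean density cancels the time length, at most 1/N, in the
  Hellinger estimate.\<close>

lemma val_increment:
 assumes k: "k < N" and st: "0 <= s" "s <= t" "t <= 1" "t - s <= 1 / N"
 shows "(sqrt (real N * cum (cell N k) t) - sqrt (real N * cum (cell N k) s))^2 <= (LINT z|\<sigma>. indicator ({s<..t} \<times> cell N k) z)"
proof (cases "s = t")
 case True then show ?thesis by simp
next
 case False
 let ?S = "LINT z|\<sigma>. indicator ({s<..t} \<times> cell N k) z :: real"
 have S: "0 <= ?S" by (rule integral_nonneg_AE) auto
 have "(sqrt (real N * cum (cell N k) t) - sqrt (real N * cum (cell N k) s))^2 = N * (sqrt (cum (cell N k) t) - sqrt (cum (cell N k) s))^2"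
  unfolding real_sqrt_mult right_diff_distrib[symmetric] power_mult_distrib by simp
 also have "... <= N * ((t - s) * ?S)"
  by (intro mult_left_mono hellinger_increment cell k) (use st False in auto)
 also have "... <= N * (1 / N * ?S)" by (intro mult_left_mono mult_right_mono st S) simp
 also have "... = ?S" using k by simp
 finally show ?thesis .
qed

text \<open>The deviation at time t is a convex combination of two increments, over the parts of the
  slab before and after t, and the \<sigma>-masses of these parts add up to that of the
  slab.\<close>

lemma coef_error:
 assumes k: "k < N" and t: "t \<in> I"
 shows "(coef N k t - sqrt (real N * cum (cell N k) t))^2 <= sig N (idx N t) k"
proof -
 have N: "N >= 1" using k by simp
 define j where "j = idx N t"
 have j: "j < N" "real j / N <= t" "t <= (real j + 1) / N" unfolding j_def using idx_less[OF N] idx_bounds[OF N t] by auto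
 define \<phi> where "\<phi> s = sqrt (real N * cum (cell N k) s)" for s
 \<comment> \<open>The position of t inside its slab, as a fraction of the slab length.\<close>
 define l where "l = real N * (t - real j / N)"
 note j1 = node[OF j(1)]
 have l: "0 <= l" "l <= 1"
  using j j1 N mult_left_mono[of "t - real j / N" "1 / N" "real N"] by (auto simp: l_def)
 have c: "coef N k t - \<phi> t = (1 - l) * (\<phi> (real j / N) - \<phi> t) + l * (\<phi> ((real j + 1) / N) - \<phi> t)"
  using coef_piece[OF j, of k] coef_node[OF k, of j] j(1)
  by (simp add: l_def \<phi>_def val_def algebra_simps)
 define A B where "A = (LINT z|\<sigma>. indicator ({real j / N<..t} \<times> cell N k) z :: real)"
  and "B = (LINT z|\<sigma>. indicator ({t<..(real j + 1) / N} \<times> cell N k) z :: real)"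
 have a: "(\<phi> (real j / N) - \<phi> t)^2 <= A"
  using val_increment[OF k, of "real j / N" t] j j1 t unfolding \<phi>_def A_def by (simp add: power2_commute)
 have b: "(\<phi> ((real j + 1) / N) - \<phi> t)^2 <= B"
  using val_increment[OF k, of t "(real j + 1) / N"] j j1 t unfolding \<phi>_def B_def by simp
 have AB: "A + B = sig N j k"
 proof -
  have "A + B = (LINT z|\<sigma>. indicator ({real j / N<..t} \<times> cell N k) z + indicator ({t<..(real j + 1) / N} \<times> cell N k) z)"
   unfolding A_def B_def by (rule LINT_add[symmetric]; intro \<sigma>_int rectangle_measurable cell k)
  also have "... = sig N j k"
   unfolding sig_def slab_def using j by (intro LINT_cong) (auto split: split_indicator)
  finally show ?thesis .
 qed
 have AB0: "0 <= A" "0 <= B" using a b by (auto intro: order_trans[OF zero_le_power2])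
 have conv: "((1 - l) * x + l * y)^2 <= (1 - l) * x^2 + l * y^2" for x y :: real
 proof -
  have "(1 - l) * x^2 + l * y^2 - ((1 - l) * x + l * y)^2 = (1 - l) * l * (x - y)^2"
   by (simp add: power2_eq_square algebra_simps)
  moreover have "0 <= (1 - l) * l * (x - y)^2" using l by simp
  ultimately show ?thesis by linarith
 qed
 have "(coef N k t - \<phi> t)^2 <= (1 - l) * (\<phi> (real j / N) - \<phi> t)^2 + l * (\<phi> ((real j + 1) / N) - \<phi> t)^2"
  unfolding c by (rule conv)
 also have "... <= (1 - l) * A + l * B" using a b l by (intro add_mono mult_left_mono) auto
 also have "... <= A + B" using AB0 l by (intro add_mono mult_left_le_one_le) auto
 finally show ?thesis unfolding AB \<phi>_def j_def .
qed

text \<open>The blocks are disjoint and the coefficient of each is below F on it, so the sum is the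
  \<sigma>-integral of a step function below F.\<close>

lemma weighted_sum_le:
 assumes N: "N >= 1" and F: "F \<in> bm borel" "!!z. z \<in> unit_square ==> \<bar>F z\<bar> <= C" "!!z. z \<in> unit_square ==> 0 <= F z"
  and c: "!!j k z. j < N ==> k < N ==> z \<in> unit_square ==> z \<in> slab N j \<times> cell N k ==> c j k <= F z"
 shows "(\<Sum>k<N. \<Sum>j<N. c j k * sig N j k) <= (LINT z|\<sigma>. F z)"
proof -
 have i: "integrable \<sigma> (%z. c j k * indicator (slab N j \<times> cell N k) z)" if "k < N" for j k
  by (intro integrable_mult_right \<sigma>_int slab_cell that)
 have "(\<Sum>k<N. \<Sum>j<N. c j k * sig N j k) = (LINT z|\<sigma>. (\<Sum>k<N. \<Sum>j<N. c j k * indicator (slab N j \<times> cell N k) z))"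
 proof -
  have "(LINT z|\<sigma>. (\<Sum>k<N. \<Sum>j<N. c j k * indicator (slab N j \<times> cell N k) z))
    = (\<Sum>k<N. LINT z|\<sigma>. (\<Sum>j<N. c j k * indicator (slab N j \<times> cell N k) z))"
   by (rule LINT_sum) (intro intble_sum i, simp)
  also have "... = (\<Sum>k<N. \<Sum>j<N. c j k * sig N j k)"
  proof (rule sum.cong[OF refl])
   fix k assume "k \<in> {..<N}"
   then have "(LINT z|\<sigma>. (\<Sum>j<N. c j k * indicator (slab N j \<times> cell N k) z)) = (\<Sum>j<N. LINT z|\<sigma>. c j k * indicator (slab N j \<times> cell N k) z)"
    by (intro LINT_sum i) simp
   then show "(LINT z|\<sigma>. (\<Sum>j<N. c j k * indicator (slab N j \<times> cell N k) z)) = (\<Sum>j<N. c j k * sig N j k)"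
    unfolding sig_def integral_mult_right_zero .
  qed
  finally show ?thesis ..
 qed
 also have "... <= (LINT z|\<sigma>. F z)"
 proof (rule integral_mono)
  show "integrable \<sigma> (%z. \<Sum>k<N. \<Sum>j<N. c j k * indicator (slab N j \<times> cell N k) z)" using i by (intro intble_sum) auto
  show "integrable \<sigma> F" by (rule finite_radon_integrable[OF radon_\<sigma> finite_radon_measurable[OF radon_\<sigma> F(1)] F(2)])
  fix z assume "z \<in> space \<sigma>"
  then have z: "z \<in> unit_square" using finite_radonD(3)[OF radon_\<sigma>] by simp
  obtain t x where tx: "z = (t, x)" by (cases z)
  have x: "x \<in> I" using z tx by (simp add: unit_square_def)
  have "(\<Sum>k<N. \<Sum>j<N. c j k * indicator (slab N j \<times> cell N k) z) = (\<Sum>k<N. (\<Sum>j<N. c j k * indicator (slab N j) t) * indicator (cell N k) x)"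
   by (simp only: tx indicator_times fst_conv snd_conv sum_distrib_right mult.assoc)
  also have "... = (\<Sum>j<N. c j (idx N x) * indicator (slab N j) t)" by (rule sum_cells[OF N x])
  also have "... <= F z"
   by (rule slab_sum_le[OF N _ F(3)[OF z]], rule c) (use z tx x idx_less[OF N] in "auto simp: cell_def")
  finally show "(\<Sum>k<N. \<Sum>j<N. c j k * indicator (slab N j \<times> cell N k) z) <= F z" .
 qed
 finally show ?thesis .
qed

lemma sum_sig: assumes N: "N >= 1" shows "j < N ==> (\<Sum>k<N. sig N j k) <= \<sigma>tot"
proof -
 assume j: "j < N"
 have "(\<Sum>k<N. sig N j k) = (\<Sum>k<N. \<Sum>i<N. (if i = j then 1 else 0) * sig N i k)"
  using j by (simp add: if_distrib[of "%u. u * _"] sum.delta cong: if_cong)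
 also have "... <= (LINT z|\<sigma>. 1)" by (rule weighted_sum_le[OF N, where C=1]) auto
 also have "... = \<sigma>tot" using finite_radonD(3)[OF radon_\<sigma>] by (simp add: \<sigma>tot_def)
 finally show ?thesis .
qed

text \<open>The amplitude before interpolation in time: its square has exactly the slice masses on
  the cells.\<close>

definition exact :: "nat => real => real => real" where
 "exact N t x = sqrt (real N * cum (cell N (idx N x)) t)"

lemma \<sigma>tot_nonneg: "0 <= \<sigma>tot" by (simp add: \<sigma>tot_def)

lemma coef_exact: assumes N: "N >= 1" and t: "t \<in> I"
 shows "nrm UI (%x. coef N (idx N x) t - exact N t x) <= sqrt (\<sigma>tot / N)"
proof -
 have "(nrm UI (%x. (%k. coef N k t - sqrt (real N * cum (cell N k) t)) (idx N x)))^2 <= \<sigma>tot / N"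
  unfolding nrm_idx[OF N, where F="%k. coef N k t - sqrt (real N * cum (cell N k) t)"]
  by (intro divide_right_mono order_trans[OF sum_mono[OF coef_error[OF _ t]] sum_sig[OF N idx_less[OF N]]]) auto
 then show ?thesis unfolding exact_def by (intro real_le_rsqrt) simp
qed

lemma exact_sum:
 assumes N: "N >= 1" and t: "t \<in> I"
 shows "(LINT x|UI. F (idx N x) * (exact N t x)^2) = (\<Sum>k<N. F k * cum (cell N k) t)"
proof -
 have "(LINT x|UI. F (idx N x) * (exact N t x)^2) = (LINT x|UI. F (idx N x) * (real N * cum (cell N (idx N x)) t))"
  unfolding exact_def using cum_nonneg_Fsigma[OF cell[OF idx_less[OF N]]] t
  by (intro LINT_cong) auto
 also have "... = (\<Sum>k<N. F k * (real N * cum (cell N k) t)) / N"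
  by (rule integral_idx[OF N, where F="%k. F k * (real N * cum (cell N k) t)"])
 also have "... = (\<Sum>k<N. F k * cum (cell N k) t)" using N by (simp add: sum_divide_distrib)
 finally show ?thesis .
qed

lemma cum_cells: assumes N: "N >= 1" shows "(\<Sum>k<N. cum (cell N k) t) = cum I t"
proof -
 have f: "cum (\<Union>k<m. cell N k) t = (\<Sum>k<m. cum (cell N k) t)" if "m <= N" for m
  using that
 proof (induction m)
  case 0
  show ?case by (simp add: cum_def signed_integral_def indicator_def)
 next
  case (Suc m)
  have "(\<Union>k<Suc m. cell N k) = (\<Union>k<m. cell N k) \<union> cell N m" by (auto simp: less_Suc_eq)
  moreover have "cum ((\<Union>k<m. cell N k) \<union> cell N m) t = cum (\<Union>k<m. cell N k) t + cum (cell N m) t"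
   using Suc(2) cell(1) by (intro cum_Un) (auto simp: cell_def intro!: sets.finite_UN)
  ultimately show ?case using Suc by simp
 qed
 have "(\<Union>k<N. cell N k) = I" using idx_less[OF N] by (auto simp: cell_def)
 then show ?thesis using f[of N] by simp
qed

lemma exact_nrm: assumes N: "N >= 1" and t: "t \<in> I" shows "nrm UI (exact N t) <= sqrt total"
proof -
 have "(nrm UI (exact N t))^2 = cum I t"
  unfolding nrm_square using exact_sum[OF N t, of "%_. 1"] cum_cells[OF N] by simp
 also have "... <= total" using cum_bounded[of "I" t] by simp
 finally show ?thesis by (rule real_le_rsqrt)
qed

lemma exact_l2: "N >= 1 ==> l2 UI (exact N t)"
 unfolding exact_def by (rule l2_idx[where F="%k. sqrt (real N * cum (cell N k) t)"])

lemma coef_nrm: assumes N: "N >= 1" and t: "t \<in> I"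
 shows "nrm UI (%x. coef N (idx N x) t) <= sqrt total + sqrt \<sigma>tot"
proof -
 have lc: "l2 UI (%x. coef N (idx N x) t)" by (rule l2_idx[OF N, where F="%k. coef N k t"])
 have "nrm UI (%x. (coef N (idx N x) t - exact N t x) + exact N t x) <= sqrt (\<sigma>tot / N) + sqrt total"
  using nrm_triangle[OF l2_diff[OF lc exact_l2[OF N]] exact_l2[OF N], of t t] coef_exact[OF N t] exact_nrm[OF N t] by linarith
 moreover have "sqrt (\<sigma>tot / N) <= sqrt \<sigma>tot" using N \<sigma>tot_nonneg by (simp add: divide_le_eq mult_le_cancel_left1)
 ultimately show ?thesis unfolding diff_add_cancel by linarith
qed

lemma slope_square: assumes k: "k < N" and t: "t \<in> I"
 shows "(slope N k t)^2 <= (real N)^2 * sig N (idx N t) k"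
proof -
 have N: "N >= 1" using k by simp
 let ?j = "idx N t"
 have j: "?j < N" by (rule idx_less[OF N])
 note j1 = node[OF j]
 have "(val N k (?j + 1) - val N k ?j)^2 <= sig N ?j k"
 proof -
  have "real (?j + 1) = real ?j + 1" by simp
  then show ?thesis
   using val_increment[OF k j1(4,3,1) order_eq_refl[OF j1(2)]] unfolding val_def sig_def slab_def by (simp only:)
 qed
 then show ?thesis unfolding slope_def power_mult_distrib by (rule mult_left_mono) simp
qed

text \<open>Each block has area 1/N^2 and squared slope at most N^2 times its \<sigma>-mass, so its
  energy is at most the weight times that mass. The oscillation \<omega> of the weight is paid
  twice, for replacing h by its nodal value and for going back under \<sigma>.\<close>

lemma slope_energy:
 assumes N: "N >= 1" and h: "m2 h" "!!t x. t \<in> I ==> x \<in> I ==> 0 <= h t x & h t x <= C"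
  and m: "(%z. h (fst z) (snd z) * indicator unit_square z) \<in> bm borel"
  and w: "!!t x s y. t \<in> I ==> x \<in> I ==> s \<in> I ==> y \<in> I ==> \<bar>t - s\<bar> <= 1 / N ==> \<bar>x - y\<bar> <= 1 / N
   ==> \<bar>h t x - h s y\<bar> <= \<omega>" and \<omega>: "0 <= \<omega>"
 shows "(LINT y|UU. h (fst y) (snd y) * (slope N (idx N (snd y)) (fst y))^2) <= (LINT z|\<sigma>. h (fst z) (snd z)) + 2 * \<omega> * \<sigma>tot"
proof -
 define c where "c j k = h (real j / N) (real k / N)" for j k
 have nd: "real j / N \<in> I" if "j < N" for j using that by (simp add: field_simps)
 let ?G = "%t x. (c (idx N t) (idx N x) + \<omega>) * ((real N)^2 * sig N (idx N t) (idx N x))"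
 have sm: "m2 (%t x. f (idx N t) (idx N x))" for f :: "nat => nat => real"
  by (rule m2_idx[where f="%k t. f (idx N t) k", OF measurable_of_idx N])
 have slm: "m2 (%t x. slope N (idx N x) t)" unfolding slope_def by (rule sm)
 have ind: "integrable UU (%y. f (idx N (fst y)) (idx N (snd y)))" for f :: "nat => nat => real"
 proof (rule UUf.integrable_const_bound[where B="\<Sum>j<N. \<Sum>k<N. \<bar>f j k\<bar>"])
  show "AE y in UU. norm (f (idx N (fst y)) (idx N (snd y))) <= (\<Sum>j<N. \<Sum>k<N. \<bar>f j k\<bar>)"
  proof (rule AE_I2)
   fix y :: "real \<times> real"
   have "\<bar>f (idx N (fst y)) (idx N (snd y))\<bar> <= (\<Sum>k<N. \<bar>f (idx N (fst y)) k\<bar>)"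
    using idx_less[OF N] by (intro member_le_sum) auto
   also have "... <= (\<Sum>j<N. \<Sum>k<N. \<bar>f j k\<bar>)"
    using idx_less[OF N] by (intro member_le_sum[where f="%j. \<Sum>k<N. \<bar>f j k\<bar>"]) (auto intro!: sum_nonneg)
   finally show "norm (f (idx N (fst y)) (idx N (snd y))) <= (\<Sum>j<N. \<Sum>k<N. \<bar>f j k\<bar>)" by simp
  qed
  show "(%y. f (idx N (fst y)) (idx N (snd y))) \<in> bm UU" using sm[of f] by (simp add: m2_def)
 qed
 have "(LINT y|UU. h (fst y) (snd y) * (slope N (idx N (snd y)) (fst y))^2) <= (LINT y|UU. ?G (fst y) (snd y))"
 proof (rule integral_mono')
  show "integrable UU (%y. ?G (fst y) (snd y))" by (rule ind[where f="%j k. (c j k + \<omega>) * ((real N)^2 * sig N j k)"])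
  fix y assume "y \<in> space UU"
  then have y: "fst y \<in> I" "snd y \<in> I" by (auto simp: space_pair_measure)
  have "h (fst y) (snd y) <= c (idx N (fst y)) (idx N (snd y)) + \<omega>"
   using w[OF y idx_dist(2)[OF N y(1)] idx_dist(2)[OF N y(2)] idx_dist(1)[OF N y(1)] idx_dist(1)[OF N y(2)]]
   unfolding c_def by linarith
  moreover have "0 <= c (idx N (fst y)) (idx N (snd y)) + \<omega>"
   using h(2)[OF idx_dist(2)[OF N y(1)] idx_dist(2)[OF N y(2)]] \<omega> unfolding c_def by linarith
  ultimately show "h (fst y) (snd y) * (slope N (idx N (snd y)) (fst y))^2 <= ?G (fst y) (snd y)" "0 <= ?G (fst y) (snd y)"
   using slope_square[OF idx_less[OF N] y(1), of "snd y"] h(2)[OF y] sig_nonneg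
   by (auto intro!: mult_mono mult_nonneg_nonneg)
 qed
 also have "... = (LINT t|UI. LINT x|UI. ?G t x)"
  using UU.integral_fst'[OF ind[where f="%j k. (c j k + \<omega>) * ((real N)^2 * sig N j k)"]] by simp
 also have "... = (LINT t|UI. (\<Sum>k<N. (c (idx N t) k + \<omega>) * ((real N)^2 * sig N (idx N t) k)) / N)"
 proof (rule LINT_cong[OF refl])
  fix t show "(LINT x|UI. ?G t x) = (\<Sum>k<N. (c (idx N t) k + \<omega>) * ((real N)^2 * sig N (idx N t) k)) / N"
   by (rule integral_idx[OF N, where F="%k. (c (idx N t) k + \<omega>) * ((real N)^2 * sig N (idx N t) k)"])
 qed
 also have "... = (\<Sum>j<N. (\<Sum>k<N. (c j k + \<omega>) * ((real N)^2 * sig N j k)) / N) / N"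
  by (rule integral_idx[OF N, where F="%j. (\<Sum>k<N. (c j k + \<omega>) * ((real N)^2 * sig N j k)) / N"])
 also have "... = (\<Sum>j<N. \<Sum>k<N. (c j k + \<omega>) * sig N j k)"
  using N by (simp add: sum_divide_distrib power2_eq_square)
 also have "... = (\<Sum>k<N. \<Sum>j<N. (c j k + \<omega>) * sig N j k)" by (rule sum.swap)
 also have "... <= (LINT z|\<sigma>. (h (fst z) (snd z) * indicator unit_square z) + 2 * \<omega>)"
 proof (rule weighted_sum_le[OF N, where C="C + 2 * \<omega>"])
  show "(%z. h (fst z) (snd z) * indicator unit_square z + 2 * \<omega>) \<in> bm borel" using m by measurable
  show "0 <= h (fst z) (snd z) * indicator unit_square z + 2 * \<omega>" if "z \<in> unit_square" for z
   using that h(2)[of "fst z" "snd z"] \<omega> by (auto simp: unit_square_def)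
  show "\<bar>h (fst z) (snd z) * indicator unit_square z + 2 * \<omega>\<bar> <= C + 2 * \<omega>" if "z \<in> unit_square" for z
   using that h(2)[of "fst z" "snd z"] \<omega> by (auto simp: unit_square_def)
  fix j k z assume j: "j < N" and k: "k < N" and z: "z \<in> unit_square" "z \<in> slab N j \<times> cell N k"
  then have u: "fst z \<in> I" "snd z \<in> I" by (auto simp: unit_square_def)
  have "\<bar>real j / N - fst z\<bar> <= 1 / N" using z by (auto simp: slab_def add_divide_distrib)
  moreover have "\<bar>real k / N - snd z\<bar> <= 1 / N" using z idx_dist(1)[OF N u(2)] by (auto simp: cell_def)
  ultimately show "c j k + \<omega> <= h (fst z) (snd z) * indicator unit_square z + 2 * \<omega>"
   using w[OF nd[OF j] nd[OF k] u] z(1) unfolding c_def by simp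
 qed
 also have "... = (LINT z|\<sigma>. h (fst z) (snd z)) + 2 * \<omega> * \<sigma>tot"
 proof -
  have "(LINT z|\<sigma>. (h (fst z) (snd z) * indicator unit_square z) + 2 * \<omega>) = (LINT z|\<sigma>. h (fst z) (snd z) * indicator unit_square z) + (LINT z|\<sigma>. 2 * \<omega>)"
  proof (rule LINT_add)
   show "integrable \<sigma> (%z. h (fst z) (snd z) * indicator unit_square z)"
    by (rule finite_radon_integrable[OF radon_\<sigma> finite_radon_measurable[OF radon_\<sigma> m], where C=C])
      (use h(2) in "auto simp: unit_square_def")
   show "integrable \<sigma> (%z. 2 * \<omega>)" by (rule finite_radon_integrable[OF radon_\<sigma>, where C="\<bar>2 * \<omega>\<bar>"]) auto
  qed
  also have "(LINT z|\<sigma>. h (fst z) (snd z) * indicator unit_square z) = (LINT z|\<sigma>. h (fst z) (snd z))"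
   using finite_radonD(3)[OF radon_\<sigma>] by (intro LINT_cong) auto
  finally show ?thesis using finite_radonD(3)[OF radon_\<sigma>] by (simp add: \<sigma>tot_def mult.commute)
 qed
 finally show ?thesis .
qed

end

section \<open>Convergence of the squared amplitudes to the slices of the defect\<close>

lemma idx_tendsto: assumes "x \<in> I" shows "(%n. real (idx (Suc n) x) / real (Suc n)) ----> x"
proof -
 have "(%n. real (idx (Suc n) x) / real (Suc n) - x) ----> 0"
  by (rule Lim_null_comparison[OF _ LIMSEQ_inverse_real_of_nat])
    (use idx_dist(1)[of "Suc _" x] assms in "auto simp: abs_minus_commute inverse_eq_divide")
 then show ?thesis by (simp only: LIM_zero_iff)
qed

lemma idx_mono: "x <= y ==> idx N x <= idx N y"
 unfolding idx_def by (intro min.mono order_refl nat_mono floor_mono mult_left_mono) auto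

lemma idx_separates:
 assumes xy: "x \<in> I" "y \<in> I" "y < x"
 shows "\<forall>\<^sub>F n in sequentially. idx (Suc n) y < idx (Suc n) x"
proof -
 have "\<forall>\<^sub>F n in sequentially. real (idx (Suc n) y) / real (Suc n) < real (idx (Suc n) x) / real (Suc n)"
 proof -
  define m where "m = (x + y) / 2"
  have "y < m" "m < x" using xy by (auto simp: m_def)
  from order_tendstoD(2)[OF idx_tendsto[OF xy(2)] this(1)] order_tendstoD(1)[OF idx_tendsto[OF xy(1)] this(2)]
  show ?thesis by eventually_elim linarith
 qed
 then show ?thesis by eventually_elim (simp add: divide_less_cancel)
qed

locale interval_measure = finite_measure m for m :: "real measure" +
 assumes sets: "sets m = sets (restrict_space borel I)"
begin

lemma space: "space m = I"
 using sets_eq_imp_space_eq[OF sets] by (simp add: space_restrict_space)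

lemma measurable_m: "f \<in> bm UI ==> f \<in> bm m"
 by (simp only: measurable_cong_sets[OF sets refl] measurable_cong_sets[OF sets_UI refl])

lemma cell_sets: "k < N ==> cell N k \<in> sets m"
 using cell(1) cell_sub by (auto simp: sets sets_restrict_space_iff)

lemma bounded_integrable: "f \<in> bm UI ==> (!!x. x \<in> I ==> \<bar>f x\<bar> <= B) ==> integrable m f" for f :: "real => real"
 by (rule integrable_const_bound[where B=B]) (auto intro!: measurable_m AE_I2 simp: space)

lemma integral_cells:
 fixes F :: "nat => real"
 assumes N: "N >= 1" shows "(LINT y|m. F (idx N y)) = (\<Sum>k<N. F k * measure m (cell N k))"
proof -
 have i: "integrable m (%y. F k * indicator (cell N k) y)" if "k < N" for k
  using cell_sets[OF that] by (intro integrable_mult_right) (simp add: less_top[symmetric])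
 have "(LINT y|m. F (idx N y)) = (LINT y|m. (\<Sum>k<N. F k * indicator (cell N k) y))"
  by (intro LINT_cong refl sum_cells[OF N, symmetric]) (simp add: space)
 also have "... = (\<Sum>k<N. LINT y|m. F k * indicator (cell N k) y)"
  by (rule LINT_sum) (use i in simp)
 also have "... = (\<Sum>k<N. F k * measure m (cell N k))"
 proof (rule sum.cong[OF refl])
  fix k assume k: "k \<in> {..<N}"
  have "cell N k Int space m = cell N k" using cell_sub space by blast
  then show "(LINT y|m. F k * indicator (cell N k) y) = F k * measure m (cell N k)"
   unfolding integral_mult_right_zero by simp
 qed
 finally show ?thesis .
qed

text \<open>Comparing cell indices instead of x <= y gives a function constant on cells. It
  converges at every y, because distinct points are eventually in different cells while y = x is
  always included.\<close>

lemma tail_approximation: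
 assumes h: "continuous_on I h" and x: "x \<in> I"
 shows "(%n. \<Sum>k<Suc n. (if idx (Suc n) x <= k then h (real k / real (Suc n)) else 0) * measure m (cell (Suc n) k))
  ----> (LINT y|m. (if x <= y then h y else 0))"
proof -
 obtain C where C: "C >= 0" "!!y. y \<in> I ==> \<bar>h y\<bar> <= C" using continuous_bounded_UI[OF h] by blast
 have hm [measurable]: "h \<in> bm UI" by (rule continuous_measurable_UI[OF h])
 let ?F = "%n k. (if idx (Suc n) x <= k then h (real k / real (Suc n)) else 0)"
 have "(%n. LINT y|m. ?F n (idx (Suc n) y)) ----> (LINT y|m. (if x <= y then h y else 0))"
 proof (rule integral_dominated_convergence[where w="%_. C"])
  show "(%y. if x <= y then h y else 0) \<in> bm m" by (rule measurable_m) measurable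
  show "(%y. ?F n (idx (Suc n) y)) \<in> bm m" for n
   by (rule measurable_m[OF measurable_of_idx[of "?F n"]])
  show "AE y in m. (%n. ?F n (idx (Suc n) y)) ----> (if x <= y then h y else 0)"
  proof (rule AE_I2)
   fix y assume "y \<in> space m"
   then have y: "y \<in> I" by (simp add: space)
   have hl: "(%n. h (real (idx (Suc n) y) / real (Suc n))) ----> h y"
    using continuous_on_tendsto_compose[OF h idx_tendsto[OF y] y] idx_dist(2)[of "Suc _" y] y by simp
   show "(%n. ?F n (idx (Suc n) y)) ----> (if x <= y then h y else 0)"
   proof (cases "x <= y")
    case True
    then show ?thesis using hl idx_mono[OF True] by simp
   next
    case False
    then have "\<forall>\<^sub>F n in sequentially. idx (Suc n) y < idx (Suc n) x" using idx_separates[OF x y] by simp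
    then have "\<forall>\<^sub>F n in sequentially. ?F n (idx (Suc n) y) = 0" by eventually_elim simp
    then show ?thesis using False by (simp add: tendsto_eventually)
   qed
  qed
  show "AE y in m. norm (?F n (idx (Suc n) y)) <= C" for n
   using C idx_dist(2)[of "Suc n"] by (auto intro!: AE_I2 simp: space)
 qed simp
 moreover have "(LINT y|m. ?F n (idx (Suc n) y)) = (\<Sum>k<Suc n. ?F n k * measure m (cell (Suc n) k))" for n
  by (rule integral_cells) simp
 ultimately show ?thesis by simp
qed

lemma cell_of_point_tendsto: assumes x: "x \<in> I"
 shows "(%n. measure m (cell (Suc n) (idx (Suc n) x))) ----> measure m {x}"
proof -
 have "(%n. LINT y|m. indicator (cell (Suc n) (idx (Suc n) x)) y :: real) ----> (LINT y|m. indicator {x} y)"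
 proof (rule integral_dominated_convergence[where w="%_. 1"])
  have c: "cell (Suc n) (idx (Suc n) x) \<in> sets m" for n by (rule cell_sets) (rule idx_less, simp)
  show "indicator {x} \<in> bm m"
   using x by (intro borel_measurable_indicator) (auto simp: sets sets_restrict_space_iff)
  show "indicator (cell (Suc n) (idx (Suc n) x)) \<in> bm m" for n
   by (intro borel_measurable_indicator c)
  show "AE y in m. (%n. indicator (cell (Suc n) (idx (Suc n) x)) y :: real) ----> indicator {x} y"
  proof (rule AE_I2)
   fix y assume "y \<in> space m"
   then have y: "y \<in> I" by (simp add: space)
   show "(%n. indicator (cell (Suc n) (idx (Suc n) x)) y :: real) ----> indicator {x} y"
   proof (cases "y = x")
    case True then show ?thesis using x by (simp add: cell_def)
   next
    case False
    then have "\<forall>\<^sub>F n in sequentially. idx (Suc n) y ~= idx (Suc n) x"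
     using idx_separates[OF x y] idx_separates[OF y x]
     by (cases "y < x") (auto elim: eventually_mono)
    then have "\<forall>\<^sub>F n in sequentially. indicator (cell (Suc n) (idx (Suc n) x)) y = (0::real)"
     by eventually_elim (auto simp: cell_def)
    then show ?thesis using False by (simp add: tendsto_eventually)
   qed
  qed
 qed (auto split: split_indicator)
 moreover have "(LINT y|m. indicator A y :: real) = measure m A" if "A \<subseteq> I" for A
  using that by (simp add: space Int_absorb2)
 ultimately show ?thesis using x cell_sub by simp
qed

lemma AE_not_atom: "AE x in UI. measure m {x} = 0"
proof -
 have c: "countable {x. measure m {x} ~= 0}" by (rule countable_support)
 have "AE x in lborel. x \<notin> {x. measure m {x} ~= 0}"
  by (rule AE_not_in) (rule countable_imp_null_set_lborel[OF c])
 then have "AE x in lborel. x \<in> I --> measure m {x} = 0" by eventually_elim simp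
 then show ?thesis by (simp add: UI_AE)
qed

end

text \<open>Measurability in t is known for the mass of a fixed set; the step sums of
  \<open>tail_approximation\<close> exhibit the tail integral as a limit of jointly measurable
  functions.\<close>

lemma m2_kernel_tail:
 assumes k: "!!t. t \<in> I ==> sets (k t) = sets (restrict_space borel I) & finite_measure (k t)"
  and m: "!!B. B \<in> sets (restrict_space borel I) ==> (%t. emeasure (k t) B) \<in> bm UI"
  and h: "m2 h" "!!t. t \<in> I ==> continuous_on I (h t)"
 shows "m2 (%t x. LINT y|k t. (if x <= y then h t y else 0))"
 unfolding m2_def
proof (rule borel_measurable_LIMSEQ_real)
 let ?u = "%n t x. \<Sum>i<Suc n. (if idx (Suc n) x <= i then h t (real i / real (Suc n)) else 0) * measure (k t) (cell (Suc n) i)"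
 fix z assume "z \<in> space UU"
 then have z: "fst z \<in> I" "snd z \<in> I" by (auto simp: space_pair_measure)
 interpret interval_measure "k (fst z)" using k[OF z(1)] by (simp add: interval_measure_def interval_measure_axioms_def)
 show "(%n. ?u n (fst z) (snd z)) ----> (LINT y|k (fst z). (if snd z <= y then h (fst z) y else 0))"
  by (rule tail_approximation[OF h(2)[OF z(1)] z(2)])
next
 let ?u = "%n t x. \<Sum>i<Suc n. (if idx (Suc n) x <= i then h t (real i / real (Suc n)) else 0) * measure (k t) (cell (Suc n) i)"
 fix n
 show "(%z. ?u n (fst z) (snd z)) \<in> bm UU"
 proof (rule borel_measurable_sum)
  fix i assume i: "i \<in> {..<Suc n}"
  have nd: "real i / real (Suc n) \<in> I" using i by auto
  have [measurable]: "(%t. h t (real i / real (Suc n))) \<in> bm UI" by (rule m2_section'[OF h(1) nd])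
  have "cell (Suc n) i \<in> sets (restrict_space borel I)"
   using cell(1)[of i "Suc n"] cell_sub i by (auto simp: sets_restrict_space_iff)
  from m[OF this] have [measurable]: "(%t. measure (k t) (cell (Suc n) i)) \<in> bm UI"
   unfolding measure_def by measurable
  show "(%z. (if idx (Suc n) (snd z) <= i then h (fst z) (real i / real (Suc n)) else 0) * measure (k (fst z)) (cell (Suc n) i)) \<in> bm UU"
   by measurable
 qed
qed

lemma interval_measureI: "sets m = sets (restrict_space borel I) ==> finite_measure m ==> interval_measure m"
 by (simp add: interval_measure_def interval_measure_axioms_def)

context fisher_rao_dominated
begin

text \<open>On functions constant on cells the squared exact amplitude and the slice integrate
  identically. Replacing h cut off below x by such a function costs the modulus \<omega> everywhere,
  and a bounded amount on the one cell containing x, whose slice mass tends to the mass of the point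
  x, assumed zero.\<close>

lemma exact_tail_limit:
 assumes t: "0 <= t" "t < 1" and h: "continuous_on I h"
  and w: "!!N y z. N >= 1 ==> y \<in> I ==> z \<in> I ==> \<bar>y - z\<bar> <= 1 / real N ==> \<bar>h y - h z\<bar> <= \<omega> N"
  and \<omega>: "\<omega> ----> 0" and x: "x \<in> I" "measure (\<kappa> t) {x} = 0"
 shows "(%n. LINT y|UI. (if x <= y then h y * (exact (Suc n) t y)^2 else 0)) ----> (LINT y|\<kappa> t. (if x <= y then h y else 0))"
proof -
 interpret m: interval_measure "\<kappa> t" by (rule interval_measureI[OF \<kappa>])
 have t1: "t \<in> I" using t by simp
 have km: "measure (\<kappa> t) (cell N k) = cum (cell N k) t" if "k < N" for N k
  by (rule \<kappa>_measure[OF t cell(1)[OF that] cell_sub])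
 obtain C where C: "C >= 0" "!!y. y \<in> I ==> \<bar>h y\<bar> <= C" using continuous_bounded_UI[OF h] by blast
 have hm [measurable]: "h \<in> bm UI" by (rule continuous_measurable_UI[OF h])
 let ?F = "%N k. (if idx N x <= k then h (real k / real N) else 0)"
 let ?\<psi> = "%y. (if x <= y then h y else 0)"
 let ?b = "%N k. \<omega> N + (if k = idx N x then C else 0)"
 have el: "integrable UI (%y. (exact N t y)^2)" if "N >= 1" for N by (rule l2_square[OF exact_l2[OF that]])
 have close: "\<bar>?\<psi> y - ?F N (idx N y)\<bar> <= ?b N (idx N y)" if N: "N >= 1" and y: "y \<in> I" for N y
 proof -
  note d = idx_dist[OF N y]
  have w1: "\<bar>h y - h (real (idx N y) / N)\<bar> <= \<omega> N" by (rule w[OF N y d(2) d(1)])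
  show ?thesis
  proof (cases "x <= y")
   case True
   then show ?thesis using idx_mono[OF True, of N] w1 C(1) by auto
  next
   case False
   then have "idx N y <= idx N x" by (intro idx_mono) simp
   then show ?thesis using False w1 C(2)[OF d(2)] by (cases "idx N x <= idx N y") auto
  qed
 qed
 have int\<psi>: "integrable UI (%y. ?\<psi> y * (exact N t y)^2)" if "N >= 1" for N
  by (rule intble_bound[OF integrable_mult_right[OF el[OF that], of C]])
    (use C borel_measurable_integrable[OF el[OF that]] in "auto intro!: AE_I2 mult_right_mono simp: abs_mult")
 have intF: "integrable UI (%y. f (idx N y) * (exact N t y)^2)" if "N >= 1" for N and f :: "nat => real"
  using l2_mult_integrable[OF l2_idx[OF that, of "%k. f k * sqrt (real N * cum (cell N k) t)"] exact_l2[OF that, of t]]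
  by (simp add: exact_def power2_eq_square mult.assoc)
 have diff: "\<bar>(LINT y|UI. ?\<psi> y * (exact N t y)^2) - (LINT y|\<kappa> t. ?F N (idx N y))\<bar>
   <= \<omega> N * cum I t + C * measure (\<kappa> t) (cell N (idx N x))" if N: "N >= 1" for N
 proof -
  have F: "(LINT y|\<kappa> t. ?F N (idx N y)) = (LINT y|UI. ?F N (idx N y) * (exact N t y)^2)"
   unfolding m.integral_cells[OF N, of "?F N"] exact_sum[OF N t1, of "?F N"] by (simp add: km)
  have "(LINT y|UI. ?\<psi> y * (exact N t y)^2) - (LINT y|UI. ?F N (idx N y) * (exact N t y)^2)
    = (LINT y|UI. ?\<psi> y * (exact N t y)^2 - ?F N (idx N y) * (exact N t y)^2)"
   by (rule LINT_diff[OF int\<psi>[OF N] intF[OF N, of "?F N"], symmetric])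
  moreover have "\<bar>LINT y|UI. ?\<psi> y * (exact N t y)^2 - ?F N (idx N y) * (exact N t y)^2\<bar>
    <= (LINT y|UI. ?b N (idx N y) * (exact N t y)^2)"
  proof (rule integral_abs_bound[THEN order_trans], rule integral_mono)
   show "integrable UI (%y. \<bar>?\<psi> y * (exact N t y)^2 - ?F N (idx N y) * (exact N t y)^2\<bar>)"
    by (intro integrable_abs intble_diff int\<psi> N) (rule intF[OF N, of "?F N"])
   show "integrable UI (%y. ?b N (idx N y) * (exact N t y)^2)" by (rule intF[OF N, of "?b N"])
   fix y assume "y \<in> space UI"
   then have "\<bar>?\<psi> y - ?F N (idx N y)\<bar> <= ?b N (idx N y)" using close[OF N] by simp
   then show "\<bar>?\<psi> y * (exact N t y)^2 - ?F N (idx N y) * (exact N t y)^2\<bar> <= ?b N (idx N y) * (exact N t y)^2"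
    unfolding left_diff_distrib[symmetric] abs_mult abs_power2 by (rule mult_right_mono) simp
  qed
  moreover have "(LINT y|UI. ?b N (idx N y) * (exact N t y)^2) = \<omega> N * cum I t + C * measure (\<kappa> t) (cell N (idx N x))"
  proof -
   have "(LINT y|UI. ?b N (idx N y) * (exact N t y)^2) = (\<Sum>k<N. ?b N k * cum (cell N k) t)" by (rule exact_sum[OF N t1, of "?b N"])
   also have "... = (\<Sum>k<N. \<omega> N * cum (cell N k) t) + (\<Sum>k<N. if k = idx N x then C * cum (cell N (idx N x)) t else 0)"
    by (simp add: distrib_right sum.distrib if_distrib[of "%u. u * _"] cong: if_cong)
   also have "... = \<omega> N * cum I t + C * measure (\<kappa> t) (cell N (idx N x))"
    using idx_less[OF N, of x] km[OF idx_less[OF N, of x]] by (simp add: sum_distrib_left[symmetric] cum_cells[OF N])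
   finally show ?thesis .
  qed
  ultimately show ?thesis unfolding F by linarith
 qed
 have D: "(%n. (LINT y|UI. ?\<psi> y * (exact (Suc n) t y)^2) - (LINT y|\<kappa> t. ?F (Suc n) (idx (Suc n) y))) ----> 0"
 proof (rule Lim_null_comparison)
  show "\<forall>\<^sub>F n in sequentially. norm ((LINT y|UI. ?\<psi> y * (exact (Suc n) t y)^2) - (LINT y|\<kappa> t. ?F (Suc n) (idx (Suc n) y)))
    <= \<omega> (Suc n) * cum I t + C * measure (\<kappa> t) (cell (Suc n) (idx (Suc n) x))"
   unfolding real_norm_def by (intro always_eventually allI diff) simp
  have "(%n. \<omega> (Suc n) * cum I t + C * measure (\<kappa> t) (cell (Suc n) (idx (Suc n) x))) ----> 0 * cum I t + C * measure (\<kappa> t) {x}"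
   by (intro tendsto_add tendsto_mult tendsto_const LIMSEQ_Suc[OF \<omega>] m.cell_of_point_tendsto x(1))
  then show "(%n. \<omega> (Suc n) * cum I t + C * measure (\<kappa> t) (cell (Suc n) (idx (Suc n) x))) ----> 0" using x(2) by simp
 qed
 have F: "(%n. LINT y|\<kappa> t. ?F (Suc n) (idx (Suc n) y)) ----> (LINT y|\<kappa> t. (if x <= y then h y else 0))"
  using m.tail_approximation[OF h x(1)] m.integral_cells[of "Suc _" "?F (Suc _)"] by simp
 have e: "(LINT y|UI. (if x <= y then h y * (exact N t y)^2 else 0)) = (LINT y|UI. ?\<psi> y * (exact N t y)^2)" for N
  by (intro LINT_cong) auto
 from tendsto_add[OF D F] show ?thesis unfolding e by simp
qed

text \<open>The difference of the squares factors into the L2-small interpolation error, of order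
  1/sqrt N, and an L2-bounded sum.\<close>

lemma coef_tail_limit:
 assumes t: "0 <= t" "t < 1" and h: "continuous_on I h"
  and w: "!!N y z. N >= 1 ==> y \<in> I ==> z \<in> I ==> \<bar>y - z\<bar> <= 1 / real N ==> \<bar>h y - h z\<bar> <= \<omega> N"
  and \<omega>: "\<omega> ----> 0" and x: "x \<in> I" "measure (\<kappa> t) {x} = 0"
 shows "(%N. LINT y|UI. (if x <= y then h y * (coef N (idx N y) t)^2 else 0)) ----> (LINT y|\<kappa> t. (if x <= y then h y else 0))"
proof -
 obtain C where C: "C >= 0" "!!y. y \<in> I ==> \<bar>h y\<bar> <= C" using continuous_bounded_UI[OF h] by blast
 have hm [measurable]: "h \<in> bm UI" by (rule continuous_measurable_UI[OF h])
 have t1: "t \<in> I" using t by simp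
 define A where "A = sqrt total + sqrt \<sigma>tot + sqrt total"
 let ?c = "%N y. coef N (idx N y) t"
 have bd: "\<bar>(LINT y|UI. (if x <= y then h y * (?c N y)^2 else 0)) - (LINT y|UI. (if x <= y then h y * (exact N t y)^2 else 0))\<bar>
   <= C * (sqrt (\<sigma>tot / N) * A)" if N: "N >= 1" for N
 proof -
  have lc: "l2 UI (?c N)" by (rule l2_idx[OF N, where F="%k. coef N k t"])
  have le: "l2 UI (exact N t)" by (rule exact_l2[OF N])
  have mb: "l2 UI (%y. (if x <= y then h y else 0) * u y)" if "l2 UI u" for u
   by (rule l2_mult_bounded[OF that, where c=C]) (use C in auto)
  have i: "integrable UI (%y. if x <= y then h y * (?c N y)^2 else 0)" "integrable UI (%y. if x <= y then h y * (exact N t y)^2 else 0)"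
   using l2_mult_integrable[OF mb[OF lc] lc] l2_mult_integrable[OF mb[OF le] le]
   by (auto simp: power2_eq_square mult.assoc if_distrib[of "%u. u * _"] cong: if_cong)
  have E: "(LINT y|UI. (if x <= y then h y * (?c N y)^2 else 0)) - (LINT y|UI. (if x <= y then h y * (exact N t y)^2 else 0))
    = (LINT y|UI. ((if x <= y then h y else 0) * (?c N y - exact N t y)) * (?c N y + exact N t y))"
   unfolding LINT_diff[OF i, symmetric]
   by (intro LINT_cong) (auto simp: power2_eq_square algebra_simps)
  have "\<bar>LINT y|UI. ((if x <= y then h y else 0) * (?c N y - exact N t y)) * (?c N y + exact N t y)\<bar>
    <= nrm UI (%y. (if x <= y then h y else 0) * (?c N y - exact N t y)) * nrm UI (%y. ?c N y + exact N t y)"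
   by (intro Cauchy_Schwarz_l2 mb l2_diff l2_add lc le)
  also have "... <= (C * sqrt (\<sigma>tot / N)) * A"
  proof (intro mult_mono)
   have "nrm UI (%y. (if x <= y then h y else 0) * (?c N y - exact N t y)) <= nrm UI (%y. C * (?c N y - exact N t y))"
   proof (rule nrm_mono[OF l2_cmult[OF l2_diff[OF lc le]] l2_measurable[OF mb[OF l2_diff[OF lc le]]]], rule AE_I2)
    fix y assume "y \<in> space UI"
    then have "\<bar>h y\<bar> <= C" using C(2) by simp
    then have "\<bar>if x <= y then h y else 0\<bar> <= \<bar>C\<bar>" using C(1) by simp
    then show "\<bar>(if x <= y then h y else 0) * (?c N y - exact N t y)\<bar> <= \<bar>C * (?c N y - exact N t y)\<bar>"
     unfolding abs_mult by (rule mult_right_mono) simp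
   qed
   also have "... <= C * sqrt (\<sigma>tot / N)" unfolding nrm_cmult using C(1) coef_exact[OF N t1] by (simp add: mult_left_mono)
   finally show "nrm UI (%y. (if x <= y then h y else 0) * (?c N y - exact N t y)) <= C * sqrt (\<sigma>tot / N)" .
   show "nrm UI (%y. ?c N y + exact N t y) <= A"
    using nrm_triangle[OF lc le] coef_nrm[OF N t1] exact_nrm[OF N t1] unfolding A_def by linarith
   show "0 <= C * sqrt (\<sigma>tot / N)" using C(1) \<sigma>tot_nonneg by simp
  qed simp
  finally show ?thesis unfolding E by (simp only: mult.assoc)
 qed
 have "(%N. C * (sqrt (\<sigma>tot / real N) * A)) ----> C * (sqrt 0 * A)"
  by (intro tendsto_intros real_tendsto_divide_at_top[OF tendsto_const filterlim_real_sequentially])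
 then have z: "(%n. C * (sqrt (\<sigma>tot / real (Suc n)) * A)) ----> 0" by (intro LIMSEQ_Suc) simp
 have "(%n. (LINT y|UI. (if x <= y then h y * (?c (Suc n) y)^2 else 0)) - (LINT y|UI. (if x <= y then h y * (exact (Suc n) t y)^2 else 0))) ----> 0"
  by (rule Lim_null_comparison[OF _ z], unfold real_norm_def, intro always_eventually allI bd) simp
 from tendsto_add[OF this exact_tail_limit[OF t h w \<omega> x]]
 have "(%n. LINT y|UI. (if x <= y then h y * (?c (Suc n) y)^2 else 0)) ----> (LINT y|\<kappa> t. (if x <= y then h y else 0))" by simp
 then show ?thesis by (rule LIMSEQ_imp_Suc)
qed

end

section \<open>Slices of \<mu> itself: the square p^2 plus the slices of the defect\<close>

subsection \<open>Time slices\<close>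

lemma sq_measure_UU: "sq_measure u = density UU (%z. ennreal ((u (fst z) (snd z))^2))"
 by (simp add: sq_measure_def lborel_square case_prod_beta')

lemma sq_measure_cong:
 assumes "m2 u" "m2 v" "AE t in UI. AE x in UI. u t x = v t x"
 shows "sq_measure u = sq_measure v"
 unfolding sq_measure_UU
proof (rule density_cong)
 note [measurable] = assms(1)[unfolded m2_def] assms(2)[unfolded m2_def]
 show "(%z. ennreal ((u (fst z) (snd z))^2)) \<in> bm UU" "(%z. ennreal ((v (fst z) (snd z))^2)) \<in> bm UU"
  by measurable
 have "{z \<in> space UU. u (fst z) (snd z) = v (fst z) (snd z)} \<in> sets UU" by measurable
 from AE_UU(1)[OF this assms(3)]
 show "AE z in UU. ennreal ((u (fst z) (snd z))^2) = ennreal ((v (fst z) (snd z))^2)" by eventually_elim simp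
qed

lemma sq_measure_integral:
 assumes "m2 u" "f \<in> bm UU"
 shows "(LINT z|sq_measure u. f z) = (LINT z|UU. (u (fst z) (snd z))^2 * f z)"
 unfolding sq_measure_UU
 by (subst integral_density) (use assms in "auto simp: m2_def")

lemma sets_UU: "sets UU = sets (restrict_space borel unit_square)"
 unfolding lborel_square[symmetric] by (rule sets_restrict_space_cong) simp

lemma finite_radon_sq_measure:
 assumes "l2 UU (%z. u (fst z) (snd z))" shows "finite_radon (sq_measure u)"
 unfolding finite_radon_def
proof
 show "sets (sq_measure u) = sets (restrict_space borel unit_square)" by (simp add: sq_measure_UU sets_UU)
 have "emeasure (sq_measure u) (space (sq_measure u)) = (\<integral>\<^sup>+ z. ennreal ((u (fst z) (snd z))^2) \<partial>UU)"
  unfolding sq_measure_UU space_density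
  by (subst emeasure_density) (use l2_measurable[OF assms] in "auto intro!: nn_integral_cong split: split_indicator")
 also have "... < \<infinity>" using l2_square[OF assms] by (simp add: integrable_iff_bounded)
 finally show "finite_measure (sq_measure u)" by (intro finite_measureI) simp
qed

context fisher_rao_dominated
begin

context
 fixes p
 assumes \<pi>: "\<pi> = sq_measure p" and p_m2: "m2 p" and p_l2: "!!t. t \<in> I ==> l2 UI (p t)"
begin

text \<open>An explicit disintegration of \<mu>; the chosen \<open>slices\<close> agrees with it at
  almost every time by uniqueness.\<close>

definition slice :: "real => real measure" where
 "slice t = add_measure (density UI (%x. ennreal ((p t x)^2))) (\<kappa> t)"

lemma density_finite: assumes "t \<in> I" shows "finite_measure (density UI (%x. ennreal ((p t x)^2)))"
proof (rule finite_measureI)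
 have "emeasure (density UI (%x. ennreal ((p t x)^2))) (space UI) = (\<integral>\<^sup>+ x. ennreal ((p t x)^2) \<partial>UI)"
  by (subst emeasure_density) (use l2_measurable[OF p_l2[OF assms]] sets.top[of UI, unfolded space_UI] in "auto intro!: nn_integral_cong split: split_indicator")
 also have "... < \<infinity>" using l2_square[OF p_l2[OF assms]] by (simp add: integrable_iff_bounded)
 finally show "emeasure (density UI (%x. ennreal ((p t x)^2))) (space (density UI (%x. ennreal ((p t x)^2)))) ~= \<infinity>" by simp
qed

lemma \<mu>_split: assumes A: "A \<in> sets \<mu>" shows "emeasure \<mu> A = emeasure \<pi> A + emeasure \<Delta> A"
proof -
 have s: "sets \<mu> = sets \<pi>" using radon by (simp add: finite_radon_def)
 have le': "emeasure \<pi> A <= emeasure \<mu> A" using le_measureD3[OF le(1)] A s by simp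
 interpret \<pi>: finite_measure \<pi> by (rule finite_radonD[OF radon(2)])
 interpret \<mu>: finite_measure \<mu> by (rule finite_radonD[OF radon(1)])
 have "emeasure \<Delta> A = emeasure \<mu> A - emeasure \<pi> A"
  by (rule emeasure_diff_measure) (use s le A in "auto simp: le_measure \<mu>.finite_measure_axioms \<pi>.finite_measure_axioms le_measureD3")
 then show ?thesis using le' by (simp add: add_diff_eq_ennreal)
qed

lemma disintegrates_slice: "disintegrates \<mu> slice"
 unfolding disintegrates_UI
proof (intro conjI ballI)
 fix t :: real assume t: "t \<in> I"
 have s: "sets (density UI (%x. ennreal ((p t x)^2))) = sets (\<kappa> t)" by (simp add: \<kappa> sets_UI)
 show "sets (slice t) = sets (restrict_space borel I)" by (simp add: slice_def sets_UI)
 show "finite_measure (slice t)" unfolding slice_def by (rule finite_add_measure[OF s density_finite[OF t] \<kappa>(2)])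
next
 have pm: "(%z. (p (fst z) (snd z))^2) \<in> bm UU" using p_m2 by (auto simp: m2_def)
 have em: "emeasure (slice t) B = (\<integral>\<^sup>+ x. ennreal ((p t x)^2) * indicator B x \<partial>UI) + emeasure (\<kappa> t) B"
  if "t \<in> I" "B \<in> sets UI" for t B
  unfolding slice_def
  by (subst emeasure_add_measure, simp add: \<kappa> sets_UI, use that in simp, subst emeasure_density)
    (use l2_measurable[OF p_l2[OF that(1)]] that in auto)
 {
  fix B assume B: "B \<in> sets (restrict_space borel {0..1::real})"
  then have Bs [measurable]: "B \<in> sets UI" by (simp add: sets_UI)
  have [measurable]: "(%t. emeasure (\<kappa> t) B) \<in> bm UI" by (rule \<kappa>_emeasure_measurable[OF B])
  have [measurable]: "(%(t, x). (p t x)^2) \<in> bm UU" using pm by (simp add: case_prod_beta')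
  have "(%t. (\<integral>\<^sup>+ x. ennreal ((p t x)^2) * indicator B x \<partial>UI) + emeasure (\<kappa> t) B) \<in> bm UI"
   by measurable
  then show "(%t. emeasure (slice t) B) \<in> bm UI"
   by (rule measurable_cong[THEN iffD2, rotated]) (use em Bs in auto)
 }
 fix A assume A: "A \<in> sets \<mu>"
 then have A': "A \<in> sets borel" "A \<subseteq> unit_square" using unit_square_sets[OF radon(1)] by auto
 then have Ai: "A Int unit_square = A" by blast
 have AU [measurable]: "A \<in> sets UU" using A radon(1) by (simp add: sets_UU finite_radon_def)
 have sec: "{x. (t, x) \<in> A} \<in> sets UI" if "t \<in> I" for t using section_sets[OF A'(1) that] by (simp add: Ai sets_UI)
 note \<Delta>d = \<Delta>_disintegration[OF A'(1), unfolded Ai]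
 have pi: "emeasure \<pi> A = (\<integral>\<^sup>+ t. \<integral>\<^sup>+ x. ennreal ((p t x)^2) * indicator A (t, x) \<partial>UI \<partial>UI)"
 proof -
  have "emeasure \<pi> A = (\<integral>\<^sup>+ z. ennreal ((p (fst z) (snd z))^2) * indicator A z \<partial>UU)"
   unfolding \<pi> sq_measure_UU by (rule emeasure_density) (use pm AU in auto)
  also have "... = (\<integral>\<^sup>+ t. \<integral>\<^sup>+ x. ennreal ((p t x)^2) * indicator A (t, x) \<partial>UI \<partial>UI)"
   using UI.nn_integral_fst[of "%z. ennreal ((p (fst z) (snd z))^2) * indicator A z" UI, symmetric] pm by simp
  finally show ?thesis .
 qed
 have [measurable]: "(%t. \<integral>\<^sup>+ x. ennreal ((p t x)^2) * indicator A (t, x) \<partial>UI) \<in> bm UI"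
 proof -
  have [measurable]: "(%(t, x). (p t x)^2) \<in> bm UU" using pm by (simp add: case_prod_beta')
  show ?thesis by measurable
 qed
 have "(\<integral>\<^sup>+ t. emeasure (slice t) {x. (t, x) \<in> A} \<partial>UI)
   = (\<integral>\<^sup>+ t. (\<integral>\<^sup>+ x. ennreal ((p t x)^2) * indicator A (t, x) \<partial>UI) + emeasure (\<kappa> t) {x. (t, x) \<in> A} \<partial>UI)"
  by (intro nn_integral_cong) (auto simp: em sec indicator_def)
 also have "... = emeasure \<pi> A + emeasure \<Delta> A"
  unfolding pi using \<Delta>d by (subst nn_integral_add) auto
 finally show "emeasure \<mu> A = (\<integral>\<^sup>+ t. emeasure (slice t) {x. (t, x) \<in> A} \<partial>UI)" using \<mu>_split[OF A] by simp
qed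

lemma disintegrates_slices: "disintegrates \<mu> (slices \<mu>)"
 unfolding slices_def by (rule someI[of "disintegrates \<mu>", OF disintegrates_slice])

lemma slices_eq: "AE t in UI. slices \<mu> t = slice t"
 by (rule disintegrates_unique[OF radon(1) disintegrates_slices disintegrates_slice])

lemma slice_tail:
 assumes t: "t \<in> I" and h: "continuous_on I h" "!!y. y \<in> I ==> 0 < h y"
 shows "(LINT y|slice t. (if x <= y then h y else 0))
  = (LINT y|UI. (if x <= y then h y * (p t y)^2 else 0)) + (LINT y|\<kappa> t. (if x <= y then h y else 0))"
proof -
 obtain C where C: "C >= 0" "!!y. y \<in> I ==> \<bar>h y\<bar> <= C" using continuous_bounded_UI[OF h(1)] by blast
 \<comment> \<open>Extension by zero, because the integral over a sum of measures is computed for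
   functions nonnegative everywhere.\<close>
 define f where "f y = (if x <= y & y \<in> I then h y else 0)" for y
 have hm [measurable]: "h \<in> bm UI" by (rule continuous_measurable_UI[OF h(1)])
 have fm: "f \<in> bm UI"
 proof -
  have "(%y. if x <= y then h y else 0) \<in> bm UI" by measurable
  then show ?thesis by (rule measurable_cong[THEN iffD2, rotated]) (auto simp: f_def)
 qed
 have f0: "0 <= f y" "\<bar>f y\<bar> <= C" for y using h(2) C by (auto simp: f_def less_imp_le)
 let ?d = "density UI (%x. ennreal ((p t x)^2))"
 interpret k: interval_measure "\<kappa> t" by (rule interval_measureI[OF \<kappa>])
 interpret dd: interval_measure ?d by (rule interval_measureI[OF _ density_finite[OF t]]) (simp add: sets_UI)
 have s: "sets ?d = sets (\<kappa> t)" by (simp add: \<kappa> sets_UI)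
 have sp: "space (slice t) = I" by (simp add: slice_def)
 have "(LINT y|slice t. (if x <= y then h y else 0)) = (LINT y|slice t. f y)"
  by (intro LINT_cong) (auto simp: f_def sp)
 also have "... = (LINT y|?d. f y) + (LINT y|\<kappa> t. f y)"
  unfolding slice_def using f0 by (intro integral_add_measure[OF s]) (auto intro!: dd.bounded_integrable[OF fm] k.bounded_integrable[OF fm])
 also have "(LINT y|?d. f y) = (LINT y|UI. (p t y)^2 * f y)"
  by (subst integral_density) (use fm l2_measurable[OF p_l2[OF t]] in auto)
 also have "... = (LINT y|UI. (if x <= y then h y * (p t y)^2 else 0))"
  by (intro LINT_cong) (auto simp: f_def)
 also have "(LINT y|\<kappa> t. f y) = (LINT y|\<kappa> t. (if x <= y then h y else 0))"
  by (intro LINT_cong) (auto simp: f_def k.space)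
 finally show ?thesis .
qed

end

end

section \<open>Choice of the sign, recovery sequence, and evaluation of the relaxed
  functional\<close>

subsection \<open>The recovery sequence\<close>

locale relaxed_curve = base_curve + fisher_rao_dominated +
 assumes constraints: "!!t. t \<in> I ==> g t 1 = 0" "!!t. t \<in> I ==> prim (et t) 1 = 1"
  "!!t. t \<in> I ==> R t 1 = 0" "!!t. t \<in> I ==> prim (%x. et t x * R t x) 1 = 0"
  and z_all: "!!t. t \<in> I ==> l2 UI (z t)"
  and \<pi>_eq: "\<pi> = sq_measure p" and \<rho>_eq: "\<rho> = sq_measure v"
begin

definition Kt where "Kt t x = (LINT y|\<kappa> t. (if x <= y then et t y else 0))"

lemma et_continuous: "t \<in> I ==> continuous_on I (et t)"
 by (rule ac_continuous[OF acx_et])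

lemma m2_Kt: "m2 Kt"
 unfolding Kt_def[abs_def]
 by (rule m2_kernel_tail) (use \<kappa> \<kappa>_emeasure_measurable m2s et_continuous in auto)

lemma g_modulus:
 assumes t: "t \<in> I" "s \<in> I" and x: "x \<in> I" "y \<in> I"
 shows "\<bar>g t x - g s y\<bar> <= C * sqrt \<bar>t - s\<bar> + C * sqrt \<bar>x - y\<bar>"
proof -
 have m: "(%t. R t x) \<in> bm UI" by (rule m2_section'[OF m2s(6) x(1)])
 have b: "AE t in UI. \<bar>R t x\<bar> <= \<bar>C\<bar>" by (rule AE_I2) (use R_bound x in "auto intro: order_trans[OF _ abs_ge_self]")
 have l: "l2 UI (%t. R t x)" by (rule l2_bound[OF UI.l2_const m b])
 have n: "nrm UI (%t. R t x) <= C" using nrm_mono[OF UI.l2_const m b] C(1) by simp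
 have "g t x - g s x = prim (%t. R t x) t - prim (%t. R t x) s"
  using ac_eq[OF ac_g[OF x(1)] t(1)] ac_eq[OF ac_g[OF x(1)] t(2)] by simp
 then have "\<bar>g t x - g s x\<bar> <= sqrt \<bar>t - s\<bar> * nrm UI (%t. R t x)" using prim_Hoelder[OF l t] by simp
 also have "... <= sqrt \<bar>t - s\<bar> * C" by (rule mult_left_mono[OF n]) simp
 finally show ?thesis using g_Hoelder[OF t(2) x] by (simp add: mult.commute)
qed

definition "\<omega> N = K * (2 * C / sqrt (real N))"

lemma \<omega>_lim: "\<omega> ----> 0"
proof -
 have "\<omega> ----> K * 0" unfolding \<omega>_def[abs_def]
  by (intro tendsto_mult tendsto_const over_sqrt_tendsto)
 then show ?thesis by simp
qed

lemma \<omega>_nonneg: "0 <= \<omega> N" using K C by (simp add: \<omega>_def)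

lemma et_modulus:
 assumes "t \<in> I" "x \<in> I" "s \<in> I" "y \<in> I" "\<bar>t - s\<bar> <= 1 / real N" "\<bar>x - y\<bar> <= 1 / real N"
 shows "\<bar>et t x - et s y\<bar> <= \<omega> N"
proof -
 have "sqrt \<bar>t - s\<bar> <= 1 / sqrt N" "sqrt \<bar>x - y\<bar> <= 1 / sqrt N"
  using real_sqrt_le_mono[OF assms(5)] real_sqrt_le_mono[OF assms(6)] by (simp_all add: real_sqrt_divide)
 then have "C * sqrt \<bar>t - s\<bar> + C * sqrt \<bar>x - y\<bar> <= C * (1 / sqrt N) + C * (1 / sqrt N)"
  using C(1) by (intro add_mono mult_left_mono)
 then have "\<bar>g t x - g s y\<bar> <= 2 * C / sqrt N" using g_modulus[OF assms(1,3,2,4)] by simp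
 then have "K * \<bar>g t x - g s y\<bar> <= K * (2 * C / sqrt N)" using K by (intro mult_left_mono) auto
 with et_lipschitz_g[OF assms(1-4)] show ?thesis unfolding \<omega>_def by linarith
qed

lemma et_borel: "(%z. et (fst z) (snd z) * indicator unit_square z) \<in> bm borel"
proof -
 have "(%z. et (fst z) (snd z)) \<in> borel_measurable (restrict_space borel unit_square)"
  using m2s(5) unfolding m2_def measurable_cong_sets[OF sets_UU refl] .
 then show ?thesis
  by (subst (asm) borel_measurable_restrict_space_iff) (auto simp: mult.commute)
qed

text \<open>Flipping all amplitudes at once flips the mixed term and leaves all squares unchanged.
  The limit force does not depend on the sign, so the choice is not circular.\<close>

definition sgn' :: "nat => real" where
 "sgn' N = (if (LINT y|UU. et (fst y) (snd y) * (v (fst y) (snd y) + force Kt (fst y) (snd y))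
   * (slope N (idx N (snd y)) (fst y) * walsh N (snd y))) <= 0 then 1 else -1)"

lemma sgn': "(sgn' N)^2 = 1" "\<bar>sgn' N\<bar> = 1" by (auto simp: sgn'_def)

text \<open>Collects the estimates for \<open>coef\<close> and \<open>slope\<close>. The sign drops
  out of all of them except the mixed term, for which it was chosen.\<close>

lemma force_limit:
 "force_limit q w z C (%N k t. sgn' N * coef N k t) (%N k t. sgn' N * slope N k t) (sqrt total + sqrt \<sigma>tot)
   (%N k. \<Sum>j\<le>N. \<bar>real N * (val N k (j + 1) - val N k j)\<bar>) Kt
   (%N. (LINT y|\<sigma>. et (fst y) (snd y)) + 2 * \<omega> N * \<sigma>tot) (LINT y|\<sigma>. et (fst y) (snd y))"
proof -
 let ?a = "%N k t. sgn' N * coef N k t" and ?ad = "%N k t. sgn' N * slope N k t"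
  and ?B = "%N k. \<Sum>j\<le>N. \<bar>real N * (val N k (j + 1) - val N k j)\<bar>" and ?A = "sqrt total + sqrt \<sigma>tot"
 have one: "m2 (%t x. 1::real)" by (simp add: m2_def)
 have spm: "(LINT z|\<sigma>. 1) = \<sigma>tot" using finite_radonD(3)[OF radon_\<sigma>] by (simp add: \<sigma>tot_def)
 have tot: "0 <= total" using cum_bounded[of "{}" 0] by (auto intro: order_trans[OF abs_ge_zero])
 interpret regular_perturbation q w z C ?a ?ad ?A ?B
 proof unfold_locales
  fix N k :: nat and t :: real
  show "?a N k 0 = 0" by (simp add: coef_def)
  assume N: "N >= 1"
  show "ac (?a N k) (?ad N k)" by (rule ac_cmult[OF coef_ac])
  show "nrm UI (%x. ?a N (idx N x) t) <= ?A" if "t \<in> I"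
   unfolding nrm_cmult sgn'(2) using coef_nrm[OF N that] by simp
  have "\<bar>slope N k t\<bar> <= ?B N k"
   unfolding slope_def
   by (rule member_le_sum[where f="%j. \<bar>real N * (val N k (j + 1) - val N k j)\<bar>"]) (auto simp: idx_def)
  moreover have "\<bar>?ad N k t\<bar> = \<bar>slope N k t\<bar>" by (simp only: abs_mult sgn'(2) mult_1)
  ultimately show "\<bar>?ad N k t\<bar> <= ?B N k" by (simp only:)
  \<comment> \<open>The energy estimate for the weight 1, whose modulus is 0.\<close>
  have sq: "(nrm UU (%y. slope N (idx N (snd y)) (fst y)))^2 <= \<sigma>tot"
   unfolding nrm_square
   using slope_energy[OF N one, of 1 0] spm by simp
  have "nrm UU (%y. ?ad N (idx N (snd y)) (fst y)) <= sqrt \<sigma>tot"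
   unfolding nrm_cmult sgn'(2) mult_1 by (rule real_le_rsqrt[OF sq])
  also have "... <= ?A" using tot by simp
  finally show "nrm UU (%y. ?ad N (idx N (snd y)) (fst y)) <= ?A" .
 qed (use constraints z_all in auto)
 show ?thesis
 proof (unfold_locales)
  show "m2 Kt" by (rule m2_Kt)
  \<comment> \<open>The final time is excluded because the slice is null there by
    convention.\<close>
  have "AE t in UI. t ~= 1" by (rule AE_UI_neq)
  then show "AE t in UI. AE x in UI. (%N. Ea N t x) ----> Kt t x"
   using AE_space
  proof eventually_elim
   case (elim t)
   then have t: "0 <= t" "t < 1" "t \<in> I" by auto
   interpret k: interval_measure "\<kappa> t" by (rule interval_measureI[OF \<kappa>])
   show ?case using k.AE_not_atom AE_space
   proof eventually_elim
    case (elim x)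
    have "(%N. LINT y|UI. (if x <= y then et t y * (coef N (idx N y) t)^2 else 0)) ----> Kt t x"
     unfolding Kt_def
     by (rule coef_tail_limit[OF t(1,2) et_continuous[OF t(3)] _ \<omega>_lim _ elim(1)])
       (use et_modulus[OF t(3) _ t(3)] elim in auto)
    then show ?case unfolding Ea_def power_mult_distrib sgn'(1) mult_1 .
   qed
  qed
  fix N :: nat assume N: "N >= 1"
  show "(LINT y|UU. et (fst y) (snd y) * (?ad N (idx N (snd y)) (fst y))^2) <= (LINT y|\<sigma>. et (fst y) (snd y)) + 2 * \<omega> N * \<sigma>tot"
   unfolding power_mult_distrib sgn'(1) mult_1
   by (rule slope_energy[OF N m2s(5) _ et_borel et_modulus \<omega>_nonneg, where C=K]) (use et_bounds in "auto simp: less_imp_le")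
  let ?I = "LINT y|UU. et (fst y) (snd y) * (v (fst y) (snd y) + force Kt (fst y) (snd y)) * (slope N (idx N (snd y)) (fst y) * walsh N (snd y))"
  have "(LINT y|UU. et (fst y) (snd y) * (v (fst y) (snd y) + force Kt (fst y) (snd y)) * adw N (fst y) (snd y)) = sgn' N * ?I"
   unfolding adw_def integral_mult_right_zero[symmetric] by (intro LINT_cong) (auto simp: algebra_simps)
  also have "... <= 0" unfolding sgn'_def by auto
  finally show "(LINT y|UU. et (fst y) (snd y) * (v (fst y) (snd y) + force Kt (fst y) (snd y)) * adw N (fst y) (snd y)) <= 0" .
 next
  have "(%N. (LINT y|\<sigma>. et (fst y) (snd y)) + 2 * \<omega> N * \<sigma>tot) ----> (LINT y|\<sigma>. et (fst y) (snd y)) + 2 * 0 * \<sigma>tot"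
   by (intro tendsto_intros \<omega>_lim)
  then show "(%N. (LINT y|\<sigma>. et (fst y) (snd y)) + 2 * \<omega> N * \<sigma>tot) ----> (LINT y|\<sigma>. et (fst y) (snd y))" by simp
 qed
qed

lemma recovery_sequence:
 assumes i: "AE x in UI. q 0 x = q0 x" "AE x in UI. p 0 x = p0 x"
 obtains pn qn B where "!!n::nat. (pn n, qn n) \<in> C0_curves p0 q0" "!!n. J0 (pn n) (qn n) <= B n"
  "B ----> (LINT y|UU. et (fst y) (snd y) * (v (fst y) (snd y) + force Kt (fst y) (snd y))^2) + (LINT y|\<sigma>. et (fst y) (snd y))"
  "!!f. l2 UI f ==> (%n. LINT x|UI. pn n 1 x * f x) ----> (LINT x|UI. p 1 x * f x)"
  "!!f. l2 UI f ==> (%n. LINT x|UI. qn n 1 x * f x) ----> (LINT x|UI. q 1 x * f x)"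
  "l2 UU (%y. force Kt (fst y) (snd y))"
proof -
 interpret f: force_limit q w z C "%N k t. sgn' N * coef N k t" "%N k t. sgn' N * slope N k t" "sqrt total + sqrt \<sigma>tot"
   "%N k. \<Sum>j\<le>N. \<bar>real N * (val N k (j + 1) - val N k j)\<bar>" Kt
   "%N. (LINT y|\<sigma>. et (fst y) (snd y)) + 2 * \<omega> N * \<sigma>tot" "LINT y|\<sigma>. et (fst y) (snd y)"
  by (rule force_limit)
 obtain B where B: "!!N. N >= f.N0 ==> J0 (f.pn N) (f.qn N) <= B N" "B ----> f.limit_energy + (LINT y|\<sigma>. et (fst y) (snd y))"
  using f.J0_limit by blast
 show thesis
 proof (rule that[of "%n. f.pn (n + f.N0)" "%n. f.qn (n + f.N0)" "%n. B (n + f.N0)"])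
  show "(f.pn (n + f.N0), f.qn (n + f.N0)) \<in> C0_curves p0 q0" for n by (rule f.in_C0_curves[OF _ i]) simp
  show "J0 (f.pn (n + f.N0)) (f.qn (n + f.N0)) <= B (n + f.N0)" for n by (rule B(1)) simp
  show "(%n. B (n + f.N0)) ----> (LINT y|UU. et (fst y) (snd y) * (v (fst y) (snd y) + force Kt (fst y) (snd y))^2) + (LINT y|\<sigma>. et (fst y) (snd y))"
   using LIMSEQ_ignore_initial_segment[OF B(2), of f.N0] unfolding f.limit_energy_def .
  show "(%n. LINT x|UI. f.pn (n + f.N0) 1 x * h x) ----> (LINT x|UI. p 1 x * h x)" if "l2 UI h" for h
   by (rule LIMSEQ_ignore_initial_segment[OF f.pn_weak[OF _ that]]) simp
  show "(%n. LINT x|UI. f.qn (n + f.N0) 1 x * h x) ----> (LINT x|UI. q 1 x * h x)" if "l2 UI h" for h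
   by (rule LIMSEQ_ignore_initial_segment[OF f.qn_weak[OF _ that]]) simp
  show "l2 UU (%y. force Kt (fst y) (snd y))" by (rule f.force_l2)
 qed
qed

end

context relaxed_curve
begin

lemma slices_curve:
 shows "disintegrates \<mu> (slices \<mu>)" "AE t in UI. slices \<mu> t = slice p t"
 by (rule disintegrates_slices[OF \<pi>_eq m2s(8)] slices_eq[OF \<pi>_eq m2s(8)], erule p_l2(1))+

text \<open>For almost every t the slice of \<mu> is p^2 dx plus the slice of the defect, so the
  force in the relaxed functional is \<open>force Kt\<close>. As \<rho> is v^2, the integral of eta
  against \<nu> minus that of eta v^2 is the integral against \<sigma>. The curve p', q' may differ
  from the base curve on null sets.\<close>

lemma JR0_eq:
 assumes q': "!!t. t \<in> I ==> l2 UI (q' t)" "!!t x. t \<in> I ==> x \<in> I ==> eta (q' t) x = et t x"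
  and p': "!!t. t \<in> I ==> l2 UI (p' t)" "!!t. t \<in> I ==> AE x in UI. p' t x = p t x"
  and v': "m2 (tderiv p')" "AE t in UI. AE x in UI. tderiv p' t x = v t x"
  and F: "l2 UU (%y. force Kt (fst y) (snd y))"
 shows "JR0 P p' q' \<mu> \<nu> = (LINT y|UU. et (fst y) (snd y) * (v (fst y) (snd y) + force Kt (fst y) (snd y))^2)
  + (LINT y|\<sigma>. et (fst y) (snd y)) + P (p' 1, q' 1)"
proof -
 let ?h = "%y. et (fst y) (snd y)" and ?v = "%y. v (fst y) (snd y)" and ?F = "%y. force Kt (fst y) (snd y)"
 note dis = slices_curve(1)[unfolded disintegrates_UI]
 define Um where "Um t x = 1/2 * (LINT y|slices \<mu> t. (if x <= y then et t y else 0))" for t x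
 define Fm where "Fm t x = Fop (et t) (Um t) (bfun (R t) (et t)) x" for t x
 have slm: "interval_measure (slices \<mu> t)" if "t \<in> I" for t using dis that by (intro interval_measureI) auto
 have U: "U_meas (slices \<mu> t) (q' t) x = Um t x" if t: "t \<in> I" and x: "x \<in> I" for t x
 proof -
  interpret interval_measure "slices \<mu> t" by (rule slm[OF t])
  have "(LINT y:{x..1}|slices \<mu> t. eta (q' t) y) = (LINT y|slices \<mu> t. (if x <= y then et t y else 0))"
   unfolding set_lebesgue_integral_def
   by (rule LINT_cong[OF refl]) (use q'(2)[OF t] in "auto simp: space split: split_indicator")
  then show ?thesis by (simp add: U_meas_def Um_def)
 qed
 have mU: "m2 Um" unfolding Um_def[abs_def]
  by (rule m2_unary(1), rule m2_kernel_tail) (use dis m2s et_continuous in auto)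
 have mF: "m2 Fm" unfolding Fm_def[abs_def] bfun_def
  by (intro m2_Fop mU m2_unary m2_arith m2s borel_measurable_times borel_measurable_const m2_integral_x)
 have fF: "AE t in UI. AE x in UI. Fm t x = force Kt t x"
  using slices_curve(2) AE_space
 proof eventually_elim
  case (elim t)
  then have t: "t \<in> I" by simp
  have "Um t = (%x. 1/2 * (Up t x + Kt t x))"
   unfolding Um_def[abs_def] elim(1) Up_def Kt_def
   using slice_tail[OF \<pi>_eq m2s(8) _ t et_continuous[OF t]] p_l2(1) et_bounds(3)[OF t] by (intro ext) auto
  then show ?case unfolding Fm_def force_def by simp
 qed
 have I: "tderiv p' t x + U_meas (slices \<mu> t) (q' t) x - pi1 (p' t) (q' t) x - pi2_meas (slices \<mu> t) (q' t) x
   = tderiv p' t x + Fm t x" if t: "t \<in> I" and x: "x \<in> I" for t x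
 proof -
  have e1: "prim (eta (q' t)) 1 = 1"
   using constraints(2)[OF t] prim_cong[of 1 "eta (q' t)" "et t"] q'(2)[OF t] by simp
  have etm: "eta (q' t) \<in> bm UI"
   using m2_section[OF m2s(5) t] by (rule measurable_cong[THEN iffD2, rotated]) (use q'(2)[OF t] in auto)
  have pr: "prim (%y. p' t y * eta (q' t) y) y = R t y" if y: "y \<in> I" for y
   unfolding R_def
  proof (rule prim_cong_AE)
   show "y <= 1" using y by simp
   show "w t \<in> bm UI" by (rule m2_section[OF m2s(2) t])
   show "(%y. p' t y * eta (q' t) y) \<in> bm UI" using l2_measurable[OF p'(1)[OF t]] etm by measurable
   show "AE y in UI. p' t y * eta (q' t) y = w t y"
    using p'(2)[OF t] AE_space
   proof eventually_elim
    case (elim y)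
    then show ?case using q'(2)[OF t, of y] et_bounds(3)[OF t, of y] by (simp add: p_def)
   qed
  qed
  have b: "bfun (prim (%y. p' t y * eta (q' t) y)) (eta (q' t)) = bfun (R t) (et t)"
   unfolding bfun_def by (auto simp: pr q'(2)[OF t] intro!: LINT_cong)
  have p1: "pi1 (p' t) (q' t) x = lin 0 (bfun (R t) (et t)) (phi (q' t) x)"
   using pi1_eq[OF q'(1)[OF t] e1 l2_measurable[OF p'(1)[OF t]]] unfolding b .
  have "proj_star (q' t) (U_meas (slices \<mu> t) (q' t)) x - lin 0 (bfun (R t) (et t)) (phi (q' t) x)
    = Fop (eta (q' t)) (U_meas (slices \<mu> t) (q' t)) (bfun (R t) (et t)) x" by (rule proj_star_eq[OF x])
  also have "... = Fm t x" unfolding Fm_def by (rule Fop_cong) (use x U[OF t] q'(2)[OF t] in auto)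
  finally show ?thesis unfolding pi2_meas_def p1 by simp
 qed
 note ms = m2s(5)[unfolded m2_def] m2s(9)[unfolded m2_def] m2_force[OF m2_Kt, unfolded m2_def] mF[unfolded m2_def] v'(1)[unfolded m2_def]
 note [measurable] = ms
 have vl: "l2 UU ?v" by (rule H1D(3)[OF Hp])
 have etU: "AE y in UU. \<bar>?h y\<bar> <= K" by (rule AE_I2) (use et_abs in "auto simp: space_pair_measure")
 have hm: "l2 UU u ==> l2 UU (%y. ?h y * u y)" for u by (rule l2_mult_bounded[OF _ ms(1) etU])
 have i1: "integrable UU (%y. ?h y * (?v y + ?F y)^2)"
  using l2_mult_integrable[OF hm[OF l2_add[OF vl F]] l2_add[OF vl F]] by (simp add: power2_eq_square mult.assoc)
 have i2: "integrable UU (%y. ?h y * (?v y)^2)"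
  using l2_mult_integrable[OF hm[OF vl] vl] by (simp add: power2_eq_square mult.assoc)
 have "(LINT (t, x):unit_square|lborel. eta (q' t) x * ((tderiv p' t x + U_meas (slices \<mu> t) (q' t) x - pi1 (p' t) (q' t) x
      - pi2_meas (slices \<mu> t) (q' t) x)^2 - (tderiv p' t x)^2))
   = (LINT y|UU. ?h y * ((tderiv p' (fst y) (snd y) + Fm (fst y) (snd y))^2 - (tderiv p' (fst y) (snd y))^2))"
  unfolding UU_integral[symmetric]
 proof (rule LINT_cong[OF refl])
  fix y assume "y \<in> space UU"
  then obtain t x where y: "y = (t, x)" and tx: "t \<in> I" "x \<in> I" by (auto simp: space_pair_measure)
  show "(case y of (t, x) => eta (q' t) x * ((tderiv p' t x + U_meas (slices \<mu> t) (q' t) x - pi1 (p' t) (q' t) x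
      - pi2_meas (slices \<mu> t) (q' t) x)^2 - (tderiv p' t x)^2))
    = ?h y * ((tderiv p' (fst y) (snd y) + Fm (fst y) (snd y))^2 - (tderiv p' (fst y) (snd y))^2)"
   unfolding y prod.case I[OF tx] q'(2)[OF tx] fst_conv snd_conv ..
 qed
 also have "... = (LINT y|UU. ?h y * (?v y + ?F y)^2 - ?h y * (?v y)^2)"
 proof (rule integral_cong_AE)
  have "{z \<in> space UU. tderiv p' (fst z) (snd z) = v (fst z) (snd z)} \<in> sets UU"
   "{z \<in> space UU. Fm (fst z) (snd z) = force Kt (fst z) (snd z)} \<in> sets UU" by measurable
  from AE_UU(1)[OF this(1) v'(2)] AE_UU(1)[OF this(2) fF]
  show "AE y in UU. ?h y * ((tderiv p' (fst y) (snd y) + Fm (fst y) (snd y))^2 - (tderiv p' (fst y) (snd y))^2)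
   = ?h y * (?v y + ?F y)^2 - ?h y * (?v y)^2"
   by eventually_elim (simp add: right_diff_distrib)
 qed measurable
 also have "... = (LINT y|UU. ?h y * (?v y + ?F y)^2) - (LINT y|UU. ?h y * (?v y)^2)"
  by (rule LINT_diff[OF i1 i2])
 finally have A: "(LINT (t, x):unit_square|lborel. eta (q' t) x * ((tderiv p' t x + U_meas (slices \<mu> t) (q' t) x - pi1 (p' t) (q' t) x
      - pi2_meas (slices \<mu> t) (q' t) x)^2 - (tderiv p' t x)^2))
   = (LINT y|UU. ?h y * (?v y + ?F y)^2) - (LINT y|UU. ?h y * (?v y)^2)" .
 have sp: "space \<nu> = unit_square" "space \<rho> = unit_square" "space \<sigma> = unit_square"
  using finite_radonD(3) radon radon_\<sigma> by auto
 let ?u = "%z. ?h z * indicator unit_square z"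
 have B: "(LINT (t, x)|\<nu>. eta (q' t) x) = (LINT z|\<nu>. ?u z)"
  by (rule LINT_cong[OF refl]) (use q'(2) in "auto simp: sp unit_square_def")
 have Bd: "\<bar>?u z\<bar> <= K" if "z \<in> unit_square" for z using that et_abs by (auto simp: unit_square_def)
 have "signed_integral (\<nu>, \<rho>) ?u = (LINT z|\<sigma>. ?u z)" by (rule integral_\<sigma>[OF et_borel Bd])
 then have S: "(LINT z|\<nu>. ?u z) - (LINT z|\<rho>. ?u z) = (LINT z|\<sigma>. ?u z)" by (simp add: signed_integral_def)
 have S1: "(LINT z|\<sigma>. ?u z) = (LINT z|\<sigma>. ?h z)" by (rule LINT_cong[OF refl]) (simp add: sp)
 have "(LINT z|\<rho>. ?u z) = (LINT z|\<rho>. ?h z)" by (rule LINT_cong[OF refl]) (simp add: sp)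
 also have "... = (LINT y|UU. ?h y * (?v y)^2)"
  unfolding \<rho>_eq sq_measure_integral[OF m2s(9) ms(1)] by (simp add: mult.commute)
 finally have S2: "(LINT z|\<rho>. ?u z) = (LINT y|UU. ?h y * (?v y)^2)" .
 show ?thesis unfolding JR0_def A B using S unfolding S1 S2 by linarith
qed

end

section \<open>The weak topology and reduction of the theorem to good representatives\<close>

subsection \<open>Weak convergence\<close>

text \<open>Membership in the open sets of a generated topology can be checked by induction, and on
  the subbasic sets it is the convergence of one pairing.\<close>

lemma weak_L2_limitin:
 assumes f: "!!n. f n \<in> L2" "l \<in> L2"
  and c: "!!g. g \<in> L2 ==> (%n. LINT x:I|lborel. f n x * g x) ----> (LINT x:I|lborel. l x * g x)"
 shows "limitin weak_L2 f l sequentially"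
proof -
 let ?S = "{{f \<in> L2. (LINT x:I|lborel. f x * g x) \<in> V} | g V. g \<in> L2 & open (V :: real set)}"
 have ev: "l \<in> U --> eventually (%n. f n \<in> U) sequentially" if "generate_topology_on ?S U" for U
  using that
 proof induction
  case (Int a b)
  then show ?case by (auto intro: eventually_conj)
 next
  case (UN K)
  show ?case
  proof
   assume "l \<in> \<Union>K"
   then obtain k where k: "k \<in> K" "l \<in> k" by blast
   then have "eventually (%n. f n \<in> k) sequentially" using UN by blast
   then show "eventually (%n. f n \<in> \<Union>K) sequentially" by eventually_elim (use k in blast)
  qed
 next
  case (Basis s)
  then obtain g V where s: "s = {f \<in> L2. (LINT x:I|lborel. f x * g x) \<in> V}" and g: "g \<in> L2" "open V" by blast
  show ?case
  proof
   assume "l \<in> s"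
   then have "eventually (%n. (LINT x:I|lborel. f n x * g x) \<in> V) sequentially"
    using topological_tendstoD[OF c[OF g(1)] g(2)] s by simp
   then show "eventually (%n. f n \<in> s) sequentially" by eventually_elim (use f s in simp)
  qed
 qed simp
 \<comment> \<open>The pairing with 0 gives a subbasic set equal to all of \<open>L2\<close>, so the
   limit lies in the topological space.\<close>
 have "(%_. 0) \<in> L2" by (simp add: L2_iff l2_def)
 then have "{f \<in> L2. (LINT x:I|lborel. f x * 0) \<in> UNIV} \<in> ?S" by (intro CollectI exI[of _ "%_. 0"] exI[of _ UNIV]) auto
 then have "l \<in> topspace weak_L2" using f(2) unfolding weak_L2_def topology_generated_by_topspace by (intro UnionI) auto
 then show ?thesis unfolding limitin_def using ev unfolding weak_L2_def openin_topology_generated_by_iff by blast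
qed

lemma weakly_continuous_sequentially:
 assumes P: "continuous_map (subtopology (prod_topology weak_L2 weak_L2) S) euclideanreal P"
  and f: "!!n. (f n, g n) \<in> S" "(f', g') \<in> S"
  and l: "!!n. l2 UI (f n)" "l2 UI f'" "!!n. l2 UI (g n)" "l2 UI g'"
  and c: "!!h. l2 UI h ==> (%n. LINT x|UI. f n x * h x) ----> (LINT x|UI. f' x * h x)"
   "!!h. l2 UI h ==> (%n. LINT x|UI. g n x * h x) ----> (LINT x|UI. g' x * h x)"
 shows "(%n. P (f n, g n)) ----> P (f', g')"
proof -
 have "limitin weak_L2 f f' sequentially" "limitin weak_L2 g g' sequentially"
  by (rule weak_L2_limitin; use l c in "simp add: L2_iff UI_integral[symmetric]")+
 then have "limitin (prod_topology weak_L2 weak_L2) (%n. (f n, g n)) (f', g') sequentially"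
  by (simp add: limitin_pairwise comp_def)
 then have "limitin (subtopology (prod_topology weak_L2 weak_L2) S) (%n. (f n, g n)) (f', g') sequentially"
  using f by (simp add: limitin_subtopology)
 from continuous_map_limit[OF P this] show ?thesis by (simp add: comp_def)
qed

text \<open>Resetting z to 0 on the null set of bad times changes no class and makes the estimates
  available at every time.\<close>

lemma regular_representative:
 assumes z: "l2 UU (%y. z (fst y) (snd y))"
 defines "z' \<equiv> %t x. if l2 UI (z t) then z t x else 0"
 shows "l2 UU (%y. z' (fst y) (snd y))" "AE t in UI. AE x in UI. z t x = z' t x" "l2 UI (z' t)"
proof -
 note s = l2_UU_sections[where u=z, OF z]
 have m: "m2 z'"
  unfolding m2_def z'_def
 proof (rule measurable_If)
  have "{y \<in> space UU. l2 UI (z (fst y))} = {t \<in> space UI. l2 UI (z t)} \<times> space UI" by (auto simp: space_pair_measure)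
  then show "{y \<in> space UU. l2 UI (z (fst y))} \<in> sets UU"
   using pair_measureI[OF l2_section_sets[OF s(7)] sets.top] by (simp only:)
 qed (use s(7) in "simp_all add: m2_def")
 show "l2 UU (%y. z' (fst y) (snd y))"
  by (rule l2_bound[OF z]) (use m in "auto simp: m2_def z'_def")
 show "AE t in UI. AE x in UI. z t x = z' t x" using s(1) by eventually_elim (simp add: z'_def)
 show "l2 UI (z' t)" by (cases "l2 UI (z t)") (simp_all add: z'_def)
qed

lemma has_tderiv_cong_curve:
 assumes H: "has_tderiv u v" and u': "L2_curve u'" "!!t. t \<in> I ==> l2 UI (u' t)"
  and e: "!!t. t \<in> I ==> AE x in UI. u' t x = u t x"
 shows "has_tderiv u' v"
proof -
 have "AE x in UI. u' t x = u' 0 x + (LINT s:{0..t}|lborel. v s x)" if t: "t \<in> I" for t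
 proof -
  have "AE x in UI. u t x = u 0 x + (LINT s:{0..t}|lborel. v s x)" using H t by (simp add: has_tderiv_def UI_AE)
  moreover have "AE x in UI. u' 0 x = u 0 x" by (rule e) simp
  ultimately show ?thesis using e[OF t] by eventually_elim simp
 qed
 then show ?thesis using H u' by (simp add: has_tderiv_def UI_AE L2_iff)
qed

theorem theorem6p16:
  fixes p0 q0 :: "real \<Rightarrow> real"
    and P :: "(real \<Rightarrow> real) \<times> (real \<Rightarrow> real) \<Rightarrow> real"
  assumes "q0 \<in> Q_space"
    and "p0 \<in> cotangent q0"
    and "continuous_map (subtopology (prod_topology weak_L2 weak_L2) cotangent_bundle)
           euclideanreal P"
  shows "\<forall>(p, q, \<mu>, \<nu>) \<in> CR0 p0 q0.
           \<exists>(pn :: nat \<Rightarrow> real \<Rightarrow> real \<Rightarrow> real) (qn :: nat \<Rightarrow> real \<Rightarrow> real \<Rightarrow> real).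
             (\<forall>n. (pn n, qn n) \<in> C0_curves p0 q0) \<and>
             limsup (\<lambda>n. ereal (J_acc P (pn n) (qn n))) \<le> ereal (JR0 P p q \<mu> \<nu>)"
proof (intro ballI, clarify)
 fix p q \<mu> \<nu> assume "(p, q, \<mu>, \<nu>) \<in> CR0 p0 q0"
 then obtain d where C0: "(p, q) \<in> C0_curves p0 q0" and rad: "finite_radon \<mu>" "finite_radon \<nu>"
  and le: "sq_measure p <= \<mu>" "sq_measure (tderiv p) <= \<nu>" and d: "signed_radon d"
  and wk: "weak_tderiv_zero_init (\<mu>, sq_measure p) d"
  and FR: "FR_dominated (\<mu>, sq_measure p) d (\<nu>, sq_measure (tderiv p))"
  by (auto simp: CR0_def)
 from C0 obtain w z where pc: "L2_curve p" and bun: "!!t. t \<in> I ==> (p t, q t) \<in> cotangent_bundle"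
  and qw: "has_tderiv q w" and wz: "has_tderiv w z"
  and wp: "!!t. t \<in> I ==> AE x in UI. w t x = eta (q t) x * p t x"
  and ini: "AE x in UI. q 0 x = q0 x" "AE x in UI. p 0 x = p0 x"
  unfolding C0_curves_def mem_Collect_eq case_prod_conv UI_AE by blast
 define z' where "z' t x = (if l2 UI (z t) then z t x else 0)" for t x
 have zl: "l2 UU (%y. z (fst y) (snd y))" using wz by (simp add: has_tderiv_def L2_curve_iff case_prod_beta')
 note z' = regular_representative[where z=z, OF zl, folded z'_def]
 have wz': "has_tderiv w z'" by (rule has_tderiv_cong[OF wz z'(1,2)])
 \<comment> \<open>Rebuilding w from z', and then q from w', makes all three compatible pointwise
   primitives in time, equal to the given curve almost everywhere at each t.\<close>
 define w' where "w' t x = w 0 x + prim (%s. z' s x) t" for t x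
 have Hw: "H1 w' z'" unfolding w'_def[abs_def] by (rule has_tderiv_H1(1)[OF wz'])
 have ww: "AE x in UI. w t x = w' t x" if "t \<in> I" for t unfolding w'_def by (rule has_tderiv_H1(2)[OF wz' that])
 have "AE t in UI. AE x in UI. w t x = w' t x" by (rule AE_I2) (use ww in simp)
 then have qw': "has_tderiv q w'" by (rule has_tderiv_cong[OF qw H1_l2[OF Hw]])
 define q' where "q' t x = q 0 x + prim (%s. w' s x) t" for t x
 have Hq: "H1 q' w'" unfolding q'_def[abs_def] by (rule has_tderiv_H1(1)[OF qw'])
 have qq: "AE x in UI. q t x = q' t x" if "t \<in> I" for t unfolding q'_def by (rule has_tderiv_H1(2)[OF qw' that])
 obtain C1 where C1: "C1 >= 0" "!!t. t \<in> I ==> nrm UI (q' t) <= C1" using H1_bounded[OF Hq] by blast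
 obtain C2 where C2: "C2 >= 0" "!!t. t \<in> I ==> nrm UI (w' t) <= C2" using H1_bounded[OF Hw] by blast
 interpret b: base_curve q' w' z' "C1 + C2"
  by unfold_locales (use Hq Hw C1 C2 in "auto intro: add_increasing add_increasing2")
 have ql: "l2 UI (q t)" and pl: "l2 UI (p t)" if "t \<in> I" for t
  using bun[OF that] by (auto simp: cotangent_bundle_def Q_space_def cotangent_def L2_iff)
 have eta: "eta (q t) x = b.et t x" if t: "t \<in> I" and x: "x \<in> I" for t x
 proof -
  have "prim (q t) x = prim (q' t) x"
   by (rule prim_cong_AE[OF _ l2_measurable[OF b.q_l2[OF t]] l2_measurable[OF ql[OF t]] qq[OF t]]) (use x in simp)
  then show ?thesis by (simp add: eta_def b.et_def b.g_def prim_def)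
 qed
 have pp: "AE x in UI. p t x = b.p t x" if t: "t \<in> I" for t
  using ww[OF t] wp[OF t] AE_space
 proof eventually_elim
  case (elim x)
  then show ?case using eta[OF t, of x] b.et_bounds(3)[OF t, of x] by (simp add: b.p_def field_simps)
 qed
 have pv: "has_tderiv p b.v" by (rule has_tderiv_cong_curve[OF H1_has_tderiv[OF b.Hp] pc pl pp])
 then have pd: "has_tderiv p (tderiv p)" unfolding tderiv_def by (rule someI[of "has_tderiv p" b.v])
 have vv: "AE t in UI. AE x in UI. tderiv p t x = b.v t x" by (rule has_tderiv_unique[OF pd pv])
 have lp: "l2 UU (%y. p (fst y) (snd y))" and lv: "l2 UU (%y. tderiv p (fst y) (snd y))"
  using pd by (auto simp: has_tderiv_def L2_curve_iff case_prod_beta')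
 note mp = l2_UU_sections(7)[where u=p, OF lp] and mv = l2_UU_sections(7)[where u="tderiv p", OF lv]
 \<comment> \<open>The measures see only the classes, so the relaxed data of the given curve are
   those of the base curve.\<close>
 have \<pi>: "sq_measure p = sq_measure b.p"
  by (rule sq_measure_cong[OF mp b.m2s(8)]) (rule AE_I2, use pp in simp)
 have \<rho>: "sq_measure (tderiv p) = sq_measure b.v" by (rule sq_measure_cong[OF mv b.m2s(9) vv])
 have ph: "phi (q t) x = prim (b.et t) x" if "t \<in> I" "x \<in> I" for t x
  unfolding phi_def prim_def[symmetric] by (rule prim_cong) (use eta that in auto)
 have wint: "(LINT x|UI. p t x * f x * eta (q t) x) = (LINT x|UI. w' t x * h x)"
  if t: "t \<in> I" and f: "!!x. x \<in> I ==> f x = h x" and h: "h \<in> bm UI" for t f h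
 proof -
  have fm: "f \<in> bm UI" "eta (q t) \<in> bm UI"
   by (rule measurable_cong[THEN iffD2, OF _ h], use f in simp)
     (rule measurable_cong[THEN iffD2, OF _ m2_section[OF b.m2s(5) t]], use eta t in simp)
  show ?thesis
  proof (rule integral_cong_AE)
   show "AE x in UI. p t x * f x * eta (q t) x = w' t x * h x"
    using ww[OF t] wp[OF t] AE_space
   proof eventually_elim
    case (elim x)
    then have "w' t x = eta (q t) x * p t x" by simp
    then show ?case using f elim(3) by (simp add: mult_ac)
   qed
  qed (use fm h l2_measurable[OF pl[OF t]] l2_measurable[OF b.w_l2[OF t]] in measurable)
 qed
 interpret r: relaxed_curve q' w' z' "C1 + C2" \<mu> "sq_measure p" \<nu> "sq_measure (tderiv p)" d
 proof unfold_locales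
  show "finite_radon (sq_measure p)" "finite_radon (sq_measure (tderiv p))"
   by (intro finite_radon_sq_measure lp lv)+
  fix t :: real assume t: "t \<in> I"
  have Q: "(LINT x:I|lborel. q t x) = 0" "(LINT x:I|lborel. eta (q t) x) = 1"
   "(LINT x|UI. p t x * 1 * eta (q t) x) = 0" "(LINT x|UI. p t x * phi (q t) x * eta (q t) x) = 0"
   using bun[OF t] by (auto simp: cotangent_bundle_def Q_space_def cotangent_def eta_inner_def UI_integral)
  have "eta (q t) 1 = 1" using Q(1) by (simp add: eta_def)
  then show "b.g t 1 = 0" using eta[OF t, of 1] by (simp add: b.et_def)
  show "prim (b.et t) 1 = 1" using Q(2) ph[OF t, of 1] by (simp add: phi_def)
  have phm: "prim (b.et t) \<in> bm UI" by (rule prim_measurable_in[OF m2_section[OF b.m2s(5) t]])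
  show R: "b.R t 1 = 0" unfolding b.R_def prim_1
   using Q(3) wint[OF t, of "%_. 1" "%_. 1"] by simp
  \<comment> \<open>Integration by parts turns the orthogonality of p to phi into the vanishing mean
    of eta R, the boundary terms being zero because R vanishes at x = 1 and the primitive of eta at
    x = 0.\<close>
  have "ac (%x. b.R t x * prim (b.et t) x) (%x. w' t x * prim (b.et t) x + b.R t x * b.et t x)"
   by (rule ac_mult[OF b.acx_R[OF t] ac_prim[OF continuous_integrable_UI[OF ac_continuous[OF b.acx_et[OF t]]]]])
  from ac_eq[OF this, of 1] R
  have "0 = prim (%x. w' t x * prim (b.et t) x + b.R t x * b.et t x) 1" by simp
  also have "... = prim (%x. w' t x * prim (b.et t) x) 1 + prim (%x. b.R t x * b.et t x) 1"
  proof (rule prim_add)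
   have ce: "continuous_on I (b.et t)" by (rule ac_continuous[OF b.acx_et[OF t]])
   show "integrable UI (%x. b.R t x * b.et t x)"
    by (intro continuous_integrable_UI continuous_intros ce ac_continuous[OF b.acx_R[OF t]])
   show "integrable UI (%x. w' t x * prim (b.et t) x)"
    using continuous_mult_integrable[OF prim_continuous[OF continuous_integrable_UI[OF ce]] UI.l2_integrable[OF b.w_l2[OF t]]]
    by (simp add: mult.commute)
  qed simp
  also have "prim (%x. w' t x * prim (b.et t) x) 1 = 0"
   unfolding prim_1 using Q(4) wint[OF t ph[OF t] phm] by simp
  finally show "prim (%x. b.et t x * b.R t x) 1 = 0" by (simp add: mult.commute)
  show "l2 UI (z' t)" by (rule z'(3))
 qed (use rad le d wk FR \<pi> \<rho> in auto)
 have "AE x in UI. q' 0 x = q0 x" "AE x in UI. b.p 0 x = p0 x"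
  using ini qq[of 0] pp[of 0] by (auto elim: eventually_elim2)
 then obtain pn qn B where n: "!!n::nat. (pn n, qn n) \<in> C0_curves p0 q0" "!!n. J0 (pn n) (qn n) <= B n"
  and B: "B ----> (LINT y|UU. b.et (fst y) (snd y) * (b.v (fst y) (snd y) + b.force r.Kt (fst y) (snd y))^2) + (LINT y|r.\<sigma>. b.et (fst y) (snd y))"
  and c: "!!f. l2 UI f ==> (%n. LINT x|UI. pn n 1 x * f x) ----> (LINT x|UI. b.p 1 x * f x)"
   "!!f. l2 UI f ==> (%n. LINT x|UI. qn n 1 x * f x) ----> (LINT x|UI. q' 1 x * f x)"
  and F: "l2 UU (%y. b.force r.Kt (fst y) (snd y))"
  using r.recovery_sequence by blast
 have JR: "JR0 P p q \<mu> \<nu> = (LINT y|UU. b.et (fst y) (snd y) * (b.v (fst y) (snd y) + b.force r.Kt (fst y) (snd y))^2)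
  + (LINT y|r.\<sigma>. b.et (fst y) (snd y)) + P (p 1, q 1)"
  by (rule r.JR0_eq[OF ql eta pl pp mv vv F])
 have nb: "(pn n 1, qn n 1) \<in> cotangent_bundle" for n using n(1)[of n] by (auto simp: C0_curves_def)
 have nl: "l2 UI (pn n 1)" "l2 UI (qn n 1)" for n
  using nb[of n] by (auto simp: cotangent_bundle_def Q_space_def cotangent_def L2_iff)
 have Plim: "(%n. P (pn n 1, qn n 1)) ----> P (p 1, q 1)"
 proof (rule weakly_continuous_sequentially[OF assms(3) nb bun nl(1) pl nl(2) ql])
  fix h assume h: "l2 UI h"
  have "(LINT x|UI. p 1 x * h x) = (LINT x|UI. b.p 1 x * h x)" "(LINT x|UI. q 1 x * h x) = (LINT x|UI. q' 1 x * h x)"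
   by (rule integral_cong_AE;
     use pp[of 1] qq[of 1] l2_measurable[OF h] l2_measurable[OF pl[of 1]] l2_measurable[OF ql[of 1]]
      l2_measurable[OF b.q_l2[of 1]] l2_measurable[OF b.p_l2(1)[of 1]] in "auto elim: eventually_mono")+
  then show "(%n. LINT x|UI. pn n 1 x * h x) ----> (LINT x|UI. p 1 x * h x)"
   "(%n. LINT x|UI. qn n 1 x * h x) ----> (LINT x|UI. q 1 x * h x)" using c[OF h] by simp_all
 qed simp_all
 \<comment> \<open>The functional is bounded by the convergent sequence B plus the penalization, so
   its limsup is at most a genuine limit.\<close>
 have "limsup (%n. ereal (J_acc P (pn n) (qn n))) <= limsup (%n. ereal (B n + P (pn n 1, qn n 1)))"
  by (intro Limsup_mono always_eventually allI) (use n(2) in "simp add: J_acc_def")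
 also have "... = ereal (JR0 P p q \<mu> \<nu>)"
  unfolding JR by (intro lim_imp_Limsup tendsto_ereal tendsto_add B Plim) simp
 finally show "\<exists>(pn :: nat => real => real => real) (qn :: nat => real => real => real).
       (\<forall>n. (pn n, qn n) \<in> C0_curves p0 q0) &
       limsup (%n. ereal (J_acc P (pn n) (qn n))) <= ereal (JR0 P p q \<mu> \<nu>)"
  using n(1) by blast
qed

end
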